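(* Let $H$ be a weak Hopf algebra over a commutative ring $k$ with bijective antipode, which is finitely generated and projective as a $k$-module. The functor $$F:{}_H\mathcal{YD}^H\to{}_{D(H)}\overline{\mathcal{M}},\qquad F(M)=M,$$ with left $D(H)$-action $$[h\bowtie h^*]\,m=\langle h^*,m_{[1]}\rangle\,hm_{[0]}$$ for all $h\in H$, $h^*\in H^*$ and $m\in M$, is an isomorphism of monoidal categories.
   Context: $\otimes=\otimes_k$. A weak $k$-bialgebra is a $k$-module $H$ with a unital associative algebra structure and a coassociative counital coalgebra structure $(\Delta,\varepsilon)$, $\Delta(h)=h_{(1)}\otimes h_{(2)}$, such that $\Delta(hk)=\Delta(h)\Delta(k)$, $(\Delta\otimes H)\Delta(1)=1_{(1)}\otimes 1_{(2)}1_{(1')}\otimes 1_{(2')}=1_{(1)}\otimes 1_{(1')}1_{(2)}\otimes 1_{(2')}$, $\varepsilon(hkl)=\varepsilon(hk_{(1)})\varepsilon(k_{(2)}l)=\varepsilon(hk_{(2)})\varepsilon(k_{(1)}l)$. Put $\varepsilon_t(h)=\varepsilon(1_{(1)}h)1_{(2)}$, $\varepsilon_s(h)=1_{(1)}\varepsilon(h1_{(2)})$, $\overline{\varepsilon}_s(h)=\varepsilon(1_{(2)}h)1_{(1)}$, $H_t=\mathrm{Im}(\varepsilon_t)$. A weak Hopf algebra is a weak bialgebra with a $k$-linear antipode $S$ such that $S(h_{(1)})h_{(2)}=\varepsilon_s(h)$, $h_{(1)}S(h_{(2)})=\varepsilon_t(h)$, $S(h_{(1)})h_{(2)}S(h_{(3)})=S(h)$.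 For any weak bialgebra $B$, the category ${}_B\mathcal{M}$ of left $B$-modules is monoidal: $M\otimes_tN=\Delta(1)(M\otimes N)$ with diagonal action, unit object $B_t$ with action $b\rightharpoonup z=\varepsilon_t(bz)$, natural associativity, $l_M(1_{(1)}\rightharpoonup z\otimes 1_{(2)}m)=zm$, $r_M(1_{(1)}m\otimes 1_{(2)}\rightharpoonup z)=\overline{\varepsilon}_s(z)m$. ${}_B\overline{\mathcal{M}}$ denotes the same category with reversed tensor product $M\,\overline{\otimes}\,N=N\otimes_tM$ (with inverse associativity constraints and $l,r$ interchanged). A left-right Yetter-Drinfeld module is a $k$-module $M$ with a left $H$-action and a (coassociative, counital) right $H$-coaction $\rho(m)=m_{[0]}\otimes m_{[1]}$ such that $\rho(m)\in M\otimes_tH$ and $h_{(1)}m_{[0]}\otimes h_{(2)}m_{[1]}=(h_{(2)}m)_{[0]}\otimes(h_{(2)}m)_{[1]}h_{(1)}$ for all $h,m$; morphisms in ${}_H\mathcal{YD}^H$ are left $H$-linear right $H$-colinear maps. ${}_H\mathcal{YD}^H$ is monoidal with $M\otimes_tN$, coaction $\rho(1_{(1)}m\otimes 1_{(2)}n)=m_{[0]}\otimes n_{[0]}\otimes n_{[1]}m_{[1]}$, unit object $H_t$ with $\rho(z)=z_{(2)}\otimes S^{-1}(z_{(1)})$, and the constraints of ${}_H\mathcal{M}$. $H^*=\mathrm{Hom}_k(H,k)$ has convolution product $\langle h^**k^*,h\rangle=\langle h^*,h_{(1)}\rangle\langle k^*,h_{(2)}\rangle$, comultiplication $\langle h^*_{(1)},h\rangle\langle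 h^*_{(2)},k\rangle=\langle h^*,hk\rangle$ and $H$-actions $\langle h\rightharpoonup h^*\leftharpoonup k,l\rangle=\langle h^*,klh\rangle$. $H\bowtie H^*$ is $H\otimes H^*$ with associative multiplication $(h\bowtie h^* )(k\bowtie k^* )=hk_{(2)}\bowtie(S^{-1}(k_{(1)})\rightharpoonup h^*\leftharpoonup k_{(3)})*k^*$ and preunit $1\bowtie\varepsilon$ ($ex=xe=xe^2$ for $e=1\bowtie\varepsilon$ and all $x$). With $p(x)=x(1\bowtie\varepsilon)$, the Drinfeld double $D(H)=(H\bowtie H^* )/\mathrm{Ker}(p)$ is an algebra with unit $[1\bowtie\varepsilon]$, and a weak Hopf algebra with $\Delta[h\bowtie h^*]=[h_{(2)}\bowtie h^*_{(1)}]\otimes[h_{(1)}\bowtie h^*_{(2)}]$ and $\varepsilon[h\bowtie h^*]=\langle h^*,1_{(2)}\rangle\langle\varepsilon,h1_{(1)}\rangle$. An isomorphism of monoidal categories is a strong monoidal functor that is an isomorphism of categories. *)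

theory Defs
  imports "HOL-Algebra.QuotRing" "HOL-Algebra.Module"
begin

section \<open>Modules over a commutative ring\<close>

text \<open>
  Modules are HOL-Algebra records over a commutative ring \<open>R\<close>. A \<open>k\<close>-algebra uses the ring
  fields and \<open>smult\<close>; for a mere module the fields \<open>mult\<close> and \<open>one\<close> carry no information.
\<close>

definition lsum :: "('a, 'e) ring_scheme \<Rightarrow> 'a list \<Rightarrow> 'a" where
  "lsum M xs = foldr (add M) xs \<zero>\<^bsub>M\<^esub>"

definition linear_map ::
  "('k, 'r) ring_scheme \<Rightarrow> ('k, 'a, 'm) module_scheme \<Rightarrow> ('k, 'b, 'n) module_scheme \<Rightarrow> ('a \<Rightarrow> 'b) \<Rightarrow> bool" where
  "linear_map R M N f \<longleftrightarrow> f \<in> carrier M \<rightarrow> carrier N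
     \<and> (\<forall>x\<in>carrier M. \<forall>y\<in>carrier M. f (x \<oplus>\<^bsub>M\<^esub> y) = f x \<oplus>\<^bsub>N\<^esub> f y)
     \<and> (\<forall>a\<in>carrier R. \<forall>x\<in>carrier M. f (a \<odot>\<^bsub>M\<^esub> x) = a \<odot>\<^bsub>N\<^esub> f x)"

definition ground :: "('k, 'r) ring_scheme \<Rightarrow> ('k, 'k) module" where
  "ground R = \<lparr>carrier = carrier R, mult = mult R, one = \<one>\<^bsub>R\<^esub>, zero = \<zero>\<^bsub>R\<^esub>, add = add R,
     smult = mult R\<rparr>"

definition free_module :: "('k, 'r) ring_scheme \<Rightarrow> 'i set \<Rightarrow> ('k, 'i \<Rightarrow> 'k) module" where
  "free_module R I = \<lparr>carrier = {f \<in> I \<rightarrow>\<^sub>E carrier R. finite {i \<in> I. f i \<noteq> \<zero>\<^bsub>R\<^esub>}},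
     mult = undefined, one = undefined,
     zero = (\<lambda>i\<in>I. \<zero>\<^bsub>R\<^esub>), add = (\<lambda>f g. \<lambda>i\<in>I. f i \<oplus>\<^bsub>R\<^esub> g i), smult = (\<lambda>a f. \<lambda>i\<in>I. a \<otimes>\<^bsub>R\<^esub> f i)\<rparr>"

definition finitely_generated_module :: "('k, 'r) ring_scheme \<Rightarrow> ('k, 'a, 'm) module_scheme \<Rightarrow> bool" where
  "finitely_generated_module R M \<longleftrightarrow> module R M \<and>
     (\<exists>X. finite X \<and> X \<subseteq> carrier M \<and>
        (\<forall>x\<in>carrier M. \<exists>c\<in>X \<rightarrow> carrier R. x = (\<Oplus>\<^bsub>M\<^esub>g\<in>X. c g \<odot>\<^bsub>M\<^esub> g)))"

text \<open>
  Projective: a direct summand of a free module. Index sets inside the type of the elements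
  of \<open>P\<close> suffice, since \<open>P\<close> is a quotient of the free module on \<open>carrier P\<close>.
\<close>

definition projective_module :: "('k, 'r) ring_scheme \<Rightarrow> ('k, 'a, 'm) module_scheme \<Rightarrow> bool" where
  "projective_module R P \<longleftrightarrow> module R P \<and>
     (\<exists>(I :: 'a set) i p. linear_map R P (free_module R I) i \<and> linear_map R (free_module R I) P p
        \<and> (\<forall>x\<in>carrier P. p (i x) = x))"


section \<open>Tensor products\<close>

text \<open>
  The tensor product \<open>M \<otimes> N\<close> over \<open>R\<close> is the set of formal sums \<open>m\<^sub>1 \<otimes> n\<^sub>1 + \<dots> + m\<^sub>r \<otimes> n\<^sub>r\<close>,
  written as lists of pairs, modulo the congruence generated by the usual relations. Every
  class is replaced by a chosen representative, so that an element of \<open>M \<otimes> N\<close> is literally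
  a list of pairs. Sweedler notation \<open>h\<^sub>(\<^sub>1\<^sub>) \<otimes> h\<^sub>(\<^sub>2\<^sub>)\<close> thus becomes a list comprehension in which
  the pair \<open>(h1, h2)\<close> runs over the list \<open>\<Delta>(h)\<close>.
\<close>

inductive tensor_cong ::
  "('k, 'r) ring_scheme \<Rightarrow> ('k, 'a, 'm) module_scheme \<Rightarrow> ('k, 'b, 'n) module_scheme
    \<Rightarrow> ('a \<times> 'b) list \<Rightarrow> ('a \<times> 'b) list \<Rightarrow> bool"
  for R M N where
  refl: "set xs \<subseteq> carrier M \<times> carrier N \<Longrightarrow> tensor_cong R M N xs xs"
| sym: "tensor_cong R M N xs ys \<Longrightarrow> tensor_cong R M N ys xs"
| trans: "tensor_cong R M N xs ys \<Longrightarrow> tensor_cong R M N ys zs \<Longrightarrow> tensor_cong R M N xs zs"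
| append: "tensor_cong R M N xs xs' \<Longrightarrow> tensor_cong R M N ys ys' \<Longrightarrow>
    tensor_cong R M N (xs @ ys) (xs' @ ys')"
| commute: "set xs \<subseteq> carrier M \<times> carrier N \<Longrightarrow> set ys \<subseteq> carrier M \<times> carrier N \<Longrightarrow>
    tensor_cong R M N (xs @ ys) (ys @ xs)"
| zero: "n \<in> carrier N \<Longrightarrow> tensor_cong R M N [(\<zero>\<^bsub>M\<^esub>, n)] []"
| add_left: "m \<in> carrier M \<Longrightarrow> m' \<in> carrier M \<Longrightarrow> n \<in> carrier N \<Longrightarrow>
    tensor_cong R M N [(m \<oplus>\<^bsub>M\<^esub> m', n)] [(m, n), (m', n)]"
| add_right: "m \<in> carrier M \<Longrightarrow> n \<in> carrier N \<Longrightarrow> n' \<in> carrier N \<Longrightarrow>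
    tensor_cong R M N [(m, n \<oplus>\<^bsub>N\<^esub> n')] [(m, n), (m, n')]"
| balanced: "a \<in> carrier R \<Longrightarrow> m \<in> carrier M \<Longrightarrow> n \<in> carrier N \<Longrightarrow>
    tensor_cong R M N [(a \<odot>\<^bsub>M\<^esub> m, n)] [(m, a \<odot>\<^bsub>N\<^esub> n)]"

definition tens ::
  "('k, 'r) ring_scheme \<Rightarrow> ('k, 'a, 'm) module_scheme \<Rightarrow> ('k, 'b, 'n) module_scheme
    \<Rightarrow> ('a \<times> 'b) list \<Rightarrow> ('a \<times> 'b) list" where
  "tens R M N xs = (SOME ys. tensor_cong R M N xs ys)"

definition tensor ::
  "('k, 'r) ring_scheme \<Rightarrow> ('k, 'a, 'm) module_scheme \<Rightarrow> ('k, 'b, 'n) module_scheme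
    \<Rightarrow> ('k, ('a \<times> 'b) list) module" where
  "tensor R M N = \<lparr>carrier = tens R M N ` {xs. set xs \<subseteq> carrier M \<times> carrier N},
     mult = undefined, one = undefined,
     zero = tens R M N [],
     add = (\<lambda>x y. tens R M N (x @ y)),
     smult = (\<lambda>a x. tens R M N [(a \<odot>\<^bsub>M\<^esub> m, n). (m, n) \<leftarrow> x])\<rparr>"

text \<open>The element \<open>\<Sum> m \<otimes> n \<otimes> p\<close> of \<open>(M \<otimes> N) \<otimes> P\<close> given by a list of triples.\<close>

definition tens3 ::
  "('k, 'r) ring_scheme \<Rightarrow> ('k, 'a, 'm) module_scheme \<Rightarrow> ('k, 'b, 'n) module_scheme
    \<Rightarrow> ('k, 'c, 'p) module_scheme \<Rightarrow> ('a \<times> 'b \<times> 'c) list \<Rightarrow> (('a \<times> 'b) list \<times> 'c) list" where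
  "tens3 R M N P xs = tens R (tensor R M N) P [(tens R M N [(m, n)], p). (m, n, p) \<leftarrow> xs]"


section \<open>Weak bialgebras and weak Hopf algebras\<close>

record ('k, 'h) bialg = "('k, 'h) module" +
  comul :: "'h \<Rightarrow> ('h \<times> 'h) list"
  counit :: "'h \<Rightarrow> 'k"

definition comul3 :: "('k, 'h, 'e) bialg_scheme \<Rightarrow> 'h \<Rightarrow> ('h \<times> 'h \<times> 'h) list" where
  "comul3 H h = [(h1, h2, h3). (h', h3) \<leftarrow> comul H h, (h1, h2) \<leftarrow> comul H h']"

locale weak_bialgebra =
  fixes R :: "('k, 'r) ring_scheme" and H :: "('k, 'h, 'e) bialg_scheme" (structure)
  assumes is_module: "module R H"
    and is_ring: "ring H"
    and smult_mult: "\<lbrakk>a \<in> carrier R; h \<in> carrier H; k \<in> carrier H\<rbrakk> \<Longrightarrow>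
      (a \<odot> h) \<otimes> k = a \<odot> (h \<otimes> k) \<and> h \<otimes> (a \<odot> k) = a \<odot> (h \<otimes> k)"
    and comul_linear: "linear_map R H (tensor R H H) (comul H)"
    and counit_linear: "linear_map R H (ground R) (counit H)"
    and coassoc: "h \<in> carrier H \<Longrightarrow>
      tens3 R H H H [(h1, h2, h3). (h', h3) \<leftarrow> comul H h, (h1, h2) \<leftarrow> comul H h'] =
      tens3 R H H H [(h1, h2, h3). (h1, h') \<leftarrow> comul H h, (h2, h3) \<leftarrow> comul H h']"
    and counit_left: "h \<in> carrier H \<Longrightarrow> lsum H [counit H h1 \<odot> h2. (h1, h2) \<leftarrow> comul H h] = h"
    and counit_right: "h \<in> carrier H \<Longrightarrow> lsum H [counit H h2 \<odot> h1. (h1, h2) \<leftarrow> comul H h] = h"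
    and comul_mult: "\<lbrakk>h \<in> carrier H; k \<in> carrier H\<rbrakk> \<Longrightarrow>
      comul H (h \<otimes> k) =
        tens R H H [(h1 \<otimes> k1, h2 \<otimes> k2). (h1, h2) \<leftarrow> comul H h, (k1, k2) \<leftarrow> comul H k]"
    and comul_one_1: "tens3 R H H H (comul3 H \<one>) =
      tens3 R H H H [(a, b \<otimes> a', b'). (a, b) \<leftarrow> comul H \<one>, (a', b') \<leftarrow> comul H \<one>]"
    and comul_one_2: "tens3 R H H H (comul3 H \<one>) =
      tens3 R H H H [(a, a' \<otimes> b, b'). (a, b) \<leftarrow> comul H \<one>, (a', b') \<leftarrow> comul H \<one>]"
    and counit_mult_1: "\<lbrakk>h \<in> carrier H; k \<in> carrier H; l \<in> carrier H\<rbrakk> \<Longrightarrow>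
      counit H (h \<otimes> k \<otimes> l) =
        lsum R [counit H (h \<otimes> k1) \<otimes>\<^bsub>R\<^esub> counit H (k2 \<otimes> l). (k1, k2) \<leftarrow> comul H k]"
    and counit_mult_2: "\<lbrakk>h \<in> carrier H; k \<in> carrier H; l \<in> carrier H\<rbrakk> \<Longrightarrow>
      counit H (h \<otimes> k \<otimes> l) =
        lsum R [counit H (h \<otimes> k2) \<otimes>\<^bsub>R\<^esub> counit H (k1 \<otimes> l). (k1, k2) \<leftarrow> comul H k]"

definition eps_t :: "('k, 'h, 'e) bialg_scheme \<Rightarrow> 'h \<Rightarrow> 'h" where
  "eps_t H h = lsum H [counit H (a \<otimes>\<^bsub>H\<^esub> h) \<odot>\<^bsub>H\<^esub> b. (a, b) \<leftarrow> comul H \<one>\<^bsub>H\<^esub>]"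

definition eps_s :: "('k, 'h, 'e) bialg_scheme \<Rightarrow> 'h \<Rightarrow> 'h" where
  "eps_s H h = lsum H [counit H (h \<otimes>\<^bsub>H\<^esub> b) \<odot>\<^bsub>H\<^esub> a. (a, b) \<leftarrow> comul H \<one>\<^bsub>H\<^esub>]"

definition eps_s_bar :: "('k, 'h, 'e) bialg_scheme \<Rightarrow> 'h \<Rightarrow> 'h" where
  "eps_s_bar H h = lsum H [counit H (b \<otimes>\<^bsub>H\<^esub> h) \<odot>\<^bsub>H\<^esub> a. (a, b) \<leftarrow> comul H \<one>\<^bsub>H\<^esub>]"

locale weak_hopf_algebra = weak_bialgebra R H
  for R :: "('k, 'r) ring_scheme" and H :: "('k, 'h, 'e) bialg_scheme" (structure) +
  fixes S :: "'h \<Rightarrow> 'h"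
  assumes antipode_linear: "linear_map R H H S"
    and antipode_left: "h \<in> carrier H \<Longrightarrow> lsum H [S h1 \<otimes> h2. (h1, h2) \<leftarrow> comul H h] = eps_s H h"
    and antipode_right: "h \<in> carrier H \<Longrightarrow> lsum H [h1 \<otimes> S h2. (h1, h2) \<leftarrow> comul H h] = eps_t H h"
    and antipode_antipode: "h \<in> carrier H \<Longrightarrow>
      lsum H [S h1 \<otimes> h2 \<otimes> S h3. (h1, h2, h3) \<leftarrow> comul3 H h] = S h"


section \<open>The Drinfeld double\<close>

definition dual :: "('k, 'r) ring_scheme \<Rightarrow> ('k, 'h, 'e) bialg_scheme \<Rightarrow> ('k, 'h \<Rightarrow> 'k) module" where
  "dual R H = \<lparr>carrier = {f \<in> extensional (carrier H). linear_map R H (ground R) f},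
     mult = (\<lambda>f g. \<lambda>h\<in>carrier H. lsum R [f h1 \<otimes>\<^bsub>R\<^esub> g h2. (h1, h2) \<leftarrow> comul H h]),
     one = restrict (counit H) (carrier H),
     zero = (\<lambda>h\<in>carrier H. \<zero>\<^bsub>R\<^esub>),
     add = (\<lambda>f g. \<lambda>h\<in>carrier H. f h \<oplus>\<^bsub>R\<^esub> g h),
     smult = (\<lambda>a f. \<lambda>h\<in>carrier H. a \<otimes>\<^bsub>R\<^esub> f h)\<rparr>"

text \<open>
  The element \<open>f\<^sub>(\<^sub>1\<^sub>) \<otimes> f\<^sub>(\<^sub>2\<^sub>)\<close> of \<open>H\<^sup>* \<otimes> H\<^sup>*\<close>; it exists and is unique when \<open>H\<close> is finitely
  generated projective.
\<close>

definition dual_comul ::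
  "('k, 'r) ring_scheme \<Rightarrow> ('k, 'h, 'e) bialg_scheme \<Rightarrow> ('h \<Rightarrow> 'k) \<Rightarrow> (('h \<Rightarrow> 'k) \<times> ('h \<Rightarrow> 'k)) list" where
  "dual_comul R H f = (THE t. t \<in> carrier (tensor R (dual R H) (dual R H)) \<and>
     (\<forall>h\<in>carrier H. \<forall>k\<in>carrier H. lsum R [f1 h \<otimes>\<^bsub>R\<^esub> f2 k. (f1, f2) \<leftarrow> t] = f (h \<otimes>\<^bsub>H\<^esub> k)))"

text \<open>\<open>h \<rightharpoonup> f \<leftharpoonup> k\<close>\<close>

definition dual_act :: "('k, 'h, 'e) bialg_scheme \<Rightarrow> 'h \<Rightarrow> ('h \<Rightarrow> 'k) \<Rightarrow> 'h \<Rightarrow> 'h \<Rightarrow> 'k" where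
  "dual_act H h f k = (\<lambda>l\<in>carrier H. f (k \<otimes>\<^bsub>H\<^esub> l \<otimes>\<^bsub>H\<^esub> h))"

abbreviation antipode_inv :: "('k, 'h, 'e) bialg_scheme \<Rightarrow> ('h \<Rightarrow> 'h) \<Rightarrow> 'h \<Rightarrow> 'h" where
  "antipode_inv H S \<equiv> inv_into (carrier H) S"

text \<open>
  \<open>H \<bowtie> H\<^sup>*\<close> is not unital in general: the field \<open>one\<close> holds the preunit \<open>1 \<bowtie> \<epsilon>\<close>, so that the
  \<open>one\<close> of the quotient ring below is its class.
\<close>

definition bowtie ::
  "('k, 'r) ring_scheme \<Rightarrow> ('k, 'h, 'e) bialg_scheme \<Rightarrow> ('h \<Rightarrow> 'h) \<Rightarrow> ('k, ('h \<times> ('h \<Rightarrow> 'k)) list) module" where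
  "bowtie R H S = (tensor R H (dual R H))
     \<lparr>mult := (\<lambda>x y. tens R H (dual R H)
        [(h \<otimes>\<^bsub>H\<^esub> k2, dual_act H (antipode_inv H S k1) f k3 \<otimes>\<^bsub>dual R H\<^esub> g).
           (h, f) \<leftarrow> x, (k, g) \<leftarrow> y, (k1, k2, k3) \<leftarrow> comul3 H k]),
      one := tens R H (dual R H) [(\<one>\<^bsub>H\<^esub>, \<one>\<^bsub>dual R H\<^esub>)]\<rparr>"

definition double_kernel ::
  "('k, 'r) ring_scheme \<Rightarrow> ('k, 'h, 'e) bialg_scheme \<Rightarrow> ('h \<Rightarrow> 'h) \<Rightarrow> ('h \<times> ('h \<Rightarrow> 'k)) list set" where
  "double_kernel R H S = a_kernel (bowtie R H S) (bowtie R H S)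
     (\<lambda>x. x \<otimes>\<^bsub>bowtie R H S\<^esub> \<one>\<^bsub>bowtie R H S\<^esub>)"

definition double_class ::
  "('k, 'r) ring_scheme \<Rightarrow> ('k, 'h, 'e) bialg_scheme \<Rightarrow> ('h \<Rightarrow> 'h) \<Rightarrow> 'h \<Rightarrow> ('h \<Rightarrow> 'k)
    \<Rightarrow> ('h \<times> ('h \<Rightarrow> 'k)) list set" where
  "double_class R H S h f =
     double_kernel R H S +>\<^bsub>bowtie R H S\<^esub> tens R H (dual R H) [(h, f)]"

definition double_ring ::
  "('k, 'r) ring_scheme \<Rightarrow> ('k, 'h, 'e) bialg_scheme \<Rightarrow> ('h \<Rightarrow> 'h)
    \<Rightarrow> ('k, ('h \<times> ('h \<Rightarrow> 'k)) list set) module" where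
  "double_ring R H S = ring.extend (bowtie R H S Quot double_kernel R H S)
     (module.fields (\<lambda>a X. \<Union>x\<in>X. double_kernel R H S +>\<^bsub>bowtie R H S\<^esub> (a \<odot>\<^bsub>bowtie R H S\<^esub> x)))"

text \<open>
  The formulas for \<open>\<Delta>\<close> and \<open>\<epsilon>\<close> on classes are evaluated on an arbitrary representative
  \<open>SOME x. x \<in> X\<close> of the class \<open>X\<close>; they do not depend on it.
\<close>

definition double ::
  "('k, 'r) ring_scheme \<Rightarrow> ('k, 'h, 'e) bialg_scheme \<Rightarrow> ('h \<Rightarrow> 'h)
    \<Rightarrow> ('k, ('h \<times> ('h \<Rightarrow> 'k)) list set) bialg" where
  "double R H S = module.extend (double_ring R H S)
     (bialg.fields
       (\<lambda>X. tens R (double_ring R H S) (double_ring R H S)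
          [(double_class R H S h2 f1, double_class R H S h1 f2).
             (h, f) \<leftarrow> (SOME x. x \<in> X), (h1, h2) \<leftarrow> comul H h, (f1, f2) \<leftarrow> dual_comul R H f])
       (\<lambda>X. lsum R [f b \<otimes>\<^bsub>R\<^esub> counit H (h \<otimes>\<^bsub>H\<^esub> a).
             (h, f) \<leftarrow> (SOME x. x \<in> X), (a, b) \<leftarrow> comul H \<one>\<^bsub>H\<^esub>]))"


section \<open>Monoidal categories\<close>

record ('o, 'a) category =
  Ob :: "'o set"
  Ar :: "'a set"
  Dom :: "'a \<Rightarrow> 'o"
  Cod :: "'a \<Rightarrow> 'o"
  Id :: "'o \<Rightarrow> 'a"
  Cmp :: "'a \<Rightarrow> 'a \<Rightarrow> 'a" (infixl \<open>\<cdot>\<index>\<close> 70)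

definition Hom :: "('o, 'a, 'e) category_scheme \<Rightarrow> 'o \<Rightarrow> 'o \<Rightarrow> 'a set" where
  "Hom C A B = {f \<in> Ar C. Dom C f = A \<and> Cod C f = B}"

locale category =
  fixes C :: "('o, 'a, 'e) category_scheme" (structure)
  assumes dom_cod: "f \<in> Ar C \<Longrightarrow> Dom C f \<in> Ob C \<and> Cod C f \<in> Ob C"
    and id_hom: "A \<in> Ob C \<Longrightarrow> Id C A \<in> Hom C A A"
    and comp_hom: "\<lbrakk>f \<in> Hom C A B; g \<in> Hom C B D\<rbrakk> \<Longrightarrow> g \<cdot> f \<in> Hom C A D"
    and comp_id: "f \<in> Hom C A B \<Longrightarrow> f \<cdot> Id C A = f"
    and id_comp: "f \<in> Hom C A B \<Longrightarrow> Id C B \<cdot> f = f"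
    and comp_assoc: "\<lbrakk>f \<in> Hom C A B; g \<in> Hom C B D; h \<in> Hom C D E\<rbrakk> \<Longrightarrow> (h \<cdot> g) \<cdot> f = h \<cdot> (g \<cdot> f)"

definition inverse_arrows :: "('o, 'a, 'e) category_scheme \<Rightarrow> 'a \<Rightarrow> 'a \<Rightarrow> bool" where
  "inverse_arrows C f g \<longleftrightarrow> f \<in> Ar C \<and> g \<in> Hom C (Cod C f) (Dom C f)
     \<and> g \<cdot>\<^bsub>C\<^esub> f = Id C (Dom C f) \<and> f \<cdot>\<^bsub>C\<^esub> g = Id C (Cod C f)"

definition iso_arrow :: "('o, 'a, 'e) category_scheme \<Rightarrow> 'a \<Rightarrow> bool" where
  "iso_arrow C f \<longleftrightarrow> (\<exists>g. inverse_arrows C f g)"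

definition inv_arrow :: "('o, 'a, 'e) category_scheme \<Rightarrow> 'a \<Rightarrow> 'a" where
  "inv_arrow C f = (THE g. inverse_arrows C f g)"

record ('o, 'a) moncat = "('o, 'a) category" +
  TensOb :: "'o \<Rightarrow> 'o \<Rightarrow> 'o" (infixl \<open>\<boxtimes>\<index>\<close> 75)
  TensAr :: "'a \<Rightarrow> 'a \<Rightarrow> 'a" (infixl \<open>\<star>\<index>\<close> 75)
  Unit :: "'o"
  Assoc :: "'o \<Rightarrow> 'o \<Rightarrow> 'o \<Rightarrow> 'a"
  Lunit :: "'o \<Rightarrow> 'a"
  Runit :: "'o \<Rightarrow> 'a"

locale monoidal_category = category C
  for C :: "('o, 'a, 'e) moncat_scheme" (structure) +
  assumes tens_ob: "\<lbrakk>A \<in> Ob C; B \<in> Ob C\<rbrakk> \<Longrightarrow> A \<boxtimes> B \<in> Ob C"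
    and tens_hom: "\<lbrakk>f \<in> Hom C A A'; g \<in> Hom C B B'\<rbrakk> \<Longrightarrow> f \<star> g \<in> Hom C (A \<boxtimes> B) (A' \<boxtimes> B')"
    and tens_id: "\<lbrakk>A \<in> Ob C; B \<in> Ob C\<rbrakk> \<Longrightarrow> Id C A \<star> Id C B = Id C (A \<boxtimes> B)"
    and tens_comp: "\<lbrakk>f \<in> Hom C A A'; f' \<in> Hom C A' A''; g \<in> Hom C B B'; g' \<in> Hom C B' B''\<rbrakk> \<Longrightarrow>
      (f' \<cdot> f) \<star> (g' \<cdot> g) = (f' \<star> g') \<cdot> (f \<star> g)"
    and unit_ob: "Unit C \<in> Ob C"
    and assoc_hom: "\<lbrakk>A \<in> Ob C; B \<in> Ob C; D \<in> Ob C\<rbrakk> \<Longrightarrow>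
      Assoc C A B D \<in> Hom C (A \<boxtimes> B \<boxtimes> D) (A \<boxtimes> (B \<boxtimes> D)) \<and> iso_arrow C (Assoc C A B D)"
    and assoc_natural: "\<lbrakk>f \<in> Hom C A A'; g \<in> Hom C B B'; h \<in> Hom C D D'\<rbrakk> \<Longrightarrow>
      Assoc C A' B' D' \<cdot> (f \<star> g \<star> h) = (f \<star> (g \<star> h)) \<cdot> Assoc C A B D"
    and lunit_hom: "A \<in> Ob C \<Longrightarrow>
      Lunit C A \<in> Hom C (Unit C \<boxtimes> A) A \<and> iso_arrow C (Lunit C A)"
    and lunit_natural: "f \<in> Hom C A B \<Longrightarrow>
      Lunit C B \<cdot> (Id C (Unit C) \<star> f) = f \<cdot> Lunit C A"
    and runit_hom: "A \<in> Ob C \<Longrightarrow>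
      Runit C A \<in> Hom C (A \<boxtimes> Unit C) A \<and> iso_arrow C (Runit C A)"
    and runit_natural: "f \<in> Hom C A B \<Longrightarrow>
      Runit C B \<cdot> (f \<star> Id C (Unit C)) = f \<cdot> Runit C A"
    and pentagon: "\<lbrakk>A \<in> Ob C; B \<in> Ob C; D \<in> Ob C; E \<in> Ob C\<rbrakk> \<Longrightarrow>
      Assoc C A B (D \<boxtimes> E) \<cdot> Assoc C (A \<boxtimes> B) D E =
      (Id C A \<star> Assoc C B D E) \<cdot> (Assoc C A (B \<boxtimes> D) E \<cdot> (Assoc C A B D \<star> Id C E))"
    and triangle: "\<lbrakk>A \<in> Ob C; B \<in> Ob C\<rbrakk> \<Longrightarrow>
      (Id C A \<star> Lunit C B) \<cdot> Assoc C A (Unit C) B = Runit C A \<star> Id C B"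

definition reversed :: "('o, 'a) moncat \<Rightarrow> ('o, 'a) moncat" where
  "reversed C = C\<lparr>TensOb := (\<lambda>A B. B \<boxtimes>\<^bsub>C\<^esub> A), TensAr := (\<lambda>f g. g \<star>\<^bsub>C\<^esub> f),
     Assoc := (\<lambda>A B D. inv_arrow C (Assoc C D B A)), Lunit := Runit C, Runit := Lunit C\<rparr>"

locale category_functor = C: category C + D: category D
  for C :: "('o, 'a, 'e) category_scheme" and D :: "('p, 'b, 'f) category_scheme" +
  fixes Fo :: "'o \<Rightarrow> 'p" and Fa :: "'a \<Rightarrow> 'b"
  assumes F_ob: "A \<in> Ob C \<Longrightarrow> Fo A \<in> Ob D"
    and F_hom: "f \<in> Hom C A B \<Longrightarrow> Fa f \<in> Hom D (Fo A) (Fo B)"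
    and F_id: "A \<in> Ob C \<Longrightarrow> Fa (Id C A) = Id D (Fo A)"
    and F_comp: "\<lbrakk>f \<in> Hom C A B; g \<in> Hom C B E\<rbrakk> \<Longrightarrow> Fa (g \<cdot>\<^bsub>C\<^esub> f) = Fa g \<cdot>\<^bsub>D\<^esub> Fa f"

locale strong_monoidal_functor =
  category_functor C D Fo Fa + C: monoidal_category C + D: monoidal_category D
  for C :: "('o, 'a, 'e) moncat_scheme" and D :: "('p, 'b, 'f) moncat_scheme"
    and Fo :: "'o \<Rightarrow> 'p" and Fa :: "'a \<Rightarrow> 'b" +
  fixes \<phi> :: "'o \<Rightarrow> 'o \<Rightarrow> 'b" and \<phi>0 :: "'b"
  assumes \<phi>_hom: "\<lbrakk>A \<in> Ob C; B \<in> Ob C\<rbrakk> \<Longrightarrow>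
      \<phi> A B \<in> Hom D (Fo A \<boxtimes>\<^bsub>D\<^esub> Fo B) (Fo (A \<boxtimes>\<^bsub>C\<^esub> B)) \<and> iso_arrow D (\<phi> A B)"
    and \<phi>_natural: "\<lbrakk>f \<in> Hom C A A'; g \<in> Hom C B B'\<rbrakk> \<Longrightarrow>
      \<phi> A' B' \<cdot>\<^bsub>D\<^esub> (Fa f \<star>\<^bsub>D\<^esub> Fa g) = Fa (f \<star>\<^bsub>C\<^esub> g) \<cdot>\<^bsub>D\<^esub> \<phi> A B"
    and \<phi>0_hom: "\<phi>0 \<in> Hom D (Unit D) (Fo (Unit C)) \<and> iso_arrow D \<phi>0"
    and \<phi>_assoc: "\<lbrakk>A \<in> Ob C; B \<in> Ob C; E \<in> Ob C\<rbrakk> \<Longrightarrow>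
      Fa (Assoc C A B E) \<cdot>\<^bsub>D\<^esub> (\<phi> (A \<boxtimes>\<^bsub>C\<^esub> B) E \<cdot>\<^bsub>D\<^esub> (\<phi> A B \<star>\<^bsub>D\<^esub> Id D (Fo E))) =
      \<phi> A (B \<boxtimes>\<^bsub>C\<^esub> E) \<cdot>\<^bsub>D\<^esub> ((Id D (Fo A) \<star>\<^bsub>D\<^esub> \<phi> B E) \<cdot>\<^bsub>D\<^esub> Assoc D (Fo A) (Fo B) (Fo E))"
    and \<phi>_lunit: "A \<in> Ob C \<Longrightarrow>
      Fa (Lunit C A) \<cdot>\<^bsub>D\<^esub> (\<phi> (Unit C) A \<cdot>\<^bsub>D\<^esub> (\<phi>0 \<star>\<^bsub>D\<^esub> Id D (Fo A))) = Lunit D (Fo A)"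
    and \<phi>_runit: "A \<in> Ob C \<Longrightarrow>
      Fa (Runit C A) \<cdot>\<^bsub>D\<^esub> (\<phi> A (Unit C) \<cdot>\<^bsub>D\<^esub> (Id D (Fo A) \<star>\<^bsub>D\<^esub> \<phi>0)) = Runit D (Fo A)"

definition isomorphism_of_categories ::
  "('o, 'a, 'e) category_scheme \<Rightarrow> ('p, 'b, 'f) category_scheme \<Rightarrow> ('o \<Rightarrow> 'p) \<Rightarrow> ('a \<Rightarrow> 'b) \<Rightarrow> bool" where
  "isomorphism_of_categories C D Fo Fa \<longleftrightarrow> category_functor C D Fo Fa
     \<and> bij_betw Fo (Ob C) (Ob D) \<and> bij_betw Fa (Ar C) (Ar D)"

definition isomorphism_of_monoidal_categories ::
  "('o, 'a, 'e) moncat_scheme \<Rightarrow> ('p, 'b, 'f) moncat_scheme \<Rightarrow> ('o \<Rightarrow> 'p) \<Rightarrow> ('a \<Rightarrow> 'b) \<Rightarrow> bool" where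
  "isomorphism_of_monoidal_categories C D Fo Fa \<longleftrightarrow>
     (\<exists>\<phi> \<phi>0. strong_monoidal_functor C D Fo Fa \<phi> \<phi>0) \<and> isomorphism_of_categories C D Fo Fa"


section \<open>A universe closed under tensor products\<close>

text \<open>
  The objects of the module categories are the modules whose carrier is a subset of
  \<open>'x universe\<close>. The constructor \<open>Tens\<close> embeds the elements of tensor products of such
  modules (lists of pairs) into the same type. The type \<open>'x\<close> of atoms is arbitrary, so these
  are the modules that are small with respect to an arbitrarily large universe.
\<close>

datatype 'x universe = Atom 'x | Tens (summands: "('x universe \<times> 'x universe) list")

text \<open>
  Transport of a module along an injection \<open>c\<close> of its carrier. The operations are made
  undefined outside of the carrier, and the meaningless fields \<open>mult\<close> and \<open>one\<close> are
  undefined.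
\<close>

definition transport ::
  "('k, 'r) ring_scheme \<Rightarrow> ('a \<Rightarrow> 'u) \<Rightarrow> ('k, 'a, 'm) module_scheme \<Rightarrow> ('k, 'u) module" where
  "transport R c M = \<lparr>carrier = c ` carrier M, mult = undefined, one = undefined,
     zero = c \<zero>\<^bsub>M\<^esub>,
     add = (\<lambda>x\<in>c ` carrier M. \<lambda>y\<in>c ` carrier M.
       c (inv_into (carrier M) c x \<oplus>\<^bsub>M\<^esub> inv_into (carrier M) c y)),
     smult = (\<lambda>a\<in>carrier R. \<lambda>x\<in>c ` carrier M. c (a \<odot>\<^bsub>M\<^esub> inv_into (carrier M) c x))\<rparr>"

text \<open>
  The normal form of the record representing a module, which makes equality of records the
  same as equality of modules.
\<close>

definition normal_module :: "('k, 'r) ring_scheme \<Rightarrow> ('k, 'a, 'm) module_scheme \<Rightarrow> bool" where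
  "normal_module R M \<longleftrightarrow> module R M \<and> mult M = undefined \<and> one M = undefined
     \<and> add M = (\<lambda>x\<in>carrier M. \<lambda>y\<in>carrier M. x \<oplus>\<^bsub>M\<^esub> y)
     \<and> smult M = (\<lambda>a\<in>carrier R. \<lambda>x\<in>carrier M. a \<odot>\<^bsub>M\<^esub> x)"


section \<open>Modules over a weak bialgebra\<close>

record ('k, 'b, 'u) bmodule = "('k, 'u) module" +
  act :: "'b \<Rightarrow> 'u \<Rightarrow> 'u"

definition left_module ::
  "('k, 'r) ring_scheme \<Rightarrow> ('k, 'b, 'e) bialg_scheme \<Rightarrow> ('k, 'b, 'u, 'm) bmodule_scheme \<Rightarrow> bool" where
  "left_module R B M \<longleftrightarrow> module R M
     \<and> (\<forall>b\<in>carrier B. linear_map R M M (act M b))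
     \<and> (\<forall>m\<in>carrier M. linear_map R B M (\<lambda>b. act M b m))
     \<and> (\<forall>b\<in>carrier B. \<forall>c\<in>carrier B. \<forall>m\<in>carrier M. act M (b \<otimes>\<^bsub>B\<^esub> c) m = act M b (act M c m))
     \<and> (\<forall>m\<in>carrier M. act M \<one>\<^bsub>B\<^esub> m = m)"

definition left_linear ::
  "('k, 'r) ring_scheme \<Rightarrow> ('k, 'b, 'e) bialg_scheme \<Rightarrow> ('k, 'b, 'u, 'm) bmodule_scheme
    \<Rightarrow> ('k, 'b, 'v, 'n) bmodule_scheme \<Rightarrow> ('u \<Rightarrow> 'v) \<Rightarrow> bool" where
  "left_linear R B M N f \<longleftrightarrow> linear_map R M N f
     \<and> (\<forall>b\<in>carrier B. \<forall>m\<in>carrier M. f (act M b m) = act N b (f m))"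

definition regular :: "('k, 'b, 'e) bialg_scheme \<Rightarrow> ('k, 'b, 'b) bmodule" where
  "regular B = \<lparr>carrier = carrier B, mult = mult B, one = \<one>\<^bsub>B\<^esub>, zero = \<zero>\<^bsub>B\<^esub>, add = add B,
     smult = smult B, act = mult B\<rparr>"

text \<open>The action of \<open>\<Delta>(b)\<close> on \<open>M \<otimes> N\<close>, and the submodule \<open>M \<otimes>\<^sub>t N = \<Delta>(1)(M \<otimes> N)\<close>.\<close>

definition diag_act ::
  "('k, 'r) ring_scheme \<Rightarrow> ('k, 'b, 'e) bialg_scheme \<Rightarrow> ('k, 'b, 'u, 'm) bmodule_scheme
    \<Rightarrow> ('k, 'b, 'v, 'n) bmodule_scheme \<Rightarrow> 'b \<Rightarrow> ('u \<times> 'v) list \<Rightarrow> ('u \<times> 'v) list" where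
  "diag_act R B M N b t =
     tens R M N [(act M b1 m, act N b2 n). (b1, b2) \<leftarrow> comul B b, (m, n) \<leftarrow> t]"

definition tensor_t ::
  "('k, 'r) ring_scheme \<Rightarrow> ('k, 'b, 'e) bialg_scheme \<Rightarrow> ('k, 'b, 'u, 'm) bmodule_scheme
    \<Rightarrow> ('k, 'b, 'v, 'n) bmodule_scheme \<Rightarrow> ('k, ('u \<times> 'v) list) module" where
  "tensor_t R B M N =
     (tensor R M N)\<lparr>carrier := diag_act R B M N \<one>\<^bsub>B\<^esub> ` carrier (tensor R M N)\<rparr>"

definition tens_mod ::
  "('k, 'r) ring_scheme \<Rightarrow> ('k, 'b, 'e) bialg_scheme \<Rightarrow> ('k, 'b, 'x universe, 'm) bmodule_scheme
    \<Rightarrow> ('k, 'b, 'x universe, 'n) bmodule_scheme \<Rightarrow> ('k, 'b, 'x universe) bmodule" where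
  "tens_mod R B M N = module.extend (transport R Tens (tensor_t R B M N))
     (bmodule.fields (\<lambda>b\<in>carrier B. \<lambda>x\<in>Tens ` carrier (tensor_t R B M N).
        Tens (diag_act R B M N b (summands x))))"

text \<open>The unit object \<open>B\<^sub>t\<close>, transported into the universe along \<open>\<iota>\<close>.\<close>

definition target :: "('k, 'b, 'e) bialg_scheme \<Rightarrow> ('k, 'b) module" where
  "target B = \<lparr>carrier = eps_t B ` carrier B, mult = mult B, one = \<one>\<^bsub>B\<^esub>, zero = \<zero>\<^bsub>B\<^esub>, add = add B,
     smult = smult B\<rparr>"

definition unit_mod ::
  "('k, 'r) ring_scheme \<Rightarrow> ('k, 'b, 'e) bialg_scheme \<Rightarrow> ('b \<Rightarrow> 'x universe) \<Rightarrow> ('k, 'b, 'x universe) bmodule" where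
  "unit_mod R B \<iota> = module.extend (transport R \<iota> (target B))
     (bmodule.fields (\<lambda>b\<in>carrier B. \<lambda>x\<in>\<iota> ` carrier (target B).
        \<iota> (eps_t B (b \<otimes>\<^bsub>B\<^esub> inv_into (carrier (target B)) \<iota> x))))"

text \<open>
  Arrows are triples consisting of the domain, the map and the codomain. The arrows below are
  shared by the category of modules and the category of Yetter-Drinfeld modules; \<open>T\<close> is the
  tensor product of objects and \<open>I\<close> the unit object.
\<close>

type_synonym ('o, 'u) arrow = "'o \<times> ('u \<Rightarrow> 'u) \<times> 'o"

definition id_arrow :: "('k, 'b, 'u, 'm) bmodule_scheme \<Rightarrow> (('k, 'b, 'u, 'm) bmodule_scheme, 'u) arrow" where
  "id_arrow M = (M, \<lambda>x\<in>carrier M. x, M)"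

fun comp_arrow ::
  "(('k, 'b, 'u, 'm) bmodule_scheme, 'u) arrow \<Rightarrow> (('k, 'b, 'u, 'm) bmodule_scheme, 'u) arrow
    \<Rightarrow> (('k, 'b, 'u, 'm) bmodule_scheme, 'u) arrow" where
  "comp_arrow (_, g, P) (M, f, _) = (M, compose (carrier M) g f, P)"

fun tens_arrow where
  "tens_arrow R T (M :: ('k, 'b, 'x universe, 'm) bmodule_scheme, f, M') (N, g, N') =
     (T M N,
      \<lambda>x\<in>carrier (T M N :: ('k, 'b, 'x universe, 'm) bmodule_scheme).
        Tens (tens R M' N' [(f m, g n). (m, n) \<leftarrow> summands x]),
      T M' N')"

text \<open>
  The natural associativity \<open>(m \<otimes> n) \<otimes> p \<mapsto> m \<otimes> (n \<otimes> p)\<close>. For an element of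
  \<open>(M \<otimes>\<^sub>t N) \<otimes>\<^sub>t P\<close>, its image in \<open>M \<otimes> (N \<otimes> P)\<close> lies in \<open>M \<otimes> (N \<otimes>\<^sub>t P)\<close>. The individual
  tensors \<open>n \<otimes> p\<close> need not lie in \<open>N \<otimes>\<^sub>t P\<close>; inserting the projection \<open>\<Delta>(1)\<close> onto \<open>N \<otimes>\<^sub>t P\<close>
  makes them do so and does not change the sum.
\<close>

definition assoc_arrow where
  "assoc_arrow R B T (M :: ('k, 'b, 'x universe, 'm) bmodule_scheme) N P =
     (T (T M N) P,
      \<lambda>x\<in>carrier (T (T M N) P :: ('k, 'b, 'x universe, 'm) bmodule_scheme).
        Tens (tens R M (T N P)
          [(m, Tens (diag_act R B N P \<one>\<^bsub>B\<^esub> [(n, p)])). (u, p) \<leftarrow> summands x, (m, n) \<leftarrow> summands u]),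
      T M (T N P))"

text \<open>Some element \<open>t\<close> of \<open>M \<otimes> N\<close> such that \<open>x = \<Delta>(1) t\<close>.\<close>

definition unproject ::
  "('k, 'r) ring_scheme \<Rightarrow> ('k, 'b, 'e) bialg_scheme \<Rightarrow> ('k, 'b, 'x universe, 'm) bmodule_scheme
    \<Rightarrow> ('k, 'b, 'x universe, 'm) bmodule_scheme \<Rightarrow> 'x universe \<Rightarrow> ('x universe \<times> 'x universe) list" where
  "unproject R B M N x =
     (SOME t. t \<in> carrier (tensor R M N) \<and> x = Tens (diag_act R B M N \<one>\<^bsub>B\<^esub> t))"

definition lunit_arrow where
  "lunit_arrow R B \<iota> T I (M :: ('k, 'b, 'x universe, 'm) bmodule_scheme) =
     (T I M,
      \<lambda>x\<in>carrier (T I M :: ('k, 'b, 'x universe, 'm) bmodule_scheme).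
        lsum M [act M (inv_into (carrier (target B)) \<iota> z) m. (z, m) \<leftarrow> unproject R B I M x],
      M)"

definition runit_arrow where
  "runit_arrow R B \<iota> T I (M :: ('k, 'b, 'x universe, 'm) bmodule_scheme) =
     (T M I,
      \<lambda>x\<in>carrier (T M I :: ('k, 'b, 'x universe, 'm) bmodule_scheme).
        lsum M [act M (eps_s_bar B (inv_into (carrier (target B)) \<iota> z)) m.
          (m, z) \<leftarrow> unproject R B M I x],
      M)"

definition module_objects ::
  "('k, 'r) ring_scheme \<Rightarrow> ('k, 'b, 'e) bialg_scheme \<Rightarrow> ('k, 'b, 'u) bmodule set" where
  "module_objects R B = {M. left_module R B M \<and> normal_module R M
     \<and> act M = (\<lambda>b\<in>carrier B. \<lambda>m\<in>carrier M. act M b m)}"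

definition module_category ::
  "('k, 'r) ring_scheme \<Rightarrow> ('k, 'b, 'e) bialg_scheme \<Rightarrow> ('b \<Rightarrow> 'x universe)
    \<Rightarrow> (('k, 'b, 'x universe) bmodule, (('k, 'b, 'x universe) bmodule, 'x universe) arrow) moncat" where
  "module_category R B \<iota> = \<lparr>
     Ob = module_objects R B,
     Ar = {(M, f, N). M \<in> module_objects R B \<and> N \<in> module_objects R B
             \<and> left_linear R B M N f \<and> f \<in> extensional (carrier M)},
     Dom = (\<lambda>(M, f, N). M),
     Cod = (\<lambda>(M, f, N). N),
     Id = id_arrow,
     Cmp = comp_arrow,
     TensOb = tens_mod R B,
     TensAr = tens_arrow R (tens_mod R B),
     Unit = unit_mod R B \<iota>,
     Assoc = assoc_arrow R B (tens_mod R B),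
     Lunit = lunit_arrow R B \<iota> (tens_mod R B) (unit_mod R B \<iota>),
     Runit = runit_arrow R B \<iota> (tens_mod R B) (unit_mod R B \<iota>)\<rparr>"


section \<open>Left-right Yetter-Drinfeld modules\<close>

record ('k, 'h, 'u) ydmodule = "('k, 'h, 'u) bmodule" +
  coact :: "'u \<Rightarrow> ('u \<times> 'h) list"

definition yd_module ::
  "('k, 'r) ring_scheme \<Rightarrow> ('k, 'h, 'e) bialg_scheme \<Rightarrow> ('k, 'h, 'u, 'm) ydmodule_scheme \<Rightarrow> bool" where
  "yd_module R H M \<longleftrightarrow> left_module R H M
     \<and> linear_map R M (tensor R M H) (coact M)
     \<and> (\<forall>m\<in>carrier M.
          tens3 R M H H [(m0, h1, h2). (m', h2) \<leftarrow> coact M m, (m0, h1) \<leftarrow> coact M m'] =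
          tens3 R M H H [(m0, h1, h2). (m0, h) \<leftarrow> coact M m, (h1, h2) \<leftarrow> comul H h])
     \<and> (\<forall>m\<in>carrier M. lsum M [counit H m1 \<odot>\<^bsub>M\<^esub> m0. (m0, m1) \<leftarrow> coact M m] = m)
     \<and> (\<forall>m\<in>carrier M. coact M m \<in> carrier (tensor_t R H M (regular H)))
     \<and> (\<forall>h\<in>carrier H. \<forall>m\<in>carrier M.
          tens R M H [(act M h1 m0, h2 \<otimes>\<^bsub>H\<^esub> m1). (h1, h2) \<leftarrow> comul H h, (m0, m1) \<leftarrow> coact M m] =
          tens R M H [(m0, m1 \<otimes>\<^bsub>H\<^esub> h1). (h1, h2) \<leftarrow> comul H h, (m0, m1) \<leftarrow> coact M (act M h2 m)])"

definition right_colinear ::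
  "('k, 'r) ring_scheme \<Rightarrow> ('k, 'h, 'e) bialg_scheme \<Rightarrow> ('k, 'h, 'u, 'm) ydmodule_scheme
    \<Rightarrow> ('k, 'h, 'v, 'n) ydmodule_scheme \<Rightarrow> ('u \<Rightarrow> 'v) \<Rightarrow> bool" where
  "right_colinear R H M N f \<longleftrightarrow>
     (\<forall>m\<in>carrier M. coact N (f m) = tens R N H [(f m0, m1). (m0, m1) \<leftarrow> coact M m])"

text \<open>
  The coaction \<open>\<rho>(\<Delta>(1)(m \<otimes> n)) = m\<^sub>[\<^sub>0\<^sub>] \<otimes> n\<^sub>[\<^sub>0\<^sub>] \<otimes> n\<^sub>[\<^sub>1\<^sub>] m\<^sub>[\<^sub>1\<^sub>]\<close> on \<open>M \<otimes>\<^sub>t N\<close>. The right-hand side is an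
  element of \<open>(M \<otimes>\<^sub>t N) \<otimes> H\<close>; as for the associativity, the projection \<open>\<Delta>(1)\<close> is inserted only
  to make the individual tensors \<open>m\<^sub>[\<^sub>0\<^sub>] \<otimes> n\<^sub>[\<^sub>0\<^sub>]\<close> lie in \<open>M \<otimes>\<^sub>t N\<close>.
\<close>

definition tens_yd ::
  "('k, 'r) ring_scheme \<Rightarrow> ('k, 'h, 'e) bialg_scheme \<Rightarrow> ('k, 'h, 'x universe) ydmodule
    \<Rightarrow> ('k, 'h, 'x universe) ydmodule \<Rightarrow> ('k, 'h, 'x universe) ydmodule" where
  "tens_yd R H M N = bmodule.extend (tens_mod R H M N)
     (ydmodule.fields (\<lambda>x\<in>carrier (tens_mod R H M N).
        tens R (tens_mod R H M N) H
          [(Tens (diag_act R H M N \<one>\<^bsub>H\<^esub> [(m0, n0)]), n1 \<otimes>\<^bsub>H\<^esub> m1).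
             (m, n) \<leftarrow> unproject R H M N x, (m0, m1) \<leftarrow> coact M m, (n0, n1) \<leftarrow> coact N n]))"

text \<open>
  The coaction \<open>\<rho>(z) = z\<^sub>(\<^sub>2\<^sub>) \<otimes> S\<^sup>-\<^sup>1(z\<^sub>(\<^sub>1\<^sub>))\<close> on \<open>H\<^sub>t\<close>. Since \<open>\<Delta>(z)\<close> is in \<open>H \<otimes> H\<^sub>t\<close>, applying the
  projection \<open>\<epsilon>\<^sub>t\<close> onto \<open>H\<^sub>t\<close> to \<open>z\<^sub>(\<^sub>2\<^sub>)\<close> does not change this element.
\<close>

definition unit_yd ::
  "('k, 'r) ring_scheme \<Rightarrow> ('k, 'h, 'e) bialg_scheme \<Rightarrow> ('h \<Rightarrow> 'h) \<Rightarrow> ('h \<Rightarrow> 'x universe)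
    \<Rightarrow> ('k, 'h, 'x universe) ydmodule" where
  "unit_yd R H S \<iota> = bmodule.extend (unit_mod R H \<iota>)
     (ydmodule.fields (\<lambda>x\<in>carrier (unit_mod R H \<iota>).
        tens R (unit_mod R H \<iota>) H
          [(\<iota> (eps_t H z2), antipode_inv H S z1).
             (z1, z2) \<leftarrow> comul H (inv_into (carrier (target H)) \<iota> x)]))"

definition yd_objects ::
  "('k, 'r) ring_scheme \<Rightarrow> ('k, 'h, 'e) bialg_scheme \<Rightarrow> ('k, 'h, 'u) ydmodule set" where
  "yd_objects R H = {M. yd_module R H M \<and> normal_module R M
     \<and> act M = (\<lambda>h\<in>carrier H. \<lambda>m\<in>carrier M. act M h m)
     \<and> coact M \<in> extensional (carrier M)}"

definition yd_category ::
  "('k, 'r) ring_scheme \<Rightarrow> ('k, 'h, 'e) bialg_scheme \<Rightarrow> ('h \<Rightarrow> 'h) \<Rightarrow> ('h \<Rightarrow> 'x universe)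
    \<Rightarrow> (('k, 'h, 'x universe) ydmodule, (('k, 'h, 'x universe) ydmodule, 'x universe) arrow) moncat" where
  "yd_category R H S \<iota> = \<lparr>
     Ob = yd_objects R H,
     Ar = {(M, f, N). M \<in> yd_objects R H \<and> N \<in> yd_objects R H
             \<and> left_linear R H M N f \<and> right_colinear R H M N f \<and> f \<in> extensional (carrier M)},
     Dom = (\<lambda>(M, f, N). M),
     Cod = (\<lambda>(M, f, N). N),
     Id = id_arrow,
     Cmp = comp_arrow,
     TensOb = tens_yd R H,
     TensAr = tens_arrow R (tens_yd R H),
     Unit = unit_yd R H S \<iota>,
     Assoc = assoc_arrow R H (tens_yd R H),
     Lunit = lunit_arrow R H \<iota> (tens_yd R H) (unit_yd R H S \<iota>),
     Runit = runit_arrow R H \<iota> (tens_yd R H) (unit_yd R H S \<iota>)\<rparr>"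


section \<open>The functor\<close>

text \<open>
  The formula for the action is evaluated on an arbitrary representative of a class in \<open>D(H)\<close>.
\<close>

definition F_ob ::
  "('k, 'r) ring_scheme \<Rightarrow> ('k, 'h, 'e) bialg_scheme \<Rightarrow> ('h \<Rightarrow> 'h) \<Rightarrow> ('k, 'h, 'u) ydmodule
    \<Rightarrow> ('k, ('h \<times> ('h \<Rightarrow> 'k)) list set, 'u) bmodule" where
  "F_ob R H S M = module.extend (module.truncate M)
     (bmodule.fields (\<lambda>X\<in>carrier (double R H S). \<lambda>m\<in>carrier M.
        lsum M [f m1 \<odot>\<^bsub>M\<^esub> act M h m0.
          (h, f) \<leftarrow> (SOME x. x \<in> X), (m0, m1) \<leftarrow> coact M m]))"

fun F_ar ::
  "('k, 'r) ring_scheme \<Rightarrow> ('k, 'h, 'e) bialg_scheme \<Rightarrow> ('h \<Rightarrow> 'h) \<Rightarrow> (('k, 'h, 'u) ydmodule, 'u) arrow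
    \<Rightarrow> (('k, ('h \<times> ('h \<Rightarrow> 'k)) list set, 'u) bmodule, 'u) arrow" where
  "F_ar R H S (M, f, N) = (F_ob R H S M, f, F_ob R H S N)"

text \<open>
  The atoms of the universe comprise the elements of \<open>H\<close> and of \<open>D(H)\<close>, which are needed for the
  unit objects, and those of an arbitrary further type \<open>'x\<close>.
\<close>

type_synonym ('k, 'h, 'x) yd_universe = "('h + ('h \<times> ('h \<Rightarrow> 'k)) list set + 'x) universe"

definition H_atom :: "'h \<Rightarrow> ('k, 'h, 'x) yd_universe" where
  "H_atom h = Atom (Inl h)"

definition double_atom :: "('h \<times> ('h \<Rightarrow> 'k)) list set \<Rightarrow> ('k, 'h, 'x) yd_universe" where
  "double_atom X = Atom (Inr (Inl X))"

end

theory Submission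
 imports Defs
begin

text \<open>
  An element \<open>\<Sum> h \<bowtie> f\<close> of \<open>H \<bowtie> H*\<close> acts on a Yetter-Drinfeld module only through the linear map
  \<open>u(l) = \<Sum> f(l) h\<close>, by \<open>u m = u(m\<^sub>1) m\<^sub>0\<close>. Under this identification, which is bijective because
  \<open>H\<close> is finitely generated projective, the compatibility condition of Yetter-Drinfeld modules is what
  makes the formula multiplicative, and a dual basis recovers the coaction from the action of \<open>D(H)\<close>;
  this gives the inverse functor. The flip \<open>M \<otimes> N \<rightarrow> N \<otimes> M\<close> carries the projection \<open>\<Delta>(1)\<close> of \<open>D(H)\<close>
  to that of \<open>H\<close>, and the diagonal action of \<open>D(H)\<close> to the action which belongs to the coaction
  \<open>m\<^sub>0 \<otimes> n\<^sub>0 \<otimes> n\<^sub>1 m\<^sub>1\<close>. So it is a monoidal constraint for the functor, and its coherence needs to be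
  verified only on the elements \<open>\<Delta>(1)(m \<otimes> n)\<close>, which generate the tensor products.
\<close>

text \<open>Two obstacles shape the proof. Elements of tensor products and of D(H) are handled
  through chosen representatives, so no formula is well defined by inspection. Hence identities are
  stated under an arbitrary bilinear or trilinear map: by the universal property such a map does not
  see the representative, and coassociativity, the axioms for \<Delta>(1) and the counit laws become
  rewrite rules for nested Sweedler sums. The weak bialgebra axioms are not verified for D(H) one by
  one. The monoidal structure depends on how \<Delta>(X), \<Delta>(1) and the counit act on modules,
  and this is computed on the Yetter-Drinfeld side, where it reduces to facts about H. A class in
  D(H) is detected by the product with the preunit, for linear maps by \<open>lact u \<one>\<close>;
  independence of a representative means invariance under passing from \<open>u\<close> to
  \<open>lact u \<one>\<close>. The counital maps of D(H) are reached through \<open>chi\<close>,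
  the action on the element 1 of H_t.\<close>

text \<open>\<open>x :. M\<close> is membership in the carrier, and a subscript names the structure of an operation.\<close>

abbreviation (input) elem (infix ":." 50) where "x :. M \<equiv> x \<in> carrier M"
abbreviation (input) over where "over M N xs \<equiv> set xs \<subseteq> carrier M \<times> carrier N"
abbreviation (input) smult_sub ("_ \<odot>\<^sub>_ _" [70, 1000, 71] 70) where "a \<odot>\<^sub>M x \<equiv> a \<odot>\<^bsub>M\<^esub> x"
abbreviation (input) mult_sub ("_ \<otimes>\<^sub>_ _" [70, 1000, 71] 70) where "x \<otimes>\<^sub>M y \<equiv> x \<otimes>\<^bsub>M\<^esub> y"
abbreviation (input) add_sub ("_ \<oplus>\<^sub>_ _" [65, 1000, 66] 65) where "x \<oplus>\<^sub>M y \<equiv> x \<oplus>\<^bsub>M\<^esub> y"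
abbreviation (input) one_sub ("\<one>\<^sub>_" [1000] 1000) where "\<one>\<^sub>M \<equiv> \<one>\<^bsub>M\<^esub>"
abbreviation (input) zero_sub ("\<zero>\<^sub>_" [1000] 1000) where "\<zero>\<^sub>M \<equiv> \<zero>\<^bsub>M\<^esub>"

section \<open>Sums over lists\<close>

lemma (in abelian_monoid) lsum_Nil [simp]: "lsum G [] = \<zero>"
 by (simp add: lsum_def)

lemma (in abelian_monoid) lsum_Cons [simp]: "lsum G (x # xs) = x \<oplus> lsum G xs"
 by (simp add: lsum_def)

lemma (in abelian_monoid) lsum_closed: "set xs \<subseteq> carrier G ==> lsum G xs :. G"
 by (induction xs) auto

lemma (in abelian_monoid) lsum_append:
 "set xs \<subseteq> carrier G ==> set ys \<subseteq> carrier G ==> lsum G (xs @ ys) = lsum G xs \<oplus> lsum G ys"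
 by (induction xs) (auto simp: a_assoc lsum_closed)

lemma (in abelian_monoid) lsum_concat:
 "(!!x. x : set xs ==> set (f x) \<subseteq> carrier G) ==>
  lsum G (concat (map f xs)) = lsum G (map (%x. lsum G (f x)) xs)"
proof (induction xs)
 case (Cons x xs)
 then have "set (concat (map f xs)) \<subseteq> carrier G"
  by fastforce
 with Cons show ?case
  by (simp add: lsum_append)
qed simp

lemma (in abelian_monoid) lsum_add:
 "(!!x. x : set xs ==> f x :. G) ==> (!!x. x : set xs ==> g x :. G) ==>
  lsum G (map (%x. f x \<oplus> g x) xs) = lsum G (map f xs) \<oplus> lsum G (map g xs)"
proof (induction xs)
 case (Cons x xs)
 have "lsum G (map f xs) :. G" "lsum G (map g xs) :. G"
  by (rule lsum_closed; use Cons in auto)+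
 with Cons show ?case
  by (simp add: a_ac)
qed simp

lemma (in abelian_monoid) lsum_zero:
 "(!!x. x : set xs ==> f x = \<zero>) ==> lsum G (map f xs) = \<zero>"
 by (induction xs) auto

lemma (in abelian_monoid) lsum_swap:
 "(!!x y. x : set xs ==> y : set ys ==> f x y :. G) ==>
  lsum G (map (%x. lsum G (map (f x) ys)) xs) = lsum G (map (%y. lsum G (map (%x. f x y) xs)) ys)"
proof (induction xs)
 case Nil
 show ?case
  by (simp add: lsum_zero)
next
 case (Cons x xs)
 then show ?case
  by (simp, subst lsum_add) (auto intro!: lsum_closed)
qed

section \<open>Linear maps and Sweedler sums\<close>

text \<open>
 The summands outside of the given carriers are skipped, so that rewriting under a Sweedler sum
 may always assume that the bound variables lie in the carriers.
\<close>

definition ssum ::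
 "('a, 'l) partial_object_scheme \<Rightarrow> ('b, 'm) partial_object_scheme \<Rightarrow> ('c, 'n) ring_scheme
  \<Rightarrow> ('a \<times> 'b) list \<Rightarrow> ('a \<Rightarrow> 'b \<Rightarrow> 'c) \<Rightarrow> 'c" where
 "ssum M N P t bb = lsum P (map (%(a, b). bb a b) (filter (%(a, b). a :. M \<and> b :. N) t))"

definition bilin where
 "bilin R M N P bb \<longleftrightarrow> (\<forall>y\<in>carrier N. linear_map R M P (%x. bb x y))
   \<and> (\<forall>x\<in>carrier M. linear_map R N P (%y. bb x y))"

definition trilin where
 "trilin R L M N P \<gamma> \<longleftrightarrow>
   (\<forall>y\<in>carrier M. \<forall>z\<in>carrier N. linear_map R L P (%x. \<gamma> x y z))
   \<and> (\<forall>x\<in>carrier L. \<forall>z\<in>carrier N. linear_map R M P (%y. \<gamma> x y z))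
   \<and> (\<forall>x\<in>carrier L. \<forall>y\<in>carrier M. linear_map R N P (%z. \<gamma> x y z))"

text \<open>The filter in \<open>ssum\<close> makes the membership premises sound; as a congruence
  rule this hands them to the simplifier at every level of a nested sum.\<close>

lemma ssum_cong [cong]:
 assumes "t = t'" and "!!a b. a :. M ==> b :. N ==> bb a b = bb' a b"
 shows "ssum M N P t bb = ssum M N P t' bb'"
 unfolding ssum_def assms(1) by (intro arg_cong[where f = "lsum P"] map_cong refl) (auto simp: assms(2))

lemmas ssum_eqI = ssum_cong[OF HOL.refl]

lemma ssum_wf:
 "over M N t ==> ssum M N P t bb = lsum P (map (%(a, b). bb a b) t)"
 unfolding ssum_def by (subst filter_True) auto

locale base =
 fixes R :: "('k, 'r) ring_scheme"
 assumes cring_base: "cring R"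
begin

lemma modD [simp]:
 assumes "module R P"
 shows "abelian_group P" "abelian_monoid P" "cring R"
 using assms by (simp_all add: module_def abelian_group.axioms)

lemma add_closed [simp]:
 "module R P ==> x :. P ==> y :. P ==> x \<oplus>\<^sub>P y :. P"
 "module R P ==> \<zero>\<^sub>P :. P"
 "module R P ==> a :. R ==> x :. P ==> a \<odot>\<^sub>P x :. P"
 by (auto simp: abelian_monoid.a_closed module.smult_closed abelian_monoid.zero_closed)

lemma lsum_ssum_closed:
 "module R P ==> (!!a b. a :. M ==> b :. N ==> bb a b :. P) ==>
  ssum M N P t bb :. P"
 unfolding ssum_def by (rule abelian_monoid.lsum_closed) auto

lemmas ssum_closed [simp] = lsum_ssum_closed

lemma linear_mapI:
 "(!!x. x :. M ==> f x :. N) ==>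
  (!!x y. x :. M ==> y :. M ==> f (x \<oplus>\<^sub>M y) = f x \<oplus>\<^sub>N f y) ==>
  (!!a x. a :. R ==> x :. M ==> f (a \<odot>\<^sub>M x) = a \<odot>\<^sub>N f x) ==> linear_map R M N f"
 by (auto simp: linear_map_def)

lemma linear_mapD:
 assumes "linear_map R M N f"
 shows "!!x. x :. M ==> f x :. N"
  and "!!x y. x :. M ==> y :. M ==> f (x \<oplus>\<^sub>M y) = f x \<oplus>\<^sub>N f y"
  and "!!a x. a :. R ==> x :. M ==> f (a \<odot>\<^sub>M x) = a \<odot>\<^sub>N f x"
 using assms by (auto simp: linear_map_def)

lemma linear_map_cong:
 assumes M: "module R M" and "!!x. x :. M ==> f x = g x" and "linear_map R M N g"
 shows "linear_map R M N f"
 using assms unfolding linear_map_def by (auto simp: Pi_iff)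

lemma linear_zero:
 assumes "module R M" "module R N" "linear_map R M N f"
 shows "f \<zero>\<^sub>M = \<zero>\<^sub>N"
proof -
 have "f \<zero>\<^sub>M :. N" "f \<zero>\<^sub>M \<oplus>\<^sub>N f \<zero>\<^sub>M = f \<zero>\<^sub>M"
  using linear_mapD(1)[OF assms(3), of "\<zero>\<^sub>M"] linear_mapD(2)[OF assms(3), of "\<zero>\<^sub>M" "\<zero>\<^sub>M"] assms
  by (auto simp: abelian_monoid.l_zero)
 then show ?thesis
  using assms(2) by (metis abelian_group.r_neg1 abelian_group.l_neg modD(1))
qed

lemma linear_lsum:
 assumes "module R M" "module R N" "linear_map R M N f" "set xs \<subseteq> carrier M"
 shows "f (lsum M xs) = lsum N (map f xs)"
 using assms(4)
proof (induction xs)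
 case Nil
 then show ?case
  using assms by (simp add: linear_zero abelian_monoid.lsum_Nil)
next
 case (Cons x xs)
 then show ?case
  using assms linear_mapD(2)[OF assms(3)]
  by (simp add: abelian_monoid.lsum_Cons abelian_monoid.lsum_closed)
qed

lemma linear_ssum:
 assumes "linear_map R Q P f" "module R Q" "module R P"
  and "!!a b. a :. A ==> b :. B ==> \<gamma> a b :. Q"
 shows "f (ssum A B Q t \<gamma>) = ssum A B P t (%a b. f (\<gamma> a b))"
 unfolding ssum_def
 by (subst linear_lsum[OF assms(2,3,1)]) (use assms(4) in \<open>auto simp: o_def case_prod_unfold\<close>)

lemma linear_comp:
 assumes "linear_map R N P f" "linear_map R M N g"
 shows "linear_map R M P (%x. f (g x))"
 using assms by (auto simp: linear_map_def Pi_iff)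

lemma linear_id [simp]: "linear_map R M M (%x. x)"
 by (auto simp: linear_map_def)

lemma linear_smult [simp]:
 assumes "module R P" "a :. R" "linear_map R M P g"
 shows "linear_map R M P (%x. a \<odot>\<^sub>P g x)"
proof -
 have P: "cring R" using assms(1) by simp
 show ?thesis
  using assms P by (auto simp: linear_map_def Pi_iff module.smult_r_distr simp flip: module.smult_assoc1
   intro!: arg_cong2[where f = "smult P"] cring.cring_simprules)
qed

lemma linear_add:
 assumes "module R P" "linear_map R M P f" "linear_map R M P g"
 shows "linear_map R M P (%x. f x \<oplus>\<^sub>P g x)"
 using assms by (intro linear_mapI)
  (auto simp: linear_mapD abelian_monoid.a_assoc abelian_monoid.a_comm abelian_monoid.a_lcomm module.smult_r_distr)

lemma linear_const_zero: "module R P ==> module R M ==> linear_map R M P (%x. \<zero>\<^sub>P)"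
 by (intro linear_mapI) (auto simp: abelian_monoid.l_zero module.smult_r_null)

lemma linear_in_lsum:
 assumes "module R P" "module R M" "!!y. y : set ys ==> linear_map R M P (%x. \<gamma> x y)"
 shows "linear_map R M P (%x. lsum P (map (\<gamma> x) ys))"
 using assms(3)
 by (induction ys) (use assms(1,2) in \<open>auto simp: abelian_monoid.lsum_Nil abelian_monoid.lsum_Cons linear_const_zero linear_add\<close>)

lemma linear_in_ssum [simp]:
 assumes "module R P" "module R M" "!!a b. a :. A ==> b :. B ==> linear_map R M P (%x. \<gamma> x a b)"
 shows "linear_map R M P (%x. ssum A B P t (\<gamma> x))"
 unfolding ssum_def case_prod_unfold
 by (rule linear_in_lsum[OF assms(1,2)]) (auto intro: assms(3))

lemma ssum_swap:
 assumes "module R P" "!!a b c d. a :. A ==> b :. B ==> c :. C ==> d :. D ==> \<gamma> a b c d :. P"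
 shows "ssum A B P t (%a b. ssum C D P u (\<gamma> a b)) = ssum C D P u (%c d. ssum A B P t (%a b. \<gamma> a b c d))"
proof -
 have "ssum A B P t (%a b. ssum C D P u (\<gamma> a b)) =
   lsum P (map (%x. lsum P (map (%y. \<gamma> (fst x) (snd x) (fst y) (snd y)) [(c,d) \<leftarrow> u. c :. C \<and> d :. D])) [(c,d) \<leftarrow> t. c :. A \<and> d :. B])"
  by (simp add: ssum_def case_prod_unfold)
 also have "... = lsum P (map (%y. lsum P (map (%x. \<gamma> (fst x) (snd x) (fst y) (snd y)) [(c,d) \<leftarrow> t. c :. A \<and> d :. B])) [(c,d) \<leftarrow> u. c :. C \<and> d :. D])"
  by (rule abelian_monoid.lsum_swap) (use assms in auto)
 finally show ?thesis
  by (simp add: ssum_def case_prod_unfold)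
qed

lemma bilinI:
 "(!!y. y :. N ==> linear_map R M P (%x. bb x y)) ==>
  (!!x. x :. M ==> linear_map R N P (%y. bb x y)) ==> bilin R M N P bb"
 by (auto simp: bilin_def)

declare bilinI [simp]

lemma trilinI [simp]:
 "(!!y z. y :. M ==> z :. N ==> linear_map R L P (%x. \<gamma> x y z)) ==>
  (!!x z. x :. L ==> z :. N ==> linear_map R M P (%y. \<gamma> x y z)) ==>
  (!!x y. x :. L ==> y :. M ==> linear_map R N P (%z. \<gamma> x y z)) ==> trilin R L M N P \<gamma>"
 by (auto simp: trilin_def)

text \<open>A linear map is composed into the argument so that, as a simp rule, this peels off one
  operation at a time; linearity of a nested Sweedler expression is then proved by recursion on its
  shape.\<close>

lemma bilin_lin:
 assumes "bilin R M N P bb"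
 shows "y :. N ==> linear_map R Q M g ==> linear_map R Q P (%x. bb (g x) y)"
  and "x :. M ==> linear_map R Q' N g' ==> linear_map R Q' P (%y. bb x (g' y))"
  and "x :. M ==> y :. N ==> bb x y :. P"
 using assms linear_comp[of M P "%x. bb x y" Q g] linear_comp[of N P "%y. bb x y" Q' g']
 by (auto simp: bilin_def linear_map_def)

text \<open>Used from left to right to draw sums and scalars out of an operation, so that both sides
  of an identity reach a form in which all Sweedler sums stand outside.\<close>

lemma bilin_push:
 assumes "bilin R M N P bb" "module R M" "module R N" "module R P"
 shows "y :. N ==> (!!a b. a :. A ==> b :. B ==> \<gamma> a b :. M) ==>
   bb (ssum A B M t \<gamma>) y = ssum A B P t (%a b. bb (\<gamma> a b) y)"
  and "x :. M ==> (!!a b. a :. A' ==> b :. B' ==> \<gamma>' a b :. N) ==>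
   bb x (ssum A' B' N t' \<gamma>') = ssum A' B' P t' (%a b. bb x (\<gamma>' a b))"
  and "y :. N ==> x :. M ==> a :. R ==> bb (a \<odot>\<^sub>M x) y = a \<odot>\<^sub>P bb x y"
  and "y :. N ==> x :. M ==> a :. R ==> bb x (a \<odot>\<^sub>N y) = a \<odot>\<^sub>P bb x y"
 using assms linear_ssum[of M P "%x. bb x y" A B \<gamma> t] linear_ssum[of N P "%y. bb x y" A' B' \<gamma>' t']
 by (auto simp: bilin_def linear_map_def)

lemma trilin_lin:
 assumes "trilin R L M N P \<gamma>"
 shows "y :. M ==> z :. N ==> linear_map R Q L g ==> linear_map R Q P (%x. \<gamma> (g x) y z)"
  and "x :. L ==> z :. N ==> linear_map R Q' M g' ==> linear_map R Q' P (%y. \<gamma> x (g' y) z)"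
  and "x :. L ==> y :. M ==> linear_map R Q'' N g'' ==> linear_map R Q'' P (%z. \<gamma> x y (g'' z))"
  and "x :. L ==> y :. M ==> z :. N ==> \<gamma> x y z :. P"
proof -
 show "y :. M ==> z :. N ==> linear_map R Q L g ==> linear_map R Q P (%x. \<gamma> (g x) y z)"
  by (rule linear_comp[where f = "%x. \<gamma> x y z"]) (use assms in \<open>auto simp: trilin_def\<close>)
 show "x :. L ==> z :. N ==> linear_map R Q' M g' ==> linear_map R Q' P (%y. \<gamma> x (g' y) z)"
  by (rule linear_comp[where f = "%y. \<gamma> x y z"]) (use assms in \<open>auto simp: trilin_def\<close>)
 show "x :. L ==> y :. M ==> linear_map R Q'' N g'' ==> linear_map R Q'' P (%z. \<gamma> x y (g'' z))"
  by (rule linear_comp[where f = "%z. \<gamma> x y z"]) (use assms in \<open>auto simp: trilin_def\<close>)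
 show "x :. L ==> y :. M ==> z :. N ==> \<gamma> x y z :. P"
  using assms linear_mapD(1)[of L P "%x. \<gamma> x y z"] by (auto simp: trilin_def)
qed

lemma trilin_push:
 assumes "trilin R L M N P \<gamma>" "module R L" "module R M" "module R N" "module R P"
 shows "y :. M ==> z :. N ==> (!!a b. a :. A ==> b :. B ==> \<phi> a b :. L) ==>
   \<gamma> (ssum A B L t \<phi>) y z = ssum A B P t (%a b. \<gamma> (\<phi> a b) y z)"
  and "x :. L ==> z :. N ==> (!!a b. a :. A' ==> b :. B' ==> \<phi>' a b :. M) ==>
   \<gamma> x (ssum A' B' M t' \<phi>') z = ssum A' B' P t' (%a b. \<gamma> x (\<phi>' a b) z)"
  and "x :. L ==> y :. M ==> (!!a b. a :. A'' ==> b :. B'' ==> \<phi>'' a b :. N) ==>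
   \<gamma> x y (ssum A'' B'' N t'' \<phi>'') = ssum A'' B'' P t'' (%a b. \<gamma> x y (\<phi>'' a b))"
  and "x :. L ==> y :. M ==> z :. N ==> a :. R ==> \<gamma> (a \<odot>\<^sub>L x) y z = a \<odot>\<^sub>P \<gamma> x y z"
  and "x :. L ==> y :. M ==> z :. N ==> a :. R ==> \<gamma> x (a \<odot>\<^sub>M y) z = a \<odot>\<^sub>P \<gamma> x y z"
  and "x :. L ==> y :. M ==> z :. N ==> a :. R ==> \<gamma> x y (a \<odot>\<^sub>N z) = a \<odot>\<^sub>P \<gamma> x y z"
 using assms linear_ssum[of L P "%x. \<gamma> x y z" A B \<phi> t] linear_ssum[of M P "%y. \<gamma> x y z" A' B' \<phi>' t']
  linear_ssum[of N P "%z. \<gamma> x y z" A'' B'' \<phi>'' t'']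
 by (auto simp: trilin_def linear_map_def)

lemma module_ground: "module R (ground R)"
proof -
 note R = cring.cring_simprules[OF cring_base]
 have "abelian_group (ground R)"
 proof (rule abelian_groupI)
  fix x assume "x :. (ground R)"
  then show "\<exists>y\<in>carrier (ground R). y \<oplus>\<^bsub>ground R\<^esub> x = \<zero>\<^bsub>ground R\<^esub>"
   by (intro bexI[of _ "\<ominus>\<^bsub>R\<^esub> x"]) (auto simp: ground_def R)
 qed (auto simp: ground_def R)
 then show ?thesis
  by (intro moduleI cring_base) (auto simp: ground_def R monoid.r_one
   ring.is_monoid cring.axioms(1)[OF cring_base])
qed

lemma carrier_ground [simp]: "carrier (ground R) = carrier R"
 by (simp add: ground_def)

lemma linear_scalar [simp]:
 assumes "module R P" "linear_map R M (ground R) g" "c :. P"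
 shows "linear_map R M P (%x. g x \<odot>\<^sub>P c)"
 using assms by (intro linear_mapI)
  (auto simp: linear_map_def Pi_iff ground_def module.smult_l_distr module.smult_assoc1)

section \<open>Tensor products\<close>

abbreviation "tn M N m n \<equiv> tens R M N [(m, n)]"

lemma tensor_cong_wf:
 assumes "module R M" "module R N" "tensor_cong R M N xs ys"
 shows "over M N xs \<and> over M N ys"
 using assms(3) by induction (use assms(1,2) in auto)

lemma tensor_cong_tens:
 assumes "over M N xs"
 shows "tensor_cong R M N xs (tens R M N xs)"
 unfolding tens_def using tensor_cong.refl[OF assms] by (rule someI)

text \<open>For congruent lists the congruence is one and the same predicate, so \<open>SOME\<close>
  picks the same representative for both.\<close>

lemma tens_eq_iff:
 assumes "over M N xs" "over M N ys"
 shows "tens R M N xs = tens R M N ys \<longleftrightarrow> tensor_cong R M N xs ys"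
proof
 assume "tensor_cong R M N xs ys"
 then have "tensor_cong R M N xs = tensor_cong R M N ys"
  by (blast intro: tensor_cong.sym tensor_cong.trans)
 then show "tens R M N xs = tens R M N ys"
  by (simp add: tens_def)
next
 assume "tens R M N xs = tens R M N ys"
 then show "tensor_cong R M N xs ys"
  using tensor_cong_tens[OF assms(1)] tensor_cong_tens[OF assms(2)]
  by (metis tensor_cong.sym tensor_cong.trans)
qed

lemma tensor_sel:
 "carrier (tensor R M N) = tens R M N ` {xs. set xs \<subseteq> carrier M \<times> carrier N}"
 "zero (tensor R M N) = tens R M N []"
 "add (tensor R M N) x y = tens R M N (x @ y)"
 "smult (tensor R M N) a x = tens R M N [(a \<odot>\<^sub>M m, n). (m, n) \<leftarrow> x]"
 by (simp_all add: tensor_def)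

lemma tens_in [simp]: "over M N xs ==> tens R M N xs :. (tensor R M N)"
 by (auto simp: tensor_sel)

lemma set_tens:
 assumes "module R M" "module R N" "over M N xs"
 shows "set (tens R M N xs) \<subseteq> carrier M \<times> carrier N"
 using tensor_cong_wf[OF assms(1,2) tensor_cong_tens[OF assms(3)]] by simp

lemma tensor_wf:
 assumes "module R M" "module R N" "t :. (tensor R M N)"
 shows "over M N t"
 using assms(3) set_tens[OF assms(1,2)] unfolding tensor_sel by blast

lemma tens_tens:
 assumes "module R M" "module R N" "over M N xs"
 shows "tens R M N (tens R M N xs) = tens R M N xs"
 by (subst tens_eq_iff) (use set_tens[OF assms] assms tensor_cong_tens[OF assms(3)] in \<open>auto intro: tensor_cong.sym\<close>)

lemma tens_id:
 assumes "module R M" "module R N" "t :. (tensor R M N)"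
 shows "tens R M N t = t"
 using assms tens_tens by (auto simp: tensor_sel)

text \<open>Induction over the congruence. Since scalars act on the left components only, the case
  \<open>balanced\<close> is where commutativity of \<open>R\<close> enters.\<close>

lemma tensor_cong_smult:
 assumes "module R M" "module R N" "a :. R" "tensor_cong R M N xs ys"
 shows "tensor_cong R M N [(a \<odot>\<^sub>M m, n). (m, n) \<leftarrow> xs] [(a \<odot>\<^sub>M m, n). (m, n) \<leftarrow> ys]"
 using assms(4)
proof induction
 case (refl xs)
 then show ?case using assms by (intro tensor_cong.refl) auto
next
 case (commute xs ys)
 then show ?case unfolding map_append using assms by (intro tensor_cong.commute) auto
next
 case (append xs xs' ys ys')
 then show ?case unfolding map_append by (intro tensor_cong.append)
next
 case (zero n)
 then show ?case using assms by (simp add: module.smult_r_null tensor_cong.zero)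
next
 case (add_left m m' n)
 then show ?case using assms by (simp add: module.smult_r_distr tensor_cong.add_left)
next
 case (add_right m n n')
 then show ?case using assms by (simp add: tensor_cong.add_right)
next
 case (balanced b m n)
 have "a \<odot>\<^sub>M (b \<odot>\<^sub>M m) = b \<odot>\<^sub>M (a \<odot>\<^sub>M m)"
  using balanced assms cring_base by (metis cring.cring_simprules(14) module.smult_assoc1)
 then show ?case using assms balanced by (simp add: tensor_cong.balanced)
qed (blast intro: tensor_cong.sym tensor_cong.trans)+

lemma tensor_add_tens:
 assumes "module R M" "module R N" "over M N xs" "over M N ys"
 shows "tens R M N xs \<oplus>\<^bsub>tensor R M N\<^esub> tens R M N ys = tens R M N (xs @ ys)"
 unfolding tensor_sel
 by (subst tens_eq_iff) (use set_tens[OF assms(1,2)] assms in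
  \<open>auto intro!: tensor_cong.append tensor_cong.sym[OF tensor_cong_tens]\<close>)

lemma tensor_smult_tens:
 assumes "module R M" "module R N" "a :. R" "over M N xs"
 shows "a \<odot>\<^bsub>tensor R M N\<^esub> tens R M N xs = tens R M N [(a \<odot>\<^sub>M m, n). (m, n) \<leftarrow> xs]"
 unfolding tensor_sel
proof (subst tens_eq_iff)
 show "tensor_cong R M N [(a \<odot>\<^sub>M m, n). (m, n) \<leftarrow> tens R M N xs] [(a \<odot>\<^sub>M m, n). (m, n) \<leftarrow> xs]"
  by (rule tensor_cong_smult) (use assms in \<open>auto intro: tensor_cong.sym[OF tensor_cong_tens]\<close>)
qed (use set_tens[OF assms(1,2,4)] assms in auto)

text \<open>Supplies the additive inverses for \<open>module_tensor\<close>: each pair cancels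
  against its negative once \<open>commute\<close> has brought the two together.\<close>

lemma tensor_cong_neg:
 assumes "module R M" "module R N" "over M N xs"
 shows "tensor_cong R M N ([(\<ominus>\<^bsub>M\<^esub> m, n). (m, n) \<leftarrow> xs] @ xs) []"
 using assms(3)
proof (induction xs)
 case (Cons x xs)
 obtain m n where x: "x = (m, n)" "m :. M" "n :. N" using Cons by auto
 let ?ys = "[(\<ominus>\<^bsub>M\<^esub> m, n). (m, n) \<leftarrow> xs]"
 have M: "abelian_group M" using assms by simp
 have nm: "\<ominus>\<^bsub>M\<^esub> m :. M" using M x by (simp add: abelian_group.a_inv_closed)
 have ys: "set ?ys \<subseteq> carrier M \<times> carrier N"
  using Cons.prems M by (auto simp: abelian_group.a_inv_closed)
 have "tensor_cong R M N ([(\<ominus>\<^bsub>M\<^esub> m, n)] @ ?ys @ [(m, n)] @ xs) ([(\<ominus>\<^bsub>M\<^esub> m, n)] @ ([(m, n)] @ ?ys) @ xs)"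
  using tensor_cong.append[OF tensor_cong.refl tensor_cong.append[OF tensor_cong.commute tensor_cong.refl],
   of "[(\<ominus>\<^bsub>M\<^esub> m, n)]" M N ?ys "[(m, n)]" xs R] x nm ys Cons.prems by simp
 moreover have "tensor_cong R M N [(\<ominus>\<^bsub>M\<^esub> m, n), (m, n)] []"
  using tensor_cong.add_left[of "\<ominus>\<^bsub>M\<^esub> m" M m n N R] tensor_cong.zero[of n N R M] x nm M
  by (metis abelian_group.l_neg tensor_cong.sym tensor_cong.trans)
 then have "tensor_cong R M N ([(\<ominus>\<^bsub>M\<^esub> m, n), (m, n)] @ (?ys @ xs)) ([] @ [])"
  using Cons by (intro tensor_cong.append) auto
 ultimately show ?case
  using x by (auto intro: tensor_cong.trans)
qed (auto intro: tensor_cong.refl)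

lemma module_tensor [simp]:
 assumes M: "module R M" and N: "module R N"
 shows "module R (tensor R M N)"
proof -
 note add = tensor_add_tens[OF M N] and sm = tensor_smult_tens[OF M N]
 have ag: "abelian_group (tensor R M N)"
 proof (rule abelian_groupI, goal_cases)
  case (1 x y)
  then show ?case by (auto simp: tensor_sel(1) add)
 next
  case 2
  show ?case by (auto simp: tensor_sel)
 next
  case (3 x y z)
  then show ?case by (auto simp: tensor_sel(1) add)
 next
  case (4 x y)
  then show ?case by (auto simp: tensor_sel(1) add tens_eq_iff tensor_cong.commute)
 next
  case (5 x)
  then show ?case by (auto simp: tensor_sel(1,2) add)
 next
  case (6 x)
  then obtain xs where xs: "x = tens R M N xs" "over M N xs"
   by (auto simp: tensor_sel)
  have "set [(\<ominus>\<^bsub>M\<^esub> m, n). (m, n) \<leftarrow> xs] \<subseteq> carrier M \<times> carrier N"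
   using xs M by (auto simp: abelian_group.a_inv_closed)
  then show ?case
   by (intro bexI[of _ "tens R M N [(\<ominus>\<^bsub>M\<^esub> m, n). (m, n) \<leftarrow> xs]"])
    (use xs tensor_cong_neg[OF M N xs(2)] in \<open>auto simp: add tensor_sel(2) tens_eq_iff\<close>)
 qed
 show ?thesis
 proof (rule moduleI[OF cring_base ag], goal_cases)
  case (1 a x)
  then obtain xs where xs: "x = tens R M N xs" "over M N xs"
   by (auto simp: tensor_sel)
  moreover have "set [(a \<odot>\<^sub>M m, n). (m, n) \<leftarrow> xs] \<subseteq> carrier M \<times> carrier N"
   using xs M 1 by auto
  ultimately show ?case using 1 by (simp add: sm)
 next
  case (2 a b x)
  then obtain xs where xs: "x = tens R M N xs" "over M N xs"
   by (auto simp: tensor_sel)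
  have ab: "a \<oplus>\<^sub>R b :. R" using 2 cring_base by (simp add: cring.cring_simprules)
  have "tensor_cong R M N [((a \<oplus>\<^sub>R b) \<odot>\<^sub>M m, n). (m, n) \<leftarrow> xs]
    ([(a \<odot>\<^sub>M m, n). (m, n) \<leftarrow> xs] @ [(b \<odot>\<^sub>M m, n). (m, n) \<leftarrow> xs])"
   using xs(2)
  proof (induction xs)
   case (Cons x xs)
   obtain m n where x: "x = (m, n)" "m :. M" "n :. N" using Cons by auto
   let ?A = "[(a \<odot>\<^sub>M m, n). (m, n) \<leftarrow> xs]" and ?B = "[(b \<odot>\<^sub>M m, n). (m, n) \<leftarrow> xs]"
   have wf: "set ?A \<subseteq> carrier M \<times> carrier N" "set ?B \<subseteq> carrier M \<times> carrier N"
    using Cons.prems M 2 by auto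
   have "tensor_cong R M N ([((a \<oplus>\<^sub>R b) \<odot>\<^sub>M m, n)] @ [((a \<oplus>\<^sub>R b) \<odot>\<^sub>M m, n). (m, n) \<leftarrow> xs])
     ([(a \<odot>\<^sub>M m, n), (b \<odot>\<^sub>M m, n)] @ ?A @ ?B)"
    using Cons x 2 M by (intro tensor_cong.append) (auto simp: module.smult_l_distr tensor_cong.add_left)
   moreover have "tensor_cong R M N ([(a \<odot>\<^sub>M m, n)] @ ([(b \<odot>\<^sub>M m, n)] @ ?A) @ ?B)
     ([(a \<odot>\<^sub>M m, n)] @ (?A @ [(b \<odot>\<^sub>M m, n)]) @ ?B)"
    using x 2 M wf by (intro tensor_cong.append tensor_cong.refl tensor_cong.commute) auto
   ultimately show ?case
    using x by (auto intro: tensor_cong.trans)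
  qed (auto intro: tensor_cong.refl)
  moreover have "set [(c \<odot>\<^sub>M m, n). (m, n) \<leftarrow> xs] \<subseteq> carrier M \<times> carrier N" if "c :. R" for c
   using xs M that by auto
  ultimately show ?case
   using xs 2 ab by (simp add: sm add tens_eq_iff)
 next
  case (3 a x y)
  then obtain xs ys where "x = tens R M N xs" "over M N xs"
   "y = tens R M N ys" "over M N ys"
   by (auto simp: tensor_sel)
  moreover have "set [(a \<odot>\<^sub>M m, n). (m, n) \<leftarrow> zs] \<subseteq> carrier M \<times> carrier N"
   if "over M N zs" for zs using M that 3 by auto
  ultimately show ?case using 3 by (simp add: sm add)
 next
  case (4 a b x)
  then obtain xs where xs: "x = tens R M N xs" "over M N xs"
   by (auto simp: tensor_sel)
  have ab: "a \<otimes>\<^sub>R b :. R" using 4 cring_base by (simp add: cring.cring_simprules)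
  have "set [(c \<odot>\<^sub>M m, n). (m, n) \<leftarrow> xs] \<subseteq> carrier M \<times> carrier N" if "c :. R" for c
   using xs M that by auto
  moreover have E: "[((a \<otimes>\<^sub>R b) \<odot>\<^sub>M m, n). (m, n) \<leftarrow> xs] = [(a \<odot>\<^sub>M m, n). (m, n) \<leftarrow> [(b \<odot>\<^sub>M m, n). (m, n) \<leftarrow> xs]]"
   using xs M 4 by (auto simp: module.smult_assoc1)
  ultimately show ?case unfolding xs(1) using xs(2) 4 ab by (simp only: sm E)
 next
  case (5 x)
  then obtain xs where xs: "x = tens R M N xs" "over M N xs"
   by (auto simp: tensor_sel)
  have "[(\<one>\<^sub>R \<odot>\<^sub>M m, n). (m, n) \<leftarrow> xs] = xs"
   using xs M by (intro map_idI) (auto simp: module.smult_one)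
  then show ?case using xs cring_base by (simp add: sm cring.cring_simprules)
 qed
qed

lemma bilin_tn:
 assumes M: "module R M" and N: "module R N"
 shows "bilin R M N (tensor R M N) (tn M N)"
proof (intro bilinI linear_mapI)
 fix a x y assume "a :. R" "x :. M" "y :. N"
 then show "tn M N x (a \<odot>\<^sub>N y) = a \<odot>\<^bsub>tensor R M N\<^esub> tn M N x y"
  using assms by (simp add: tensor_smult_tens tens_eq_iff tensor_cong.sym[OF tensor_cong.balanced])
qed (use assms in \<open>auto simp: tensor_add_tens tensor_smult_tens tens_eq_iff tensor_cong.add_left tensor_cong.add_right\<close>)

lemmas tn_simps [simp] = bilin_lin[OF bilin_tn] bilin_push[OF bilin_tn]

lemma tens_Cons:
 assumes "module R M" "module R N" "m :. M" "n :. N" "over M N xs"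
 shows "tens R M N ((m, n) # xs) = tn M N m n \<oplus>\<^bsub>tensor R M N\<^esub> tens R M N xs"
 using assms by (simp add: tensor_add_tens)

lemma tens_lsum:
 assumes "module R M" "module R N" "over M N xs"
 shows "tens R M N xs = lsum (tensor R M N) (map (%x. tens R M N [x]) xs)"
 using assms(3)
proof (induction xs)
 case Nil
 then show ?case using assms by (simp add: abelian_monoid.lsum_Nil tensor_sel)
next
 case (Cons x xs)
 obtain m n where x: "x = (m, n)" by (cases x)
 have "tens R M N (x # xs) = tn M N m n \<oplus>\<^bsub>tensor R M N\<^esub> tens R M N xs"
  unfolding x by (rule tens_Cons) (use assms Cons x in auto)
 then show ?case
  using assms Cons x by (simp only: list.map abelian_monoid.lsum_Cons modD module_tensor list.set) auto
qed

lemma tens_ssum: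
 assumes "module R M" "module R N" "over M N xs"
 shows "tens R M N xs = ssum M N (tensor R M N) xs (tn M N)"
 unfolding ssum_wf[OF assms(3)] by (simp only: tens_lsum[OF assms] case_prod_unfold prod.collapse)

text \<open>The representative of \<open>t\<close>, read as a list, is itself a decomposition of
  \<open>t\<close> into pure tensors; this is why pure tensors determine linear maps on a tensor
  product.\<close>

lemma tensor_elem:
 assumes "module R M" "module R N" "t :. (tensor R M N)"
 shows "ssum M N (tensor R M N) t (tn M N) = t"
 using tens_ssum[OF assms(1,2) tensor_wf[OF assms]] tens_id[OF assms] by simp

lemma ssum_append:
 assumes "module R P" "!!a b. a :. M ==> b :. N ==> bb a b :. P"
 shows "ssum M N P (xs @ ys) bb = ssum M N P xs bb \<oplus>\<^sub>P ssum M N P ys bb"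
 unfolding ssum_def filter_append map_append
 by (rule abelian_monoid.lsum_append) (use assms in auto)

text \<open>The universal property in terms of lists: each generating relation of the congruence is
  one that a bilinear map respects.\<close>

lemma ssum_tensor_cong:
 assumes P: "module R P" and M: "module R M" and N: "module R N" and bb: "bilin R M N P bb"
  and "tensor_cong R M N xs ys"
 shows "ssum M N P xs bb = ssum M N P ys bb"
 using assms(5)
proof induction
 case (append xs xs' ys ys')
 then show ?case by (simp add: ssum_append[OF P] bilin_lin[OF bb])
next
 case (commute xs ys)
 then show ?case
  using P by (simp add: ssum_append[OF P] bilin_lin[OF bb] abelian_monoid.a_comm)
next
 case (zero n)
 have "bb \<zero>\<^sub>M n = \<zero>\<^sub>P"
  by (rule linear_zero[OF M P]) (use bb zero in \<open>auto simp: bilin_def\<close>)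
 then show ?case
  using zero M P by (simp add: ssum_def abelian_monoid.lsum_Cons abelian_monoid.lsum_Nil abelian_monoid.r_zero)
qed (use assms in \<open>auto simp: ssum_def abelian_monoid.lsum_Cons abelian_monoid.lsum_Nil
  bilin_lin[OF bb] bilin_push[OF bb M N P] abelian_monoid.r_zero bilin_def linear_map_def Pi_iff\<close>)

lemma ssum_tens:
 assumes "module R P" "module R M" "module R N" "bilin R M N P bb" "over M N xs"
 shows "ssum M N P (tens R M N xs) bb = ssum M N P xs bb"
 by (rule ssum_tensor_cong[OF assms(1-4), symmetric]) (rule tensor_cong_tens[OF assms(5)])

lemma ssum_tn [simp]:
 assumes "module R P" "module R M" "module R N" "bilin R M N P bb" "m :. M" "n :. N"
 shows "ssum M N P (tn M N m n) bb = bb m n"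
 by (subst ssum_tens[OF assms(1-4)]) (use assms(1,5,6) in \<open>auto simp: ssum_def abelian_monoid.lsum_Cons
  abelian_monoid.lsum_Nil abelian_monoid.r_zero bilin_lin[OF assms(4)]\<close>)

lemma linear_tens_ssum:
 assumes "module R P" "module R M" "module R N" "bilin R M N P bb"
 shows "linear_map R (tensor R M N) P (%t. ssum M N P t bb)"
proof (rule linear_mapI)
 note c = bilin_lin(3)[OF assms(4)]
 fix x y assume "x :. (tensor R M N)" "y :. (tensor R M N)"
 then show "ssum M N P (x \<oplus>\<^bsub>tensor R M N\<^esub> y) bb = ssum M N P x bb \<oplus>\<^sub>P ssum M N P y bb"
  using assms c tensor_wf[OF assms(2,3)] by (simp add: tensor_sel(3) ssum_tens ssum_append)
next
 note c = bilin_lin(3)[OF assms(4)]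
 fix a x assume a: "a :. R" and x: "x :. (tensor R M N)"
 note wf = tensor_wf[OF assms(2,3) x]
 have wf': "set [(a \<odot>\<^sub>M m, n). (m, n) \<leftarrow> x] \<subseteq> carrier M \<times> carrier N"
  using wf a assms by auto
 have l: "linear_map R P P (%z. a \<odot>\<^sub>P z)"
  using a assms by simp
 have "ssum M N P (a \<odot>\<^bsub>tensor R M N\<^esub> x) bb = lsum P (map (%(m, n). bb m n) [(a \<odot>\<^sub>M m, n). (m, n) \<leftarrow> x])"
  using assms wf' by (simp add: tensor_sel(4) ssum_tens ssum_wf)
 also have "... = lsum P (map (%z. a \<odot>\<^sub>P z) (map (%(m, n). bb m n) x))"
  unfolding map_map by (intro arg_cong[where f = "lsum P"] map_cong refl)
   (use wf a bilin_push(3)[OF assms(4,2,3,1)] in auto)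
 also have "... = a \<odot>\<^sub>P ssum M N P x bb"
  by (subst ssum_wf[OF wf], rule linear_lsum[OF assms(1,1) l, symmetric]) (use wf c in auto)
 finally show "ssum M N P (a \<odot>\<^bsub>tensor R M N\<^esub> x) bb = ..." .
qed (use assms bilin_lin(3)[OF assms(4)] in auto)

lemma linear_in_t [simp]:
 assumes "module R P" "module R M" "module R N" "linear_map R Q (tensor R M N) g" "bilin R M N P bb"
 shows "linear_map R Q P (%x. ssum M N P (g x) bb)"
 using linear_comp[OF linear_tens_ssum[OF assms(1,2,3,5)] assms(4)] .

lemma ssum_in_t [simp]:
 assumes "module R P" "module R M" "module R N" "bilin R M N P bb"
  and "!!a b. a :. A ==> b :. B ==> \<tau> a b :. (tensor R M N)"
 shows "ssum M N P (ssum A B (tensor R M N) u \<tau>) bb = ssum A B P u (%a b. ssum M N P (\<tau> a b) bb)"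
 using linear_ssum[OF linear_tens_ssum[OF assms(1,2,3,4)], of A B \<tau>] assms by simp

lemma smult_ssum:
 assumes "module R P" "r :. R" "!!a b. a :. A ==> b :. B ==> \<gamma> a b :. P"
 shows "r \<odot>\<^sub>P ssum A B P t \<gamma> = ssum A B P t (%a b. r \<odot>\<^sub>P \<gamma> a b)"
 by (rule linear_ssum) (use assms in auto)

lemma linear_eq_tensor:
 assumes "module R P" "module R M" "module R N"
  and f: "linear_map R (tensor R M N) P f" and g: "linear_map R (tensor R M N) P g"
  and eq: "!!m n. m :. M ==> n :. N ==> f (tn M N m n) = g (tn M N m n)"
  and t: "t :. (tensor R M N)"
 shows "f t = g t"
proof -
 have "f (ssum M N (tensor R M N) t (tn M N)) = g (ssum M N (tensor R M N) t (tn M N))"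
  using assms by (simp add: linear_ssum[OF f] linear_ssum[OF g] cong: ssum_cong)
 then show ?thesis
  using tensor_elem[OF assms(2,3) t] by simp
qed

end

section \<open>From list comprehensions to nested Sweedler sums\<close>

context base
begin

lemma lsum_comp:
 assumes "module R Q" and t: "over A B t"
  and u: "!!a b. a :. A ==> b :. B ==> set (u a b) \<subseteq> carrier C \<times> carrier D"
  and c: "!!a b c d. a :. A ==> b :. B ==> c :. C ==> d :. D ==> F (g a b c d) :. Q"
 shows "lsum Q (map F (concat (map (%(a, b). map (%(c, d). g a b c d) (u a b)) t))) =
  ssum A B Q t (%a b. ssum C D Q (u a b) (%c d. F (g a b c d)))"
proof -
 have "lsum Q (map F (concat (map (%(a, b). map (%(c, d). g a b c d) (u a b)) t))) =
   lsum Q (concat (map (%(a, b). map (%(c, d). F (g a b c d)) (u a b)) t))"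
  by (simp add: map_concat o_def case_prod_unfold)
 also have "... = lsum Q (map (%x. lsum Q (case x of (a, b) \<Rightarrow> map (%(c, d). F (g a b c d)) (u a b))) t)"
  by (rule abelian_monoid.lsum_concat) (use assms in \<open>fastforce+\<close>)
 also have "... = ssum A B Q t (%a b. ssum C D Q (u a b) (%c d. F (g a b c d)))"
  unfolding ssum_wf[OF t]
 proof (rule arg_cong[where f = "lsum Q"], rule map_cong[OF HOL.refl])
  fix x assume "x : set t"
  then obtain a b where x: "x = (a, b)" "a :. A" "b :. B" using t by (cases x) auto
  then show "lsum Q (case x of (a, b) \<Rightarrow> map (%(c, d). F (g a b c d)) (u a b)) =
    (case x of (a, b) \<Rightarrow> ssum C D Q (u a b) (%c d. F (g a b c d)))"
   by (simp add: ssum_wf[OF u])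
 qed
 finally show ?thesis .
qed

lemma set_comp:
 assumes "over A B t"
  and "!!a b. a :. A ==> b :. B ==> set (u a b) \<subseteq> carrier C \<times> carrier D"
  and "!!a b c d. a :. A ==> b :. B ==> c :. C ==> d :. D ==> g a b c d : X"
 shows "set (concat (map (%(a, b). map (%(c, d). g a b c d) (u a b)) t)) \<subseteq> X"
 using assms by fastforce

lemma ssum_comp:
 assumes "module R Q" "over A B t"
  and "!!a b. a :. A ==> b :. B ==> set (u a b) \<subseteq> carrier C \<times> carrier D"
  and "!!a b c d. a :. A ==> b :. B ==> c :. C ==> d :. D ==>
   f a b c d :. M \<and> g a b c d :. N"
  and "!!m n. m :. M ==> n :. N ==> bb m n :. Q"
 shows "ssum M N Q (concat (map (%(a, b). map (%(c, d). (f a b c d, g a b c d)) (u a b)) t)) bb =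
  ssum A B Q t (%a b. ssum C D Q (u a b) (%c d. bb (f a b c d) (g a b c d)))"
proof -
 have wf: "set (concat (map (%(a, b). map (%(c, d). (f a b c d, g a b c d)) (u a b)) t)) \<subseteq> carrier M \<times> carrier N"
  by (rule set_comp[OF assms(2,3)]) (use assms(4) in auto)
 show ?thesis
  unfolding ssum_wf[OF wf]
  by (subst lsum_comp[OF assms(1,2,3)]) (use assms(4,5) in auto)
qed

lemma tens_comp_ssum:
 assumes "module R M" "module R N" "over A B t"
  and "!!a b. a :. A ==> b :. B ==> set (u a b) \<subseteq> carrier C \<times> carrier D"
  and "!!a b c d. a :. A ==> b :. B ==> c :. C ==> d :. D ==>
   f a b c d :. M \<and> g a b c d :. N"
 shows "tens R M N (concat (map (%(a, b). map (%(c, d). (f a b c d, g a b c d)) (u a b)) t)) =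
  ssum A B (tensor R M N) t (%a b. ssum C D (tensor R M N) (u a b) (%c d. tn M N (f a b c d) (g a b c d)))"
proof -
 have wf: "set (concat (map (%(a, b). map (%(c, d). (f a b c d, g a b c d)) (u a b)) t)) \<subseteq> carrier M \<times> carrier N"
  by (rule set_comp[OF assms(3,4)]) (use assms(5) in auto)
 show ?thesis
  unfolding tens_ssum[OF assms(1,2) wf] by (rule ssum_comp) (use assms in auto)
qed

lemma tens_map_ssum:
 assumes "module R M" "module R N" "over A B t"
  and "!!a b. a :. A ==> b :. B ==> f a b :. M \<and> g a b :. N"
 shows "tens R M N (map (%(a, b). (f a b, g a b)) t) = ssum A B (tensor R M N) t (%a b. tn M N (f a b) (g a b))"
proof -
 have "set (map (%(a, b). (f a b, g a b)) t) \<subseteq> carrier M \<times> carrier N"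
  using assms(3,4) by fastforce
 then show ?thesis
  using assms by (subst tens_lsum) (auto simp: ssum_wf o_def case_prod_unfold)
qed

text \<open>The universal property of (M \<otimes> N) \<otimes> P, obtained by using that of a
  twofold tensor product for the inner and for the outer sum.\<close>

lemma tens3_lift:
 assumes "module R M" "module R N" "module R P" "module R Q" "trilin R M N P Q \<gamma>"
  and "set xs \<subseteq> carrier M \<times> carrier N \<times> carrier P"
 shows "ssum (tensor R M N) P Q (tens3 R M N P xs) (%t p. ssum M N Q t (%m n. \<gamma> m n p)) =
  lsum Q (map (%(m, n, p). \<gamma> m n p) xs)"
proof -
 note [simp] = trilin_lin[OF assms(5)]
 have wf: "set (map (%(m, n, p). (tn M N m n, p)) xs) \<subseteq> carrier (tensor R M N) \<times> carrier P"
  using assms by fastforce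
 have el: "m :. M \<and> n :. N \<and> p :. P" if "(m, n, p) : set xs" for m n p
  using assms(6) that by auto
 have B: "bilin R (tensor R M N) P Q (%t p. ssum M N Q t (%m n. \<gamma> m n p))"
  using assms(1-4) by simp
 have "ssum (tensor R M N) P Q (tens3 R M N P xs) (%t p. ssum M N Q t (%m n. \<gamma> m n p)) =
   lsum Q (map (%(t, p). ssum M N Q t (%m n. \<gamma> m n p)) (map (%(m, n, p). (tn M N m n, p)) xs))"
  unfolding tens3_def ssum_wf[OF wf, symmetric]
  by (rule ssum_tens[OF assms(4) module_tensor[OF assms(1,2)] assms(3) B wf])
 also have "... = lsum Q (map (%(m, n, p). \<gamma> m n p) xs)"
  using assms(1-4) el by (auto intro!: arg_cong[where f = "lsum Q"])
 finally show ?thesis .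
qed

lemma tens3_lsum:
 assumes "module R M" "module R N" "module R P" "set xs \<subseteq> carrier M \<times> carrier N \<times> carrier P"
 shows "tens3 R M N P xs = lsum (tensor R (tensor R M N) P) (map (%(m, n, p). tn (tensor R M N) P (tn M N m n) p) xs)"
proof -
 have wf: "set (map (%(m, n, p). (tn M N m n, p)) xs) \<subseteq> carrier (tensor R M N) \<times> carrier P"
  using assms by fastforce
 show ?thesis
  unfolding tens3_def by (subst tens_lsum[OF _ _ wf]) (use assms in \<open>auto simp: o_def case_prod_unfold\<close>)
qed

text \<open>Coassociativity and the axioms for \<Delta>(1) are given as equations between lists of
  triples; this turns each of them into an identity of double Sweedler sums under an arbitrary
  trilinear map.\<close>

lemma tens3_comp_eq:
 assumes "module R M" "module R N" "module R P" "module R Q" "trilin R M N P Q \<gamma>"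
  and eq: "tens3 R M N P (concat (map (%(a, b). map (%(c, d). (f a b c d, g a b c d, h a b c d)) (u a b)) t)) =
   tens3 R M N P (concat (map (%(a, b). map (%(c, d). (f' a b c d, g' a b c d, h' a b c d)) (u' a b)) t'))"
  and t: "over A B t" "set t' \<subseteq> carrier A' \<times> carrier B'"
  and u: "!!a b. a :. A ==> b :. B ==> set (u a b) \<subseteq> carrier C \<times> carrier D"
   "!!a b. a :. A' ==> b :. B' ==> set (u' a b) \<subseteq> carrier C' \<times> carrier D'"
  and c: "!!a b c d. a :. A ==> b :. B ==> c :. C ==> d :. D ==>
    f a b c d :. M \<and> g a b c d :. N \<and> h a b c d :. P"
   "!!a b c d. a :. A' ==> b :. B' ==> c :. C' ==> d :. D' ==>
    f' a b c d :. M \<and> g' a b c d :. N \<and> h' a b c d :. P"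
 shows "ssum A B Q t (%a b. ssum C D Q (u a b) (%c d. \<gamma> (f a b c d) (g a b c d) (h a b c d))) =
  ssum A' B' Q t' (%a b. ssum C' D' Q (u' a b) (%c d. \<gamma> (f' a b c d) (g' a b c d) (h' a b c d)))"
proof -
 note [simp] = trilin_lin[OF assms(5)]
 have wf: "set (concat (map (%(a, b). map (%(c, d). (f a b c d, g a b c d, h a b c d)) (u a b)) t)) \<subseteq> carrier M \<times> carrier N \<times> carrier P"
  "set (concat (map (%(a, b). map (%(c, d). (f' a b c d, g' a b c d, h' a b c d)) (u' a b)) t')) \<subseteq> carrier M \<times> carrier N \<times> carrier P"
  by (rule set_comp[OF t(1) u(1)]; simp add: c) (rule set_comp[OF t(2) u(2)]; simp add: c)
 have "lsum Q (map (%(m, n, p). \<gamma> m n p) (concat (map (%(a, b). map (%(c, d). (f a b c d, g a b c d, h a b c d)) (u a b)) t))) =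
  lsum Q (map (%(m, n, p). \<gamma> m n p) (concat (map (%(a, b). map (%(c, d). (f' a b c d, g' a b c d, h' a b c d)) (u' a b)) t')))"
  unfolding tens3_lift[OF assms(1-5) wf(1), symmetric] tens3_lift[OF assms(1-5) wf(2), symmetric] by (simp only: eq)
 then show ?thesis
  by (subst (asm) lsum_comp[OF assms(4) t(1) u(1)], simp_all add: c, subst (asm) lsum_comp[OF assms(4) t(2) u(2)], simp_all add: c)
qed

lemma tens3_comp_ssum:
 assumes "module R M" "module R N" "module R P"
  and t: "over A B t"
  and u: "!!a b. a :. A ==> b :. B ==> set (u a b) \<subseteq> carrier C \<times> carrier D"
  and c: "!!a b c d. a :. A ==> b :. B ==> c :. C ==> d :. D ==>
    f a b c d :. M \<and> g a b c d :. N \<and> h a b c d :. P"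
 shows "tens3 R M N P (concat (map (%(a, b). map (%(c, d). (f a b c d, g a b c d, h a b c d)) (u a b)) t)) =
  ssum A B (tensor R (tensor R M N) P) t (%a b. ssum C D (tensor R (tensor R M N) P) (u a b)
   (%c d. tn (tensor R M N) P (tn M N (f a b c d) (g a b c d)) (h a b c d)))"
 by (subst tens3_lsum[OF assms(1-3)], rule set_comp[OF t u], assumption+, simp add: c,
   subst lsum_comp[OF _ t u], simp_all add: c assms(1-3))

lemma smult_commute:
 "module R P ==> a :. R ==> b :. R ==> x :. P ==> a \<odot>\<^sub>P (b \<odot>\<^sub>P x) = b \<odot>\<^sub>P (a \<odot>\<^sub>P x)"
 using cring_base by (metis cring.cring_simprules(14) module.smult_assoc1)

end

sublocale weak_bialgebra \<subseteq> base R
 by (rule base.intro) (use is_module in \<open>simp add: module_def\<close>)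

section \<open>Weak bialgebras\<close>

context weak_bialgebra
begin

abbreviation "sw P h bb \<equiv> ssum H H P (comul H h) bb"

declare is_module [simp]

lemma H_ring [simp]:
 "x :. H ==> y :. H ==> x \<otimes> y :. H"
 "\<one> :. H"
 "x :. H ==> \<one> \<otimes> x = x"
 "x :. H ==> x \<otimes> \<one> = x"
 "x :. H ==> y :. H ==> z :. H ==> x \<otimes> y \<otimes> z = x \<otimes> (y \<otimes> z)"
 "a :. R ==> x :. H ==> y :. H ==> (a \<odot> x) \<otimes> y = a \<odot> (x \<otimes> y)"
 "a :. R ==> x :. H ==> y :. H ==> x \<otimes> (a \<odot> y) = a \<odot> (x \<otimes> y)"
 using is_ring smult_mult by (auto simp: ring.ring_simprules ring.is_monoid monoid.m_assoc)

lemma bilin_mult: "bilin R H H H (\<otimes>)"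
 using is_ring by (intro bilinI linear_mapI) (auto simp: ring.ring_simprules)

lemmas mult_simps [simp] = bilin_lin[OF bilin_mult] bilin_push[OF bilin_mult is_module is_module is_module]

lemma comul_carrier [simp]: "h :. H ==> comul H h :. (tensor R H H)"
 using linear_mapD(1)[OF comul_linear] .

lemma comul_wf: "h :. H ==> set (comul H h) \<subseteq> carrier H \<times> carrier H"
 using tensor_wf[OF is_module is_module comul_carrier] .

lemmas comul_lin [simp] = linear_comp[OF comul_linear]

lemma counit_closed [simp]: "h :. H ==> counit H h :. R"
 using linear_mapD(1)[OF counit_linear] by simp

lemmas counit_lin [simp] = linear_comp[OF counit_linear]

lemma counit_push [simp]:
 assumes "module R P" "c :. P"
 shows "(!!a b. a :. A ==> b :. B ==> \<gamma> a b :. H) ==>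
   counit H (ssum A B H t \<gamma>) \<odot>\<^sub>P c = ssum A B P t (%a b. counit H (\<gamma> a b) \<odot>\<^sub>P c)"
  and "r :. R ==> h :. H ==> counit H (r \<odot> h) \<odot>\<^sub>P c = r \<odot>\<^sub>P (counit H h \<odot>\<^sub>P c)"
 by (rule linear_ssum[of H P "%x. counit H x \<odot>\<^sub>P c"], use assms in auto)
  (use linear_mapD(3)[of H P "%x. counit H x \<odot>\<^sub>P c" r h] assms in auto)

lemma sw_lin: "module R P ==> bilin R H H P bb ==> linear_map R H P (%h. sw P h bb)"
 by (rule linear_in_t) auto

lemma sw_push [simp]:
 assumes "module R P" "bilin R H H P bb"
 shows "(!!a b. a :. A ==> b :. B ==> \<gamma> a b :. H) ==>
   sw P (ssum A B H t \<gamma>) bb = ssum A B P t (%a b. sw P (\<gamma> a b) bb)"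
  and "r :. R ==> h :. H ==> sw P (r \<odot> h) bb = r \<odot>\<^sub>P sw P h bb"
 using linear_ssum[OF sw_lin[OF assms], of A B \<gamma> t] linear_mapD(3)[OF sw_lin[OF assms], of r h] assms(1)
 by auto

declare smult_ssum [simp]

text \<open>Oriented from a split first leg to a split second leg, so that rewriting brings iterated
  comultiplications to right-nested form.\<close>

lemma coas:
 assumes "module R P" "h :. H" "trilin R H H H P \<gamma>"
 shows "sw P h (%a b. sw P a (%c d. \<gamma> c d b)) = sw P h (%a b. sw P b (%c d. \<gamma> a c d))"
 using tens3_comp_eq[OF is_module is_module is_module assms(1,3) coassoc[OF assms(2)]
   comul_wf[OF assms(2)] comul_wf[OF assms(2)] comul_wf comul_wf] by simp

lemma one1:
 assumes "module R P" "trilin R H H H P \<gamma>"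
 shows "sw P \<one> (%a b. sw P a (%c d. \<gamma> c d b)) = sw P \<one> (%a b. sw P \<one> (%c d. \<gamma> a (b \<otimes> c) d))"
 using tens3_comp_eq[OF is_module is_module is_module assms comul_one_1[unfolded comul3_def]
   comul_wf comul_wf comul_wf comul_wf] by simp

lemma one2:
 assumes "module R P" "trilin R H H H P \<gamma>"
 shows "sw P \<one> (%a b. sw P a (%c d. \<gamma> c d b)) = sw P \<one> (%a b. sw P \<one> (%c d. \<gamma> a (c \<otimes> b) d))"
 using tens3_comp_eq[OF is_module is_module is_module assms comul_one_2[unfolded comul3_def]
   comul_wf comul_wf comul_wf comul_wf] by simp

lemma sw_mult:
 assumes "module R P" "h :. H" "k :. H" "bilin R H H P bb"
 shows "sw P (h \<otimes> k) bb = sw P h (%a b. sw P k (%c d. bb (a \<otimes> c) (b \<otimes> d)))"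
proof -
 note [simp] = bilin_lin[OF assms(4)]
 have wf: "set (concat (map (%(h1, h2). map (%(k1, k2). (h1 \<otimes> k1, h2 \<otimes> k2)) (comul H k)) (comul H h))) \<subseteq> carrier H \<times> carrier H"
  by (rule set_comp[OF comul_wf comul_wf]) (use assms in auto)
 have "sw P (h \<otimes> k) bb = ssum H H P (concat (map (%(h1, h2). map (%(k1, k2). (h1 \<otimes> k1, h2 \<otimes> k2)) (comul H k)) (comul H h))) bb"
  unfolding comul_mult[OF assms(2,3)] by (rule ssum_tens[OF assms(1) is_module is_module assms(4) wf])
 then show ?thesis
  by (subst (asm) ssum_comp[OF assms(1) comul_wf comul_wf]) (use assms in auto)
qed

lemma cou_l:
 assumes "module R P" "h :. H" "linear_map R H P g"
 shows "sw P h (%a b. counit H a \<odot>\<^sub>P g b) = g h"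
proof -
 have "h = sw H h (%a b. counit H a \<odot> b)"
  using counit_left[OF assms(2)] by (simp add: ssum_wf[OF comul_wf[OF assms(2)]])
 then have "g h = g (sw H h (%a b. counit H a \<odot> b))" by simp
 then show ?thesis
  using assms(1) by (simp add: linear_ssum[OF assms(3)] linear_mapD[OF assms(3)])
qed

lemma cou_r:
 assumes "module R P" "h :. H" "linear_map R H P g"
 shows "sw P h (%a b. counit H b \<odot>\<^sub>P g a) = g h"
proof -
 have "h = sw H h (%a b. counit H b \<odot> a)"
  using counit_right[OF assms(2)] by (simp add: ssum_wf[OF comul_wf[OF assms(2)]])
 then have "g h = g (sw H h (%a b. counit H b \<odot> a))" by simp
 then show ?thesis
  using assms(1) by (simp add: linear_ssum[OF assms(3)] linear_mapD[OF assms(3)])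
qed

lemma cm_l:
 assumes "module R P" "h :. H" "bilin R H H P bb"
 shows "sw P h bb = sw P \<one> (%a b. sw P h (%c d. bb (a \<otimes> c) (b \<otimes> d)))"
 using sw_mult[OF assms(1) _ assms(2,3), of \<one>] assms(2) by simp

lemma cm_r:
 assumes "module R P" "h :. H" "bilin R H H P bb"
 shows "sw P h bb = sw P h (%c d. sw P \<one> (%a b. bb (c \<otimes> a) (d \<otimes> b)))"
 using sw_mult[OF assms(1,2) _ assms(3), of \<one>] assms(2) by simp

text \<open>The two axioms for the counit of a product, with middle element 1. Counit values occur
  as coefficients only, so their products are expressed by scalars acting on \<open>x\<close>, which
  keeps all sums inside modules.\<close>

lemma counit_unit:
 assumes "module R P" "x :. P" "h :. H" "l :. H"
 shows "counit H (h \<otimes> l) \<odot>\<^sub>P x = sw P \<one> (%a b. counit H (h \<otimes> a) \<odot>\<^sub>P (counit H (b \<otimes> l) \<odot>\<^sub>P x))"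
  and "counit H (h \<otimes> l) \<odot>\<^sub>P x = sw P \<one> (%a b. counit H (h \<otimes> b) \<odot>\<^sub>P (counit H (a \<otimes> l) \<odot>\<^sub>P x))"
proof -
 have lg: "lsum R xs = lsum (ground R) xs" for xs
  by (simp add: lsum_def ground_def)
 have L: "linear_map R (ground R) P (%r. r \<odot>\<^sub>P x)"
  using assms module_ground by simp
 note R = cring.cring_simprules[OF cring_base]
 have "counit H (h \<otimes> l) = lsum R (map (%(a, b). counit H (h \<otimes> a) \<otimes>\<^sub>R counit H (b \<otimes> l)) (comul H \<one>))"
  using counit_mult_1[OF assms(3) _ assms(4), of \<one>] assms by simp
 then have "counit H (h \<otimes> l) = sw (ground R) \<one> (%a b. counit H (h \<otimes> a) \<otimes>\<^sub>R counit H (b \<otimes> l))"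
  by (simp add: lg ssum_wf comul_wf)
 then show "counit H (h \<otimes> l) \<odot>\<^sub>P x = sw P \<one> (%a b. counit H (h \<otimes> a) \<odot>\<^sub>P (counit H (b \<otimes> l) \<odot>\<^sub>P x))"
  using assms by (simp add: linear_ssum[OF L module_ground] R(5) module.smult_assoc1)
 have "counit H (h \<otimes> l) = lsum R (map (%(a, b). counit H (h \<otimes> b) \<otimes>\<^sub>R counit H (a \<otimes> l)) (comul H \<one>))"
  using counit_mult_2[OF assms(3) _ assms(4), of \<one>] assms by simp
 then have "counit H (h \<otimes> l) = sw (ground R) \<one> (%a b. counit H (h \<otimes> b) \<otimes>\<^sub>R counit H (a \<otimes> l))"
  by (simp add: lg ssum_wf comul_wf)
 then show "counit H (h \<otimes> l) \<odot>\<^sub>P x = sw P \<one> (%a b. counit H (h \<otimes> b) \<odot>\<^sub>P (counit H (a \<otimes> l) \<odot>\<^sub>P x))"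
  using assms by (simp add: linear_ssum[OF L module_ground] R(5) module.smult_assoc1)
qed

lemma sw_swap:
 "module R P ==> (!!a b c d. a :. H ==> b :. H ==> c :. H ==> d :. H ==> \<gamma> a b c d :. P) ==>
  sw P h (%a b. sw P k (%c d. \<gamma> a b c d)) = sw P k (%c d. sw P h (%a b. \<gamma> a b c d))"
 by (rule ssum_swap)

section \<open>The counital maps\<close>

abbreviation "et \<equiv> eps_t H"
abbreviation "es \<equiv> eps_s H"
abbreviation "esb \<equiv> eps_s_bar H"
text \<open>The fourth counital map, which completes the list formed by \<open>et\<close>,
  \<open>es\<close> and \<open>esb\<close>. It is \<open>es\<close> followed by the inverse of the
  antipode (\<open>T_es\<close>) and is needed to commute the preunit with elements of H
  (\<open>lact_ue\<close>).\<close>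

definition "etb h = sw H \<one> (%a b. counit H (h \<otimes> a) \<odot> b)"

lemma eps_sw:
 "et h = sw H \<one> (%a b. counit H (a \<otimes> h) \<odot> b)"
 "es h = sw H \<one> (%a b. counit H (h \<otimes> b) \<odot> a)"
 "esb h = sw H \<one> (%a b. counit H (b \<otimes> h) \<odot> a)"
 by (simp_all add: eps_t_def eps_s_def eps_s_bar_def ssum_wf comul_wf)

lemma eps_lin0: "linear_map R H H et" "linear_map R H H es" "linear_map R H H esb" "linear_map R H H etb"
 unfolding eps_sw[abs_def] etb_def[abs_def] by simp_all

lemmas eps_lin [simp] = eps_lin0[THEN linear_comp]
lemmas eps_closed [simp] = eps_lin0[THEN linear_mapD(1)]

text \<open>Expanding the counital map produces the sum that \<open>counit_unit\<close> contracts;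
  the four cases differ in which of its two forms applies.\<close>

lemma counit_eps [simp]:
 assumes "module R P" "x :. P" "h :. H" "k :. H"
 shows "counit H (h \<otimes> et k) \<odot>\<^sub>P x = counit H (h \<otimes> k) \<odot>\<^sub>P x"
  and "counit H (h \<otimes> esb k) \<odot>\<^sub>P x = counit H (h \<otimes> k) \<odot>\<^sub>P x"
  and "counit H (es h \<otimes> k) \<odot>\<^sub>P x = counit H (h \<otimes> k) \<odot>\<^sub>P x"
  and "counit H (etb h \<otimes> k) \<odot>\<^sub>P x = counit H (h \<otimes> k) \<odot>\<^sub>P x"
proof -
 show "counit H (h \<otimes> et k) \<odot>\<^sub>P x = counit H (h \<otimes> k) \<odot>\<^sub>P x"
  using assms by (simp add: counit_unit(2)[OF assms] eps_sw smult_commute)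
 show "counit H (h \<otimes> esb k) \<odot>\<^sub>P x = counit H (h \<otimes> k) \<odot>\<^sub>P x"
  using assms by (simp add: counit_unit(1)[OF assms] eps_sw smult_commute)
 show "counit H (es h \<otimes> k) \<odot>\<^sub>P x = counit H (h \<otimes> k) \<odot>\<^sub>P x"
  using assms by (simp add: counit_unit(2)[OF assms] eps_sw smult_commute)
 show "counit H (etb h \<otimes> k) \<odot>\<^sub>P x = counit H (h \<otimes> k) \<odot>\<^sub>P x"
  using assms by (simp add: counit_unit(1)[OF assms] etb_def smult_commute)
qed

lemma counit_eps' [simp]:
 assumes "module R P" "x :. P" "h :. H" "k :. H" "a :. H"
 shows "counit H (a \<otimes> (h \<otimes> et k)) \<odot>\<^sub>P x = counit H (a \<otimes> (h \<otimes> k)) \<odot>\<^sub>P x"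
  and "counit H (a \<otimes> (h \<otimes> esb k)) \<odot>\<^sub>P x = counit H (a \<otimes> (h \<otimes> k)) \<odot>\<^sub>P x"
 using counit_eps(1,2)[OF assms(1,2) H_ring(1)[OF assms(5,3)] assms(4)] assms(3-5) by simp_all

text \<open>\<open>W2\<close>, \<open>W3\<close>, \<open>W4\<close> and \<open>W4'\<close> share one
  proof: insert the counit into the leg that contains \<open>h\<close>, expand \<Delta> of the
  product, rearrange \<Delta>^2(1) by one of its two axioms, and contract \<Delta>(1)\<Delta>(h) or
  \<Delta>(h)\<Delta>(1) to \<Delta>(h). The coefficient that is left is a counital map.\<close>

lemma W2:
 assumes [simp]: "module R P" "h :. H" and bb: "bilin R H H P bb"
 shows "sw P h (%a b. bb a (et b)) = sw P \<one> (%a b. bb (a \<otimes> h) b)"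
proof -
 note [simp] = bilin_lin[OF bb] bilin_push[OF bb is_module is_module assms(1)]
 have "sw P \<one> (%a b. bb (a \<otimes> h) b) = sw P \<one> (%a b. sw P (a \<otimes> h) (%p q. counit H q \<odot>\<^sub>P bb p b))"
  by (simp add: cou_r)
 also have "... = sw P \<one> (%a b. sw P a (%c d. sw P h (%x y. counit H (d \<otimes> y) \<odot>\<^sub>P bb (c \<otimes> x) b)))"
  by (simp add: sw_mult)
 also have "... = sw P \<one> (%a b. sw P h (%x y. sw P \<one> (%c d. counit H (c \<otimes> (b \<otimes> y)) \<odot>\<^sub>P bb (a \<otimes> x) d)))"
  by (subst one2) (simp_all add: sw_swap[of P _ \<one> h])
 also have "... = sw P h (%a b. bb a (et b))"
  by (subst cm_l[of _ h]) (simp_all add: eps_sw)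
 finally show ?thesis ..
qed

lemma W3:
 assumes [simp]: "module R P" "h :. H" and bb: "bilin R H H P bb"
 shows "sw P h (%a b. bb (es a) b) = sw P \<one> (%a b. bb a (h \<otimes> b))"
proof -
 note [simp] = bilin_lin[OF bb] bilin_push[OF bb is_module is_module assms(1)]
 have "sw P \<one> (%a b. bb a (h \<otimes> b)) = sw P \<one> (%a b. sw P (h \<otimes> b) (%p q. counit H p \<odot>\<^sub>P bb a q))"
  by (simp add: cou_l)
 also have "... = sw P \<one> (%a b. sw P a (%c d. sw P h (%x y. counit H (x \<otimes> d) \<odot>\<^sub>P bb c (y \<otimes> b))))"
  by (simp add: sw_mult sw_swap[of P _ h] coas)
 also have "... = sw P \<one> (%a b. sw P \<one> (%c d. sw P h (%x y. counit H (x \<otimes> (c \<otimes> b)) \<odot>\<^sub>P bb a (y \<otimes> d))))"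
  by (subst one2) simp_all
 also have "... = sw P h (%x y. sw P \<one> (%c d. sw P \<one> (%a b. counit H (x \<otimes> (c \<otimes> b)) \<odot>\<^sub>P bb a (y \<otimes> d))))"
  by (rule HOL.trans, (rule sw_swap; simp)) (simp add: sw_swap[of P _ h])
 also have "... = sw P h (%a b. bb (es a) b)"
  by (subst (3) cm_r) (simp_all add: eps_sw)
 finally show ?thesis ..
qed

lemma W4:
 assumes [simp]: "module R P" "h :. H" and bb: "bilin R H H P bb"
 shows "sw P h (%a b. bb (esb a) b) = sw P \<one> (%a b. bb a (b \<otimes> h))"
proof -
 note [simp] = bilin_lin[OF bb] bilin_push[OF bb is_module is_module assms(1)]
 have "sw P \<one> (%a b. bb a (b \<otimes> h)) = sw P \<one> (%a b. sw P (b \<otimes> h) (%p q. counit H p \<odot>\<^sub>P bb a q))"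
  by (simp add: cou_l)
 also have "... = sw P \<one> (%a b. sw P a (%c d. sw P h (%x y. counit H (d \<otimes> x) \<odot>\<^sub>P bb c (b \<otimes> y))))"
  by (simp add: sw_mult coas)
 also have "... = sw P \<one> (%a b. sw P \<one> (%c d. sw P h (%x y. counit H (b \<otimes> (c \<otimes> x)) \<odot>\<^sub>P bb a (d \<otimes> y))))"
  by (subst one1) simp_all
 also have "... = sw P \<one> (%a b. sw P h (%x y. counit H (b \<otimes> x) \<odot>\<^sub>P bb a y))"
  by (rule ssum_eqI, rule HOL.sym, rule HOL.trans, rule cm_l) simp_all
 also have "... = sw P h (%a b. bb (esb a) b)"
  by (rule HOL.trans, (rule sw_swap; simp)) (simp add: eps_sw)
 finally show ?thesis ..
qed

lemma W4':
 assumes [simp]: "module R P" "h :. H" and bb: "bilin R H H P bb"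
 shows "sw P h (%a b. bb a (etb b)) = sw P \<one> (%a b. bb (h \<otimes> a) b)"
proof -
 note [simp] = bilin_lin[OF bb] bilin_push[OF bb is_module is_module assms(1)]
 have "sw P \<one> (%a b. bb (h \<otimes> a) b) = sw P \<one> (%a b. sw P (h \<otimes> a) (%p q. counit H q \<odot>\<^sub>P bb p b))"
  by (simp add: cou_r)
 also have "... = sw P \<one> (%a b. sw P a (%c d. sw P h (%x y. counit H (y \<otimes> d) \<odot>\<^sub>P bb (x \<otimes> c) b)))"
  by (simp add: sw_mult sw_swap[of P _ h])
 also have "... = sw P \<one> (%a b. sw P \<one> (%c d. sw P h (%x y. counit H (y \<otimes> (b \<otimes> c)) \<odot>\<^sub>P bb (x \<otimes> a) d)))"
  by (subst one1) simp_all
 also have "... = sw P \<one> (%c d. sw P h (%x y. sw P \<one> (%a b. counit H (y \<otimes> (b \<otimes> c)) \<odot>\<^sub>P bb (x \<otimes> a) d)))"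
  by (rule HOL.trans, (rule sw_swap; simp)) (simp add: sw_swap[of P _ h \<one>])
 also have "... = sw P \<one> (%c d. sw P h (%x y. counit H (y \<otimes> c) \<odot>\<^sub>P bb x d))"
  by (rule ssum_eqI, rule HOL.sym, rule HOL.trans, rule cm_r) simp_all
 also have "... = sw P h (%a b. bb a (etb b))"
  by (rule HOL.trans, (rule sw_swap; simp)) (simp add: etb_def)
 finally show ?thesis ..
qed

lemma W1:
 assumes "module R P" "bilin R H H P bb"
 shows "sw P \<one> (%a b. bb a (et b)) = sw P \<one> bb" "sw P \<one> (%a b. bb (es a) b) = sw P \<one> bb"
  "sw P \<one> (%a b. bb (esb a) b) = sw P \<one> bb"
 using W2[OF assms(1) _ assms(2), of \<one>] W3[OF assms(1) _ assms(2), of \<one>] W4[OF assms(1) _ assms(2), of \<one>]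
 by simp_all

lemma eps_eps:
 assumes [simp]: "h :. H" "k :. H"
 shows "et (h \<otimes> et k) = et (h \<otimes> k)" "et (h \<otimes> esb k) = et (h \<otimes> k)" "esb (h \<otimes> esb k) = esb (h \<otimes> k)"
  "esb (h \<otimes> et k) = esb (h \<otimes> k)" "es (es h \<otimes> k) = es (h \<otimes> k)"
  "et (et k) = et k" "et (esb k) = et k" "esb (esb k) = esb k" "esb (et k) = esb k" "es (es k) = es k"
proof -
 have *: "et (h \<otimes> et k) = et (h \<otimes> k)" "et (h \<otimes> esb k) = et (h \<otimes> k)" "esb (h \<otimes> esb k) = esb (h \<otimes> k)"
  "esb (h \<otimes> et k) = esb (h \<otimes> k)" "es (es h \<otimes> k) = es (h \<otimes> k)" if [simp]: "h :. H" "k :. H" for h k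
  unfolding eps_sw(1)[of "_ \<otimes> _"] eps_sw(2)[of "_ \<otimes> _"] eps_sw(3)[of "_ \<otimes> _"]
  by simp_all
 show "et (h \<otimes> et k) = et (h \<otimes> k)" "et (h \<otimes> esb k) = et (h \<otimes> k)" "esb (h \<otimes> esb k) = esb (h \<otimes> k)"
  "esb (h \<otimes> et k) = esb (h \<otimes> k)" "es (es h \<otimes> k) = es (h \<otimes> k)"
  by (simp_all add: *)
 show "et (et k) = et k" using *(1)[of \<one> k] by simp
 show "et (esb k) = et k" using *(2)[of \<one> k] by simp
 show "esb (esb k) = esb k" using *(3)[of \<one> k] by simp
 show "esb (et k) = esb k" using *(4)[of \<one> k] by simp
 show "es (es k) = es k" using *(5)[of k \<one>] by simp
qed

text \<open>Fixed points instead of images: the same sets, as both maps are idempotent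
  (\<open>eps_eps\<close>), but a member may be replaced by its counital value in rewriting.\<close>

definition "Ht = {z\<in>carrier H. et z = z}"
definition "Hs = {w\<in>carrier H. es w = w}"

lemma HtD: "z : Ht ==> z :. H" "z : Ht ==> et z = z"
 and HsD: "w : Hs ==> w :. H" "w : Hs ==> es w = w"
 and HtI: "z :. H ==> et z = z ==> z : Ht"
 and HsI: "w :. H ==> es w = w ==> w : Hs"
 by (auto simp: Ht_def Hs_def)

declare HtD(2) [simp] HsD(2) [simp]

lemma et_in [simp]: "h :. H ==> et h : Ht" and es_in [simp]: "h :. H ==> es h : Hs"
 by (auto intro!: HtI HsI simp: eps_eps)

text \<open>Writing z = \<epsilon>(1_1 z) 1_2 turns \<Delta>(z) into a sum over \<Delta>^2(1); the
  two axioms for \<Delta>(1) give the two forms.\<close>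

lemma W7t:
 assumes [simp]: "module R P" and z: "z : Ht" and bb: "bilin R H H P bb"
 shows "sw P z bb = sw P \<one> (%a b. bb (a \<otimes> z) b)" "sw P z bb = sw P \<one> (%a b. bb (z \<otimes> a) b)"
proof -
 note [simp] = bilin_lin[OF bb] bilin_push[OF bb is_module is_module assms(1)]
 have [simp]: "z :. H" using z by (auto dest: HtD HsD)
 have "sw P z bb = sw P (et z) bb" using z by simp
 also have "... = sw P \<one> (%a b. sw P b (%c d. counit H (a \<otimes> z) \<odot>\<^sub>P bb c d))"
  unfolding eps_sw by simp
 also have "... = sw P \<one> (%a b. sw P a (%c d. counit H (c \<otimes> z) \<odot>\<^sub>P bb d b))"
  by (simp add: coas)
 finally have *: "sw P z bb = ..." .
 have e: "z = sw H \<one> (%a b. counit H (a \<otimes> z) \<odot> b)" using z by (simp flip: eps_sw)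
 have "sw P z bb = sw P \<one> (%a b. sw P \<one> (%c d. counit H (a \<otimes> z) \<odot>\<^sub>P bb (c \<otimes> b) d))"
  unfolding * by (subst one2) simp_all
 also have "... = sw P \<one> (%c d. bb (c \<otimes> sw H \<one> (%a b. counit H (a \<otimes> z) \<odot> b)) d)"
  by (rule HOL.trans, (rule sw_swap; simp)) simp
 finally show "sw P z bb = sw P \<one> (%a b. bb (a \<otimes> z) b)" unfolding e[symmetric] .
 have "sw P z bb = sw P \<one> (%a b. sw P \<one> (%c d. counit H (a \<otimes> z) \<odot>\<^sub>P bb (b \<otimes> c) d))"
  unfolding * by (subst one1) simp_all
 also have "... = sw P \<one> (%c d. bb (sw H \<one> (%a b. counit H (a \<otimes> z) \<odot> b) \<otimes> c) d)"
  by (rule HOL.trans, (rule sw_swap; simp)) simp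
 finally show "sw P z bb = sw P \<one> (%a b. bb (z \<otimes> a) b)" unfolding e[symmetric] .
qed

lemma W7s:
 assumes [simp]: "module R P" and w: "w : Hs" and bb: "bilin R H H P bb"
 shows "sw P w bb = sw P \<one> (%a b. bb a (b \<otimes> w))" "sw P w bb = sw P \<one> (%a b. bb a (w \<otimes> b))"
proof -
 note [simp] = bilin_lin[OF bb] bilin_push[OF bb is_module is_module assms(1)]
 have [simp]: "w :. H" using w by (auto dest: HtD HsD)
 have "sw P w bb = sw P (es w) bb" using w by simp
 also have "... = sw P \<one> (%a b. sw P a (%c d. counit H (w \<otimes> b) \<odot>\<^sub>P bb c d))"
  unfolding eps_sw by simp
 finally have *: "sw P w bb = ..." .
 have e: "w = sw H \<one> (%a b. counit H (w \<otimes> b) \<odot> a)" using w by (simp flip: eps_sw)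
 have "sw P w bb = sw P \<one> (%a b. sw P \<one> (%c d. counit H (w \<otimes> d) \<odot>\<^sub>P bb a (b \<otimes> c)))"
  unfolding * by (subst one1) simp_all
 also have "... = sw P \<one> (%a b. bb a (b \<otimes> sw H \<one> (%a b. counit H (w \<otimes> b) \<odot> a)))"
  by simp
 finally show "sw P w bb = sw P \<one> (%a b. bb a (b \<otimes> w))" unfolding e[symmetric] .
 have "sw P w bb = sw P \<one> (%a b. sw P \<one> (%c d. counit H (w \<otimes> d) \<odot>\<^sub>P bb a (c \<otimes> b)))"
  unfolding * by (subst one2) simp_all
 also have "... = sw P \<one> (%a b. bb a (sw H \<one> (%a b. counit H (w \<otimes> b) \<odot> a) \<otimes> b))"
  by simp
 finally show "sw P w bb = sw P \<one> (%a b. bb a (w \<otimes> b))" unfolding e[symmetric] .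
qed

text \<open>Apply the counit to the second leg of \<Delta>(esb h): by \<open>one2\<close> the result
  is es(esb h).\<close>

lemma esb_in [simp]:
 assumes [simp]: "h :. H"
 shows "esb h : Hs"
proof -
 have "esb h = sw H (esb h) (%a b. counit H b \<odot> a)"
  by (rule cou_r[symmetric]) auto
 also have "... = sw H \<one> (%a b. sw H a (%c d. counit H (b \<otimes> h) \<odot> (counit H d \<odot> c)))"
  unfolding eps_sw by simp
 also have "... = sw H \<one> (%a b. sw H \<one> (%c d. counit H (d \<otimes> h) \<odot> (counit H (c \<otimes> b) \<odot> a)))"
  by (subst one2) simp_all
 also have "... = es (esb h)"
  unfolding eps_sw by simp
 finally have "es (esb h) = esb h" ..
 then show ?thesis by (intro HsI) auto
qed

lemma esb_Hs [simp]:
 assumes w: "w : Hs"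
 shows "esb w = w"
proof -
 have [simp]: "w :. H" using w by (auto dest: HtD HsD)
 have "w = sw H w (%a b. counit H b \<odot> a)"
  by (rule cou_r[symmetric]) auto
 also have "... = esb w"
  by (subst W7s(1)) (use w in \<open>simp_all add: eps_sw\<close>)
 finally show ?thesis ..
qed

text \<open>Both products arise by contracting the outer legs of \<Delta>^2(1) with the same
  functionals; the two axioms for \<Delta>(1) evaluate the middle leg in the two orders.\<close>

lemma comm_Ht_Hs:
 assumes z: "z : Ht" and w: "w : Hs"
 shows "z \<otimes> w = w \<otimes> z"
proof -
 have [simp]: "z :. H" "w :. H" using z w by (auto dest: HtD HsD)
 have "z \<otimes> w = et z \<otimes> es w" using z w by simp
 also have "... = sw H \<one> (%a b. sw H \<one> (%c d. counit H (a \<otimes> z) \<odot> (counit H (w \<otimes> d) \<odot> (b \<otimes> c))))"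
  unfolding eps_sw by (subst sw_swap) (simp_all add: smult_commute)
 also have "... = sw H \<one> (%a b. sw H a (%c d. counit H (c \<otimes> z) \<odot> (counit H (w \<otimes> b) \<odot> d)))"
  by (subst one1) simp_all
 also have "... = sw H \<one> (%a b. sw H \<one> (%c d. counit H (a \<otimes> z) \<odot> (counit H (w \<otimes> d) \<odot> (c \<otimes> b))))"
  by (subst one2) simp_all
 also have "... = es w \<otimes> et z"
  unfolding eps_sw by (simp add: smult_commute)
 finally show ?thesis using z w by simp
qed

text \<open>The product is the counit applied to the first leg of \<Delta>(z)\<Delta>(z'). By
  \<open>W7t\<close> both comultiplications reduce to \<Delta>(1), whose square is \<Delta>(1), and
  what remains is et(zz').\<close>

lemma Ht_mult [simp]:
 assumes z: "z : Ht" "z' : Ht"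
 shows "z \<otimes> z' : Ht"
proof -
 have [simp]: "z :. H" "z' :. H" using z by (auto dest: HtD HsD)
 have "z \<otimes> z' = sw H (z \<otimes> z') (%a b. counit H a \<odot> b)"
  by (rule cou_l[symmetric]) auto
 also have "... = sw H z (%a b. sw H z' (%c d. counit H (a \<otimes> c) \<odot> (b \<otimes> d)))"
  by (rule sw_mult) auto
 also have "... = sw H z (%a b. sw H \<one> (%c d. counit H (a \<otimes> (c \<otimes> z')) \<odot> (b \<otimes> d)))"
  by (simp add: W7t(1)[OF _ z(2)])
 also have "... = sw H \<one> (%a b. sw H \<one> (%c d. counit H (z \<otimes> (a \<otimes> (c \<otimes> z'))) \<odot> (b \<otimes> d)))"
  by (simp add: W7t(2)[OF _ z(1)])
 also have "... = sw H \<one> (%a b. counit H (z \<otimes> (a \<otimes> z')) \<odot> b)"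
  by (subst (3) cm_l) simp_all
 also have "... = sw H z (%a b. counit H (a \<otimes> z') \<odot> b)"
  by (simp add: W7t(2)[OF _ z(1)])
 also have "... = et (z \<otimes> z')"
  by (subst W7t(1)[OF _ z(1)]) (simp_all add: eps_sw)
 finally have "et (z \<otimes> z') = z \<otimes> z'" ..
 then show ?thesis by (intro HtI) auto
qed

lemma Hs_mult [simp]:
 assumes w: "w : Hs" "w' : Hs"
 shows "w \<otimes> w' : Hs"
proof -
 have [simp]: "w :. H" "w' :. H" using w by (auto dest: HtD HsD)
 have "w \<otimes> w' = sw H (w \<otimes> w') (%a b. counit H b \<odot> a)"
  by (rule cou_r[symmetric]) auto
 also have "... = sw H w (%a b. sw H w' (%c d. counit H (b \<otimes> d) \<odot> (a \<otimes> c)))"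
  by (rule sw_mult) auto
 also have "... = sw H w (%a b. sw H \<one> (%c d. counit H (b \<otimes> (d \<otimes> w')) \<odot> (a \<otimes> c)))"
  by (simp add: W7s(1)[OF _ w(2)])
 also have "... = sw H \<one> (%a b. sw H \<one> (%c d. counit H (w \<otimes> (b \<otimes> (d \<otimes> w'))) \<odot> (a \<otimes> c)))"
  by (simp add: W7s(2)[OF _ w(1)])
 also have "... = sw H \<one> (%a b. counit H (w \<otimes> (b \<otimes> w')) \<odot> a)"
  by (subst (3) cm_l) simp_all
 also have "... = sw H w (%a b. counit H (b \<otimes> w') \<odot> a)"
  by (simp add: W7s(2)[OF _ w(1)])
 also have "... = esb (w \<otimes> w')"
  by (subst W7s(1)[OF _ w(1)]) (simp_all add: eps_sw)
 \<comment> \<open>The product has become a value of \<open>esb\<close>, so it lies in H_s by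
   \<open>esb_in\<close>.\<close>
 finally show ?thesis by (metis esb_in H_ring(1) \<open>w :. H\<close> \<open>w' :. H\<close>)
qed

lemma et_mult: "z : Ht ==> k :. H ==> et (z \<otimes> k) = z \<otimes> et k"
 by (metis Ht_mult HtD et_in eps_eps(1))

lemma esb_mult: "w : Hs ==> k :. H ==> esb (w \<otimes> k) = w \<otimes> esb k"
 by (metis Hs_mult HsD(1) esb_Hs esb_in eps_eps(3))

lemma one_in [simp]: "\<one> : Ht" "\<one> : Hs"
proof -
 have "et \<one> = \<one>" "es \<one> = \<one>"
  unfolding eps_sw using cou_l[of H \<one> "%x. x"] cou_r[of H \<one> "%x. x"] by simp_all
 then show "\<one> : Ht" "\<one> : Hs"
  by (auto intro: HtI HsI)
qed

end

context weak_bialgebra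
begin

text \<open>By \<open>W7t\<close> the element z comes with a factor \<Delta>(1) only, and
  \<Delta>(h) absorbs that factor.\<close>

lemma sw_Ht:
 assumes [simp]: "module R P" "h :. H" and z: "z : Ht" and bb: "bilin R H H P bb"
 shows "sw P (h \<otimes> z) bb = sw P h (%a b. bb (a \<otimes> z) b)" "sw P (z \<otimes> h) bb = sw P h (%a b. bb (z \<otimes> a) b)"
proof -
 note [simp] = bilin_lin[OF bb] HtD(1)[OF z]
 have "sw P (h \<otimes> z) bb = sw P h (%a b. sw P \<one> (%c d. bb (a \<otimes> (c \<otimes> z)) (b \<otimes> d)))"
  by (simp add: sw_mult W7t(1)[OF _ z])
 also have "... = sw P h (%a b. bb (a \<otimes> z) b)"
  by (rule HOL.sym, rule HOL.trans, rule cm_r) simp_all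
 finally show "sw P (h \<otimes> z) bb = ..." .
 have "sw P (z \<otimes> h) bb = sw P \<one> (%c d. sw P h (%a b. bb (z \<otimes> (c \<otimes> a)) (d \<otimes> b)))"
  by (simp add: sw_mult W7t(2)[OF _ z])
 also have "... = sw P h (%a b. bb (z \<otimes> a) b)"
  by (rule HOL.sym, rule HOL.trans, rule cm_l) simp_all
 finally show "sw P (z \<otimes> h) bb = ..." .
qed

lemma sw_Hs:
 assumes [simp]: "module R P" "h :. H" and w: "w : Hs" and bb: "bilin R H H P bb"
 shows "sw P (h \<otimes> w) bb = sw P h (%a b. bb a (b \<otimes> w))" "sw P (w \<otimes> h) bb = sw P h (%a b. bb a (w \<otimes> b))"
proof -
 note [simp] = bilin_lin[OF bb] HsD(1)[OF w]
 have "sw P (h \<otimes> w) bb = sw P h (%a b. sw P \<one> (%c d. bb (a \<otimes> c) (b \<otimes> (d \<otimes> w))))"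
  by (simp add: sw_mult W7s(1)[OF _ w])
 also have "... = sw P h (%a b. bb a (b \<otimes> w))"
  by (rule HOL.sym, rule HOL.trans, rule cm_r) simp_all
 finally show "sw P (h \<otimes> w) bb = ..." .
 have "sw P (w \<otimes> h) bb = sw P \<one> (%c d. sw P h (%a b. bb (c \<otimes> a) (w \<otimes> (d \<otimes> b))))"
  by (simp add: sw_mult W7s(2)[OF _ w])
 also have "... = sw P h (%a b. bb a (w \<otimes> b))"
  by (rule HOL.sym, rule HOL.trans, rule cm_l) simp_all
 finally show "sw P (w \<otimes> h) bb = ..." .
qed

lemma etb_in [simp]:
 assumes [simp]: "h :. H"
 shows "etb h : Ht"
proof -
 have "etb h = sw H (etb h) (%a b. counit H a \<odot> b)"
  by (rule cou_l[symmetric]) auto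
 also have "... = sw H \<one> (%a b. sw H b (%c d. counit H (h \<otimes> a) \<odot> (counit H c \<odot> d)))"
  unfolding etb_def by simp
 also have "... = sw H \<one> (%a b. sw H a (%c d. counit H (h \<otimes> c) \<odot> (counit H d \<odot> b)))"
  by (simp add: coas)
 also have "... = sw H \<one> (%a b. sw H \<one> (%c d. counit H (h \<otimes> a) \<odot> (counit H (c \<otimes> b) \<odot> d)))"
  by (subst one2) simp_all
 also have "... = et (etb h)"
  unfolding eps_sw etb_def by (subst sw_swap) (simp_all add: smult_commute)
 finally have "et (etb h) = etb h" ..
 then show ?thesis by (intro HtI) auto
qed

lemma es_etb: "h :. H ==> es (etb h) = es h"
 unfolding eps_sw(2) by simp

end

section \<open>The antipode\<close>

context weak_hopf_algebra
begin

lemmas S_lin [simp] = linear_comp[OF antipode_linear]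
lemmas S_closed [simp] = linear_mapD(1)[OF antipode_linear]
lemmas S_push [simp] = linear_ssum[OF antipode_linear is_module is_module] linear_mapD(3)[OF antipode_linear]

lemma antp_l:
 assumes "module R P" "h :. H" "linear_map R H P f"
 shows "sw P h (%a b. f (S a \<otimes> b)) = f (es h)"
proof -
 have "es h = sw H h (%a b. S a \<otimes> b)"
  using antipode_left[OF assms(2)] by (simp add: ssum_wf[OF comul_wf[OF assms(2)]])
 then show ?thesis
  using assms(1) by (simp add: linear_ssum[OF assms(3)])
qed

lemma antp_r:
 assumes "module R P" "h :. H" "linear_map R H P f"
 shows "sw P h (%a b. f (a \<otimes> S b)) = f (et h)"
proof -
 have "et h = sw H h (%a b. a \<otimes> S b)"
  using antipode_right[OF assms(2)] by (simp add: ssum_wf[OF comul_wf[OF assms(2)]])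
 then show ?thesis
  using assms(1) by (simp add: linear_ssum[OF assms(3)])
qed

text \<open>The two bracketings of S(h_1) h_2 S(h_3), each contracted by one of the other two
  antipode axioms.\<close>

lemma S_et:
 assumes [simp]: "h :. H"
 shows "S h = sw H h (%a b. S a \<otimes> et b)" "S h = sw H h (%a b. es a \<otimes> S b)"
proof -
 have "lsum H (map (%(x, y, z). S x \<otimes> y \<otimes> S z) (comul3 H h)) = sw H h (%a b. sw H a (%c d. S c \<otimes> d \<otimes> S b))"
  unfolding comul3_def by (subst lsum_comp[OF _ comul_wf comul_wf]) auto
 then have *: "S h = sw H h (%a b. sw H a (%c d. S c \<otimes> (d \<otimes> S b)))"
  using antipode_antipode[OF assms] by simp
 then have "S h = sw H h (%a b. sw H b (%c d. S a \<otimes> (c \<otimes> S d)))"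
  by (simp add: coas)
 then show "S h = sw H h (%a b. S a \<otimes> et b)"
  by (rule HOL.trans) (rule ssum_eqI, rule antp_r[where f = "%x. S _ \<otimes> x"], simp_all)
 have "sw H h (%a b. sw H a (%c d. S c \<otimes> d \<otimes> S b)) = sw H h (%a b. es a \<otimes> S b)"
  by (rule ssum_eqI, rule antp_l[where f = "%x. x \<otimes> S _"]) simp_all
 with * show "S h = sw H h (%a b. es a \<otimes> S b)" by simp
qed

text \<open>As \<Delta>(z) = z 1_1 \<otimes> 1_2 and \<open>et\<close> may be dropped on 1_2, the
  sum S(z_1) et(z_2) equals S(z_1) z_2.\<close>

lemma S_Ht: "z : Ht ==> S z = es z"
proof -
 assume z: "z : Ht"
 note [simp] = HtD(1)[OF z]
 have "S z = sw H \<one> (%a b. S (z \<otimes> a) \<otimes> et b)"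
  by (subst S_et(1)) (simp_all add: W7t(2)[OF _ z])
 also have "... = sw H z (%a b. S a \<otimes> b)"
  by (rule HOL.trans, (rule W1(1); simp)) (simp add: W7t(2)[OF _ z])
 also have "... = es z"
  by (rule antp_l) simp_all
 finally show "S z = es z" .
qed

lemma S_Hs: "w : Hs ==> S w = et w"
proof -
 assume w: "w : Hs"
 note [simp] = HsD(1)[OF w]
 have "S w = sw H \<one> (%a b. es a \<otimes> S (w \<otimes> b))"
  by (subst S_et(2)) (simp_all add: W7s(2)[OF _ w])
 also have "... = sw H w (%a b. a \<otimes> S b)"
  by (rule HOL.trans, (rule W1(2); simp)) (simp add: W7s(2)[OF _ w])
 also have "... = et w"
  by (rule antp_r) simp_all
 finally show "S w = et w" .
qed

lemma S_one [simp]: "S \<one> = \<one>"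
 by (simp add: S_Ht)

text \<open>The antipode axiom for hz, with \<Delta>(hz) = h_1 z \<otimes> h_2.\<close>

lemma et_adjoint:
 assumes [simp]: "h :. H" and z: "z : Ht"
 shows "et (h \<otimes> z) = sw H h (%a b. a \<otimes> (z \<otimes> S b))"
proof -
 note [simp] = HtD(1)[OF z]
 have "et (h \<otimes> z) = sw H (h \<otimes> z) (%a b. a \<otimes> S b)"
  by (rule antp_r[symmetric]) simp_all
 then show ?thesis
  by (simp add: sw_Ht(1)[OF _ _ z])
qed

lemma es_adjoint:
 assumes [simp]: "h :. H" and w: "w : Hs"
 shows "es (w \<otimes> h) = sw H h (%a b. S a \<otimes> (w \<otimes> b))"
proof -
 note [simp] = HsD(1)[OF w]
 have "es (w \<otimes> h) = sw H (w \<otimes> h) (%a b. S a \<otimes> b)"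
  by (rule antp_l[symmetric]) simp_all
 then show ?thesis
  by (simp add: sw_Hs(2)[OF _ _ w])
qed

text \<open>The classical argument that both sides are convolution inverse to the multiplication,
  with counital maps in place of the counit: \<open>et_adjoint\<close> and \<open>es_adjoint\<close>
  carry them past a factor, and \<open>comm_Ht_Hs\<close> exchanges \<open>et\<close> of a leg of k
  with \<open>es\<close> of a leg of h.\<close>

lemma S_mult:
 assumes [simp]: "h :. H" "k :. H"
 shows "S (h \<otimes> k) = S k \<otimes> S h"
proof -
 have "S (h \<otimes> k) = sw H h (%a b. sw H k (%c d. S (a \<otimes> c) \<otimes> et (b \<otimes> et d)))"
  by (subst S_et(1)) (simp_all add: sw_mult eps_eps)
 also have "... = sw H h (%a b. sw H k (%c d. sw H b (%p q. S (a \<otimes> c) \<otimes> (p \<otimes> (et d \<otimes> S q)))))"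
  by (simp add: et_adjoint)
 also have "... = sw H h (%a b. sw H a (%p q. sw H k (%c d. S (p \<otimes> c) \<otimes> (q \<otimes> (et d \<otimes> S b)))))"
  by (rule HOL.trans, rule ssum_eqI, (rule sw_swap; simp)) (simp add: coas)
 also have "... = sw H h (%a b. sw H a (%p q. sw H k (%c d. sw H d (%x y. S (p \<otimes> c) \<otimes> (q \<otimes> (x \<otimes> (S y \<otimes> S b)))))))"
 proof (intro ssum_cong HOL.refl)
  fix a b p q c d assume [simp]: "a :. H" "b :. H" "p :. H" "q :. H" "c :. H" "d :. H"
  show "S (p \<otimes> c) \<otimes> (q \<otimes> (et d \<otimes> S b)) = sw H d (%x y. S (p \<otimes> c) \<otimes> (q \<otimes> (x \<otimes> (S y \<otimes> S b))))"
   using antp_r[of H d "%x. S (p \<otimes> c) \<otimes> (q \<otimes> (x \<otimes> S b))"] by simp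
 qed
 also have "... = sw H h (%a b. sw H k (%c d. sw H a (%p q. sw H c (%x y. S (p \<otimes> x) \<otimes> (q \<otimes> (y \<otimes> (S d \<otimes> S b)))))))"
  by (rule HOL.trans[rotated], rule ssum_eqI, (rule sw_swap; simp)) (simp add: coas)
 also have "... = sw H h (%a b. sw H k (%c d. es (es a \<otimes> c) \<otimes> (S d \<otimes> S b)))"
 proof (intro ssum_cong HOL.refl)
  fix a b c d assume [simp]: "a :. H" "b :. H" "c :. H" "d :. H"
  show "sw H a (%p q. sw H c (%x y. S (p \<otimes> x) \<otimes> (q \<otimes> (y \<otimes> (S d \<otimes> S b))))) = es (es a \<otimes> c) \<otimes> (S d \<otimes> S b)"
   using antp_l[of H "a \<otimes> c" "%x. x \<otimes> (S d \<otimes> S b)"] by (simp add: sw_mult eps_eps)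
 qed
 also have "... = sw H h (%a b. sw H k (%c d. sw H d (%x y. S c \<otimes> (es a \<otimes> (x \<otimes> (S y \<otimes> S b))))))"
  by (simp add: es_adjoint coas)
 also have "... = sw H h (%a b. sw H k (%c d. S c \<otimes> (et d \<otimes> (es a \<otimes> S b))))"
 proof (intro ssum_cong HOL.refl)
  fix a b c d assume [simp]: "a :. H" "b :. H" "c :. H" "d :. H"
  have "et d \<otimes> (es a \<otimes> S b) = es a \<otimes> (et d \<otimes> S b)"
   using comm_Ht_Hs[of "et d" "es a"] by (simp flip: H_ring(5))
  then show "sw H d (%x y. S c \<otimes> (es a \<otimes> (x \<otimes> (S y \<otimes> S b)))) = S c \<otimes> (et d \<otimes> (es a \<otimes> S b))"
   using antp_r[of H d "%x. S c \<otimes> (es a \<otimes> (x \<otimes> S b))"] by simp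
 qed
 also have "... = sw H k (%c d. S c \<otimes> et d) \<otimes> sw H h (%a b. es a \<otimes> S b)"
  by simp
 also have "... = S k \<otimes> S h"
  by (simp flip: S_et)
 finally show ?thesis .
qed

text \<open>Follows from S(h) = S(h_1) et(h_2), since \<open>et\<close> drops out under the counit
  and S(h_1) h_2 is es(h).\<close>

lemma S_counit:
 assumes [simp]: "module R P" "x :. P" "h :. H"
 shows "counit H (S h) \<odot>\<^sub>P x = counit H h \<odot>\<^sub>P x"
proof -
 have "counit H (S h) \<odot>\<^sub>P x = sw P h (%a b. counit H (S a \<otimes> b) \<odot>\<^sub>P x)"
  by (subst S_et(1)) simp_all
 also have "... = counit H (es h) \<odot>\<^sub>P x"
  by (rule antp_l) simp_all
 also have "... = counit H h \<odot>\<^sub>P x"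
  using counit_eps(3)[of P x h \<one>] by simp
 finally show ?thesis .
qed

text \<open>By \<open>W1\<close> the legs of \<Delta>(1) may be replaced by values of
  \<open>es\<close> and \<open>et\<close>, on which the antipode is known from \<open>S_Hs\<close>
  and \<open>S_Ht\<close>; the coefficients then contract by \<open>counit_unit\<close>.\<close>

lemma S_comul_one:
 assumes [simp]: "module R P" and bb: "bilin R H H P bb"
 shows "sw P \<one> (%a b. bb (S b) (S a)) = sw P \<one> bb"
proof -
 note [simp] = bilin_lin[OF bb] bilin_push[OF bb is_module is_module assms(1)]
 have "sw P \<one> (%a b. bb (S b) (S a)) = sw P \<one> (%a b. bb (es (et b)) (et (es a)))"
  by (rule HOL.trans, rule HOL.trans, (rule W1(1)[symmetric]; simp), (rule W1(2)[symmetric]; simp)) (simp add: S_Ht S_Hs)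
 also have "... = sw P \<one> (%a b. bb (es b) (et a))"
  by (rule HOL.trans, (rule W1(1); simp), rule W1(2)) simp_all
 also have "... = sw P \<one> (%a b. sw P \<one> (%e f. sw P \<one> (%c d. counit H (e \<otimes> a) \<odot>\<^sub>P (counit H (b \<otimes> d) \<odot>\<^sub>P bb c f))))"
  unfolding eps_sw by (simp add: smult_commute)
 also have "... = sw P \<one> (%e f. sw P \<one> (%c d. counit H (e \<otimes> d) \<odot>\<^sub>P bb c f))"
  by (rule HOL.trans, rule HOL.trans, (rule sw_swap; simp), rule ssum_eqI, (rule sw_swap; simp)) (simp flip: counit_unit(1))
 also have "... = sw P \<one> (%c d. sw P \<one> (%e f. counit H (e \<otimes> d) \<odot>\<^sub>P bb c f))"
  by (rule sw_swap) simp_all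
 also have "... = sw P \<one> (%c d. bb c (et d))"
  unfolding eps_sw by simp
 also have "... = sw P \<one> bb"
  by (rule W1(1)) (simp_all add: bb)
 finally show ?thesis .
qed

text \<open>Put F(h) = S(h_2) \<otimes> S(h_1). The facts \<open>A\<close> and \<open>B\<close> are
  \<Delta>(h_1)F(h_2) = \<Delta>(et h) and F(h_1)\<Delta>(h_2) = \<Delta>(es h). Hence \<Delta>(S h)
  = \<Delta>(S h_1)\<Delta>(h_2)F(h_3) = F(h_1)\<Delta>(h_2)F(h_3), and this equals F(h) by
  \<open>S_et\<close> and \<open>S_comul_one\<close>.\<close>

lemma S_comul:
 assumes [simp]: "module R P" "h :. H" and bb: "bilin R H H P bb"
 shows "sw P (S h) bb = sw P h (%a b. bb (S b) (S a))"
proof -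
 have A: "sw P (et h) bb = sw P h (%a b. sw P a (%p q. sw P b (%u v. bb (p \<otimes> S v) (q \<otimes> S u))))"
  if [simp]: "h :. H" and bb: "bilin R H H P bb" for bb h
 proof -
  note [simp] = bilin_lin[OF bb] bilin_push[OF bb is_module is_module assms(1)]
  have "sw P h (%a b. sw P a (%p q. sw P b (%u v. bb (p \<otimes> S v) (q \<otimes> S u)))) =
    sw P h (%p r. sw P r (%m v. sw P m (%q u. bb (p \<otimes> S v) (q \<otimes> S u))))"
   by (simp add: coas)
  also have "... = sw P h (%p r. sw P r (%m v. bb (p \<otimes> S v) (et m)))"
   by (intro ssum_cong HOL.refl, rule antp_r) simp_all
  also have "... = sw P h (%l v. sw P l (%p m. bb (p \<otimes> S v) (et m)))"
   by (simp add: coas)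
  also have "... = sw P \<one> (%c d. sw P h (%l v. bb (c \<otimes> (l \<otimes> S v)) d))"
   by (rule HOL.trans, rule ssum_eqI, (rule W2[where bb = "%p m. bb (p \<otimes> S _) m"]; simp), subst sw_swap) simp_all
  also have "... = sw P (et h) bb"
   by (rule HOL.trans, rule ssum_eqI, (rule antp_r; simp)) (simp add: W7t(1)[of P "et h"] bb)
  finally show ?thesis ..
 qed
 have B: "sw P (es h) bb = sw P h (%a b. sw P a (%u v. sw P b (%p q. bb (S v \<otimes> p) (S u \<otimes> q))))"
  if [simp]: "h :. H" and bb: "bilin R H H P bb" for bb h
 proof -
  note [simp] = bilin_lin[OF bb] bilin_push[OF bb is_module is_module assms(1)]
  have "sw P h (%a b. sw P a (%u v. sw P b (%p q. bb (S v \<otimes> p) (S u \<otimes> q)))) =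
    sw P h (%u r. sw P r (%m q. sw P m (%v p. bb (S v \<otimes> p) (S u \<otimes> q))))"
   by (simp add: coas)
  also have "... = sw P h (%u r. sw P r (%m q. bb (es m) (S u \<otimes> q)))"
   by (intro ssum_cong HOL.refl, rule antp_l) simp_all
  also have "... = sw P \<one> (%c d. sw P h (%u r. bb c (S u \<otimes> r \<otimes> d)))"
   by (rule HOL.trans, rule ssum_eqI, (rule W3[where bb = "%m q. bb m (S _ \<otimes> q)"]; simp), subst sw_swap) simp_all
  also have "... = sw P (es h) bb"
   by (rule HOL.trans, rule ssum_eqI, (rule antp_l; simp)) (simp add: W7s(2)[of P "es h"] bb)
  finally show ?thesis ..
 qed
 note [simp] = bilin_lin[OF bb] bilin_push[OF bb is_module is_module assms(1)]
 have "sw P (S h) bb = sw P h (%a b. sw P (S a) (%x y. sw P b (%c d. sw P c (%p q. sw P d (%u v. bb (x \<otimes> (p \<otimes> S v)) (y \<otimes> (q \<otimes> S u)))))))"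
  by (subst S_et(1)) (simp_all add: sw_mult bb A)
 also have "... = sw P h (%e d. sw P e (%a c. sw P (S a) (%x y. sw P c (%p q. sw P d (%u v. bb (x \<otimes> (p \<otimes> S v)) (y \<otimes> (q \<otimes> S u)))))))"
  by (rule HOL.trans, rule ssum_eqI, (rule sw_swap; simp)) (simp add: coas)
 also have "... = sw P h (%e d. sw P (es e) (%x y. sw P d (%u v. bb (x \<otimes> S v) (y \<otimes> S u))))"
 proof (rule ssum_eqI)
  fix e d assume [simp]: "e :. H" "d :. H"
  have "sw P (es e) (%x y. sw P d (%u v. bb (x \<otimes> S v) (y \<otimes> S u))) =
   sw P e (%a c. sw P (S a \<otimes> c) (%x y. sw P d (%u v. bb (x \<otimes> S v) (y \<otimes> S u))))"
   by (rule antp_l[symmetric]) simp_all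
  then show "sw P e (%a c. sw P (S a) (%x y. sw P c (%p q. sw P d (%u v. bb (x \<otimes> (p \<otimes> S v)) (y \<otimes> (q \<otimes> S u)))))) =
    sw P (es e) (%x y. sw P d (%u v. bb (x \<otimes> S v) (y \<otimes> S u)))"
   by (simp add: sw_mult)
 qed
 also have "... = sw P h (%e d. sw P e (%a b. sw P a (%u v. sw P b (%p q. sw P d (%u' v'. bb (S v \<otimes> (p \<otimes> S v')) (S u \<otimes> (q \<otimes> S u')))))))"
  by (simp add: B)
 also have "... = sw P h (%a e. sw P e (%b d. sw P a (%u v. sw P b (%p q. sw P d (%u' v'. bb (S v \<otimes> (p \<otimes> S v')) (S u \<otimes> (q \<otimes> S u')))))))"
  by (simp only: coas assms trilinI linear_in_t linear_in_ssum linear_id comul_lin is_module bilinI S_lin mult_simps H_ring S_closed bilin_lin[OF bb] module_tensor)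
 also have "... = sw P h (%a e. sw P a (%u v. sw P (et e) (%p q. bb (S v \<otimes> p) (S u \<otimes> q))))"
  by (rule HOL.trans, rule ssum_eqI, (rule sw_swap; simp)) (simp add: A)
 also have "... = sw P h (%a e. sw P a (%u v. sw P \<one> (%p q. bb (S v \<otimes> (et e \<otimes> p)) (S u \<otimes> q))))"
  by (simp add: W7t(2)[of P "et _"])
 also have "... = sw P h (%u r. sw P r (%v e. sw P \<one> (%p q. bb (S v \<otimes> et e \<otimes> p) (S u \<otimes> q))))"
  by (simp add: coas)
 also have "... = sw P h (%u r. sw P \<one> (%p q. bb (S r \<otimes> p) (S u \<otimes> q)))"
 proof (rule ssum_eqI)
  fix u r assume [simp]: "u :. H" "r :. H"
  have "sw P \<one> (%p q. bb (S r \<otimes> p) (S u \<otimes> q)) = sw P \<one> (%p q. sw P r (%v e. bb (S v \<otimes> (et e \<otimes> p)) (S u \<otimes> q)))"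
   by (subst S_et(1)) simp_all
  then show "sw P r (%v e. sw P \<one> (%p q. bb (S v \<otimes> et e \<otimes> p) (S u \<otimes> q))) = sw P \<one> (%p q. bb (S r \<otimes> p) (S u \<otimes> q))"
   by (simp add: sw_swap[of P _ r \<one>])
 qed
 also have "... = sw P h (%u r. sw P \<one> (%p q. bb (S (q \<otimes> r)) (S (p \<otimes> u))))"
  by (rule ssum_eqI, subst S_comul_one[symmetric]) (simp_all add: S_mult)
 also have "... = sw P h (%a b. bb (S b) (S a))"
  by (rule HOL.trans, (rule sw_swap; simp), rule HOL.sym, rule HOL.trans, rule cm_l) simp_all
 finally show ?thesis .
qed

end

section \<open>The inverse of the antipode\<close>

locale weak_hopf_bij = weak_hopf_algebra +
 assumes bij_S: "bij_betw S (carrier H) (carrier H)"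
begin

abbreviation "T \<equiv> antipode_inv H S"

lemma TS [simp]: "x :. H ==> T (S x) = x" "x :. H ==> S (T x) = x"
 and T_closed [simp]: "x :. H ==> T x :. H"
 using bij_S by (auto simp: bij_betw_inv_into_left bij_betw_inv_into_right bij_betwE[OF bij_betw_inv_into])

lemma S_eqD: "x :. H ==> y :. H ==> S x = S y ==> x = y"
 using bij_S by (auto simp: bij_betw_def inj_on_def)

lemma T_linear: "linear_map R H H T"
 by (intro linear_mapI; (rule S_eqD)?) (simp_all add: linear_mapD[OF antipode_linear])

lemmas T_lin [simp] = linear_comp[OF T_linear]
lemmas T_push [simp] = linear_ssum[OF T_linear is_module is_module] linear_mapD(3)[OF T_linear]

lemma T_mult: "h :. H ==> k :. H ==> T (h \<otimes> k) = T k \<otimes> T h"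
 by (rule S_eqD) (simp_all add: S_mult)

lemma T_one [simp]: "T \<one> = \<one>"
 by (rule S_eqD) simp_all

lemma T_counit:
 "module R P ==> x :. P ==> h :. H ==> counit H (T h) \<odot>\<^sub>P x = counit H h \<odot>\<^sub>P x"
 using S_counit[of P x "T h"] by simp

lemma T_comul:
 assumes [simp]: "module R P" "h :. H" and bb: "bilin R H H P bb"
 shows "sw P (T h) bb = sw P h (%a b. bb (T b) (T a))"
proof -
 note [simp] = bilin_lin[OF bb]
 have "sw P (S (T h)) (%a b. bb (T b) (T a)) = sw P (T h) (%a b. bb (T (S a)) (T (S b)))"
  by (subst S_comul) simp_all
 then show ?thesis by simp
qed

text \<open>On H_s the antipode is \<open>et\<close> (\<open>S_Hs\<close>), and et(esb h) = et
  h.\<close>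

lemma T_et: "h :. H ==> T (et h) = esb h"
 by (rule S_eqD) (simp_all add: S_Hs eps_eps)

lemma T_r:
 assumes [simp]: "module R P" "h :. H" and f: "linear_map R H P f"
 shows "sw P h (%a b. f (b \<otimes> T a)) = f (esb h)"
 using antp_r[OF assms(1,2), of "%x. f (T x)"] linear_comp[OF f T_linear] by (simp add: T_mult T_et)

lemma T_l:
 assumes [simp]: "module R P" "h :. H" and f: "linear_map R H P f"
 shows "sw P h (%a b. f (T b \<otimes> a)) = f (T (es h))"
 using antp_l[OF assms(1,2), of "%x. f (T x)"] linear_comp[OF f T_linear] by (simp add: T_mult)

lemma T_Ht: "z : Ht ==> T z = esb z"
 using T_et[of z] by (simp add: HtD)

lemma T_es: "h :. H ==> T (es h) = etb h"
 by (rule S_eqD) (simp_all add: S_Ht es_etb)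

lemma T_Hs: "w : Hs ==> T w : Ht"
 using T_es[of w] by (simp add: HsD)

lemma S_comul_one':
 assumes [simp]: "module R P" and bb: "bilin R H H P bb"
 shows "sw P \<one> (%a b. bb (T b) (T a)) = sw P \<one> bb"
 using T_comul[OF assms(1) _ bb, of \<one>] by simp

end

section \<open>Structures with the same underlying module\<close>

context base
begin

text \<open>These are the fields on which linear maps, sums and tensor products depend. The relation
  compares records of different types, such as a module and the Yetter-Drinfeld module or
  D(H)-module built on it.\<close>

definition same_module ::
 "('k, 'a, 'm) module_scheme \<Rightarrow> ('k, 'a, 'n) module_scheme \<Rightarrow> bool" where
 "same_module M M' \<longleftrightarrow> carrier M = carrier M' \<and> zero M = zero M' \<and> add M = add M' \<and> smult M = smult M'"

lemma same_module_sym: "same_module M M' ==> same_module M' M"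
 by (simp add: same_module_def)

lemma tensor_cong_same:
 assumes "same_module M M'" "same_module N N'" "tensor_cong R M N xs ys"
 shows "tensor_cong R M' N' xs ys"
 using assms(3)
proof induction
 case (refl xs)
 then show ?case using assms by (intro tensor_cong.refl) (simp add: same_module_def)
next
 case (commute xs ys)
 then show ?case using assms by (intro tensor_cong.commute) (simp_all add: same_module_def)
next
 case (zero n)
 then show ?case using assms tensor_cong.zero[of n N' R M'] by (simp add: same_module_def)
next
 case (add_left m m' n)
 then show ?case using assms tensor_cong.add_left[of m M' m' n N' R] by (simp add: same_module_def)
next
 case (add_right m n n')
 then show ?case using assms tensor_cong.add_right[of m M' n N' n' R] by (simp add: same_module_def)
next
 case (balanced a m n)
 then show ?case using assms tensor_cong.balanced[of a R m M' n N'] by (simp add: same_module_def)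
qed (blast intro: tensor_cong.sym tensor_cong.trans tensor_cong.append)+

text \<open>Even the chosen representatives agree, since \<open>SOME\<close> sees only the
  congruence; passing to another record on the same module is thus an equality, not an
  isomorphism.\<close>

lemma same_tens: "same_module M M' ==> same_module N N' ==> tens R M N = tens R M' N'"
proof -
 assume a: "same_module M M'" "same_module N N'"
 have "tensor_cong R M N xs = tensor_cong R M' N' xs" for xs
  using tensor_cong_same[OF a] tensor_cong_same[OF a[THEN same_module_sym]] by blast
 then show ?thesis by (simp add: tens_def fun_eq_iff)
qed

lemma same_tensor: "same_module M M' ==> same_module N N' ==> tensor R M N = tensor R M' N'"
 unfolding tensor_def by (simp add: same_tens[of M M' N N']) (simp add: same_module_def)

lemma left_moduleD:
 assumes "left_module R B M"
 shows "module R M" "!!b. b :. B ==> linear_map R M M (act M b)"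
  "!!m. m :. M ==> linear_map R B M (%b. act M b m)"
  "!!b c m. b :. B ==> c :. B ==> m :. M ==> act M (b \<otimes>\<^sub>B c) m = act M b (act M c m)"
  "!!m. m :. M ==> act M \<one>\<^sub>B m = m"
 using assms by (auto simp: left_module_def)

lemma bilin_act: "left_module R B M ==> bilin R B M M (act M)"
 by (simp add: left_moduleD bilin_def)

lemmas act_lin = bilin_lin[OF bilin_act]
lemmas act_push = bilin_push[OF bilin_act]

end

section \<open>Twisted composition of linear endomorphisms\<close>

context weak_hopf_bij
begin

abbreviation "lin u \<equiv> linear_map R H H u"

text \<open>
 An element \<open>\<Sum> h \<bowtie> f\<close> is identified with the linear map \<open>u(l) = \<Sum> f(l) h\<close>. Then
 \<open>lact u h\<close> is the product of \<open>u\<close> with \<open>h \<bowtie> \<epsilon>\<close>, and \<open>star\<close> is the multiplication.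
\<close>

definition lact where
 "lact u h l = sw H h (%a r. sw H r (%b c. u (c \<otimes> (l \<otimes> T a)) \<otimes> b))"

definition star where
 "star u v l = sw H l (%a b. lact u (v b) a)"

text \<open>The linear map that belongs to the preunit 1 \<bowtie> \<epsilon>
  (\<open>hat_one\<close>).\<close>

definition ue where
 "ue l = counit H l \<odot> \<one>"

lemma bilin_lact: "lin u ==> bilin R H H H (lact u)"
proof -
 assume u: "lin u"
 note [simp] = linear_comp[OF u] linear_mapD(1)[OF u]
 show "bilin R H H H (lact u)"
  unfolding lact_def[abs_def] by simp
qed

lemmas lact_lin [simp] = bilin_lin[OF bilin_lact]
lemmas lact_push [simp] = bilin_push[OF bilin_lact is_module is_module is_module]

lemma star_lin: "lin u ==> lin v ==> lin (star u v)"
proof -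
 assume u: "lin u" "lin v"
 note [simp] = linear_comp[OF u(2)] linear_mapD(1)[OF u(2)] u
 show "lin (star u v)"
  unfolding star_def[abs_def] by simp
qed

lemma ue_lin: "lin ue"
 unfolding ue_def[abs_def] by simp

lemma lact_mult:
 assumes u: "lin u" and [simp]: "h :. H" "k :. H" "l :. H"
 shows "lact (lact u h) k l = lact u (h \<otimes> k) l"
proof -
 note [simp] = linear_comp[OF u] linear_mapD(1)[OF u]
 have "lact (lact u h) k l = sw H k (%a' r'. sw H r' (%b' c'. sw H h (%a r. sw H r (%b c.
   u (c \<otimes> (c' \<otimes> (l \<otimes> (T a' \<otimes> T a)))) \<otimes> (b \<otimes> b')))))"
  unfolding lact_def by simp
 also have "... = sw H h (%a r. sw H k (%a' r'. sw H r (%b c. sw H r' (%b' c'.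
   u (c \<otimes> (c' \<otimes> (l \<otimes> (T a' \<otimes> T a)))) \<otimes> (b \<otimes> b')))))"
  by (rule HOL.trans, rule HOL.trans, rule ssum_eqI, (rule sw_swap; simp), (rule sw_swap; simp), rule ssum_eqI, rule ssum_eqI, rule sw_swap) simp_all
 also have "... = lact u (h \<otimes> k) l"
  unfolding lact_def by (simp add: sw_mult T_mult)
 finally show ?thesis .
qed

text \<open>Coassociativity for five legs: from the bracketing that arises when \<Delta>(c l T(a))
  is expanded, to the one in which an inner \<open>lact\<close> is visible.\<close>

lemma regroup5:
 assumes [simp]: "module R P" "h :. H"
  and l [simp]: "!!b c d e g. b :. H ==> c :. H ==> d :. H ==> e :. H ==> lin g ==> linear_map R H P (%x. \<gamma> (g x) b c d e)"
   "!!a c d e g. a :. H ==> c :. H ==> d :. H ==> e :. H ==> lin g ==> linear_map R H P (%x. \<gamma> a (g x) c d e)"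
   "!!a b d e g. a :. H ==> b :. H ==> d :. H ==> e :. H ==> lin g ==> linear_map R H P (%x. \<gamma> a b (g x) d e)"
   "!!a b c e g. a :. H ==> b :. H ==> c :. H ==> e :. H ==> lin g ==> linear_map R H P (%x. \<gamma> a b c (g x) e)"
   "!!a b c d g. a :. H ==> b :. H ==> c :. H ==> d :. H ==> lin g ==> linear_map R H P (%x. \<gamma> a b c d (g x))"
 shows "sw P h (%a r. sw P r (%b c. sw P c (%c1 c2. sw P a (%a1 a2. \<gamma> a1 a2 b c1 c2)))) =
  sw P h (%a r. sw P r (%b c. sw P b (%p s. sw P s (%q t. \<gamma> a p q t c))))"
proof -
 have [simp]: "\<gamma> a b c d e :. P"
  if "a :. H" "b :. H" "c :. H" "d :. H" "e :. H" for a b c d e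
  using linear_mapD(1)[OF l(1)[OF that(2-5) linear_id]] that(1) .
 have "sw P h (%a r. sw P r (%b c. sw P c (%c1 c2. sw P a (%a1 a2. \<gamma> a1 a2 b c1 c2)))) = sw P h (%a r. sw P r (%b c. sw P b (%p s. sw P s (%q t. \<gamma> a p q t c))))"
  by (rule HOL.trans, rule HOL.trans, rule ssum_eqI, rule ssum_eqI, (rule sw_swap; simp), rule ssum_eqI, (rule sw_swap; simp)) (simp add: coas)
 then show ?thesis .
qed

text \<open>The action of h on a convolution product: the sandwich h_3 l S^-1(h_1) is split by
  \<Delta> into two sandwiches, one nested in the other. \<open>star_lact\<close> and
  \<open>dot_lact\<close> are instances.\<close>

lemma lact_conv:
 assumes [simp]: "h :. H" "l :. H" and K: "bilin R H H H K"
 shows "lact (%l. sw H l K) h l =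
  sw H h (%a r. sw H r (%b c. sw H l (%x y. lact (%z. K z (c \<otimes> (y \<otimes> T a))) b x)))"
proof -
 note [simp] = bilin_lin[OF K] bilin_push[OF K is_module is_module is_module]
 have "lact (%l. sw H l K) h l = sw H h (%a r. sw H r (%b c. sw H c (%c1 c2. sw H l (%x y. sw H a (%a1 a2.
   K (c1 \<otimes> (x \<otimes> T a2)) (c2 \<otimes> (y \<otimes> T a1)) \<otimes> b)))))"
  unfolding lact_def by (simp add: sw_mult T_comul K)
 also have "... = sw H h (%a r. sw H r (%b c. sw H b (%p s. sw H s (%q t. sw H l (%x y.
   K (t \<otimes> (x \<otimes> T p)) (c \<otimes> (y \<otimes> T a)) \<otimes> q)))))"
  by (rule HOL.trans, rule ssum_eqI, rule ssum_eqI, rule ssum_eqI, (rule sw_swap; simp), rule regroup5) simp_all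
 also have "... = sw H h (%a r. sw H r (%b c. sw H l (%x y. lact (%z. K z (c \<otimes> (y \<otimes> T a))) b x)))"
 proof (rule ssum_eqI, rule ssum_eqI)
  fix a r b c assume [simp]: "a :. H" "r :. H" "b :. H" "c :. H"
  have "sw H b (%p s. sw H s (%q t. sw H l (%x y. K (t \<otimes> (x \<otimes> T p)) (c \<otimes> (y \<otimes> T a)) \<otimes> q))) = sw H l (%x y. sw H b (%p s. sw H s (%q t. K (t \<otimes> (x \<otimes> T p)) (c \<otimes> (y \<otimes> T a)) \<otimes> q)))"
   by (rule HOL.trans, rule ssum_eqI, (rule sw_swap; simp), rule sw_swap) simp_all
  then show "sw H b (%p s. sw H s (%q t. sw H l (%x y. K (t \<otimes> (x \<otimes> T p)) (c \<otimes> (y \<otimes> T a)) \<otimes> q))) =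
   sw H l (%x y. lact (%z. K z (c \<otimes> (y \<otimes> T a))) b x)"
   by (simp add: lact_def)
 qed
 finally show ?thesis .
qed

lemma star_lact:
 assumes u: "lin u" and v: "lin v" and [simp]: "h :. H" "l :. H"
 shows "lact (star u v) h l = star u (lact v h) l"
proof -
 note [simp] = u v linear_comp[OF u] linear_comp[OF v] linear_mapD(1)[OF u] linear_mapD(1)[OF v]
 have "lact (star u v) h l = sw H h (%a r. sw H r (%b c. sw H l (%x y. lact u (v (c \<otimes> (y \<otimes> T a)) \<otimes> b) x)))"
  unfolding star_def[abs_def] by (subst lact_conv) (simp_all add: lact_mult)
 also have "... = sw H l (%x y. sw H h (%a r. sw H r (%b c. lact u (v (c \<otimes> (y \<otimes> T a)) \<otimes> b) x)))"
  by (rule HOL.trans, rule ssum_eqI, (rule sw_swap; simp), rule sw_swap) simp_all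
 also have "... = star u (lact v h) l"
  unfolding star_def lact_def[of v] by simp
 finally show ?thesis .
qed

text \<open>Once \<open>lact\<close> passes to the right factor (\<open>star_lact\<close>), only
  coassociativity for l is left.\<close>

lemma star_assoc:
 assumes u: "lin u" and v: "lin v" and w: "lin w" and [simp]: "l :. H"
 shows "star (star u v) w l = star u (star v w) l"
proof -
 note [simp] = u v linear_comp[OF u] linear_comp[OF v] linear_mapD(1)[OF u] linear_mapD(1)[OF v]
   linear_comp[OF w] linear_mapD(1)[OF w]
 have "star (star u v) w l = sw H l (%x y. sw H x (%p q. lact u (lact v (w y) q) p))"
  unfolding star_def[of _ w] by (simp add: star_lact) (simp add: star_def)
 also have "... = sw H l (%x y. sw H y (%p q. lact u (lact v (w q) p) x))"
  by (simp add: coas)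
 also have "... = star u (star v w) l"
  unfolding star_def by simp
 finally show ?thesis .
qed

lemma star_ue:
 assumes u: "lin u" and [simp]: "l :. H"
 shows "star u ue l = lact u \<one> l"
 unfolding star_def ue_def using cou_r[of H l "%x. lact u \<one> x"] u by simp

lemma counit_T_es:
 assumes [simp]: "module R P" "x :. P" "z :. H" "h :. H"
 shows "counit H (z \<otimes> T (es h)) \<odot>\<^sub>P x = counit H (z \<otimes> T h) \<odot>\<^sub>P x"
 using S_counit[of P x "z \<otimes> T h"] S_counit[of P x "z \<otimes> T (es h)"] by (simp add: S_mult)

text \<open>Under the counit, \<open>etb\<close> may be put on the third leg of k and
  \<open>es\<close> on the first; \<open>W4'\<close> and \<open>W3\<close> then replace the outer
  legs by legs of \<Delta>(1) and leave k itself as a left factor.\<close>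

lemma lact_ue:
 assumes [simp]: "k :. H" "l :. H"
 shows "lact ue k l = k \<otimes> lact ue \<one> l"
proof -
 have l: "lact ue k l = sw H k (%a r. sw H r (%b c. counit H (c \<otimes> (l \<otimes> T a)) \<odot> b))"
  if [simp]: "k :. H" for k
  unfolding lact_def ue_def by simp
 have "lact ue k l = sw H k (%a r. sw H r (%b c. counit H (etb c \<otimes> (l \<otimes> T a)) \<odot> b))"
  by (simp add: l)
 also have "... = sw H k (%a r. sw H \<one> (%b c. counit H ((c \<otimes> l) \<otimes> T (es a)) \<odot> (r \<otimes> b)))"
  by (rule HOL.trans, rule ssum_eqI, (rule W4'; simp)) (simp only: counit_T_es H_ring assms T_closed is_module cong: ssum_cong)
 also have "... = sw H \<one> (%a r. sw H \<one> (%b c. counit H (c \<otimes> (l \<otimes> T a)) \<odot> (k \<otimes> (r \<otimes> b))))"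
  by (rule HOL.trans, (rule W3[where bb = "%a r. sw H \<one> (%b c. counit H ((c \<otimes> l) \<otimes> T a) \<odot> (r \<otimes> b))"]; simp)) simp
 also have "... = sw H \<one> (%a b. sw H a (%c d. counit H (b \<otimes> (l \<otimes> T c)) \<odot> (k \<otimes> d)))"
  by (subst one1) simp_all
 also have "... = k \<otimes> lact ue \<one> l"
  by (simp add: coas l)
 finally show ?thesis .
qed

text \<open>\<Delta>^2(1) is 1_1 \<otimes> 1_2 1'_1 \<otimes> 1'_2, so its outer legs are legs of
  \<Delta>(1) and \<open>W1\<close> applies to each.\<close>

lemma one_es_et:
 assumes [simp]: "module R P" and \<delta>: "trilin R H H H P \<delta>"
 shows "sw P \<one> (%a r. sw P r (%b c. \<delta> (es a) b (et c))) = sw P \<one> (%a r. sw P r (%b c. \<delta> a b c))"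
proof -
 note [simp] = trilin_lin[OF \<delta>]
 have "sw P \<one> (%a r. sw P r (%b c. \<delta> (es a) b (et c))) = sw P \<one> (%a r. sw P a (%b c. \<delta> (es b) c (et r)))"
  by (simp add: coas)
 also have "... = sw P \<one> (%a b. sw P \<one> (%c d. \<delta> (es a) (b \<otimes> c) (et d)))"
  by (subst one1) simp_all
 also have "... = sw P \<one> (%a r. sw P a (%b c. \<delta> b c r))"
  by (rule HOL.trans, rule HOL.trans, rule ssum_eqI, (rule W1(1); simp), (rule W1(2); simp), subst one1) simp_all
 also have "... = sw P \<one> (%a r. sw P r (%b c. \<delta> a b c))"
  by (simp add: coas)
 finally show ?thesis .
qed

text \<open>Both \<open>z\<close> and \<open>T w\<close> lie in H_t, so in \<Delta>(z l T(w)) they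
  affect the first leg only, and there the counit is applied.\<close>

lemma counit_sandwich:
 assumes [simp]: "module R P" "l :. H" and z: "z : Ht" and w: "w : Hs" and f: "linear_map R H P f"
 shows "sw P l (%x y. counit H (z \<otimes> (x \<otimes> T w)) \<odot>\<^sub>P f y) = f (z \<otimes> (l \<otimes> T w))"
proof -
 note [simp] = HtD(1)[OF z] HsD(1)[OF w] linear_comp[OF f] linear_mapD(1)[OF f]
 have "f (z \<otimes> (l \<otimes> T w)) = sw P (z \<otimes> (l \<otimes> T w)) (%a b. counit H a \<odot>\<^sub>P f b)"
  by (rule cou_l[symmetric]) (simp_all add: f)
 then show ?thesis
  by (simp add: sw_Ht(2)[OF _ _ z] sw_Ht(1)[OF _ _ T_Hs[OF w]])
qed

lemma lact_one:
 assumes [simp]: "module R P" "l :. H" and bb: "bilin R H H P bb"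
 shows "sw P l (%x y. sw P \<one> (%a r. sw P r (%b c. counit H (c \<otimes> (x \<otimes> T a)) \<odot>\<^sub>P bb b y))) =
  sw P \<one> (%a r. sw P r (%b c. bb b (c \<otimes> (l \<otimes> T a))))"
proof -
 note [simp] = bilin_lin[OF bb]
 have "sw P l (%x y. sw P \<one> (%a r. sw P r (%b c. counit H (c \<otimes> (x \<otimes> T a)) \<odot>\<^sub>P bb b y))) =
   sw P l (%x y. sw P \<one> (%a r. sw P r (%b c. counit H (et c \<otimes> (x \<otimes> T (es a))) \<odot>\<^sub>P bb b y)))"
  by (rule ssum_eqI, subst one_es_et[symmetric]) simp_all
 also have "... = sw P \<one> (%a r. sw P r (%b c. bb b (et c \<otimes> (l \<otimes> T (es a)))))"
  by (rule HOL.trans, rule HOL.trans, (rule sw_swap; simp), rule ssum_eqI, (rule sw_swap; simp), intro ssum_cong HOL.refl, rule counit_sandwich) simp_all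
 also have "... = sw P \<one> (%a r. sw P r (%b c. bb b (c \<otimes> (l \<otimes> T a))))"
  by (rule one_es_et) simp_all
 finally show ?thesis .
qed

text \<open>With \<open>star_ue\<close> this says that the preunit multiplies from the left as it
  does from the right. \<open>lact_ue\<close> frees v(y) from the action on the preunit, and
  \<open>lact_one\<close> evaluates the sum that remains.\<close>

lemma ue_star:
 assumes v: "lin v" and [simp]: "l :. H"
 shows "star ue v l = lact v \<one> l"
proof -
 note [simp] = linear_comp[OF v] linear_mapD(1)[OF v] ue_lin
 have "star ue v l = sw H l (%x y. v y \<otimes> lact ue \<one> x)"
  unfolding star_def by (rule ssum_eqI, rule lact_ue) simp_all
 also have "... = sw H l (%x y. sw H \<one> (%a r. sw H r (%b c. counit H (c \<otimes> (x \<otimes> T a)) \<odot> (v y \<otimes> b))))"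
  unfolding lact_def ue_def by simp
 also have "... = lact v \<one> l"
  unfolding lact_def by (subst lact_one) simp_all
 finally show ?thesis .
qed

text \<open>The product with 1 \<bowtie> g, without the preunit that the true product leaves between
  the factors; by \<open>dot_lact\<close> the two agree after multiplication by the preunit.\<close>

definition dot where
 "dot u g l = sw H l (%x y. g y \<odot> u x)"

lemma dot_lin:
 assumes u: "lin u" and g: "linear_map R H (ground R) g"
 shows "lin (dot u g)"
proof -
 note [simp] = linear_comp[OF u] linear_mapD(1)[OF u] linear_comp[OF g] linear_mapD(1)[OF g, simplified]
 show ?thesis
  unfolding dot_def[abs_def] by simp
qed

lemma dot_lact:
 assumes u: "lin u" and g: "linear_map R H (ground R) g" and [simp]: "l :. H"
 shows "lact (dot (lact u \<one>) g) \<one> l = lact (dot u g) \<one> l"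
proof -
 note [simp] = u linear_comp[OF g] linear_mapD(1)[OF g, simplified]
 have *: "lact (dot u g) \<one> l = sw H \<one> (%a r. sw H r (%b c. sw H l (%x y. g (c \<otimes> (y \<otimes> T a)) \<odot> lact u b x)))"
  if u: "lin u" for u
 proof -
  note [simp] = linear_comp[OF u] linear_mapD(1)[OF u]
  show ?thesis
   unfolding dot_def[abs_def] by (subst lact_conv) (simp_all add: lact_def)
 qed
 show ?thesis
  by (simp add: * lact_mult)
qed

end

section \<open>Yetter-Drinfeld modules\<close>

lemma (in base) yd_moduleD:
 assumes "yd_module R H M"
 shows "left_module R H M" "linear_map R M (tensor R M H) (coact M)"
  "!!m. m :. M ==>
     tens3 R M H H [(m0, h1, h2). (m', h2) \<leftarrow> coact M m, (m0, h1) \<leftarrow> coact M m'] =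
     tens3 R M H H [(m0, h1, h2). (m0, h) \<leftarrow> coact M m, (h1, h2) \<leftarrow> comul H h]"
  "!!m. m :. M ==> lsum M [counit H m1 \<odot>\<^sub>M m0. (m0, m1) \<leftarrow> coact M m] = m"
  "!!m. m :. M ==> coact M m :. (tensor_t R H M (regular H))"
  "!!h m. h :. H ==> m :. M ==>
     tens R M H [(act M h1 m0, h2 \<otimes>\<^sub>H m1). (h1, h2) \<leftarrow> comul H h, (m0, m1) \<leftarrow> coact M m] =
     tens R M H [(m0, m1 \<otimes>\<^sub>H h1). (h1, h2) \<leftarrow> comul H h, (m0, m1) \<leftarrow> coact M (act M h2 m)]"
 using assms unfolding yd_module_def by blast+

lemmas (in base) yd_left [simp] = yd_moduleD(1)

context weak_hopf_bij
begin

abbreviation "co M P m bb \<equiv> ssum M H P (coact M m) bb"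

lemma yd_mod [simp]: "yd_module R H M ==> module R M"
 by (auto dest: yd_left left_moduleD(1))

lemmas act_H [simp] = bilin_lin[OF bilin_act[where B = H]]

lemmas yd_push [simp] = act_push[OF yd_left is_module yd_mod yd_mod]

lemma yd_act [simp]:
 "yd_module R H M ==> m :. M ==> act M \<one> m = m"
 "yd_module R H M ==> h :. H ==> k :. H ==> m :. M ==> act M (h \<otimes> k) m = act M h (act M k m)"
 by (simp_all add: left_moduleD[OF yd_left])

lemma coact_linear: "yd_module R H M ==> linear_map R M (tensor R M H) (coact M)"
 by (rule yd_moduleD)

lemmas coact_lin [simp] = linear_comp[OF coact_linear]
lemmas coact_closed [simp] = linear_mapD(1)[OF coact_linear]

lemma coact_wf: "yd_module R H M ==> m :. M ==> set (coact M m) \<subseteq> carrier M \<times> carrier H"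
 using tensor_wf[OF yd_mod is_module coact_closed] .

lemma co_push [simp]:
 assumes "yd_module R H M" "module R P" "bilin R M H P bb"
 shows "(!!a b. a :. A ==> b :. B ==> \<gamma> a b :. M) ==>
   co M P (ssum A B M t \<gamma>) bb = ssum A B P t (%a b. co M P (\<gamma> a b) bb)"
  and "r :. R ==> m :. M ==> co M P (r \<odot>\<^sub>M m) bb = r \<odot>\<^sub>P co M P m bb"
proof -
 have L: "linear_map R M P (%m. co M P m bb)"
  using assms by simp
 show "(!!a b. a :. A ==> b :. B ==> \<gamma> a b :. M) ==>
   co M P (ssum A B M t \<gamma>) bb = ssum A B P t (%a b. co M P (\<gamma> a b) bb)"
  using linear_ssum[OF L, of A B \<gamma> t] assms by simp
 show "r :. R ==> m :. M ==> co M P (r \<odot>\<^sub>M m) bb = r \<odot>\<^sub>P co M P m bb"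
  using linear_mapD(3)[OF L] .
qed

lemma co_swap:
 "module R P ==> (!!a b c d. a :. M ==> b :. H ==> c :. H ==> d :. H ==> \<gamma> a b c d :. P) ==>
  co M P h (%a b. sw P k (%c d. \<gamma> a b c d)) = sw P k (%c d. co M P h (%a b. \<gamma> a b c d))"
 by (rule ssum_swap)

lemma co_coas:
 assumes "yd_module R H M" "module R P" "m :. M" "trilin R M H H P \<gamma>"
 shows "co M P m (%x b. co M P x (%y a. \<gamma> y a b)) = co M P m (%x h. sw P h (%a b. \<gamma> x a b))"
proof -
 have "tens3 R M H H (concat (map (%(m', h2). map (%(m0, h1). (m0, h1, h2)) (coact M m')) (coact M m))) =
   tens3 R M H H (concat (map (%(m0, h). map (%(h1, h2). (m0, h1, h2)) (comul H h)) (coact M m)))"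
  by (rule yd_moduleD) (use assms in auto)
 then show ?thesis
  using tens3_comp_eq[OF yd_mod[OF assms(1)] is_module is_module assms(2,4) _ coact_wf[OF assms(1,3)]
   coact_wf[OF assms(1,3)] coact_wf[OF assms(1)] comul_wf] by simp
qed

lemma co_counit:
 assumes "yd_module R H M" "module R P" "m :. M" "linear_map R M P f"
 shows "co M P m (%x h. counit H h \<odot>\<^sub>P f x) = f m"
proof -
 have "m = co M M m (%x h. counit H h \<odot>\<^sub>M x)"
  using yd_moduleD(4)[OF assms(1,3)] by (simp add: ssum_wf[OF coact_wf[OF assms(1,3)]])
 then have "f m = f (co M M m (%x h. counit H h \<odot>\<^sub>M x))" by simp
 then show ?thesis
  using assms(1-3) by (simp add: linear_ssum[OF assms(4)] linear_mapD[OF assms(4)])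
qed

lemma co_compat:
 assumes "yd_module R H M" "module R P" "m :. M" "h :. H" "bilin R M H P bb"
 shows "sw P h (%a b. co M P m (%x k. bb (act M a x) (b \<otimes> k))) =
  sw P h (%a b. co M P (act M b m) (%x k. bb x (k \<otimes> a)))"
proof -
 note [simp] = bilin_lin[OF assms(5)] assms(1-4)
 have eq: "tens R M H (concat (map (%(h1, h2). map (%(m0, m1). (act M h1 m0, h2 \<otimes> m1)) (coact M m)) (comul H h))) =
   tens R M H (concat (map (%(h1, h2). map (%(m0, m1). (m0, m1 \<otimes> h1)) (coact M (act M h2 m))) (comul H h)))"
  by (rule yd_moduleD) (use assms in auto)
 have "ssum (tensor R M H) (tensor R M H) P [] (%a b. \<zero>\<^sub>P) = \<zero>\<^sub>P"
  by (simp add: ssum_def abelian_monoid.lsum_Nil)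
 have "sw P h (%a b. co M P m (%x k. bb (act M a x) (b \<otimes> k))) =
   ssum M H P (tens R M H (concat (map (%(h1, h2). map (%(m0, m1). (act M h1 m0, h2 \<otimes> m1)) (coact M m)) (comul H h)))) bb"
  by (subst tens_comp_ssum[OF _ _ comul_wf coact_wf]) (simp_all add: assms(5))
 also have "... = sw P h (%a b. co M P (act M b m) (%x k. bb x (k \<otimes> a)))"
  unfolding eq by (subst tens_comp_ssum[OF _ _ comul_wf coact_wf]) (simp_all add: assms(5))
 finally show ?thesis .
qed

text \<open>The coaction lies in the image of \<Delta>(1), and \<Delta>(1) is idempotent.\<close>

lemma co_t:
 assumes "yd_module R H M" "module R P" "m :. M" "bilin R M H P bb"
 shows "co M P m bb = sw P \<one> (%a b. co M P m (%x k. bb (act M a x) (b \<otimes> k)))"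
proof -
 note [simp] = bilin_lin[OF assms(4)] assms(1-3)
 have "coact M m :. (tensor_t R H M (regular H))"
  by (rule yd_moduleD) (use assms in auto)
 moreover have [simp]: "tensor R M (regular H) = tensor R M H" "tens R M (regular H) = tens R M H"
  "act (regular H) = mult H" "carrier (regular H) = carrier H"
 proof -
  have "same_module (regular H) H" "same_module M M"
   by (simp_all add: same_module_def regular_def)
  then show "tensor R M (regular H) = tensor R M H" "tens R M (regular H) = tens R M H"
   using same_tensor[of M M "regular H" H] same_tens[of M M "regular H" H] by simp_all
 qed (simp_all add: regular_def)
 ultimately obtain t where t: "t :. (tensor R M H)"
  "coact M m = tens R M H (concat (map (%(b1, b2). map (%(m, n). (act M b1 m, b2 \<otimes> n)) t) (comul H \<one>)))"
  by (auto simp: tensor_t_def diag_act_def)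
 have wf: "over M H t" using tensor_wf[OF _ _ t(1)] by simp
 have c: "coact M m = sw (tensor R M H) \<one> (%a b. ssum M H (tensor R M H) t (%x k. tn M H (act M a x) (b \<otimes> k)))"
  unfolding t(2) by (subst tens_comp_ssum[OF _ _ comul_wf wf]) simp_all
 have e: "co M P m bb' = sw P \<one> (%a b. ssum M H P t (%x k. bb' (act M a x) (b \<otimes> k)))" if bb': "bilin R M H P bb'" for bb'
  unfolding c using bilin_lin[OF bb'] bb' by simp
 have "sw P \<one> (%a b. co M P m (%x k. bb (act M a x) (b \<otimes> k))) =
   sw P \<one> (%a b. sw P \<one> (%c d. ssum M H P t (%x k. bb (act M (a \<otimes> c) x) ((b \<otimes> d) \<otimes> k))))"
  by (simp add: e)
 also have "... = sw P \<one> (%a b. ssum M H P t (%x k. bb (act M a x) (b \<otimes> k)))"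
  by (rule HOL.sym, rule HOL.trans, rule cm_l) simp_all
 also have "... = co M P m bb"
  by (simp add: e assms(4))
 finally show ?thesis ..
qed

text \<open>The compatibility condition, solved for the coaction of hm: multiplication by S^-1 of
  one more leg of h turns the stray leg into a value of \<open>esb\<close> (\<open>T_r\<close>),
  \<open>W4\<close> trades this for \<Delta>(1), and \<open>co_t\<close> absorbs it.\<close>

lemma co_act:
 assumes [simp]: "yd_module R H M" "module R P" "m :. M" "h :. H" and bb: "bilin R M H P bb"
 shows "co M P (act M h m) bb = sw P h (%a r. sw P r (%b c. co M P m (%x k. bb (act M b x) (c \<otimes> (k \<otimes> T a)))))"
proof -
 note [simp] = bilin_lin[OF bb]
 have "sw P h (%a r. sw P r (%b c. co M P m (%x k. bb (act M b x) (c \<otimes> (k \<otimes> T a))))) =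
   sw P h (%a r. sw P r (%b c. co M P (act M c m) (%x k. bb x (k \<otimes> b \<otimes> T a))))"
 proof (rule ssum_eqI)
  fix a r assume [simp]: "a :. H" "r :. H"
  show "sw P r (%b c. co M P m (%x k. bb (act M b x) (c \<otimes> (k \<otimes> T a)))) =
    sw P r (%b c. co M P (act M c m) (%x k. bb x (k \<otimes> b \<otimes> T a)))"
   using co_compat[OF assms(1,2,3), of r "%x k. bb x (k \<otimes> T a)"] by simp
 qed
 also have "... = sw P h (%a r. sw P a (%b c. co M P (act M r m) (%x k. bb x (k \<otimes> (c \<otimes> T b)))))"
  by (simp add: coas)
 also have "... = sw P \<one> (%a r. co M P (act M (r \<otimes> h) m) (%x k. bb x (k \<otimes> a)))"
  by (rule HOL.trans, rule ssum_eqI, (rule T_r[where f = "%y. co M P (act M _ m) (%x k. bb x (k \<otimes> y))"]; simp), rule W4) simp_all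
 also have "... = sw P \<one> (%a b. co M P (act M h m) (%x k. bb (act M a x) (b \<otimes> k)))"
  using co_compat[OF assms(1,2) _ _ bb, of "act M h m" \<one>] by simp
 also have "... = co M P (act M h m) bb"
  using co_t[OF assms(1,2) _ bb, of "act M h m"] by simp
 finally show ?thesis ..
qed

lemma co_one:
 assumes [simp]: "yd_module R H M" "module R P" "m :. M" and bb: "bilin R M H P bb"
 shows "sw P \<one> (%a b. co M P m (%x k. bb (act M b x) (k \<otimes> T a))) = co M P m bb"
proof -
 note [simp] = bilin_lin[OF bb]
 have "co M P (act M \<one> m) bb = sw P \<one> (%a r. sw P a (%b c. co M P m (%x k. bb (act M c x) (r \<otimes> (k \<otimes> T b)))))"
  by (rule HOL.trans, (rule co_act; simp add: bb)) (simp add: coas)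
 also have "... = sw P \<one> (%a b. sw P \<one> (%c d. co M P m (%x k. bb (act M b (act M c x)) (d \<otimes> k \<otimes> T a))))"
  by (subst one1) simp_all
 also have "... = sw P \<one> (%a b. co M P m (%x k. bb (act M b x) (k \<otimes> T a)))"
  by (rule ssum_eqI, rule co_t[where bb = "%x k. bb (act M _ x) (k \<otimes> T _)", symmetric]) simp_all
 finally show ?thesis by simp
qed

section \<open>The action of a linear map on a Yetter-Drinfeld module\<close>

definition ua where
 "ua M u m = co M M m (%x k. act M (u k) x)"

lemma ua_linear: "yd_module R H M ==> lin u ==> linear_map R M M (ua M u)"
proof -
 assume [simp]: "yd_module R H M" and u: "lin u"
 note [simp] = linear_comp[OF u] linear_mapD(1)[OF u]
 show ?thesis unfolding ua_def[abs_def] by simp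
qed

text \<open>The shape of \<open>lact\<close> can be read off here: it is what \<open>co_act\<close>
  makes of u(m_1) m_0 when m is replaced by hm.\<close>

lemma ua_act:
 assumes [simp]: "yd_module R H M" "m :. M" "h :. H" and u: "lin u"
 shows "ua M u (act M h m) = ua M (lact u h) m"
proof -
 note [simp] = linear_comp[OF u] linear_mapD(1)[OF u]
 have "ua M u (act M h m) = sw M h (%a r. sw M r (%b c. co M M m (%x k. act M (u (c \<otimes> (k \<otimes> T a))) (act M b x))))"
  unfolding ua_def by (rule co_act) simp_all
 also have "... = co M M m (%x k. sw M h (%a r. sw M r (%b c. act M (u (c \<otimes> (k \<otimes> T a))) (act M b x))))"
  by (rule HOL.trans, rule ssum_eqI, (rule co_swap[symmetric]; simp), rule co_swap[symmetric]) simp_all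
 also have "... = ua M (lact u h) m"
  unfolding ua_def lact_def by simp
 finally show ?thesis .
qed

lemma ua_star:
 assumes [simp]: "yd_module R H M" "m :. M" and u: "lin u" and v: "lin v"
 shows "ua M (star u v) m = ua M u (ua M v m)"
proof -
 note [simp] = u linear_comp[OF u] linear_mapD(1)[OF u] linear_comp[OF v] linear_mapD(1)[OF v]
 have "ua M (star u v) m = co M M m (%x h. sw M h (%a b. act M (lact u (v b) a) x))"
  unfolding ua_def star_def by simp
 also have "... = co M M m (%x b. co M M x (%y a. act M (lact u (v b) a) y))"
  by (subst co_coas) simp_all
 also have "... = co M M m (%x b. ua M u (act M (v b) x))"
  by (simp add: ua_act) (simp add: ua_def)
 also have "... = ua M u (ua M v m)"
  using linear_ssum[OF ua_linear[OF assms(1) u], of M H "%x k. act M (v k) x" "coact M m"] by (simp add: ua_def)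
 finally show ?thesis .
qed

lemma ua_ue:
 assumes [simp]: "yd_module R H M" "m :. M"
 shows "ua M ue m = m"
 unfolding ua_def ue_def using co_counit[of M M m "%x. x"] by simp

text \<open>Since 1 acts as the identity, a map and its product with the preunit act alike;
  therefore the action factors through D(H).\<close>

lemma ua_lact_one:
 assumes [simp]: "yd_module R H M" "m :. M" and u: "lin u"
 shows "ua M (lact u \<one>) m = ua M u m"
 using ua_act[OF assms(1,2) _ u, of \<one>] by simp

end

section \<open>Transport of modules\<close>

context base
begin

lemma same_module_refl [simp]: "same_module M M"
 by (simp add: same_module_def)

lemma same_module_module:
 assumes "same_module M M'" "module R M"
 shows "module R M'"
proof -
 have e: "carrier M' = carrier M" "zero M' = zero M" "add M' = add M" "smult M' = smult M"
  using assms(1) by (simp_all add: same_module_def)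
 have ab: "abelian_group M" "abelian_monoid M" using assms(2) by auto
 have "abelian_group M'"
 proof (rule abelian_groupI)
  fix x assume "x :. M'"
  then show "\<exists>y\<in>carrier M'. y \<oplus>\<^sub>M' x = \<zero>\<^sub>M'"
   using ab by (intro bexI[of _ "\<ominus>\<^bsub>M\<^esub> x"]) (auto simp: e abelian_group.l_neg abelian_group.a_inv_closed)
 qed (use assms(2) ab in \<open>auto simp: e abelian_monoid.a_assoc abelian_monoid.a_comm abelian_monoid.a_lcomm abelian_monoid.r_zero\<close>)
 then show ?thesis
  by (rule moduleI[OF cring_base]) (use assms(2) in \<open>auto simp: e module.smult_l_distr module.smult_r_distr
    module.smult_assoc1 module.smult_one\<close>)
qed

lemma same_module_linear:
 assumes "same_module M M'" "same_module N N'"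
 shows "linear_map R M N f = linear_map R M' N' f"
 using assms by (simp add: same_module_def linear_map_def)

lemma left_module_same:
 assumes "same_module M M'" "act M = act M'" "left_module R B M"
 shows "left_module R B M'"
proof -
 have "module R M'"
  using assms same_module_module by (auto simp: left_module_def)
 then show ?thesis
  using assms by (simp add: left_module_def same_module_def linear_map_def)
qed

text \<open>Serves for the image of \<Delta>(1) on a tensor product and for the image of
  \<open>eps_t\<close>.\<close>

lemma module_fixed:
 assumes M: "module R M" and f: "linear_map R M M f"
 shows "module R (M\<lparr>carrier := f ` carrier M\<rparr>)"
proof -
 let ?N = "M\<lparr>carrier := f ` carrier M\<rparr>"
 note l = linear_mapD[OF f]
 have ab: "abelian_group M" "abelian_monoid M" using M by auto
 have "abelian_group ?N"
 proof (rule abelian_groupI)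
  fix x y assume "x :. ?N" "y :. ?N"
  then show "x \<oplus>\<^sub>?N y :. ?N"
   using M by (auto simp flip: l(2))
 next
  show "\<zero>\<^sub>?N :. ?N"
   using linear_zero[OF M M f] M by (auto simp: image_iff intro!: bexI[of _ "\<zero>\<^sub>M"])
 next
  fix x assume "x :. ?N"
  then obtain y where y: "x = f y" "y :. M" by auto
  have n: "\<ominus>\<^bsub>M\<^esub> y :. M" using ab y by (simp add: abelian_group.a_inv_closed)
  have "f (\<ominus>\<^bsub>M\<^esub> y) \<oplus>\<^sub>M f y = \<zero>\<^sub>M"
   using y n ab linear_zero[OF M M f] by (simp add: abelian_group.l_neg flip: l(2))
  then show "\<exists>z\<in>carrier ?N. z \<oplus>\<^sub>?N x = \<zero>\<^sub>?N"
   using y n by auto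
 qed (use l ab in \<open>auto simp: abelian_monoid.a_assoc abelian_monoid.a_comm abelian_monoid.l_zero\<close>)
 then show ?thesis
  by (rule moduleI[OF cring_base]) (use M l in \<open>auto simp: module.smult_l_distr module.smult_r_distr
    module.smult_assoc1 module.smult_one simp flip: l(3)\<close>)
qed

lemma transport_simps:
 "carrier (transport R c M) = c ` carrier M"
 "zero (transport R c M) = c \<zero>\<^sub>M"
 "inj_on c (carrier M) ==> x :. M ==> y :. M ==> add (transport R c M) (c x) (c y) = c (x \<oplus>\<^sub>M y)"
 "inj_on c (carrier M) ==> a :. R ==> x :. M ==> smult (transport R c M) a (c x) = c (a \<odot>\<^sub>M x)"
 by (simp_all add: transport_def)

lemma module_transport:
 assumes M: "module R M" and c: "inj_on c (carrier M)"
 shows "module R (transport R c M)"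
proof -
 have ab: "abelian_group M" "abelian_monoid M" using M by auto
 note s = transport_simps[of c M]
 have "abelian_group (transport R c M)"
 proof (rule abelian_groupI)
  fix x assume "x :. (transport R c M)"
  then obtain y where y: "x = c y" "y :. M" by (auto simp: s)
  have n: "\<ominus>\<^bsub>M\<^esub> y :. M" using ab y by (simp add: abelian_group.a_inv_closed)
  then have "c (\<ominus>\<^bsub>M\<^esub> y) \<oplus>\<^bsub>transport R c M\<^esub> x = \<zero>\<^bsub>transport R c M\<^esub>"
   using y ab by (simp add: s c abelian_group.l_neg)
  then show "\<exists>z\<in>carrier (transport R c M). z \<oplus>\<^bsub>transport R c M\<^esub> x = \<zero>\<^bsub>transport R c M\<^esub>"
   using n by (auto simp: s(1))
 qed (use M ab in \<open>auto simp: s c abelian_monoid.a_assoc abelian_monoid.a_comm abelian_monoid.a_lcomm abelian_monoid.r_zero\<close>)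
 then show ?thesis
  by (rule moduleI[OF cring_base]) (use M cring_base in \<open>auto simp: s c module.smult_l_distr module.smult_r_distr
    module.smult_assoc1 module.smult_one cring.cring_simprules\<close>)
qed

lemma normal_transport: "module R M ==> inj_on c (carrier M) ==> normal_module R (transport R c M)"
 by (auto simp: normal_module_def module_transport) (auto simp: transport_def fun_eq_iff)

lemma transport_linear:
 assumes "module R M" "inj_on c (carrier M)"
 shows "linear_map R M (transport R c M) c" "linear_map R (transport R c M) M (inv_into (carrier M) c)"
 by (intro linear_mapI; use assms in \<open>simp add: transport_simps\<close>)
   (intro linear_mapI; use assms in \<open>auto simp: transport_simps\<close>)

end

section \<open>Tensor products of modules over an algebra with a comultiplication\<close>

text \<open>
 The assumptions hold both for \<open>H\<close> and for \<open>D(H)\<close>; the projection \<open>\<Delta>(1)\<close> need only be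
 idempotent on the tensor products of the modules under consideration.
\<close>

locale diag_tensor = base R
 for R :: "('k, 'r) ring_scheme" +
 fixes B :: "('k, 'b, 'e) bialg_scheme"
  and obj :: "('k, 'b, 'x universe, 'm) bmodule_scheme \<Rightarrow> bool"
 assumes B_module [simp]: "module R B"
  and B_ring: "ring B"
  and comul_B: "linear_map R B (tensor R B B) (comul B)"
  and obj_left [simp]: "obj M ==> left_module R B M"
  and diag_diag: "obj M ==> obj N ==> b :. B ==> c :. B ==> t :. (tensor R M N) ==>
   diag_act R B M N b (diag_act R B M N c t) = diag_act R B M N (b \<otimes>\<^sub>B c) t"
begin

abbreviation "dg \<equiv> diag_act R B"
abbreviation "TM \<equiv> tens_mod R B"
abbreviation "sB P b bb \<equiv> ssum B B P (comul B b) bb"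

lemma B_simps [simp]: "\<one>\<^sub>B :. B" "x :. B ==> y :. B ==> x \<otimes>\<^sub>B y :. B"
 "x :. B ==> \<one>\<^sub>B \<otimes>\<^sub>B x = x" "x :. B ==> x \<otimes>\<^sub>B \<one>\<^sub>B = x"
 using B_ring by (auto simp: ring.ring_simprules ring.is_monoid monoid.r_one)

lemmas comul_B_lin [simp] = linear_comp[OF comul_B]
lemmas comul_B_closed [simp] = linear_mapD(1)[OF comul_B]

lemma comul_B_wf: "b :. B ==> set (comul B b) \<subseteq> carrier B \<times> carrier B"
 using tensor_wf[OF B_module B_module comul_B_closed] .

lemma obj_module [simp]: "obj M ==> module R M"
 by (rule left_moduleD(1)[OF obj_left])

lemmas act_B [simp] = bilin_lin[OF bilin_act[where B = B], OF obj_left]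
 bilin_push[OF bilin_act[where B = B], OF obj_left B_module obj_module obj_module]

lemma act_B_one [simp]: "obj M ==> m :. M ==> act M \<one>\<^sub>B m = m"
 "obj M ==> b :. B ==> c :. B ==> m :. M ==> act M (b \<otimes>\<^sub>B c) m = act M b (act M c m)"
 by (auto simp: left_moduleD[OF obj_left])

lemma diag_ssum:
 assumes "obj M" "obj N" "b :. B" "over M N t"
 shows "dg M N b t = sB (tensor R M N) b (%a c. ssum M N (tensor R M N) t (%m n. tn M N (act M a m) (act N c n)))"
 unfolding diag_act_def by (rule tens_comp_ssum[OF _ _ comul_B_wf]) (use assms in auto)

lemma diag_pair:
 assumes "obj M" "obj N" "b :. B" "m :. M" "n :. N"
 shows "dg M N b [(m, n)] = sB (tensor R M N) b (%a c. tn M N (act M a m) (act N c n))"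
 using assms by (subst diag_ssum)
  (auto simp: ssum_def abelian_monoid.lsum_Cons abelian_monoid.lsum_Nil abelian_monoid.r_zero)

lemma diag_pair_tn:
 assumes "obj M" "obj N" "b :. B" "m :. M" "n :. N"
 shows "dg M N b [(m, n)] = dg M N b (tn M N m n)"
 using assms set_tens[of M N "[(m, n)]"] by (simp add: diag_pair) (simp add: diag_ssum)

lemma diag_linear0:
 assumes "obj M" "obj N" "b :. B"
 shows "linear_map R (tensor R M N) (tensor R M N) (dg M N b)"
 by (rule linear_map_cong[where g = "%t. sB (tensor R M N) b (%a c. ssum M N (tensor R M N) t (%m n. tn M N (act M a m) (act N c n)))"])
  (simp_all add: assms diag_ssum tensor_wf)

lemmas diag_linear [simp] = linear_comp[OF diag_linear0]
lemmas diag_closed [simp] = linear_mapD(1)[OF diag_linear0]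

lemma diag_linear_b:
 assumes "obj M" "obj N" "t :. (tensor R M N)"
 shows "linear_map R B (tensor R M N) (%b. dg M N b t)"
 by (rule linear_map_cong[where g = "%b. sB (tensor R M N) b (%a c. ssum M N (tensor R M N) t (%m n. tn M N (act M a m) (act N c n)))"])
  (simp_all add: assms diag_ssum tensor_wf)

lemma tensor_t_carrier:
 assumes "obj M" "obj N"
 shows "t :. (tensor_t R B M N) \<longleftrightarrow> t :. (tensor R M N) \<and> dg M N \<one>\<^sub>B t = t"
 using assms by (auto simp: tensor_t_def diag_diag image_iff) metis

lemma tensor_t_sel:
 "add (tensor_t R B M N) = add (tensor R M N)" "smult (tensor_t R B M N) = smult (tensor R M N)"
 "zero (tensor_t R B M N) = zero (tensor R M N)"
 by (simp_all add: tensor_t_def)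

lemma module_tensor_t:
 assumes "obj M" "obj N"
 shows "module R (tensor_t R B M N)"
 unfolding tensor_t_def by (rule module_fixed) (use assms in \<open>auto intro: diag_linear0\<close>)

lemma inj_Tens: "inj_on Tens X"
 by (simp add: inj_on_def)

lemma TM_sel:
 "carrier (TM M N) = Tens ` carrier (tensor_t R B M N)"
 "same_module (TM M N) (transport R Tens (tensor_t R B M N))"
 "act (TM M N) = (\<lambda>b\<in>carrier B. \<lambda>x\<in>Tens ` carrier (tensor_t R B M N). Tens (dg M N b (summands x)))"
 by (simp_all add: tens_mod_def module.defs bmodule.defs transport_simps same_module_def)

lemma TM_module [simp]:
 assumes "obj M" "obj N"
 shows "module R (TM M N)"
 using same_module_module[OF same_module_sym[OF TM_sel(2)] module_transport[OF module_tensor_t[OF assms] inj_Tens]] .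

lemma TM_normal:
 assumes "obj M" "obj N"
 shows "normal_module R (TM M N)"
 using normal_transport[OF module_tensor_t[OF assms] inj_Tens] TM_module[OF assms]
 by (simp add: normal_module_def tens_mod_def module.defs)

lemma TM_carrier:
 assumes "obj M" "obj N"
 shows "x :. (TM M N) \<longleftrightarrow> (\<exists>t. x = Tens t \<and> t :. (tensor R M N) \<and> dg M N \<one>\<^sub>B t = t)"
 by (auto simp: TM_sel tensor_t_carrier[OF assms])

lemma summands_linear0:
 assumes "obj M" "obj N"
 shows "linear_map R (TM M N) (tensor R M N) summands"
 unfolding same_module_linear[OF TM_sel(2) same_module_refl]
 by (intro linear_mapI) (auto simp: transport_simps inj_Tens tensor_t_sel tensor_t_carrier[OF assms])

lemmas summands_linear [simp] = linear_comp[OF summands_linear0]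
lemmas summands_closed [simp] = linear_mapD(1)[OF summands_linear0]

lemma summands_TM:
 assumes "obj M" "obj N" "x :. (TM M N)"
 shows "dg M N \<one>\<^sub>B (summands x) = summands x" "Tens (summands x) = x"
 using assms by (auto simp: TM_carrier)

lemma proj_linear0:
 assumes "obj M" "obj N"
 shows "linear_map R (tensor R M N) (TM M N) (%t. Tens (dg M N \<one>\<^sub>B t))"
 unfolding same_module_linear[OF same_module_refl TM_sel(2)]
proof (intro linear_mapI)
 have c: "dg M N \<one>\<^sub>B t :. (tensor_t R B M N)" if "t :. (tensor R M N)" for t
  using assms that by (simp add: tensor_t_def)
 fix t u a assume "t :. (tensor R M N)"
 then show "Tens (dg M N \<one>\<^sub>B t) :. (transport R Tens (tensor_t R B M N))"
  using c by (simp add: transport_simps)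
 { assume "u :. (tensor R M N)" "t :. (tensor R M N)"
  then show "Tens (dg M N \<one>\<^sub>B (t \<oplus>\<^bsub>tensor R M N\<^esub> u)) =
   Tens (dg M N \<one>\<^sub>B t) \<oplus>\<^bsub>transport R Tens (tensor_t R B M N)\<^esub> Tens (dg M N \<one>\<^sub>B u)"
   using c linear_mapD(2)[OF diag_linear0[OF assms]] by (simp add: transport_simps inj_Tens tensor_t_sel) }
 { assume "a :. R" "t :. (tensor R M N)"
  then show "Tens (dg M N \<one>\<^sub>B (a \<odot>\<^bsub>tensor R M N\<^esub> t)) =
   a \<odot>\<^bsub>transport R Tens (tensor_t R B M N)\<^esub> Tens (dg M N \<one>\<^sub>B t)"
   using c linear_mapD(3)[OF diag_linear0[OF assms]] by (simp add: transport_simps inj_Tens tensor_t_sel) }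
qed

lemmas proj_linear [simp] = linear_comp[OF proj_linear0]
lemmas proj_closed [simp] = linear_mapD(1)[OF proj_linear0]

text \<open>Built from the list \<open>[(m, n)]\<close> and not from its chosen representative, to
  match the formulas for the associativity and for the coaction; by \<open>pt_proj\<close> the
  result is the same.\<close>

definition pt where
 "pt M N m n = Tens (dg M N \<one>\<^sub>B [(m, n)])"

lemma pt_proj:
 "obj M ==> obj N ==> m :. M ==> n :. N ==> pt M N m n = Tens (dg M N \<one>\<^sub>B (tn M N m n))"
 by (simp add: pt_def diag_pair_tn)

lemma pt_bilin:
 assumes "obj M" "obj N"
 shows "bilin R M N (TM M N) (pt M N)"
proof -
 have "linear_map R M (TM M N) (%m. Tens (dg M N \<one>\<^sub>B (tn M N m n)))" if "n :. N" for n
  by (rule linear_comp[OF proj_linear0]) (use assms that in auto)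
 moreover have "linear_map R N (TM M N) (%n. Tens (dg M N \<one>\<^sub>B (tn M N m n)))" if "m :. M" for m
  by (rule linear_comp[OF proj_linear0]) (use assms that in auto)
 ultimately show ?thesis
  using assms by (auto intro!: bilinI simp: pt_proj
   intro: linear_map_cong[where g = "%m. Tens (dg M N \<one>\<^sub>B (tn M N m n))" for n]
    linear_map_cong[where g = "%n. Tens (dg M N \<one>\<^sub>B (tn M N m n))" for m])
qed

lemmas pt_simps [simp] = bilin_lin[OF pt_bilin] bilin_push[OF pt_bilin, OF _ _ obj_module obj_module TM_module]

lemma proj_ssum:
 assumes "obj M" "obj N" "over M N t"
 shows "Tens (dg M N \<one>\<^sub>B t) = ssum M N (TM M N) t (pt M N)"
proof -
 have 1: "dg M N \<one>\<^sub>B t = dg M N \<one>\<^sub>B (tens R M N t)"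
  using assms by (simp add: diag_ssum set_tens ssum_tens)
 have "Tens (dg M N \<one>\<^sub>B (ssum M N (tensor R M N) t (tn M N))) = ssum M N (TM M N) t (%m n. Tens (dg M N \<one>\<^sub>B (tn M N m n)))"
  by (rule linear_ssum[OF proj_linear0]) (use assms in auto)
 also have "... = ssum M N (TM M N) t (pt M N)"
  using assms by (simp add: pt_proj)
 finally show ?thesis
  using assms by (simp add: 1 tens_ssum)
qed

lemma TM_elem:
 assumes "obj M" "obj N" "x :. (TM M N)"
 shows "x = ssum M N (TM M N) (summands x) (pt M N)"
proof -
 have "Tens (dg M N \<one>\<^sub>B (summands x)) = ssum M N (TM M N) (summands x) (pt M N)"
  by (rule proj_ssum) (simp_all add: assms tensor_wf)
 then show ?thesis
  by (simp only: summands_TM[OF assms])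
qed

lemma act_TM:
 assumes "obj M" "obj N" "b :. B" "x :. (TM M N)"
 shows "act (TM M N) b x = Tens (dg M N b (summands x))"
 using assms by (simp add: TM_sel)

lemma summands_act:
 assumes "obj M" "obj N" "b :. B" "m :. M" "n :. N"
 shows "summands (act (TM M N) b (pt M N m n)) = sB (tensor R M N) b (%a c. tn M N (act M a m) (act N c n))"
 using assms by (simp add: act_TM) (simp add: pt_def diag_pair_tn diag_diag, simp add: diag_pair flip: diag_pair_tn)

lemma act_pt:
 assumes "obj M" "obj N" "b :. B" "m :. M" "n :. N"
 shows "act (TM M N) b (pt M N m n) = sB (TM M N) b (%a c. pt M N (act M a m) (act N c n))"
proof -
 have "act (TM M N) b (pt M N m n) = Tens (dg M N b (tn M N m n))"
  using assms by (simp add: act_TM) (simp add: pt_def diag_pair_tn diag_diag)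
 also have "... = Tens (dg M N \<one>\<^sub>B (dg M N b (tn M N m n)))"
  using assms by (simp add: diag_diag)
 also have "... = Tens (dg M N \<one>\<^sub>B (sB (tensor R M N) b (%a c. tn M N (act M a m) (act N c n))))"
  using assms by (simp add: diag_pair flip: diag_pair_tn)
 also have "... = sB (TM M N) b (%a c. Tens (dg M N \<one>\<^sub>B (tn M N (act M a m) (act N c n))))"
  by (rule linear_ssum[OF proj_linear0]) (use assms in auto)
 also have "... = sB (TM M N) b (%a c. pt M N (act M a m) (act N c n))"
  using assms by (simp add: pt_proj)
 finally show ?thesis .
qed

lemma pt_one:
 assumes "obj M" "obj N" "m :. M" "n :. N"
 shows "summands (pt M N m n) = sB (tensor R M N) \<one>\<^sub>B (%a c. tn M N (act M a m) (act N c n))"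
 using assms by (simp add: pt_def diag_pair)

lemma TM_left [simp]:
 assumes "obj M" "obj N"
 shows "left_module R B (TM M N)"
 unfolding left_module_def
proof (intro conjI ballI)
 have c: "act (TM M N) b x = Tens (dg M N \<one>\<^sub>B (dg M N b (summands x)))"
  if "b :. B" "x :. (TM M N)" for b x
  using that assms by (simp add: act_TM diag_diag)
 fix b assume b: "b :. B"
 show "linear_map R (TM M N) (TM M N) (act (TM M N) b)"
  by (rule linear_map_cong[OF _ c]) (use assms b in \<open>simp_all add: linear_comp[OF proj_linear0]\<close>)
next
 have c: "act (TM M N) b x = Tens (dg M N \<one>\<^sub>B (dg M N b (summands x)))"
  if "b :. B" "x :. (TM M N)" for b x
  using that assms by (simp add: act_TM diag_diag)
 fix x assume x: "x :. (TM M N)"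
 show "linear_map R B (TM M N) (%b. act (TM M N) b x)"
  by (rule linear_map_cong[OF _ c]) (use assms x in \<open>simp_all add: linear_comp[OF proj_linear0] diag_linear_b\<close>)
 show "act (TM M N) \<one>\<^sub>B x = x"
  using x assms by (simp add: act_TM summands_TM)
 fix b c assume b: "b :. B" "c :. B"
 have "act (TM M N) c x :. (TM M N)"
  using b x assms by (simp add: c)
 then show "act (TM M N) (b \<otimes>\<^sub>B c) x = act (TM M N) b (act (TM M N) c x)"
  using b x assms by (simp add: act_TM diag_diag)
qed (use assms in simp)

section \<open>The universal property of M \<otimes>_t N\<close>

definition lft where
 "lft M N P bb x = ssum M N P (summands x) bb"

text \<open>The bilinear maps that factor through the projection \<Delta>(1). For these
  \<open>lft\<close>, the restriction of the induced map on M \<otimes> N, has the expected value on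
  generators (\<open>lft_pt\<close>).\<close>

definition balanced where
 "balanced M N P bb \<longleftrightarrow> bilin R M N P bb \<and> (\<forall>m\<in>carrier M. \<forall>n\<in>carrier N.
   sB P \<one>\<^sub>B (%a c. bb (act M a m) (act N c n)) = bb m n)"

lemma lft_linear: "obj M ==> obj N ==> module R P ==> bilin R M N P bb ==> linear_map R (TM M N) P (lft M N P bb)"
 unfolding lft_def[abs_def] by simp

lemma lft_pt:
 assumes "obj M" "obj N" "module R P" "balanced M N P bb" "m :. M" "n :. N"
 shows "lft M N P bb (pt M N m n) = bb m n"
proof -
 have bb: "bilin R M N P bb" using assms by (simp add: balanced_def)
 show ?thesis
  unfolding lft_def pt_one[OF assms(1,2,5,6)]
  using assms bilin_lin[OF bb] bb by (simp add: balanced_def)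
qed

lemma TM_ext:
 assumes "obj M" "obj N" "module R P" "linear_map R (TM M N) P f" "linear_map R (TM M N) P g"
  and "!!m n. m :. M ==> n :. N ==> f (pt M N m n) = g (pt M N m n)"
  and x: "x :. (TM M N)"
 shows "f x = g x"
proof -
 have "f (ssum M N (TM M N) (summands x) (pt M N)) = g (ssum M N (TM M N) (summands x) (pt M N))"
  using assms by (simp add: linear_ssum[OF assms(4)] linear_ssum[OF assms(5)])
 then show ?thesis
  using TM_elem[OF assms(1,2) x] by simp
qed

text \<open>A balanced map sees only the projected element, so any preimage under \<Delta>(1) may be
  used and the choice made by \<open>unproject\<close> is harmless.\<close>

lemma unproject_ssum:
 assumes "obj M" "obj N" "module R P" "balanced M N P bb" "x :. (TM M N)"
 shows "ssum M N P (unproject R B M N x) bb = lft M N P bb x"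
  and "unproject R B M N x :. (tensor R M N)"
proof -
 let ?t = "unproject R B M N x"
 have "\<exists>t. t :. (tensor R M N) \<and> x = Tens (dg M N \<one>\<^sub>B t)"
  using assms by (metis summands_TM summands_closed)
 then have t: "?t :. (tensor R M N) \<and> x = Tens (dg M N \<one>\<^sub>B ?t)"
  unfolding unproject_def by (rule someI_ex)
 then show "?t :. (tensor R M N)" ..
 then have wf: "set ?t \<subseteq> carrier M \<times> carrier N"
  using assms by (intro tensor_wf) auto
 have b: "bilin R M N P bb" using assms by (simp add: balanced_def)
 have "lft M N P bb x = lft M N P bb (ssum M N (TM M N) ?t (pt M N))"
  using t proj_ssum[OF assms(1,2) wf] by simp
 also have "... = ssum M N P ?t (%m n. lft M N P bb (pt M N m n))"
  using assms b by (simp add: linear_ssum[OF lft_linear])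
 also have "... = ssum M N P ?t bb"
  using assms by (simp add: lft_pt)
 finally show "ssum M N P ?t bb = lft M N P bb x" ..
qed

definition tmap where
 "tmap M' N' f g x = Tens (tens R M' N' (map (%(m, n). (f m, g n)) (summands x)))"

text \<open>f \<otimes> g commutes with \<Delta>(1), so the list of images already represents an
  element fixed by \<Delta>(1) and can be written as a sum of generators.\<close>

lemma tmap_lft:
 assumes "obj M" "obj N" "obj M'" "obj N'" "left_linear R B M M' f" "left_linear R B N N' g" "x :. (TM M N)"
 shows "tmap M' N' f g x = lft M N (TM M' N') (%m n. pt M' N' (f m) (g n)) x"
proof -
 have f: "linear_map R M M' f" "linear_map R N N' g"
  using assms by (auto simp: left_linear_def)
 note [simp] = linear_mapD(1)[OF f(1)] linear_mapD(1)[OF f(2)] linear_comp[OF f(1)] linear_comp[OF f(2)] assms(1-4)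
 have wf: "set (summands x) \<subseteq> carrier M \<times> carrier N"
  using assms by (intro tensor_wf) auto
 have 1: "tens R M' N' (map (%(m, n). (f m, g n)) (summands x)) =
   ssum M N (tensor R M' N') (summands x) (%m n. tn M' N' (f m) (g n))"
  by (rule tens_map_ssum[OF _ _ wf]) auto
 have *: "ssum M N (tensor R M' N') (summands x) (%m n. tn M' N' (f m) (g n)) =
  dg M' N' \<one>\<^sub>B (ssum M N (tensor R M' N') (summands x) (%m n. tn M' N' (f m) (g n)))"
  (is "?L x = dg M' N' _ (?L x)")
 proof (rule TM_ext[OF assms(1,2) _ _ _ _ assms(7), where P = "tensor R M' N'"])
  fix m n assume mn: "m :. M" "n :. N"
  have "?L (pt M N m n) = sB (tensor R M' N') \<one>\<^sub>B (%a c. tn M' N' (act M' a (f m)) (act N' c (g n)))"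
   using mn assms(5,6) by (simp add: pt_one left_linear_def)
  also have "... = dg M' N' \<one>\<^sub>B (tn M' N' (f m) (g n))"
   using mn by (simp add: diag_pair flip: diag_pair_tn)
  finally show "?L (pt M N m n) = dg M' N' \<one>\<^sub>B (?L (pt M N m n))"
   using mn by (simp add: diag_diag)
 qed (simp_all del: comul_B_closed)
 have "tmap M' N' f g x = Tens (dg M' N' \<one>\<^sub>B (?L x))"
  unfolding tmap_def 1 using * by simp
 also have "... = ssum M N (TM M' N') (summands x) (%m n. Tens (dg M' N' \<one>\<^sub>B (tn M' N' (f m) (g n))))"
  by (rule linear_ssum[OF proj_linear0]) simp_all
 also have "... = lft M N (TM M' N') (%m n. pt M' N' (f m) (g n)) x"
  unfolding lft_def by (simp add: pt_proj)
 finally show ?thesis .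
qed

lemma tmap_balanced:
 assumes "obj M" "obj N" "obj M'" "obj N'" "left_linear R B M M' f" "left_linear R B N N' g"
 shows "balanced M N (TM M' N') (%m n. pt M' N' (f m) (g n))"
proof -
 have f: "linear_map R M M' f" "linear_map R N N' g"
  using assms by (auto simp: left_linear_def)
 note [simp] = linear_mapD(1)[OF f(1)] linear_mapD(1)[OF f(2)] linear_comp[OF f(1)] linear_comp[OF f(2)] assms(1-4)
 show ?thesis
  unfolding balanced_def
 proof (intro conjI ballI)
  fix m n assume mn: "m :. M" "n :. N"
  have "sB (TM M' N') \<one>\<^sub>B (%a c. pt M' N' (f (act M a m)) (g (act N c n))) = act (TM M' N') \<one>\<^sub>B (pt M' N' (f m) (g n))"
   using mn assms(5,6) by (simp add: act_pt left_linear_def)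
  then show "sB (TM M' N') \<one>\<^sub>B (%a c. pt M' N' (f (act M a m)) (g (act N c n))) = pt M' N' (f m) (g n)"
   using mn by (simp add: left_moduleD(5)[OF TM_left])
 qed simp
qed

lemma tmap_pt:
 assumes "obj M" "obj N" "obj M'" "obj N'" "left_linear R B M M' f" "left_linear R B N N' g" "m :. M" "n :. N"
 shows "tmap M' N' f g (pt M N m n) = pt M' N' (f m) (g n)"
 using assms by (simp add: tmap_lft[OF assms(1-6)] lft_pt tmap_balanced)

lemma tmap_linear:
 assumes "obj M" "obj N" "obj M'" "obj N'" "left_linear R B M M' f" "left_linear R B N N' g"
 shows "left_linear R B (TM M N) (TM M' N') (tmap M' N' f g)"
proof -
 have f: "linear_map R M M' f" "linear_map R N N' g"
  using assms by (auto simp: left_linear_def)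
 note [simp] = linear_mapD(1)[OF f(1)] linear_mapD(1)[OF f(2)] linear_comp[OF f(1)] linear_comp[OF f(2)] assms(1-4)
 have L: "linear_map R (TM M N) (TM M' N') (tmap M' N' f g)"
  by (rule linear_map_cong[OF _ tmap_lft[OF assms]]) (use assms in \<open>auto intro!: lft_linear\<close>)
 show ?thesis
  unfolding left_linear_def
 proof (intro conjI ballI L)
  fix b x assume b: "b :. B" and x: "x :. (TM M N)"
  show "tmap M' N' f g (act (TM M N) b x) = act (TM M' N') b (tmap M' N' f g x)"
  proof (rule TM_ext[OF assms(1,2) _ _ _ _ x])
   show "linear_map R (TM M N) (TM M' N') (%x. tmap M' N' f g (act (TM M N) b x))"
    "linear_map R (TM M N) (TM M' N') (%x. act (TM M' N') b (tmap M' N' f g x))"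
    using b L by (auto intro!: linear_comp[OF L] left_moduleD(2)[OF TM_left] linear_comp[OF left_moduleD(2)[OF TM_left]])
   fix m n assume mn: "m :. M" "n :. N"
   show "tmap M' N' f g (act (TM M N) b (pt M N m n)) = act (TM M' N') b (tmap M' N' f g (pt M N m n))"
    using b mn assms(5,6)
    by (simp add: act_pt linear_ssum[OF L] tmap_pt[OF assms]) (simp add: left_linear_def)
  qed simp
 qed
qed

end

context base
begin

lemma ssum_same: "same_module P P' ==> ssum M N P t bb = ssum M N P' t bb"
 by (simp add: ssum_def lsum_def same_module_def)

end

text \<open>The tensor product \<open>TT\<close> is a parameter because that of Yetter-Drinfeld
  modules also carries a coaction; as a module with action it agrees with \<open>tens_mod\<close>.
  The assumption \<open>coas_one\<close> is coassociativity at 1 as it acts on modules, the form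
  that is accessible for D(H) too.\<close>

locale diag_tensor_T = diag_tensor R B obj
 for R :: "('k, 'r) ring_scheme" and B :: "('k, 'b, 'e) bialg_scheme"
  and obj :: "('k, 'b, 'x universe, 'm) bmodule_scheme \<Rightarrow> bool" +
 fixes TT :: "('k, 'b, 'x universe, 'm) bmodule_scheme \<Rightarrow> ('k, 'b, 'x universe, 'm) bmodule_scheme \<Rightarrow> ('k, 'b, 'x universe, 'm) bmodule_scheme"
 assumes TT_same: "obj M ==> obj N ==> same_module (tens_mod R B M N) (TT M N)"
  and TT_act: "obj M ==> obj N ==> act (TT M N) = act (tens_mod R B M N)"
  and TT_obj [simp]: "obj M ==> obj N ==> obj (TT M N)"
  and coas_one: "obj M ==> obj N ==> obj P ==> m :. M ==> n :. N ==> p :. P ==>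
   tens3 R M N P [(act M a1 m, act N a2 n, act P b p). (a, b) \<leftarrow> comul B \<one>\<^sub>B, (a1, a2) \<leftarrow> comul B a] =
   tens3 R M N P [(act M a m, act N b1 n, act P b2 p). (a, b) \<leftarrow> comul B \<one>\<^sub>B, (b1, b2) \<leftarrow> comul B b]"
begin

context
 fixes M N
 assumes MN: "obj M" "obj N"
begin

lemmas TT_sub = TT_same[OF MN]

lemma TT_carrier: "carrier (TT M N) = carrier (TM M N)"
 using TT_sub by (simp add: same_module_def)

lemma TT_pt_bilin: "bilin R M N (TT M N) (pt M N)"
 using pt_bilin[OF MN] by (simp add: bilin_def same_module_linear[OF same_module_refl TT_sub])

lemma TT_summands_linear: "linear_map R (TT M N) (tensor R M N) summands"
 using summands_linear0[OF MN] by (simp add: same_module_linear[OF TT_sub same_module_refl])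

lemma TT_proj_linear: "linear_map R (tensor R M N) (TT M N) (%t. Tens (dg M N \<one>\<^sub>B t))"
 using proj_linear0[OF MN] by (simp add: same_module_linear[OF same_module_refl TT_sub])

lemma TT_act_pt: "b :. B ==> m :. M ==> n :. N ==>
  act (TT M N) b (pt M N m n) = sB (TT M N) b (%a c. pt M N (act M a m) (act N c n))"
 using act_pt[OF MN] by (simp add: TT_act[OF MN] ssum_same[OF TT_sub])

lemma TT_lft_linear: "module R P ==> bilin R M N P bb ==> linear_map R (TT M N) P (lft M N P bb)"
 using lft_linear[OF MN] by (simp add: same_module_linear[OF TT_sub same_module_refl])

lemma TT_ext:
 "module R P ==> linear_map R (TT M N) P f ==> linear_map R (TT M N) P g ==>
  (!!m n. m :. M ==> n :. N ==> f (pt M N m n) = g (pt M N m n)) ==>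
  x :. (TT M N) ==> f x = g x"
 using TM_ext[OF MN, of P f g x] by (simp add: TT_carrier same_module_linear[OF TT_sub same_module_refl])

lemma TT_summands: "x :. (TT M N) ==> dg M N \<one>\<^sub>B (summands x) = summands x"
 "x :. (TT M N) ==> Tens (summands x) = x"
 using summands_TM[OF MN] by (simp_all add: TT_carrier)

end

lemmas TT_simps [simp] = bilin_lin[OF TT_pt_bilin] bilin_push[OF TT_pt_bilin, OF _ _ obj_module obj_module obj_module[OF TT_obj]]
 linear_comp[OF TT_summands_linear] linear_mapD(1)[OF TT_summands_linear]
 linear_comp[OF TT_proj_linear] linear_mapD(1)[OF TT_proj_linear]
 linear_mapD(3)[OF TT_summands_linear]

lemma TT_summands_push [simp]:
 "obj M ==> obj N ==> (!!a b. a :. A ==> b :. C ==> \<gamma> a b :. (TT M N)) ==>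
  summands (ssum A C (TT M N) t \<gamma>) = ssum A C (tensor R M N) t (%a b. summands (\<gamma> a b))"
 by (rule linear_ssum[OF TT_summands_linear]) simp_all

lemma TT_ext2:
 assumes [simp]: "obj M" "obj N" "obj P" "module R Q"
  and f: "linear_map R (TT (TT M N) P) Q f" and g: "linear_map R (TT (TT M N) P) Q g"
  and eq: "!!m n p. m :. M ==> n :. N ==> p :. P ==>
    f (pt (TT M N) P (pt M N m n) p) = g (pt (TT M N) P (pt M N m n) p)"
  and x: "x :. (TT (TT M N) P)"
 shows "f x = g x"
proof (rule TT_ext[OF _ _ _ f g _ x])
 fix u p assume u: "u :. (TT M N)" and p [simp]: "p :. P"
 show "f (pt (TT M N) P u p) = g (pt (TT M N) P u p)"
  by (rule TT_ext[where x = u and P = Q and f = "%u. f (pt (TT M N) P u p)" and g = "%u. g (pt (TT M N) P u p)"])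
   (use eq u in \<open>auto intro!: linear_comp[OF f] linear_comp[OF g]\<close>)
qed auto

lemma TT_ext2':
 assumes [simp]: "obj M" "obj N" "obj P" "module R Q"
  and f: "linear_map R (TT M (TT N P)) Q f" and g: "linear_map R (TT M (TT N P)) Q g"
  and eq: "!!m n p. m :. M ==> n :. N ==> p :. P ==>
    f (pt M (TT N P) m (pt N P n p)) = g (pt M (TT N P) m (pt N P n p))"
  and x: "x :. (TT M (TT N P))"
 shows "f x = g x"
proof (rule TT_ext[OF _ _ _ f g _ x])
 fix m u assume u: "u :. (TT N P)" and p [simp]: "m :. M"
 show "f (pt M (TT N P) m u) = g (pt M (TT N P) m u)"
  by (rule TT_ext[where x = u and P = Q and f = "%u. f (pt M (TT N P) m u)" and g = "%u. g (pt M (TT N P) m u)"])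
   (use eq u in \<open>auto intro!: linear_comp[OF f] linear_comp[OF g]\<close>)
qed auto

text \<open>The associativity as a map into the full tensor product, before \<open>Tens\<close> is
  applied; \<open>asm\<close> is the formula of \<open>assoc_arrow\<close> verbatim.\<close>

definition asr where
 "asr M N P x = ssum (TT M N) P (tensor R M (TT N P)) (summands x)
   (%u p. ssum M N (tensor R M (TT N P)) (summands u) (%m n. tn M (TT N P) m (pt N P n p)))"

definition asm where
 "asm M N P x = Tens (tens R M (TT N P)
   [(m, Tens (dg N P \<one>\<^sub>B [(n, p)])). (u, p) \<leftarrow> summands x, (m, n) \<leftarrow> summands u])"

lemma asr_linear:
 assumes [simp]: "obj M" "obj N" "obj P"
 shows "linear_map R (TT (TT M N) P) (tensor R M (TT N P)) (asr M N P)"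
 unfolding asr_def[abs_def] by simp

lemma asm_asr:
 assumes [simp]: "obj M" "obj N" "obj P" and x: "x :. (TT (TT M N) P)"
 shows "asm M N P x = Tens (asr M N P x)"
proof -
 have 1: "set (summands x) \<subseteq> carrier (TT M N) \<times> carrier P"
  by (rule tensor_wf) (use x in auto)
 have 2: "set (summands u) \<subseteq> carrier M \<times> carrier N" if "u :. (TT M N)" for u
  by (rule tensor_wf) (use that in auto)
 show ?thesis
  unfolding asm_def asr_def pt_def[symmetric] by (subst tens_comp_ssum[OF _ _ 1 2]) auto
qed

lemma asr_pt:
 assumes [simp]: "obj M" "obj N" "obj P" "m :. M" "n :. N" "p :. P"
 shows "asr M N P (pt (TT M N) P (pt M N m n) p) = summands (pt M (TT N P) m (pt N P n p))"
proof -
 let ?Q = "tensor R M (TT N P)"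
 have tri: "trilin R M N P ?Q (%m n p. tn M (TT N P) m (pt N P n p))"
  by simp
 have lin: "linear_map R (TT M N) ?Q (%u. ssum M N ?Q (summands u) (%m n. tn M (TT N P) m (pt N P n p)))"
  if "p :. P" for p using that by simp
 have s: "summands (act (TT M N) a (pt M N m n)) = sB (tensor R M N) a (%c d. tn M N (act M c m) (act N d n))"
  if "a :. B" for a using that by (simp add: TT_act summands_act)
 have "asr M N P (pt (TT M N) P (pt M N m n) p) = sB ?Q \<one>\<^sub>B (%a b. sB ?Q a (%c d. tn M (TT N P) (act M c m) (pt N P (act N d n) (act P b p))))"
  unfolding asr_def by (simp add: pt_one s)
 also have "... = sB ?Q \<one>\<^sub>B (%a b. sB ?Q b (%c d. tn M (TT N P) (act M a m) (pt N P (act N c n) (act P d p))))"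
  using tens3_comp_eq[OF _ _ _ _ tri coas_one comul_B_wf comul_B_wf comul_B_wf comul_B_wf] by simp
 also have "... = summands (pt M (TT N P) m (pt N P n p))"
  by (simp add: pt_one TT_act_pt)
 finally show ?thesis .
qed

lemma asm_pt:
 assumes [simp]: "obj M" "obj N" "obj P" "m :. M" "n :. N" "p :. P"
 shows "asm M N P (pt (TT M N) P (pt M N m n) p) = pt M (TT N P) m (pt N P n p)"
 by (simp add: asm_asr asr_pt) (simp add: pt_def)

lemma asm_linear:
 assumes [simp]: "obj M" "obj N" "obj P"
 shows "linear_map R (TT (TT M N) P) (TT M (TT N P)) (asm M N P)"
proof (rule linear_map_cong)
 fix x assume x: "x :. (TT (TT M N) P)"
 \<comment> \<open>On generators the value is \<open>summands\<close> of an element of the tensor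
   product (\<open>asr_pt\<close>), hence fixed by \<Delta>(1).\<close>
 have "asr M N P x = dg M (TT N P) \<one>\<^sub>B (asr M N P x)"
  by (rule TT_ext2[OF assms _ asr_linear[OF assms] _ _ x])
   (simp_all add: asr_linear asr_pt TT_summands linear_comp[OF diag_linear0])
 then show "asm M N P x = Tens (dg M (TT N P) \<one>\<^sub>B (asr M N P x))"
  using x by (simp add: asm_asr)
qed (simp_all add: asr_linear linear_comp[OF TT_proj_linear])

end

section \<open>The unit object\<close>

text \<open>Collects what makes B_t a module under z \<mapsto> eps_t(bz): \<open>et_mult\<close>
  yields both the idempotence of \<open>eps_t\<close> and the associativity of this action. For D(H)
  it will follow from the formula \<open>eps_D\<close>.\<close>

locale unit_alg = base R
 for R :: "('k, 'r) ring_scheme" +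
 fixes B :: "('k, 'b, 'e) bialg_scheme" and \<iota> :: "'b \<Rightarrow> 'x universe"
 assumes B: "module R B" "ring B"
  and sm: "!!a x y. a :. R ==> x :. B ==> y :. B ==>
   (a \<odot>\<^sub>B x) \<otimes>\<^sub>B y = a \<odot>\<^sub>B (x \<otimes>\<^sub>B y) \<and> x \<otimes>\<^sub>B (a \<odot>\<^sub>B y) = a \<odot>\<^sub>B (x \<otimes>\<^sub>B y)"
  and et: "linear_map R B B (eps_t B)"
  and et_mult: "!!b c. b :. B ==> c :. B ==> eps_t B (b \<otimes>\<^sub>B eps_t B c) = eps_t B (b \<otimes>\<^sub>B c)"
  and inj: "inj_on \<iota> (carrier B)"
begin

lemma et_idem: "b :. B ==> eps_t B (eps_t B b) = eps_t B b"
 using et_mult[of "\<one>\<^sub>B" b] B(2) linear_mapD(1)[OF et] by (simp add: ring.ring_simprules)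

lemma target_sel: "carrier (target B) = eps_t B ` carrier B" "zero (target B) = zero B" "add (target B) = add B"
 "smult (target B) = smult B"
 by (simp_all add: target_def)

lemma target_carrier: "z :. (target B) \<longleftrightarrow> z :. B \<and> eps_t B z = z"
 using linear_mapD(1)[OF et] et_idem by (auto simp: target_sel image_iff) metis

lemma module_target: "module R (target B)"
proof -
 have "same_module (B\<lparr>carrier := eps_t B ` carrier B\<rparr>) (target B)"
  by (simp add: same_module_def target_sel)
 then show ?thesis
  using same_module_module module_fixed[OF B(1) et] by blast
qed

lemma inj_target: "inj_on \<iota> (carrier (target B))"
 using inj by (rule inj_on_subset) (auto simp: target_carrier)

lemma unit_sel:
 "carrier (unit_mod R B \<iota>) = \<iota> ` carrier (target B)"
 "same_module (unit_mod R B \<iota>) (transport R \<iota> (target B))"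
 "b :. B ==> z :. (target B) ==> act (unit_mod R B \<iota>) b (\<iota> z) = \<iota> (eps_t B (b \<otimes>\<^sub>B z))"
 "act (unit_mod R B \<iota>) = (\<lambda>b\<in>carrier B. \<lambda>m\<in>carrier (unit_mod R B \<iota>). act (unit_mod R B \<iota>) b m)"
 using inj_target
 by (auto simp: unit_mod_def module.defs bmodule.defs transport_simps same_module_def inv_into_f_f fun_eq_iff)

lemma unit_module: "module R (unit_mod R B \<iota>)"
 using same_module_module[OF same_module_sym[OF unit_sel(2)] module_transport[OF module_target inj_target]] .

lemma unit_normal: "normal_module R (unit_mod R B \<iota>)"
 using normal_transport[OF module_target inj_target] unit_module
 by (simp add: normal_module_def unit_mod_def module.defs)

lemma unit_linear: "linear_map R (target B) (unit_mod R B \<iota>) \<iota>"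
 "linear_map R (unit_mod R B \<iota>) B (inv_into (carrier (target B)) \<iota>)"
proof -
 show "linear_map R (target B) (unit_mod R B \<iota>) \<iota>"
  using transport_linear(1)[OF module_target inj_target]
  by (simp add: same_module_linear[OF same_module_refl unit_sel(2)])
 have "linear_map R (unit_mod R B \<iota>) (target B) (inv_into (carrier (target B)) \<iota>)"
  using transport_linear(2)[OF module_target inj_target]
  by (simp add: same_module_linear[OF unit_sel(2) same_module_refl])
 then show "linear_map R (unit_mod R B \<iota>) B (inv_into (carrier (target B)) \<iota>)"
  by (auto simp: linear_map_def target_sel Pi_iff) (use linear_mapD(1)[OF et] in fastforce)
qed

lemma unit_et_linear: "linear_map R B (unit_mod R B \<iota>) (%b. \<iota> (eps_t B b))"
proof -
 have "linear_map R B (target B) (eps_t B)"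
  using et by (auto simp: linear_map_def target_sel)
 then show ?thesis by (rule linear_comp[OF unit_linear(1)])
qed

lemma bilin_mult_B: "bilin R B B B (mult B)"
 using B(2) sm by (intro bilinI linear_mapI) (auto simp: ring.ring_simprules)

abbreviation (input) "unI \<equiv> inv_into (carrier (target B)) \<iota>"

lemma unit_elem:
 assumes "x :. (unit_mod R B \<iota>)"
 shows "unI x :. (target B)" "\<iota> (unI x) = x" "unI x :. B" "eps_t B (unI x) = unI x"
 using assms inj_target by (auto simp: unit_sel(1) inv_into_f_f target_carrier)

lemma unit_act:
 assumes "b :. B" "x :. (unit_mod R B \<iota>)"
 shows "act (unit_mod R B \<iota>) b x = \<iota> (eps_t B (b \<otimes>\<^sub>B unI x))"
 using unit_sel(3)[OF assms(1) unit_elem(1)[OF assms(2)]] unit_elem(2)[OF assms(2)] by simp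

lemma unI_act:
 assumes "b :. B" "x :. (unit_mod R B \<iota>)"
 shows "unI (act (unit_mod R B \<iota>) b x) = eps_t B (b \<otimes>\<^sub>B unI x)"
proof -
 have "eps_t B (b \<otimes>\<^sub>B unI x) :. (target B)"
  using assms B(2) unit_elem(3) by (auto simp: target_sel ring.ring_simprules)
 then show ?thesis
  using assms inj_target by (simp add: unit_act inv_into_f_f)
qed

lemma unit_left: "left_module R B (unit_mod R B \<iota>)"
proof -
 let ?U = "unit_mod R B \<iota>"
 note L = unit_act unit_elem bilin_lin[OF bilin_mult_B] linear_comp[OF unit_et_linear] linear_comp[OF unit_linear(2)]
  linear_mapD(1)[OF et] B(2) ring.ring_simprules B(1) unit_module
 show ?thesis
  unfolding left_module_def
 proof (intro conjI ballI)
  show "module R ?U" by (rule unit_module)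
  fix b assume b: "b :. B"
  show "linear_map R ?U ?U (act ?U b)"
   by (rule linear_map_cong[OF unit_module unit_act[OF b]]) (simp_all add: L b)
 next
  fix x assume x: "x :. ?U"
  show "linear_map R B ?U (%b. act ?U b x)"
   by (rule linear_map_cong[OF B(1) unit_act[OF _ x]]) (simp_all add: L x)
  show "act ?U \<one>\<^sub>B x = x"
   using x by (simp add: unit_act unit_elem ring.ring_simprules B(2))
  fix b c assume bc: "b :. B" "c :. B"
  have c: "act ?U c x :. ?U"
   using x bc B(2) unit_elem(3)[OF x] by (auto simp: unit_act unit_sel(1) target_sel ring.ring_simprules)
  have "act ?U (b \<otimes>\<^sub>B c) x = \<iota> (eps_t B (b \<otimes>\<^sub>B (c \<otimes>\<^sub>B unI x)))"
   using x bc B(2) unit_elem(3)[OF x] by (simp add: unit_act ring.ring_simprules ring.is_monoid monoid.m_assoc)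
  also have "... = act ?U b (act ?U c x)"
   using x bc c B(2) unit_elem(3)[OF x] by (simp add: unit_act[of b] unI_act et_mult ring.ring_simprules)
  finally show "act ?U (b \<otimes>\<^sub>B c) x = ..." .
 qed
qed

end

section \<open>The tensor product of Yetter-Drinfeld modules\<close>

context weak_hopf_bij
begin

text \<open>The converse of \<open>co_act\<close>. At h = 1 the formula shows that the coaction is
  fixed by \<Delta>(1); for general h the compatibility condition comes back when the factor S^-1 is
  cancelled by \<open>T_l\<close> and \<open>W3\<close>.\<close>

lemma yd_moduleI:
 assumes M: "left_module R H M" and \<rho>: "linear_map R M (tensor R M H) (coact M)"
  and coassoc_M: "!!m. m :. M ==>
   co M (tensor R (tensor R M H) H) m (%x b. co M (tensor R (tensor R M H) H) x (%y a. tn (tensor R M H) H (tn M H y a) b)) =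
   co M (tensor R (tensor R M H) H) m (%x h. sw (tensor R (tensor R M H) H) h (%a b. tn (tensor R M H) H (tn M H x a) b))"
  and counit: "!!m. m :. M ==> co M M m (%x h. counit H h \<odot>\<^sub>M x) = m"
  and act: "!!h m. h :. H ==> m :. M ==>
   coact M (act M h m) = sw (tensor R M H) h (%a r. sw (tensor R M H) r (%b c. co M (tensor R M H) m (%x k. tn M H (act M b x) (c \<otimes> (k \<otimes> T a)))))"
 shows "yd_module R H M"
proof -
 note [simp] = M left_moduleD(1)[OF M] linear_comp[OF \<rho>] linear_mapD(1)[OF \<rho>] left_moduleD(4,5)[OF M]
 have wf: "set (coact M m) \<subseteq> carrier M \<times> carrier H" if "m :. M" for m
  using tensor_wf[of M H "coact M m"] that by simp
 show ?thesis
  unfolding yd_module_def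
 proof (intro conjI ballI M \<rho>)
  fix m assume m: "m :. M"
  show "tens3 R M H H (concat (map (%(m', h2). map (%(m0, h1). (m0, h1, h2)) (coact M m')) (coact M m))) =
   tens3 R M H H (concat (map (%(m0, h). map (%(h1, h2). (m0, h1, h2)) (comul H h)) (coact M m)))"
   (is "?l = ?r")
  proof -
   have "?l = co M (tensor R (tensor R M H) H) m (%x b. co M (tensor R (tensor R M H) H) x (%y a. tn (tensor R M H) H (tn M H y a) b))"
    by (rule tens3_comp_ssum) (use m wf in simp_all)
   also have "... = co M (tensor R (tensor R M H) H) m (%x h. sw (tensor R (tensor R M H) H) h (%a b. tn (tensor R M H) H (tn M H x a) b))"
    by (rule coassoc_M[OF m])
   also have "... = ?r"
    by (rule tens3_comp_ssum[symmetric]) (use m wf comul_wf in simp_all)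
   finally show ?thesis .
  qed
  show "lsum M (map (%(m0, m1). counit H m1 \<odot>\<^sub>M m0) (coact M m)) = m"
   using counit[OF m] by (simp add: ssum_wf[OF wf[OF m]])
  let ?t = "coact M m"
  have "sw (tensor R M H) \<one> (%p q. co M (tensor R M H) m (%x k. tn M H (act M p x) (q \<otimes> k))) =
    sw (tensor R M H) \<one> (%p q. ssum M H (tensor R M H) (coact M (act M \<one> m)) (%x k. tn M H (act M p x) (q \<otimes> k)))"
   using m by simp
  also have "... = sw (tensor R M H) \<one> (%p q. sw (tensor R M H) \<one> (%a r. sw (tensor R M H) r (%b c. co M (tensor R M H) m (%x k. tn M H (act M (p \<otimes> b) x) (q \<otimes> c \<otimes> (k \<otimes> T a))))))"
   unfolding act[OF H_ring(2) m] using m by simp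
  also have "... = sw (tensor R M H) \<one> (%a r. sw (tensor R M H) \<one> (%p q. sw (tensor R M H) r (%b c. co M (tensor R M H) m (%x k. tn M H (act M (p \<otimes> b) x) (q \<otimes> c \<otimes> (k \<otimes> T a))))))"
   using m by (intro sw_swap) simp_all
  also have "... = sw (tensor R M H) \<one> (%a r. sw (tensor R M H) r (%b c. co M (tensor R M H) m (%x k. tn M H (act M b x) (c \<otimes> (k \<otimes> T a)))))"
   by (rule ssum_eqI, rule HOL.sym, rule HOL.trans, rule cm_l) (use m in simp_all)
  also have "... = coact M m"
   by (rule act[OF H_ring(2) m, unfolded left_moduleD(5)[OF M m], symmetric])
  finally have t: "sw (tensor R M H) \<one> (%p q. co M (tensor R M H) m (%x k. tn M H (act M p x) (q \<otimes> k))) = ?t" .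
  have reg: "same_module (regular H) H" "act (regular H) = mult H"
   by (simp_all add: same_module_def regular_def)
  have "diag_act R H M (regular H) \<one> ?t = ?t"
  proof (rule HOL.trans[OF _ t])
   show "diag_act R H M (regular H) \<one> ?t = sw (tensor R M H) \<one> (%p q. co M (tensor R M H) m (%x k. tn M H (act M p x) (q \<otimes> k)))"
    unfolding diag_act_def reg(2) same_tens[OF same_module_refl reg(1)]
    by (rule tens_comp_ssum) (use m wf comul_wf in simp_all)
  qed
  then show "?t :. (tensor_t R H M (regular H))"
   unfolding tensor_t_def same_tensor[OF same_module_refl reg(1)]
   using m by (auto simp: image_iff intro!: bexI[of _ ?t])
 next
  fix h m assume h: "h :. H" and m: "m :. M"
  let ?P = "tensor R M H"
  have "sw ?P h (%p q. co M ?P (act M q m) (%x k. tn M H x (k \<otimes> p))) =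
    sw ?P h (%p q. sw ?P q (%a r. sw ?P r (%b c. co M ?P m (%x k. tn M H (act M b x) (c \<otimes> (k \<otimes> (T a \<otimes> p)))))))"
   using h m by (simp add: act)
  also have "... = sw ?P h (%q r. sw ?P q (%p a. sw ?P r (%b c. co M ?P m (%x k. tn M H (act M b x) (c \<otimes> (k \<otimes> (T a \<otimes> p)))))))"
   using h m by (simp add: coas)
  also have "... = sw ?P \<one> (%a r. sw ?P (h \<otimes> r) (%b c. co M ?P m (%x k. tn M H (act M b x) (c \<otimes> (k \<otimes> T a)))))"
   by (rule HOL.trans, rule ssum_eqI, (rule T_l[where f = "%y. sw ?P _ (%b c. co M ?P m (%x k. tn M H (act M b x) (c \<otimes> (k \<otimes> y))))"]; (use m in simp)), rule W3) (use h m in simp_all)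
  also have "... = sw ?P \<one> (%a r. sw ?P h (%p q. sw ?P r (%b c. co M ?P m (%x k. tn M H (act M p (act M b x)) (q \<otimes> (c \<otimes> (k \<otimes> T a)))))))"
   using h m by (simp add: sw_mult)
  also have "... = sw ?P h (%p q. sw ?P \<one> (%a r. sw ?P r (%b c. co M ?P m (%x k. tn M H (act M p (act M b x)) (q \<otimes> (c \<otimes> (k \<otimes> T a)))))))"
   by (rule sw_swap) (use h m in simp_all)
  also have "... = sw ?P h (%p q. ssum M H ?P (coact M (act M \<one> m)) (%x k. tn M H (act M p x) (q \<otimes> k)))"
   unfolding act[OF H_ring(2) m] using h m by simp
  also have "... = sw ?P h (%p q. co M ?P m (%x k. tn M H (act M p x) (q \<otimes> k)))"
   using m by simp
  finally have e: "sw ?P h (%p q. co M ?P (act M q m) (%x k. tn M H x (k \<otimes> p))) = ..." .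
  show "tens R M H (concat (map (%(h1, h2). map (%(m0, m1). (act M h1 m0, h2 \<otimes> m1)) (coact M m)) (comul H h))) =
   tens R M H (concat (map (%(h1, h2). map (%(m0, m1). (m0, m1 \<otimes> h1)) (coact M (act M h2 m))) (comul H h)))"
   (is "?l = ?r")
  proof -
   have "?l = sw ?P h (%p q. co M ?P m (%x k. tn M H (act M p x) (q \<otimes> k)))"
    by (rule tens_comp_ssum) (use h m wf comul_wf in simp_all)
   moreover have "?r = sw ?P h (%p q. co M ?P (act M q m) (%x k. tn M H x (k \<otimes> p)))"
    by (rule tens_comp_ssum) (use h m wf comul_wf in simp_all)
   ultimately show ?thesis using e by simp
  qed
 qed
qed

text \<open>Reduced to w = es(h), whose comultiplication is known from \<open>W7s\<close>; the
  compatibility condition, used for w and for 1, then moves w from the coefficient to m.\<close>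

lemma co_counit_l:
 assumes [simp]: "yd_module R H M" "module R P" "m :. M" "h :. H" and f: "linear_map R M P f"
 shows "co M P m (%x k. counit H (h \<otimes> k) \<odot>\<^sub>P f x) = f (act M (es h) m)"
proof -
 let ?w = "es h"
 note [simp] = linear_comp[OF f] linear_mapD(1)[OF f]
 have w: "?w : Hs" by simp
 have "co M P m (%x k. counit H (h \<otimes> k) \<odot>\<^sub>P f x) = co M P m (%x k. counit H (?w \<otimes> k) \<odot>\<^sub>P f x)"
  by simp
 also have "... = sw P \<one> (%a b. co M P m (%x k. counit H (?w \<otimes> b \<otimes> k) \<odot>\<^sub>P f (act M a x)))"
  by (subst co_t) simp_all
 also have "... = sw P ?w (%a b. co M P m (%x k. counit H (b \<otimes> k) \<odot>\<^sub>P f (act M a x)))"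
  by (subst W7s(2)[OF _ w]) simp_all
 also have "... = sw P \<one> (%a b. co M P (act M b (act M ?w m)) (%x k. counit H (k \<otimes> a) \<odot>\<^sub>P f x))"
  by (rule HOL.trans, (rule co_compat[where bb = "%x k. counit H k \<odot>\<^sub>P f x"]; simp), subst W7s(1)[OF _ w]) simp_all
 also have "... = f (act M ?w m)"
  by (rule HOL.trans, rule HOL.trans, (rule co_compat[where bb = "%x k. counit H k \<odot>\<^sub>P f x", symmetric]; simp), (rule co_t[symmetric]; simp), rule co_counit) (simp_all add: f)
 finally show ?thesis .
qed

text \<open>With \<Delta>(1) inserted by \<open>co_t\<close>, the two sides are those of the
  compatibility condition for z, read through the two forms of \<Delta>(z) in
  \<open>W7t\<close>.\<close>

lemma co_Ht:
 assumes [simp]: "yd_module R H M" "module R P" "m :. M" and z: "z : Ht" and bb: "bilin R M H P bb"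
 shows "co M P m (%x k. bb x (k \<otimes> z)) = co M P m (%x k. bb (act M z x) k)"
proof -
 note [simp] = bilin_lin[OF bb] HtD(1)[OF z]
 have "co M P m (%x k. bb x (k \<otimes> z)) = sw P \<one> (%a b. co M P m (%x k. bb (act M a x) (b \<otimes> k \<otimes> z)))"
  by (subst co_t) simp_all
 also have "... = sw P \<one> (%a b. co M P (act M b m) (%x k. bb x (k \<otimes> a \<otimes> z)))"
  using co_compat[OF assms(1,2,3) H_ring(2), of "%x k. bb x (k \<otimes> z)"] by simp
 also have "... = sw P z (%a b. co M P (act M b m) (%x k. bb x (k \<otimes> a)))"
  by (subst W7t(1)[OF _ z]) simp_all
 also have "... = sw P \<one> (%a b. co M P m (%x k. bb (act M z (act M a x)) (b \<otimes> k)))"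
  by (rule HOL.trans, (rule co_compat[symmetric]; simp add: bb), subst W7t(2)[OF _ z]) simp_all
 also have "... = co M P m (%x k. bb (act M z x) k)"
  by (rule co_t[where bb = "%x k. bb (act M z x) k", symmetric]) simp_all
 finally show ?thesis .
qed

lemma co_counit_r:
 assumes [simp]: "yd_module R H M" "module R P" "m :. M" "h :. H" and f: "linear_map R M P f"
 shows "co M P m (%x k. counit H (k \<otimes> h) \<odot>\<^sub>P f x) = f (act M (et h) m)"
proof -
 note [simp] = linear_comp[OF f] linear_mapD(1)[OF f]
 have "co M P m (%x k. counit H (k \<otimes> h) \<odot>\<^sub>P f x) = co M P m (%x k. counit H (k \<otimes> et h) \<odot>\<^sub>P f x)"
  by simp
 also have "... = f (act M (et h) m)"
  by (rule HOL.trans, (rule co_Ht[where bb = "%x k. counit H k \<odot>\<^sub>P f x"]; simp), rule co_counit[where f = "%x. f (act M (et h) x)"]) simp_all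
 finally show ?thesis .
qed

text \<open>The counit law for the coaction on M \<otimes>_t N. Splitting \<epsilon>(n_1 m_1) by
  \<open>counit_unit\<close> makes m and n be acted on by es(1_1) and et(1_2), and \<open>W1\<close>
  removes \<open>es\<close> and \<open>et\<close>.\<close>

lemma co_co_counit:
 assumes [simp]: "yd_module R H M" "yd_module R H N" "module R P" "m :. M" "n :. N"
  and bb: "bilin R M N P bb"
 shows "co M P m (%x k. co N P n (%y l. counit H (l \<otimes> k) \<odot>\<^sub>P bb x y)) = sw P \<one> (%a b. bb (act M a m) (act N b n))"
proof -
 note [simp] = bilin_lin[OF bb]
 have "co M P m (%x k. co N P n (%y l. counit H (l \<otimes> k) \<odot>\<^sub>P bb x y)) =
   co M P m (%x k. co N P n (%y l. sw P \<one> (%a b. counit H (a \<otimes> k) \<odot>\<^sub>P (counit H (l \<otimes> b) \<odot>\<^sub>P bb x y))))"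
  by (rule ssum_eqI, rule ssum_eqI, subst counit_unit(2)) (simp_all add: smult_commute)
 also have "... = sw P \<one> (%a b. co M P m (%x k. counit H (a \<otimes> k) \<odot>\<^sub>P co N P n (%y l. counit H (l \<otimes> b) \<odot>\<^sub>P bb x y)))"
  by (rule HOL.trans, rule HOL.trans, rule ssum_eqI, (rule co_swap; simp), (rule co_swap; simp)) simp
 also have "... = sw P \<one> (%a b. co M P m (%x k. counit H (a \<otimes> k) \<odot>\<^sub>P bb x (act N (et b) n)))"
 proof (rule ssum_eqI, rule ssum_eqI)
  fix a b x k assume [simp]: "a :. H" "b :. H" "x :. M" "k :. H"
  show "counit H (a \<otimes> k) \<odot>\<^sub>P co N P n (%y l. counit H (l \<otimes> b) \<odot>\<^sub>P bb x y) = counit H (a \<otimes> k) \<odot>\<^sub>P bb x (act N (et b) n)"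
   by (subst co_counit_r[where f = "bb x"]) simp_all
 qed
 also have "... = sw P \<one> (%a b. bb (act M a m) (act N b n))"
  by (rule HOL.trans, rule HOL.trans, rule ssum_eqI, (rule co_counit_l[where f = "%x. bb x (act N (et _) n)"]; simp), (rule W1(1); simp), rule W1(2)) simp_all
 finally show ?thesis .
qed

text \<open>The formula of \<open>co_act\<close> for a tensor product. The factor S^-1 comes from
  \<open>co_act\<close> for M; for N the compatibility condition suffices, because the leg that it
  needs on the right is the one that M has produced.\<close>

lemma co_co_act:
 assumes [simp]: "yd_module R H M" "yd_module R H N" "module R P" "m :. M" "n :. N" "h :. H"
  and bb: "trilin R M N H P bb"
 shows "sw P h (%p q. co M P (act M p m) (%x k. co N P (act N q n) (%y l. bb x y (l \<otimes> k)))) =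
  sw P h (%a r. sw P r (%s d. sw P s (%b c. co M P m (%x k. co N P n (%y l. bb (act M b x) (act N c y) (d \<otimes> (l \<otimes> (k \<otimes> T a))))))))"
proof -
 note [simp] = trilin_lin[OF bb]
 have "sw P h (%p q. co M P (act M p m) (%x k. co N P (act N q n) (%y l. bb x y (l \<otimes> k)))) =
  sw P h (%p q. sw P p (%a r. sw P r (%b c. co M P m (%x k. co N P (act N q n) (%y l. bb (act M b x) y (l \<otimes> (c \<otimes> (k \<otimes> T a))))))))"
  by (rule ssum_eqI, subst co_act) simp_all
 also have "... = sw P h (%a r. sw P r (%b s. co M P m (%x k. sw P s (%c q. co N P (act N q n) (%y l. bb (act M b x) y (l \<otimes> (c \<otimes> (k \<otimes> T a))))))))"
  by (rule HOL.trans[rotated], rule ssum_eqI, rule ssum_eqI, (rule co_swap[symmetric]; simp)) (simp add: coas)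
 also have "... = sw P h (%a r. sw P r (%b s. co M P m (%x k. sw P s (%c d. co N P n (%y l. bb (act M b x) (act N c y) (d \<otimes> (l \<otimes> (k \<otimes> T a))))))))"
 proof (rule ssum_eqI, rule ssum_eqI, rule ssum_eqI)
  fix a r b s x k assume [simp]: "a :. H" "r :. H" "b :. H" "s :. H" "x :. M" "k :. H"
  show "sw P s (%c q. co N P (act N q n) (%y l. bb (act M b x) y (l \<otimes> (c \<otimes> (k \<otimes> T a))))) =
    sw P s (%c d. co N P n (%y l. bb (act M b x) (act N c y) (d \<otimes> (l \<otimes> (k \<otimes> T a)))))"
   using co_compat[OF assms(2,3,5), of s "%y l. bb (act M b x) y (l \<otimes> (k \<otimes> T a))"] by simp
 qed
 also have "... = sw P h (%a r. sw P r (%s d. sw P s (%b c. co M P m (%x k. co N P n (%y l. bb (act M b x) (act N c y) (d \<otimes> (l \<otimes> (k \<otimes> T a))))))))"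
  by (rule HOL.trans, rule ssum_eqI, rule ssum_eqI, (rule co_swap; simp)) (simp add: coas)
 finally show ?thesis .
qed

text \<open>Makes the coaction on M \<otimes>_t N well defined. Of the four legs of 1 in
  \<open>co_co_act\<close>, the last is split off by \<open>one1\<close> and absorbed into N by
  \<open>co_t\<close>, the first is split off by \<open>one2\<close> and absorbed into M by
  \<open>co_one\<close>.\<close>

lemma co_co_one:
 assumes [simp]: "yd_module R H M" "yd_module R H N" "module R P" "m :. M" "n :. N"
  and bb: "trilin R M N H P bb"
 shows "sw P \<one> (%p q. co M P (act M p m) (%x k. co N P (act N q n) (%y l. bb x y (l \<otimes> k)))) =
  sw P \<one> (%a b. co M P m (%x k. co N P n (%y l. bb (act M a x) (act N b y) (l \<otimes> k))))"
proof -
 note [simp] = trilin_lin[OF bb]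
 let ?g = "%a b c d. co M P m (%x k. co N P n (%y l. bb (act M b x) (act N c y) (d \<otimes> (l \<otimes> (k \<otimes> T a)))))"
 let ?g' = "%a b c. co M P m (%x k. co N P n (%y l. bb (act M b x) (act N c y) (l \<otimes> (k \<otimes> T a))))"
 have "sw P \<one> (%p q. co M P (act M p m) (%x k. co N P (act N q n) (%y l. bb x y (l \<otimes> k)))) = sw P \<one> (%a d. sw P a (%r c. sw P r (%x b. ?g x b c d)))"
  by (rule HOL.trans, (rule co_co_act; simp add: bb)) (simp add: coas)
 also have "... = sw P \<one> (%a e. sw P \<one> (%c d. sw P a (%x b. ?g x b (e \<otimes> c) d)))"
  by (subst one1) simp_all
 also have "... = sw P \<one> (%a e. sw P a (%x b. sw P \<one> (%c d. ?g x b (e \<otimes> c) d)))"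
  by (rule ssum_eqI, rule sw_swap) simp_all
 also have "... = sw P \<one> (%a e. sw P a (%x b. ?g' x b e))"
 proof (rule ssum_eqI, rule ssum_eqI)
  fix a e x b assume [simp]: "a :. H" "e :. H" "x :. H" "b :. H"
  have "sw P \<one> (%c d. ?g x b (e \<otimes> c) d) = co M P m (%u k. sw P \<one> (%c d. co N P n (%y l. bb (act M b u) (act N (e \<otimes> c) y) (d \<otimes> (l \<otimes> (k \<otimes> T x))))))"
   by (rule co_swap[symmetric]) simp_all
  also have "... = ?g' x b e"
  proof (rule ssum_eqI)
   fix u k assume [simp]: "u :. M" "k :. H"
   show "sw P \<one> (%c d. co N P n (%y l. bb (act M b u) (act N (e \<otimes> c) y) (d \<otimes> (l \<otimes> (k \<otimes> T x))))) =
     co N P n (%y l. bb (act M b u) (act N e y) (l \<otimes> (k \<otimes> T x)))"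
    using co_t[OF assms(2,3,5), of "%y l. bb (act M b u) (act N e y) (l \<otimes> (k \<otimes> T x))"] by simp
  qed
  finally show "sw P \<one> (%c d. ?g x b (e \<otimes> c) d) = ?g' x b e" .
 qed
 also have "... = sw P \<one> (%a b. sw P \<one> (%c d. ?g' a (c \<otimes> b) d))"
  by (subst one2) simp_all
 also have "... = sw P \<one> (%c d. sw P \<one> (%a b. ?g' a (c \<otimes> b) d))"
  by (rule sw_swap) simp_all
 also have "... = sw P \<one> (%c d. co M P m (%x k. co N P n (%y l. bb (act M c x) (act N d y) (l \<otimes> k))))"
 proof (rule ssum_eqI)
  fix c d assume [simp]: "c :. H" "d :. H"
  show "sw P \<one> (%a b. ?g' a (c \<otimes> b) d) = co M P m (%x k. co N P n (%y l. bb (act M c x) (act N d y) (l \<otimes> k)))"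
   using co_one[OF assms(1,3,4), of "%x k. co N P n (%y l. bb (act M c x) (act N d y) (l \<otimes> k))"] by simp
 qed
 finally show ?thesis .
qed

end

context base
begin

lemma tens_concat:
 assumes "module R M" "module R N" "!!x. x : set xs ==> set (F x) \<subseteq> carrier M \<times> carrier N"
 shows "tens R M N (concat (map F xs)) = lsum (tensor R M N) (map (%x. tens R M N (F x)) xs)"
 using assms(3)
proof (induction xs)
 case Nil
 then show ?case using assms by (simp add: abelian_monoid.lsum_Nil tensor_sel)
next
 case (Cons x xs)
 have wf: "set (concat (map F xs)) \<subseteq> carrier M \<times> carrier N" using Cons.prems by fastforce
 have "tens R M N (concat (map F (x # xs))) = tens R M N (F x) \<oplus>\<^bsub>tensor R M N\<^esub> tens R M N (concat (map F xs))"
  using tensor_add_tens[OF assms(1,2) _ wf, of "F x"] Cons.prems by simp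
 then show ?case
  using Cons assms by (simp add: abelian_monoid.lsum_Cons)
qed

lemma tens_comp3_ssum:
 assumes M: "module R M" "module R N" and t: "over A B t"
  and u: "!!a b. a :. A ==> b :. B ==> set (u a b) \<subseteq> carrier C \<times> carrier D"
  and v: "!!a b. a :. A ==> b :. B ==> set (v a b) \<subseteq> carrier E \<times> carrier F"
  and c: "!!a b c d e f. a :. A ==> b :. B ==> c :. C ==> d :. D ==>
   e :. E ==> f :. F ==> p a b c d e f :. M \<and> q a b c d e f :. N"
 shows "tens R M N (concat (map (%(a, b). concat (map (%(c, d). map (%(e, f). (p a b c d e f, q a b c d e f)) (v a b)) (u a b))) t)) =
  ssum A B (tensor R M N) t (%a b. ssum C D (tensor R M N) (u a b) (%c d. ssum E F (tensor R M N) (v a b)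
    (%e f. tn M N (p a b c d e f) (q a b c d e f))))"
  (is "tens R M N (concat (map ?F t)) = _")
proof -
 have el: "a :. A \<and> b :. B" if "(a, b) : set t" for a b using t that by auto
 have wf: "set (?F x) \<subseteq> carrier M \<times> carrier N" if "x : set t" for x
 proof -
  obtain a b where x: "x = (a, b)" by (cases x)
  then have ab: "a :. A" "b :. B" using el that by auto
  show ?thesis
   unfolding x prod.case by (rule set_comp[OF u[OF ab] v[OF ab]]) (use c ab in auto)
 qed
 have "tens R M N (concat (map ?F t)) = lsum (tensor R M N) (map (%x. tens R M N (?F x)) t)"
  by (rule tens_concat[OF M wf])
 also have "... = lsum (tensor R M N) (map (%(a, b). ssum C D (tensor R M N) (u a b) (%c d. ssum E F (tensor R M N) (v a b)
    (%e f. tn M N (p a b c d e f) (q a b c d e f)))) t)"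
 proof (rule arg_cong[where f = "lsum (tensor R M N)"], rule map_cong[OF HOL.refl])
  fix x assume "x : set t"
  moreover obtain a b where x: "x = (a, b)" by (cases x)
  ultimately have ab: "a :. A" "b :. B" using el by auto
  show "tens R M N (?F x) = (case x of (a, b) \<Rightarrow> ssum C D (tensor R M N) (u a b) (%c d. ssum E F (tensor R M N) (v a b)
    (%e f. tn M N (p a b c d e f) (q a b c d e f))))"
   unfolding x prod.case by (rule tens_comp_ssum[OF M u[OF ab] v[OF ab]]) (use c ab in auto)
 qed
 finally show ?thesis by (simp add: ssum_wf[OF t])
qed

end

lemma (in weak_bialgebra) diag_act_mult:
 assumes [simp]: "left_module R H M" "left_module R H N" "b :. H" "c :. H" "t :. (tensor R M N)"
 shows "diag_act R H M N b (diag_act R H M N c t) = diag_act R H M N (b \<otimes> c) t"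
proof -
 note [simp] = left_moduleD(1,4)[OF assms(1)] left_moduleD(1,4)[OF assms(2)]
  bilin_lin[OF bilin_act[OF assms(1)]] bilin_lin[OF bilin_act[OF assms(2)]]
 let ?P = "tensor R M N"
 have wf: "over M N t" by (rule tensor_wf) simp_all
 have d: "diag_act R H M N b t = sw ?P b (%p q. ssum M N ?P t (%m n. tn M N (act M p m) (act N q n)))"
  if "b :. H" "t :. ?P" for b t
  unfolding diag_act_def by (rule tens_comp_ssum) (use that comul_wf tensor_wf[of M N t] in simp_all)
 have "diag_act R H M N b (diag_act R H M N c t) = diag_act R H M N (b \<otimes> c) t"
  by (simp add: d d sw_mult)
 then show ?thesis .
qed

locale yd_univ = weak_hopf_bij R H S
 for R :: "('k, 'r) ring_scheme" and H :: "('k, 'h, 'e) bialg_scheme" (structure) and S +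
 fixes \<iota> :: "'h \<Rightarrow> 'x universe"
 assumes inj_iota: "inj_on \<iota> (carrier H)"

sublocale yd_univ \<subseteq> YT: diag_tensor R H "yd_module R H :: ('k, 'h, 'x universe) ydmodule \<Rightarrow> bool"
 by (intro diag_tensor.intro diag_tensor_axioms.intro)
  (simp_all add: base_axioms is_ring comul_linear diag_act_mult)

context yd_univ
begin

abbreviation "pt \<equiv> YT.pt"
abbreviation "yT \<equiv> tens_yd R H"

lemma yT_sel:
 "same_module (tens_mod R H M N) (yT M N)" "act (yT M N) = act (tens_mod R H M N)" "carrier (yT M N) = carrier (tens_mod R H M N)"
 by (simp_all add: tens_yd_def bmodule.defs ydmodule.defs same_module_def)

lemma yT_coact_bal:
 fixes M N :: "('k, 'h, 'x universe) ydmodule"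
 assumes [simp]: "yd_module R H M" "yd_module R H N"
 shows "YT.balanced M N (tensor R (tens_mod R H M N) H) (%m n. co M (tensor R (tens_mod R H M N) H) m (%x k.
  co N (tensor R (tens_mod R H M N) H) n (%y l. tn (tens_mod R H M N) H (pt M N x y) (l \<otimes> k))))"
 unfolding YT.balanced_def
proof (intro conjI ballI)
 let ?Q = "tensor R (tens_mod R H M N) H"
 let ?t = "tn (tens_mod R H M N) H"
 fix m n assume [simp]: "m :. M" "n :. N"
 have "sw ?Q \<one> (%a c. co M ?Q (act M a m) (%x k. co N ?Q (act N c n) (%y l. ?t (pt M N x y) (l \<otimes> k)))) = co M ?Q m (%x k. co N ?Q n (%y l. ?t (act (tens_mod R H M N) \<one> (pt M N x y)) (l \<otimes> k)))"
  by (rule HOL.trans, rule HOL.trans, (rule co_co_one[where bb = "%x y. ?t (pt M N x y)"]; simp), (rule co_swap[symmetric]; simp), (rule HOL.trans, rule ssum_eqI, (rule co_swap[symmetric]; simp))) (simp add: YT.act_pt)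
 also have "... = co M ?Q m (%x k. co N ?Q n (%y l. ?t (pt M N x y) (l \<otimes> k)))"
  by (simp add: left_moduleD(5)[OF YT.TM_left])
 finally show "sw ?Q \<one> (%a c. co M ?Q (act M a m) (%x k. co N ?Q (act N c n) (%y l. ?t (pt M N x y) (l \<otimes> k)))) = ..." .
qed simp

lemma yT_coact:
 fixes M N :: "('k, 'h, 'x universe) ydmodule"
 assumes [simp]: "yd_module R H M" "yd_module R H N" and x: "x :. (tens_mod R H M N)"
 shows "coact (yT M N) x = YT.lft M N (tensor R (tens_mod R H M N) H) (%m n. co M (tensor R (tens_mod R H M N) H) m (%x k.
  co N (tensor R (tens_mod R H M N) H) n (%y l. tn (tens_mod R H M N) H (pt M N x y) (l \<otimes> k)))) x"
proof -
 have wf: "set (unproject R H M N x) \<subseteq> carrier M \<times> carrier N"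
  by (rule tensor_wf[OF _ _ YT.unproject_ssum(2)[OF _ _ _ yT_coact_bal x]]) simp_all
 have "coact (yT M N) x = tens R (tens_mod R H M N) H (concat (map (%(m, n). concat (map (%(m0, m1). map (%(n0, n1).
   (pt M N m0 n0, n1 \<otimes> m1)) (coact N n)) (coact M m))) (unproject R H M N x)))"
  using x by (simp add: tens_yd_def bmodule.defs ydmodule.defs YT.pt_def)
 also have "... = ssum M N (tensor R (tens_mod R H M N) H) (unproject R H M N x) (%m n. co M (tensor R (tens_mod R H M N) H) m (%x k.
  co N (tensor R (tens_mod R H M N) H) n (%y l. tn (tens_mod R H M N) H (pt M N x y) (l \<otimes> k))))"
  by (rule tens_comp3_ssum) (simp_all add: wf coact_wf)
 also have "... = YT.lft M N (tensor R (tens_mod R H M N) H) (%m n. co M (tensor R (tens_mod R H M N) H) m (%x k.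
  co N (tensor R (tens_mod R H M N) H) n (%y l. tn (tens_mod R H M N) H (pt M N x y) (l \<otimes> k)))) x"
  by (rule YT.unproject_ssum(1)[OF _ _ _ yT_coact_bal x]) simp_all
 finally show ?thesis .
qed

lemma yT_coact_linear:
 fixes M N :: "('k, 'h, 'x universe) ydmodule"
 assumes [simp]: "yd_module R H M" "yd_module R H N"
 shows "linear_map R (tens_mod R H M N) (tensor R (tens_mod R H M N) H) (coact (yT M N))"
 by (rule linear_map_cong[OF _ yT_coact]) (auto intro!: YT.lft_linear)

lemma yT_coact_pt:
 fixes M N :: "('k, 'h, 'x universe) ydmodule"
 assumes [simp]: "yd_module R H M" "yd_module R H N" "m :. M" "n :. N"
 shows "coact (yT M N) (pt M N m n) = co M (tensor R (tens_mod R H M N) H) m (%x k.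
  co N (tensor R (tens_mod R H M N) H) n (%y l. tn (tens_mod R H M N) H (pt M N x y) (l \<otimes> k)))"
 by (subst yT_coact) (simp_all add: YT.lft_pt yT_coact_bal)

lemma yT_yd [simp]:
 fixes M N :: "('k, 'h, 'x universe) ydmodule"
 assumes [simp]: "yd_module R H M" "yd_module R H N"
 shows "yd_module R H (yT M N)"
proof -
 let ?T = "tens_mod R H M N" and ?X = "yT M N"
 let ?Q = "tensor R ?T H"
 have sT: "tens R ?X H = tens R ?T H" "tensor R ?X H = tensor R ?T H"
  by (rule same_tens same_tensor; simp add: same_module_sym[OF yT_sel(1)])+
 have sl: "linear_map R A ?X f = linear_map R A ?T f" "linear_map R ?X B g = linear_map R ?T B g"
  for A :: "('k, 'a, 'b) module_scheme" and f and B :: "('k, 'c, 'd) module_scheme" and g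
  by (rule same_module_linear; simp add: same_module_sym[OF yT_sel(1)])+
 have ss: "ssum A B ?X t bb = ssum A B ?T t bb" for A :: "('a, 'l) partial_object_scheme" and B :: "('b, 'm) partial_object_scheme" and t bb
  by (rule ssum_same[OF same_module_sym[OF yT_sel(1)]])
 have ss2: "ssum ?X H P t bb = ssum ?T H P t bb" for P :: "('c, 'n) ring_scheme" and t bb
  by (simp add: ssum_def yT_sel)
 have sm: "smult ?X = smult ?T"
  using yT_sel(1)[of M N] by (simp add: same_module_def)
 note cl [simp] = yT_coact_linear[OF assms] linear_comp[OF yT_coact_linear[OF assms]] linear_mapD(1)[OF yT_coact_linear[OF assms]]
 note al [simp] = bilin_lin[OF bilin_act[OF YT.TM_left[OF assms]]]
 have cpt: "ssum ?T H P (coact ?X (pt M N m n)) bb = co M P m (%x k. co N P n (%y l. bb (pt M N x y) (l \<otimes> k)))"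
  if [simp]: "module R P" "m :. M" "n :. N" and b: "bilin R ?T H P bb" for P :: "('k, 'c, 'n) module_scheme" and m n bb
  using bilin_lin[OF b] b by (simp add: yT_coact_pt)
 show ?thesis
 \<comment> \<open>The criterion is transferred to the underlying module \<open>tens_mod\<close>,
   where equality of linear maps can be tested on generators.\<close>
 proof (rule yd_moduleI, unfold sT sl ss ss2 sm yT_sel(2,3))
  show "left_module R H ?X"
   by (rule left_module_same[OF yT_sel(1) yT_sel(2)[symmetric]]) simp
  show "linear_map R ?T ?Q (coact ?X)" by simp
 next
  let ?P = "tensor R ?Q H"
  let ?\<gamma> = "%y a b. tn ?Q H (tn ?T H y a) b"
  fix x assume x: "x :. ?T"
  show "ssum ?T H ?P (coact ?X x) (%x b. ssum ?T H ?P (coact ?X x) (%y a. ?\<gamma> y a b)) =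
   ssum ?T H ?P (coact ?X x) (%x h. sw ?P h (%a b. ?\<gamma> x a b))"
  proof (rule YT.TM_ext[OF assms _ _ _ _ x, where P = ?P])
   fix m n assume [simp]: "m :. M" "n :. N"
   have "ssum ?T H ?P (coact ?X (pt M N m n)) (%x b. ssum ?T H ?P (coact ?X x) (%y a. ?\<gamma> y a b)) =
    co M ?P m (%x k. co N ?P n (%y l. co M ?P x (%x' k'. co N ?P y (%y' l'. ?\<gamma> (pt M N x' y') (l' \<otimes> k') (l \<otimes> k)))))"
    by (simp add: cpt)
   also have "... = co M ?P m (%x k. co N ?P n (%y l. sw ?P k (%k1 k2. sw ?P l (%l1 l2. ?\<gamma> (pt M N x y) (l1 \<otimes> k1) (l2 \<otimes> k2)))))"
    by (rule HOL.trans, rule HOL.trans, rule ssum_eqI, (rule ssum_swap; simp), rule ssum_eqI, rule ssum_eqI, (rule co_coas[where \<gamma> = "%y l1 l2. ?\<gamma> (pt M N _ y) (l1 \<otimes> _) (l2 \<otimes> _)"]; simp), (rule HOL.trans, (rule co_coas[where \<gamma> = "%x k1 k2. co N ?P n (%y l. sw ?P l (%l1 l2. ?\<gamma> (pt M N x y) (l1 \<otimes> k1) (l2 \<otimes> k2)))"]; simp), rule ssum_eqI, rule ssum_swap)) simp_all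
   also have "... = ssum ?T H ?P (coact ?X (pt M N m n)) (%x h. sw ?P h (%a b. ?\<gamma> x a b))"
    by (rule HOL.trans, rule ssum_eqI, rule ssum_eqI, (rule sw_swap; simp)) (simp add: cpt sw_mult)
   finally show "ssum ?T H ?P (coact ?X (pt M N m n)) (%x b. ssum ?T H ?P (coact ?X x) (%y a. ?\<gamma> y a b)) = ..." .
  qed simp_all
 next
  fix x assume x: "x :. ?T"
  show "ssum ?T H ?T (coact ?X x) (%x h. counit H h \<odot>\<^sub>?T x) = x"
  proof (rule YT.TM_ext[OF assms _ _ _ _ x, where P = ?T])
   fix m n assume [simp]: "m :. M" "n :. N"
   have "ssum ?T H ?T (coact ?X (pt M N m n)) (%x h. counit H h \<odot>\<^sub>?T x) = sw ?T \<one> (%a b. pt M N (act M a m) (act N b n))"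
    by (simp add: cpt co_co_counit)
   also have "... = pt M N m n"
    by (simp add: left_moduleD(5)[OF YT.TM_left] flip: YT.act_pt)
   finally show "ssum ?T H ?T (coact ?X (pt M N m n)) (%x h. counit H h \<odot>\<^sub>?T x) = pt M N m n" .
  qed simp_all
 next
  fix h x assume [simp]: "h :. H" and x: "x :. ?T"
  show "coact ?X (act ?T h x) = sw ?Q h (%a r. sw ?Q r (%b c. ssum ?T H ?Q (coact ?X x) (%x k. tn ?T H (act ?T b x) (c \<otimes> (k \<otimes> T a)))))"
  proof (rule YT.TM_ext[OF assms _ _ _ _ x, where P = ?Q])
   fix m n assume [simp]: "m :. M" "n :. N"
   have "coact ?X (act ?T h (pt M N m n)) = sw ?Q h (%p q. co M ?Q (act M p m) (%x k. co N ?Q (act N q n) (%y l. tn ?T H (pt M N x y) (l \<otimes> k))))"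
    by (simp add: YT.act_pt linear_ssum[OF yT_coact_linear] yT_coact_pt)
   also have "... = sw ?Q h (%a r. sw ?Q r (%s d. ssum ?T H ?Q (coact ?X (pt M N m n)) (%x k. tn ?T H (act ?T s x) (d \<otimes> (k \<otimes> T a)))))"
    by (rule HOL.trans, rule HOL.trans, (rule co_co_act[where bb = "%x y. tn ?T H (pt M N x y)"]; simp), rule ssum_eqI, rule ssum_eqI, (rule ssum_swap; simp), (rule HOL.trans, rule ssum_eqI, rule ssum_eqI, rule ssum_eqI, (rule ssum_swap; simp))) (simp add: cpt YT.act_pt)
   finally show "coact ?X (act ?T h (pt M N m n)) = sw ?Q h (%a r. sw ?Q r (%b c. ssum ?T H ?Q (coact ?X (pt M N m n)) (%x k. tn ?T H (act ?T b x) (c \<otimes> (k \<otimes> T a)))))" .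
  qed simp_all
 qed
qed

end

sublocale yd_univ \<subseteq> YT: diag_tensor_T R H "yd_module R H :: ('k, 'h, 'x universe) ydmodule \<Rightarrow> bool" "tens_yd R H"
proof
 fix M N P :: "('k, 'h, 'x universe) ydmodule" and m n p
 assume [simp]: "yd_module R H M" "yd_module R H N"
 show "same_module (tens_mod R H M N) (tens_yd R H M N)" "act (tens_yd R H M N) = act (tens_mod R H M N)"
  "yd_module R H (tens_yd R H M N)"
  by (simp_all add: yT_sel)
 assume [simp]: "yd_module R H P" "m :. M" "n :. N" "p :. P"
 show "tens3 R M N P [(act M a1 m, act N a2 n, act P b p). (a, b) \<leftarrow> comul H \<one>, (a1, a2) \<leftarrow> comul H a] =
   tens3 R M N P [(act M a m, act N b1 n, act P b2 p). (a, b) \<leftarrow> comul H \<one>, (b1, b2) \<leftarrow> comul H b]"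
  (is "?l = ?r")
 proof -
  let ?Q = "tensor R (tensor R M N) P"
  have "?l = sw ?Q \<one> (%a b. sw ?Q a (%c d. tn (tensor R M N) P (tn M N (act M c m) (act N d n)) (act P b p)))"
   by (rule tens3_comp_ssum) (use comul_wf in simp_all)
  also have "... = ?r"
   by (rule HOL.trans, (rule coas; simp), rule tens3_comp_ssum[symmetric]) (use comul_wf in simp_all)
  finally show ?thesis .
 qed
qed

section \<open>The unit Yetter-Drinfeld module\<close>

context weak_hopf_bij
begin

text \<open>The second leg of \<Delta>(z) is that of \<Delta>(1), where \<open>W1\<close> inserts
  \<open>et\<close>; this is why the projection in \<open>unit_yd\<close> changes nothing.\<close>

lemma sw_Ht_et:
 assumes [simp]: "module R P" and z: "z : Ht" and bb: "bilin R H H P bb"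
 shows "sw P z (%a b. bb a (et b)) = sw P z bb"
proof -
 note [simp] = bilin_lin[OF bb] HtD(1)[OF z]
 have "sw P z (%a b. bb a (et b)) = sw P z bb"
  by (rule HOL.trans, rule HOL.trans, (rule W7t(1)[OF _ z]; simp), (rule W1(1); simp), rule W7t(1)[OF _ z, symmetric]) (simp_all add: bb)
 then show ?thesis .
qed

text \<open>When \<open>et\<close> is expanded, \<Delta>(1)\<Delta>(h) contracts and the counit law
  is left. For the left unit constraint this gives linearity over H and, at h = 1,
  balancedness.\<close>

lemma sw_et_mult:
 assumes [simp]: "module R P" "h :. H" and z: "z : Ht" and f: "linear_map R H P f"
 shows "sw P h (%a b. f (et (a \<otimes> z) \<otimes> b)) = f (h \<otimes> z)"
proof -
 note [simp] = HtD(1)[OF z] linear_comp[OF f] linear_mapD(1)[OF f] linear_ssum[OF f] linear_mapD(3)[OF f]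
 have "sw P h (%a b. f (et (a \<otimes> z) \<otimes> b)) = sw P h (%a b. sw P \<one> (%c d. counit H (c \<otimes> (a \<otimes> z)) \<odot>\<^sub>P f (d \<otimes> b)))"
  unfolding eps_sw by simp
 also have "... = sw P h (%a b. counit H (a \<otimes> z) \<odot>\<^sub>P f b)"
  by (rule HOL.trans, (rule sw_swap; simp), rule HOL.sym, rule HOL.trans, rule cm_l) simp_all
 also have "... = f (h \<otimes> z)"
  by (rule HOL.trans, (rule sw_Ht(1)[OF _ _ z, symmetric]; simp), rule cou_l) (simp_all add: f)
 finally show ?thesis .
qed

lemma sw_esb_mult:
 assumes [simp]: "module R P" "h :. H" "z :. H" and f: "linear_map R H P f"
 shows "sw P h (%a b. f (esb (b \<otimes> z) \<otimes> a)) = f (h \<otimes> esb z)"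
proof -
 note [simp] = linear_comp[OF f] linear_mapD(1)[OF f] linear_ssum[OF f] linear_mapD(3)[OF f]
 have "sw P h (%a b. f (esb (b \<otimes> z) \<otimes> a)) = sw P h (%a b. sw P \<one> (%c d. counit H (d \<otimes> (b \<otimes> z)) \<odot>\<^sub>P f (c \<otimes> a)))"
  unfolding eps_sw by simp
 also have "... = sw P h (%a b. counit H (b \<otimes> z) \<odot>\<^sub>P f a)"
  by (rule HOL.trans, (rule sw_swap; simp), rule HOL.sym, rule HOL.trans, rule cm_l) simp_all
 also have "... = sw P \<one> (%a b. counit H (b \<otimes> z) \<odot>\<^sub>P f (h \<otimes> a))"
  by (rule HOL.trans[rotated], (rule W4'; simp)) simp
 also have "... = f (h \<otimes> esb z)"
  unfolding eps_sw by simp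
 finally show ?thesis .
qed

lemma sw_one_et:
 assumes [simp]: "module R P" and z: "z : Ht" and bb: "bilin R H H P bb"
 shows "sw P \<one> (%a b. bb (et a) (b \<otimes> z)) = sw P \<one> (%a b. bb (et (a \<otimes> z)) b)"
proof -
 note [simp] = bilin_lin[OF bb] HtD(1)[OF z]
 have "sw P \<one> (%a b. bb (et a) (b \<otimes> z)) = sw P z (%a b. bb (et a) b)"
  by (rule HOL.trans, (rule W4[symmetric]; simp)) (simp add: eps_eps)
 also have "... = sw P \<one> (%a b. bb (et (a \<otimes> z)) b)"
  by (rule W7t(1)[OF _ z]) simp_all
 finally show ?thesis .
qed

text \<open>Carries an element of H_t across \<Delta>(1) to the other leg. It is the source of the
  triangle identity (\<open>pt_unit\<close>) and of the inverse of the right unit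
  constraint.\<close>

lemma sw_one_esb:
 assumes [simp]: "module R P" and z: "z : Ht" and bb: "bilin R H H P bb"
 shows "sw P \<one> (%a b. bb a (b \<otimes> z)) = sw P \<one> (%a b. bb (a \<otimes> esb z) b)"
proof -
 note [simp] = bilin_lin[OF bb] HtD(1)[OF z]
 have "sw P \<one> (%a b. bb a (b \<otimes> z)) = sw P \<one> (%a b. bb (es a \<otimes> esb z) b)"
  by (rule HOL.trans, rule HOL.trans, (rule W4[symmetric]; simp add: bb), (rule W7t(1)[OF _ z]; simp), (rule HOL.trans, (rule W1(2)[symmetric]; simp))) (simp add: esb_mult)
 also have "... = sw P \<one> (%a b. bb (a \<otimes> esb z) b)"
  by (rule W1(2)) simp_all
 finally show ?thesis .
qed

lemma sw_one_esb_et: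
 assumes [simp]: "module R P" and z: "z : Ht" and bb: "bilin R H H P bb"
 shows "sw P \<one> (%a b. bb a (et (b \<otimes> z))) = sw P \<one> (%a b. bb (a \<otimes> esb z) (et b))"
proof -
 note [simp] = bilin_lin[OF bb] HtD(1)[OF z]
 show ?thesis
  by (rule sw_one_esb[OF _ z]) simp_all
qed

text \<open>In \<open>co_act\<close> only the leg under S^-1 receives z; \<open>one1\<close> splits
  off a \<Delta>(1) that \<open>co_t\<close> absorbs. Used for the colinearity of the left unit
  constraint.\<close>

lemma co_act_Ht:
 assumes [simp]: "yd_module R H M" "module R P" "m :. M" and z: "z : Ht" and bb: "bilin R M H P bb"
 shows "co M P (act M z m) bb = sw P z (%a b. co M P m (%x k. bb (act M b x) (k \<otimes> T a)))"
proof -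
 note [simp] = bilin_lin[OF bb] HtD(1)[OF z]
 have "co M P (act M z m) bb = sw P \<one> (%a r. sw P a (%b c. co M P m (%x k. bb (act M c x) (r \<otimes> (k \<otimes> T (b \<otimes> z))))))"
  by (rule HOL.trans, rule HOL.trans, (rule co_act; simp add: bb), (rule W7t(1)[OF _ z]; simp)) (simp add: coas)
 also have "... = sw P \<one> (%a b. sw P \<one> (%c d. co M P m (%x k. bb (act M b (act M c x)) (d \<otimes> k \<otimes> T (a \<otimes> z)))))"
  by (subst one1) simp_all
 also have "... = sw P z (%a b. co M P m (%x k. bb (act M b x) (k \<otimes> T a)))"
  by (rule HOL.trans, rule ssum_eqI, (rule co_t[where bb = "%x k. bb (act M _ x) (k \<otimes> T (_ \<otimes> z))", symmetric]; simp), rule W7t(1)[OF _ z, symmetric]) simp_all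
 finally show ?thesis .
qed

text \<open>In \<open>co_act\<close> the element w reaches the last leg only, which leaves the
  formula for the coaction of 1m with w in front. Used for the colinearity of the right unit
  constraint.\<close>

lemma co_act_Hs:
 assumes [simp]: "yd_module R H M" "module R P" "m :. M" and w: "w : Hs" and bb: "bilin R M H P bb"
 shows "co M P (act M w m) bb = co M P m (%x k. bb x (w \<otimes> k))"
proof -
 note [simp] = bilin_lin[OF bb] HsD(1)[OF w]
 have "co M P (act M w m) bb = co M P (act M \<one> m) (%x k. bb x (w \<otimes> k))"
  by (rule HOL.trans, rule HOL.trans, (rule co_act; simp add: bb), (rule W7s(2)[OF _ w]; simp), (rule HOL.trans, rule ssum_eqI, (rule sw_Hs(2)[OF _ _ w]; simp), subst co_act[of M P m \<one>])) simp_all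
 then show ?thesis by simp
qed

text \<open>As \<open>esb\<close> is S^-1 after \<open>et\<close>, both legs of \<Delta>(z) appear
  under S^-1, which turns \<Delta>(1) into itself with legs exchanged; \<open>co_t\<close> absorbs
  the result. Used with \<open>co_act_Hs\<close> for the right unit constraint.\<close>

lemma co_unit_r:
 assumes [simp]: "yd_module R H M" "module R P" "m :. M" and z: "z : Ht" and bb: "bilin R M H P bb"
 shows "co M P m (%x k. sw P z (%a b. bb (act M (esb b) x) (T a \<otimes> k))) = co M P m (%x k. bb x (esb z \<otimes> k))"
proof -
 note [simp] = bilin_lin[OF bb] HtD(1)[OF z]
 have "co M P m (%x k. sw P z (%a b. bb (act M (esb b) x) (T a \<otimes> k))) =
   co M P m (%x k. sw P \<one> (%a b. bb (act M a x) (esb z \<otimes> (b \<otimes> k))))"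
 proof (rule ssum_eqI)
  fix x k assume [simp]: "x :. M" "k :. H"
  have "sw P z (%a b. bb (act M (esb b) x) (T a \<otimes> k)) = sw P \<one> (%a b. bb (act M (T (et b)) x) (esb z \<otimes> (T a \<otimes> k)))"
   by (rule HOL.trans, (rule W7t(1)[OF _ z]; simp)) (simp add: T_mult T_Ht[OF z] T_et)
  also have "... = sw P \<one> (%a b. bb (act M a x) (esb z \<otimes> (b \<otimes> k)))"
   by (rule HOL.trans, (rule W1(1); simp), rule S_comul_one') simp_all
  finally show "sw P z (%a b. bb (act M (esb b) x) (T a \<otimes> k)) = ..." .
 qed
 also have "... = co M P m (%x k. bb x (esb z \<otimes> k))"
  by (rule HOL.trans, (rule co_swap; simp), rule co_t[symmetric]) simp_all
 finally show ?thesis .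
qed

end

sublocale yd_univ \<subseteq> UN: unit_alg R H \<iota>
 by (intro unit_alg.intro unit_alg_axioms.intro)
  (simp_all add: base_axioms is_ring smult_mult eps_lin0 eps_eps inj_iota)

context yd_univ
begin

abbreviation "uI \<equiv> inv_into (carrier (target H)) \<iota>"
abbreviation "yU \<equiv> unit_yd R H S \<iota>"
abbreviation "mU \<equiv> unit_mod R H \<iota>"

lemmas mU_module [simp] = UN.unit_module
lemmas mU_left [simp] = UN.unit_left
lemmas uI_linear [simp] = linear_comp[OF UN.unit_linear(2)]
lemmas uI_closed [simp] = UN.unit_elem(2,3,4)
lemmas iet_linear [simp] = linear_comp[OF UN.unit_et_linear]
lemmas iet_closed [simp] = linear_mapD(1)[OF UN.unit_et_linear]
lemmas iet_push [simp] = linear_ssum[OF UN.unit_et_linear] linear_mapD(3)[OF UN.unit_et_linear]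

lemma uI_Ht [simp]: "x :. mU ==> uI x : Ht"
 by (intro HtI) auto

lemma uI_iet [simp]: "h :. H ==> uI (\<iota> (et h)) = et h"
 by (rule inv_into_f_f[OF UN.inj_target]) (auto simp: UN.target_sel)

lemma uI_act [simp]: "h :. H ==> x :. mU ==> uI (act mU h x) = et (h \<otimes> uI x)"
 "h :. H ==> x :. mU ==> act mU h x = \<iota> (et (h \<otimes> uI x))"
 using UN.unI_act UN.unit_act by auto

lemma yU_sel:
 "same_module mU yU" "act yU = act mU" "carrier yU = carrier mU"
 by (simp_all add: unit_yd_def bmodule.defs ydmodule.defs same_module_def)

lemma yU_coact:
 assumes [simp]: "x :. mU"
 shows "coact yU x = sw (tensor R mU H) (uI x) (%a b. tn mU H (\<iota> (et b)) (T a))"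
proof -
 have "coact yU x = sw (tensor R mU H) (uI x) (%a b. tn mU H (\<iota> (et b)) (T a))"
  by (rule HOL.trans[rotated], (rule tens_map_ssum; (use comul_wf in simp))) (simp add: unit_yd_def bmodule.defs ydmodule.defs)
 then show ?thesis .
qed

lemma yU_coact_linear: "linear_map R mU (tensor R mU H) (coact yU)"
 by (rule linear_map_cong[OF _ yU_coact]) simp_all

lemma yU_yd [simp]: "yd_module R H yU"
proof -
 let ?X = "yU" and ?T = mU
 let ?Q = "tensor R ?T H"
 have sT: "tens R ?X H = tens R ?T H" "tensor R ?X H = tensor R ?T H"
  by (rule same_tens same_tensor; simp add: same_module_sym[OF yU_sel(1)])+
 have sl: "linear_map R A ?X f = linear_map R A ?T f" "linear_map R ?X B g = linear_map R ?T B g"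
  for A :: "('k, 'a, 'b) module_scheme" and f and B :: "('k, 'c, 'd) module_scheme" and g
  by (rule same_module_linear; simp add: same_module_sym[OF yU_sel(1)])+
 have ss: "ssum A B ?X t bb = ssum A B ?T t bb" for A :: "('a, 'l) partial_object_scheme" and B :: "('b, 'm) partial_object_scheme" and t bb
  by (rule ssum_same[OF same_module_sym[OF yU_sel(1)]])
 have ss2: "ssum ?X H P t bb = ssum ?T H P t bb" for P :: "('c, 'n) ring_scheme" and t bb
  by (simp add: ssum_def yU_sel)
 have sm: "smult ?X = smult ?T"
  using yU_sel(1) by (simp add: same_module_def)
 note cl [simp] = yU_coact_linear linear_comp[OF yU_coact_linear] linear_mapD(1)[OF yU_coact_linear]
 have cx: "ssum ?T H P (coact ?X x) bb = sw P (uI x) (%a b. bb (\<iota> (et b)) (T a))"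
  if [simp]: "module R P" "x :. mU" and b: "bilin R ?T H P bb" for P :: "('k, 'c, 'n) module_scheme" and x bb
  using bilin_lin[OF b] b by (simp add: yU_coact)
 show ?thesis
 proof (rule yd_moduleI, unfold sT sl ss ss2 sm yU_sel(2,3))
  show "left_module R H ?X"
   by (rule left_module_same[OF yU_sel(1) yU_sel(2)[symmetric]]) simp
  show "linear_map R ?T ?Q (coact ?X)" by simp
 next
  let ?P = "tensor R ?Q H"
  let ?\<gamma> = "%y a b. tn ?Q H (tn ?T H y a) b"
  fix x assume x [simp]: "x :. ?T"
  have "ssum ?T H ?P (coact ?X x) (%x b. ssum ?T H ?P (coact ?X x) (%y a. ?\<gamma> y a b)) =
   sw ?P (uI x) (%p q. sw ?P (et q) (%a b. ?\<gamma> (\<iota> (et b)) (T a) (T p)))"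
   by (simp add: cx)
  also have "... = sw ?P (uI x) (%p q. sw ?P p (%u v. ?\<gamma> (\<iota> (et q)) (T v) (T u)))"
   by (rule HOL.trans, (rule sw_Ht_et; simp)) (simp add: coas)
  also have "... = ssum ?T H ?P (coact ?X x) (%x h. sw ?P h (%a b. ?\<gamma> x a b))"
   by (simp add: cx T_comul)
  finally show "ssum ?T H ?P (coact ?X x) (%x b. ssum ?T H ?P (coact ?X x) (%y a. ?\<gamma> y a b)) = ..." .
 next
  fix x assume x [simp]: "x :. ?T"
  have "sw ?T (uI x) (%a b. counit H a \<odot>\<^sub>?T \<iota> (et b)) = \<iota> (et (uI x))"
   by (rule cou_l) simp_all
  then show "ssum ?T H ?T (coact ?X x) (%x h. counit H h \<odot>\<^sub>?T x) = x"
   by (simp add: cx T_counit)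
 next
  fix h x assume [simp]: "h :. H" and x [simp]: "x :. ?T"
  let ?z = "uI x"
  let ?t = "%b. tn ?T H (\<iota> (et b))"
  have z: "?z : Ht" by simp
  have "sw ?Q h (%a r. sw ?Q r (%b c. ssum ?T H ?Q (coact ?X x) (%x k. tn ?T H (act ?T b x) (c \<otimes> (k \<otimes> T a))))) = sw ?Q h (%e c. sw ?Q e (%a b. sw ?Q ?z (%p q. ?t (b \<otimes> q) (c \<otimes> T (a \<otimes> p)))))"
   by (simp add: cx eps_eps T_mult coas)
  also have "... = sw ?Q h (%e c. sw ?Q (e \<otimes> ?z) (%a b. ?t b (c \<otimes> T a)))"
   by (simp add: sw_mult)
  also have "... = sw ?Q (h \<otimes> ?z) (%e c. sw ?Q e (%a b. ?t (et b) (c \<otimes> T a)))"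
   by (rule HOL.trans, (rule sw_Ht(1)[OF _ _ z, symmetric]; simp)) (simp add: eps_eps)
  also have "... = sw ?Q \<one> (%a b. sw ?Q (h \<otimes> ?z) (%e c. ?t b (c \<otimes> T e \<otimes> T a)))"
   by (rule HOL.trans, rule ssum_eqI, (rule W2; simp), subst sw_swap) (simp_all add: T_mult)
  also have "... = sw ?Q \<one> (%a b. ?t b (T (et (h \<otimes> ?z)) \<otimes> T a))"
   unfolding T_et[OF H_ring(1)[OF \<open>h :. H\<close> uI_closed(2)[OF x]]]
   by (rule ssum_eqI, rule T_r[where f = "%y. ?t _ (y \<otimes> T _)"]) simp_all
  also have "... = sw ?Q \<one> (%a b. ?t b (T (a \<otimes> et (h \<otimes> ?z))))"
   by (simp add: T_mult)
  also have "... = coact ?X (act ?T h x)"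
   by (rule HOL.trans, (rule W7t(1)[symmetric]; simp)) (simp add: yU_coact)
  finally show "coact ?X (act ?T h x) = sw ?Q h (%a r. sw ?Q r (%b c. ssum ?T H ?Q (coact ?X x) (%x k. tn ?T H (act ?T b x) (c \<otimes> (k \<otimes> T a)))))"
   by (rule HOL.sym)
 qed
qed

end

section \<open>Dual bases\<close>

text \<open>The free module that contains H may have infinite rank, but on H only the coordinates in
  \<open>J\<close> matter, the union of the supports of finitely many generators. The dual basis
  consists of the images of the unit vectors under the retraction and the coordinate functionals,
  for the indices in \<open>J\<close>.\<close>

lemma (in base) dual_basis:
 fixes H :: "('k, 'h, 'm) module_scheme"
 assumes H: "module R H" and fg: "finitely_generated_module R H" and pr: "projective_module R H"
 shows "\<exists>db. set db \<subseteq> carrier H \<times> {f. linear_map R H (ground R) f} \<and>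
  (\<forall>h\<in>carrier H. h = lsum H (map (%(e, f). f h \<odot>\<^sub>H e) db))"
proof -
 note cr = cring.cring_simprules[OF cring_base]
 obtain I :: "'h set" and i p where i: "linear_map R H (free_module R I) i" and p: "linear_map R (free_module R I) H p"
  and pi: "!!x. x :. H ==> p (i x) = x"
  using pr unfolding projective_module_def by blast
 obtain X where X: "finite X" "X \<subseteq> carrier H"
  and gen: "!!x. x :. H ==> \<exists>c\<in>X \<rightarrow> carrier R. x = (\<Oplus>\<^bsub>H\<^esub>g\<in>X. c g \<odot>\<^sub>H g)"
  using fg by (auto simp: finitely_generated_module_def)
 have ic: "i x : I \<rightarrow>\<^sub>E carrier R \<and> finite {j\<in>I. i x j \<noteq> \<zero>\<^sub>R}" if "x :. H" for x
  using linear_mapD(1)[OF i that] by (simp add: free_module_def)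
 have ia: "i (x \<oplus>\<^sub>H y) j = i x j \<oplus>\<^sub>R i y j" if "x :. H" "y :. H" "j : I" for x y j
  using linear_mapD(2)[OF i that(1,2)] that(3) by (simp add: free_module_def)
 have ism: "i (a \<odot>\<^sub>H x) j = a \<otimes>\<^sub>R i x j" if "a :. R" "x :. H" "j : I" for a x j
  using linear_mapD(3)[OF i that(1,2)] that(3) by (simp add: free_module_def)
 have ir: "i x j :. R" if "x :. H" "j : I" for x j
  using ic[OF that(1)] that(2) by auto
 define J where "J = (\<Union>g\<in>X. {j\<in>I. i g j \<noteq> \<zero>\<^sub>R})"
 have J: "finite J" "J \<subseteq> I" using X ic by (auto simp: J_def)
 have am: "abelian_monoid H" using H by simp
 have i0: "i x j = \<zero>\<^sub>R" if x: "x :. H" and j: "j : I - J" for x j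
 proof -
  obtain c where c: "c : X \<rightarrow> carrier R" "x = (\<Oplus>\<^bsub>H\<^esub>g\<in>X. c g \<odot>\<^sub>H g)" using gen[OF x] by blast
  have "A \<subseteq> X ==> i (\<Oplus>\<^bsub>H\<^esub>g\<in>A. c g \<odot>\<^sub>H g) j = \<zero>\<^sub>R \<and> (\<Oplus>\<^bsub>H\<^esub>g\<in>A. c g \<odot>\<^sub>H g) :. H" if "finite A" for A
   using that
  proof induction
   case empty
   have "i (\<zero>\<^sub>R \<odot>\<^sub>H \<zero>\<^sub>H) j = \<zero>\<^sub>R"
    using j H ir[of "\<zero>\<^sub>H" j] by (simp add: ism cr)
   then show ?case
    using H am by (simp add: abelian_monoid.finsum_empty module.smult_r_null cr)
  next
   case (insert g A)
   then have g: "g :. H" "c g :. R" "i g j = \<zero>\<^sub>R" using X c j by (auto simp: J_def)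
   have F: "(%g. c g \<odot>\<^sub>H g) : A \<rightarrow> carrier H"
   proof
    fix a assume "a : A"
    then have "c a :. R" "a :. H" using insert.prems X c(1) by auto
    then show "c a \<odot>\<^sub>H a :. H" using H by simp
   qed
   show ?case
    using insert g F j H by (subst (1 2) abelian_monoid.finsum_insert[OF am]) (simp_all add: ia ism cr)
  qed
  from this[OF X(1)] show ?thesis using c by simp
 qed
 obtain js where js: "set js = J" "distinct js" using finite_distinct_list[OF J(1)] by blast
 define \<delta> where "\<delta> j = (\<lambda>k\<in>I. if k = j then \<one>\<^sub>R else \<zero>\<^sub>R)" for j
 have \<delta>: "\<delta> j :. (free_module R I)" for j
  using cr by (auto simp: \<delta>_def free_module_def)
 have p0: "p (\<lambda>k\<in>I. \<zero>\<^sub>R) = \<zero>\<^sub>H"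
 proof -
  have z: "(\<lambda>k\<in>I. \<zero>\<^sub>R) :. (free_module R I)" using cr by (auto simp: free_module_def)
  have "p (\<zero>\<^sub>R \<odot>\<^bsub>free_module R I\<^esub> (\<lambda>k\<in>I. \<zero>\<^sub>R)) = \<zero>\<^sub>H"
   using linear_mapD(3)[OF p _ z, of "\<zero>\<^sub>R"] linear_mapD(1)[OF p z] H cr by (simp add: module.smult_l_null)
  moreover have "\<zero>\<^sub>R \<odot>\<^bsub>free_module R I\<^esub> (\<lambda>k\<in>I. \<zero>\<^sub>R) = (\<lambda>k\<in>I. \<zero>\<^sub>R)"
   using cr by (auto simp: free_module_def restrict_def)
  ultimately show ?thesis by simp
 qed
 \<comment> \<open>The function \<phi> cut off outside \<open>ks\<close>: the form in which the
   expansion along unit vectors can be proved by induction on the list of indices.\<close>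
 define w where "w \<phi> ks = (\<lambda>k\<in>I. if k : set ks then \<phi> k else \<zero>\<^sub>R)" for \<phi> and ks :: "'h list"
 have R0: "\<zero>\<^sub>R :. R" "\<one>\<^sub>R :. R" using cr by auto
 have R1: "a :. R ==> a \<otimes>\<^sub>R \<zero>\<^sub>R = \<zero>\<^sub>R \<and> a \<otimes>\<^sub>R \<one>\<^sub>R = a \<and> a \<oplus>\<^sub>R \<zero>\<^sub>R = a \<and> \<zero>\<^sub>R \<oplus>\<^sub>R a = a" for a
  using cr by auto
 have sum: "p (w \<phi> ks) = lsum H (map (%j. \<phi> j \<odot>\<^sub>H p (\<delta> j)) ks)"
  if \<phi>: "!!k. k : I ==> \<phi> k :. R" and ks: "distinct ks" "set ks \<subseteq> I" for ks \<phi>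
  using ks
 proof (induction ks)
  case Nil
  have "w \<phi> [] = (\<lambda>k\<in>I. \<zero>\<^sub>R)" by (simp add: w_def)
  then have "p (w \<phi> []) = p (\<lambda>k\<in>I. \<zero>\<^sub>R)" by (rule arg_cong)
  from HOL.trans[OF this p0] have "p (w \<phi> []) = \<zero>\<^sub>H" .
  then show ?case using am by (simp add: abelian_monoid.lsum_Nil)
 next
  case (Cons j ks)
  have "finite {k\<in>I. w \<phi> ks k \<noteq> \<zero>\<^sub>R}"
   by (rule finite_subset[of _ "set ks"]) (auto simp: w_def split: if_splits)
  moreover have "w \<phi> ks : I \<rightarrow>\<^sub>E carrier R" using \<phi> R0 by (auto simp: w_def)
  ultimately have r: "w \<phi> ks :. (free_module R I)" by (simp add: free_module_def)
  have "finite {k\<in>I. (\<phi> j \<odot>\<^bsub>free_module R I\<^esub> \<delta> j) k \<noteq> \<zero>\<^sub>R}"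
   by (rule finite_subset[of _ "{j}"]) (use \<phi>[of j] Cons.prems R1 in \<open>auto simp: \<delta>_def free_module_def split: if_splits\<close>)
  moreover have "\<phi> j \<odot>\<^bsub>free_module R I\<^esub> \<delta> j : I \<rightarrow>\<^sub>E carrier R"
   using \<phi>[of j] Cons.prems R1 R0 by (auto simp: \<delta>_def free_module_def)
  ultimately have s: "\<phi> j \<odot>\<^bsub>free_module R I\<^esub> \<delta> j :. (free_module R I)" by (simp add: free_module_def)
  have w: "w \<phi> (j # ks) = (\<phi> j \<odot>\<^bsub>free_module R I\<^esub> \<delta> j) \<oplus>\<^bsub>free_module R I\<^esub> w \<phi> ks"
   using Cons.prems \<phi> R0 R1 by (auto simp: free_module_def \<delta>_def w_def intro!: restrict_ext)
  have "p (w \<phi> (j # ks)) = p (\<phi> j \<odot>\<^bsub>free_module R I\<^esub> \<delta> j) \<oplus>\<^sub>H p (w \<phi> ks)"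
   unfolding w by (rule linear_mapD(2)[OF p s r])
  also have "p (\<phi> j \<odot>\<^bsub>free_module R I\<^esub> \<delta> j) = \<phi> j \<odot>\<^sub>H p (\<delta> j)"
   using linear_mapD(3)[OF p _ \<delta>, of "\<phi> j"] \<phi> Cons.prems by simp
  also have "p (w \<phi> ks) = lsum H (map (%j. \<phi> j \<odot>\<^sub>H p (\<delta> j)) ks)"
   using Cons by simp
  finally show ?case using am by (simp add: abelian_monoid.lsum_Cons)
 qed
 define db where "db = map (%j. (p (\<delta> j), %h. i h j)) js"
 have "h = lsum H (map (%(e, f). f h \<odot>\<^sub>H e) db)" if h: "h :. H" for h
 proof -
  have "i h = w (i h) js"
   unfolding w_def using ic[OF h] i0[OF h] js by (auto simp: fun_eq_iff restrict_def PiE_def extensional_def)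
  then have "h = p (w (i h) js)"
   using pi[OF h] by simp
  then show ?thesis
   using sum[of "i h" js] js J ir[OF h] by (simp add: db_def o_def)
 qed
 moreover have "set db \<subseteq> carrier H \<times> {f. linear_map R H (ground R) f}"
  using J js linear_mapD(1)[OF p \<delta>] by (auto simp: db_def linear_map_def ground_def ia ism ir)
 ultimately show ?thesis by blast
qed

text \<open>Application as a constant, so that its bilinearity can be used by rewriting.\<close>

definition ap :: "('a \<Rightarrow> 'b) \<Rightarrow> 'a \<Rightarrow> 'b" where
 "ap f h = f h"

locale weak_hopf_fgp = weak_hopf_bij +
 assumes fg: "finitely_generated_module R H" and proj: "projective_module R H"
begin

abbreviation "Hd \<equiv> dual R H"

lemma Hd_sel: "f :. Hd \<longleftrightarrow> f : extensional (carrier H) \<and> linear_map R H (ground R) f"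
 "\<zero>\<^sub>Hd = (\<lambda>h\<in>carrier H. \<zero>\<^sub>R)" "f \<oplus>\<^sub>Hd g = (\<lambda>h\<in>carrier H. f h \<oplus>\<^sub>R g h)"
 "a \<odot>\<^sub>Hd f = (\<lambda>h\<in>carrier H. a \<otimes>\<^sub>R f h)" "\<one>\<^sub>Hd = restrict (counit H) (carrier H)"
 "f \<otimes>\<^sub>Hd g = (\<lambda>h\<in>carrier H. lsum R [f h1 \<otimes>\<^sub>R g h2. (h1, h2) \<leftarrow> comul H h])"
 by (auto simp: dual_def)

lemma Hd_linear: "f :. Hd ==> linear_map R H (ground R) f"
 by (simp add: Hd_sel)

lemma Hd_closed [simp]: "f :. Hd ==> h :. H ==> f h :. R"
 using linear_mapD(1)[OF Hd_linear] by simp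

lemma restrict_in_Hd: "linear_map R H (ground R) f ==> restrict f (carrier H) :. Hd"
 using is_module by (simp add: Hd_sel linear_map_def Pi_iff)

lemma module_Hd [simp]: "module R Hd"
proof -
 note R = cring.cring_simprules[OF cring_base]
 have n: "(\<lambda>h\<in>carrier H. \<ominus>\<^bsub>R\<^esub> f h) :. Hd" if "f :. Hd" for f
  using that is_module unfolding Hd_sel
  by (auto simp: linear_map_def Pi_iff ground_def R)
 have ag: "abelian_group Hd"
 proof (rule abelian_groupI)
  fix f assume f: "f :. Hd"
  show "\<exists>g\<in>carrier Hd. g \<oplus>\<^sub>Hd f = \<zero>\<^sub>Hd"
   by (rule bexI[OF _ n[OF f]]) (use f in \<open>auto simp: Hd_sel(2,3) R intro!: restrict_ext\<close>)
  show "\<zero>\<^sub>Hd \<oplus>\<^sub>Hd f = f"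
   using f by (auto simp: Hd_sel(2,3) R fun_eq_iff Hd_sel(1) extensional_def linear_map_def Pi_iff)
  fix g assume g: "g :. Hd"
  show "f \<oplus>\<^sub>Hd g :. Hd"
   using f g is_module unfolding Hd_sel by (auto simp: linear_map_def Pi_iff ground_def R)
  show "f \<oplus>\<^sub>Hd g = g \<oplus>\<^sub>Hd f"
   using f g by (auto simp: Hd_sel(3) R intro!: restrict_ext)
  fix k assume "k :. Hd"
  then show "f \<oplus>\<^sub>Hd g \<oplus>\<^sub>Hd k = f \<oplus>\<^sub>Hd (g \<oplus>\<^sub>Hd k)"
   using f g by (auto simp: Hd_sel(3) R intro!: restrict_ext)
 next
  show "\<zero>\<^sub>Hd :. Hd"
   using is_module unfolding Hd_sel by (auto simp: linear_map_def Pi_iff ground_def R)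
 qed
 show ?thesis
 proof (rule moduleI[OF cring_base ag])
  fix a f assume a: "a :. R" and f: "f :. Hd"
  show "a \<odot>\<^sub>Hd f :. Hd"
   using a f is_module unfolding Hd_sel by (auto simp: linear_map_def Pi_iff ground_def R)
 next
  fix f assume f: "f :. Hd"
  show "\<one>\<^sub>R \<odot>\<^sub>Hd f = f"
   using f by (auto simp: Hd_sel(4) R fun_eq_iff Hd_sel(1) extensional_def linear_map_def Pi_iff)
 next
  fix a b f assume a: "a :. R" and b: "b :. R" and f: "f :. Hd"
  show "(a \<oplus>\<^sub>R b) \<odot>\<^sub>Hd f = a \<odot>\<^sub>Hd f \<oplus>\<^sub>Hd b \<odot>\<^sub>Hd f"
   "(a \<otimes>\<^sub>R b) \<odot>\<^sub>Hd f = a \<odot>\<^sub>Hd (b \<odot>\<^sub>Hd f)"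
   using a b f by (auto simp: Hd_sel(3,4) R intro!: restrict_ext)
 next
  fix a f g assume "a :. R" "f :. Hd" "g :. Hd"
  then show "a \<odot>\<^sub>Hd (f \<oplus>\<^sub>Hd g) = a \<odot>\<^sub>Hd f \<oplus>\<^sub>Hd a \<odot>\<^sub>Hd g"
   by (auto simp: Hd_sel(3,4) R intro!: restrict_ext)
 qed
qed

lemma bilin_ap: "bilin R Hd H (ground R) ap"
proof (rule bilinI)
 show "linear_map R Hd (ground R) (%f. ap f h)" if "h :. H" for h
  using that by (auto simp: Hd_sel(3,4) ground_def ap_def intro!: linear_mapI)
 show "linear_map R H (ground R) (ap f)" if "f :. Hd" for f
  using Hd_linear[OF that] by (simp add: ap_def[abs_def])
qed

lemmas ap_lin [simp] = bilin_lin[OF bilin_ap]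
lemmas ap_push = bilin_push[OF bilin_ap module_Hd is_module module_ground]

lemma ap_closed [simp]: "f :. Hd ==> h :. H ==> ap f h :. R"
 by (simp add: ap_def)

lemma bilin_ap_smult: "module R P ==> c :. P ==> bilin R Hd H P (%f h. ap f h \<odot>\<^sub>P c)"
 using is_module by (intro bilinI) simp_all

lemmas ap_smult_push [simp] = bilin_push[OF bilin_ap_smult module_Hd is_module]

text \<open>A dual basis, taken as an element of H \<otimes> H^* so that bilinear maps can be summed
  over it; it is the element that corresponds to the identity map of H.\<close>

definition db where
 "db = (SOME db. db :. (tensor R H Hd) \<and> (\<forall>h\<in>carrier H. ssum H Hd H db (%e f. ap f h \<odot> e) = h))"

lemma db: "db :. (tensor R H Hd)" "h :. H ==> ssum H Hd H db (%e f. ap f h \<odot> e) = h"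
proof -
 obtain xs where xs: "set xs \<subseteq> carrier H \<times> {f. linear_map R H (ground R) f}"
  "!!h. h :. H ==> h = lsum H (map (%(e, f). f h \<odot> e) xs)"
  using dual_basis[OF is_module fg proj] by blast
 let ?ys = "map (%(e, f). (e, restrict f (carrier H))) xs"
 have wf: "set ?ys \<subseteq> carrier H \<times> carrier Hd"
  using xs(1) by (auto intro!: restrict_in_Hd)
 have "ssum H Hd H (tens R H Hd ?ys) (%e f. ap f h \<odot> e) = h" if h: "h :. H" for h
 proof -
  have "ssum H Hd H (tens R H Hd ?ys) (%e f. ap f h \<odot> e) = ssum H Hd H ?ys (%e f. ap f h \<odot> e)"
   by (rule ssum_tens) (use h wf in simp_all)
  also have "... = lsum H (map (%(e, f). f h \<odot> e) xs)"
   unfolding ssum_wf[OF wf] using h by (simp add: o_def case_prod_unfold ap_def)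
  finally show ?thesis using xs(2)[OF h] by simp
 qed
 then have "\<exists>db. db :. (tensor R H Hd) \<and> (\<forall>h\<in>carrier H. ssum H Hd H db (%e f. ap f h \<odot> e) = h)"
  using wf by (intro exI[of _ "tens R H Hd ?ys"]) auto
 from someI_ex[OF this] show "db :. (tensor R H Hd)" "h :. H ==> ssum H Hd H db (%e f. ap f h \<odot> e) = h"
  unfolding db_def[symmetric] by auto
qed

lemma db_lin:
 assumes "module R P" "h :. H" and f: "linear_map R H P f"
 shows "ssum H Hd P db (%e g. ap g h \<odot>\<^sub>P f e) = f h"
proof -
 have "f h = f (ssum H Hd H db (%e f. ap f h \<odot> e))" using db(2)[OF assms(2)] by simp
 also have "... = ssum H Hd P db (%e g. ap g h \<odot>\<^sub>P f e)"
  using assms by (simp add: linear_ssum[OF f] linear_mapD(3)[OF f] cong: ssum_cong)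
 finally show ?thesis ..
qed

lemma Hd_ext: "f :. Hd ==> g :. Hd ==> (!!h. h :. H ==> f h = g h) ==> f = g"
 by (auto simp: Hd_sel intro: extensionalityI)

lemma db_dual:
 assumes f: "f :. Hd"
 shows "ssum H Hd Hd db (%e g. ap f e \<odot>\<^sub>Hd g) = f"
proof (rule Hd_ext)
 note R = cring.cring_simprules[OF cring_base]
 fix h assume h: "h :. H"
 have l: "linear_map R Hd (ground R) (%f. ap f h)" using h by simp
 have "ap (ssum H Hd Hd db (%e g. ap f e \<odot>\<^sub>Hd g)) h = ssum H Hd (ground R) db (%e g. ap (ap f e \<odot>\<^sub>Hd g) h)"
  by (rule linear_ssum[OF l]) (use f module_ground in auto)
 also have "... = ssum H Hd (ground R) db (%e g. ap g h \<odot>\<^bsub>ground R\<^esub> ap f e)"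
  using f h by (simp add: Hd_sel(4) ground_def R ap_def)
 also have "... = ap f h"
  by (rule db_lin) (use h f module_ground in auto)
 finally show "ssum H Hd Hd db (%e g. ap f e \<odot>\<^sub>Hd g) h = f h" by (simp add: ap_def)
qed (use f in auto)

text \<open>By the dual basis, t is the sum of all (id \<otimes> g)(t) \<otimes> e. This reduces
  identities between coactions to identities between actions of functionals.\<close>

lemma tensor_dual_ext:
 assumes M: "module R M" and t: "t :. (tensor R M H)" "u :. (tensor R M H)"
  and eq: "!!f. f :. Hd ==> ssum M H M t (%x k. ap f k \<odot>\<^sub>M x) = ssum M H M u (%x k. ap f k \<odot>\<^sub>M x)"
 shows "t = u"
proof -
 let ?Q = "tensor R M H"
 have *: "t = ssum H Hd ?Q db (%e g. tn M H (ssum M H M t (%x k. ap g k \<odot>\<^sub>M x)) e)"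
  if t: "t :. ?Q" for t
 proof -
  have "t = ssum M H ?Q t (%x k. tn M H x k)"
   using tensor_elem[OF M is_module t] by simp
  also have "... = ssum M H ?Q t (%x k. ssum H Hd ?Q db (%e g. ap g k \<odot>\<^sub>?Q tn M H x e))"
   using M by (intro ssum_cong HOL.refl db_lin[symmetric]) simp_all
  also have "... = ssum H Hd ?Q db (%e g. ssum M H ?Q t (%x k. ap g k \<odot>\<^sub>?Q tn M H x e))"
   using M by (intro ssum_swap) simp_all
  also have "... = ssum H Hd ?Q db (%e g. tn M H (ssum M H M t (%x k. ap g k \<odot>\<^sub>M x)) e)"
   using M by simp
  finally show ?thesis .
 qed
 show ?thesis
  using *[OF t(1)] *[OF t(2)] eq by (simp cong: ssum_cong)
qed

section \<open>Endomorphisms and the algebra \<open>H \<bowtie> H*\<close>\<close>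

definition hat where
 "hat x l = ssum H Hd H x (%h f. ap f l \<odot> h)"

lemma hat_lin0: "lin (hat x)"
 unfolding hat_def[abs_def] by simp

lemmas hat_lin [simp] = hat_lin0 linear_comp[OF hat_lin0]
lemmas hat_closed [simp] = linear_mapD(1)[OF hat_lin0]

lemma hat_linear: "l :. H ==> linear_map R (tensor R H Hd) H (%x. hat x l)"
 unfolding hat_def by simp

lemma hat_tn [simp]: "h :. H ==> f :. Hd ==> l :. H ==> hat (tn H Hd h f) l = ap f l \<odot> h"
 unfolding hat_def by simp

text \<open>The inverse of \<open>hat\<close>: a linear map u is expanded along the dual basis as
  the sum of all u(e) \<bowtie> g.\<close>

definition rep where
 "rep u = ssum H Hd (tensor R H Hd) db (%e g. tn H Hd (u e) g)"

lemma rep_hat: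
 assumes x: "x :. (tensor R H Hd)"
 shows "rep (hat x) = x"
proof -
 let ?Q = "tensor R H Hd"
 have "rep (hat x) = ssum H Hd ?Q db (%e g. ssum H Hd ?Q x (%h f. ap f e \<odot>\<^sub>?Q tn H Hd h g))"
  unfolding rep_def hat_def by simp
 also have "... = ssum H Hd ?Q x (%h f. tn H Hd h (ssum H Hd Hd db (%e g. ap f e \<odot>\<^sub>Hd g)))"
  by (rule HOL.trans, (rule ssum_swap; simp)) simp
 also have "... = ssum H Hd ?Q x (tn H Hd)"
  by (simp add: db_dual)
 finally show ?thesis
  using tensor_elem[OF is_module module_Hd x] by simp
qed

lemma rep_closed [simp]: "lin u ==> rep u :. (tensor R H Hd)"
 unfolding rep_def by (simp add: linear_mapD(1))

lemma hat_rep [simp]: "lin u ==> l :. H ==> hat (rep u) l = u l"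
proof -
 assume u: "lin u" and l: "l :. H"
 have "hat (rep u) l = ssum H Hd H db (%e g. hat (tn H Hd (u e) g) l)"
  unfolding rep_def by (rule linear_ssum[OF hat_linear[OF l]]) (simp_all add: linear_mapD(1)[OF u])
 also have "... = u l"
  using db_lin[OF is_module l u] l by (simp add: linear_mapD(1)[OF u])
 finally show ?thesis .
qed

lemma hat_inj:
 assumes "x :. (tensor R H Hd)" "y :. (tensor R H Hd)" "!!l. l :. H ==> hat x l = hat y l"
 shows "x = y"
proof -
 have "x = rep (hat x)" using rep_hat assms(1) by simp
 also have "... = rep (hat y)" unfolding rep_def by (simp add: assms(3))
 also have "... = y" by (rule rep_hat[OF assms(2)])
 finally show ?thesis .
qed

abbreviation "bt \<equiv> bowtie R H S"

lemma bt_sel: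
 "carrier bt = carrier (tensor R H Hd)" "zero bt = zero (tensor R H Hd)" "add bt = add (tensor R H Hd)"
 "smult bt = smult (tensor R H Hd)" "one bt = tn H Hd \<one> \<one>\<^sub>Hd"
 by (simp_all add: bowtie_def)

lemma dual_act_in: "f :. Hd ==> h :. H ==> k :. H ==> dual_act H h f k :. Hd"
 unfolding dual_act_def by (rule restrict_in_Hd, rule linear_comp[OF Hd_linear]) simp_all

lemma ap_dual_act: "h :. H ==> k :. H ==> l :. H ==> ap (dual_act H h f k) l = ap f (k \<otimes> l \<otimes> h)"
 by (simp add: ap_def dual_act_def)

lemma Hd_one [simp]: "\<one>\<^sub>Hd :. Hd" "h :. H ==> \<one>\<^sub>Hd h = counit H h"
 by (simp_all add: Hd_sel(5) restrict_in_Hd counit_linear)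

lemma lsum_R: "lsum R xs = lsum (ground R) xs"
 by (simp add: lsum_def ground_def)

lemma Hd_mult_sw: "f :. Hd ==> g :. Hd ==> h :. H ==>
  (f \<otimes>\<^sub>Hd g) h = sw (ground R) h (%a b. f a \<odot>\<^bsub>ground R\<^esub> g b)"
 by (simp add: Hd_sel(6) lsum_R ssum_wf[OF comul_wf]) (simp add: ground_def)

lemma Hd_mult [simp]:
 assumes f: "f :. Hd" and g: "g :. Hd"
 shows "f \<otimes>\<^sub>Hd g :. Hd"
proof -
 note R = cring.cring_simprules[OF cring_base]
 have b: "bilin R H H (ground R) (%a b. f a \<odot>\<^bsub>ground R\<^esub> g b)"
  using f g module_ground by (intro bilinI linear_smult linear_scalar) (auto intro: Hd_linear)
 have "linear_map R H (ground R) (%h. sw (ground R) h (%a b. f a \<odot>\<^bsub>ground R\<^esub> g b))"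
  by (rule sw_lin[OF module_ground b])
 then have "linear_map R H (ground R) (f \<otimes>\<^sub>Hd g)"
  by (rule linear_map_cong[OF is_module, rotated]) (rule Hd_mult_sw[OF f g])
 then show ?thesis
  by (simp add: Hd_sel(1)) (simp add: Hd_sel(6))
qed

lemma Hd_mult_smult:
 assumes "f :. Hd" "g :. Hd" "h :. H" "module R P" "c :. P"
 shows "ap (f \<otimes>\<^sub>Hd g) h \<odot>\<^sub>P c = sw P h (%a b. ap f a \<odot>\<^sub>P (ap g b \<odot>\<^sub>P c))"
proof -
 have "(f \<otimes>\<^sub>Hd g) h \<odot>\<^sub>P c = sw P h (%a b. (f a \<odot>\<^bsub>ground R\<^esub> g b) \<odot>\<^sub>P c)"
  unfolding Hd_mult_sw[OF assms(1-3)]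
  by (rule linear_ssum[of "ground R" P "%r. r \<odot>\<^sub>P c"])
   (use assms module_ground in \<open>auto simp: ground_def cring.cring_simprules[OF cring_base]\<close>)
 then show ?thesis
  using assms by (simp add: ground_def module.smult_assoc1 ap_def cong: ssum_cong)
qed

lemma bt_mult_wf:
 assumes x: "x :. (tensor R H Hd)" and y: "y :. (tensor R H Hd)"
 shows "set [(h \<otimes> k2, dual_act H (T k1) f k3 \<otimes>\<^sub>Hd g). (h, f) \<leftarrow> x, (k, g) \<leftarrow> y, (k1, k2, k3) \<leftarrow> comul3 H k]
  \<subseteq> carrier H \<times> carrier Hd"
proof -
 have c3: "k1 :. H \<and> k2 :. H \<and> k3 :. H"
  if k: "k :. H" and kk: "(k1, k2, k3) : set (comul3 H k)" for k k1 k2 k3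
 proof -
  obtain k' where "(k', k3) : set (comul H k)" "(k1, k2) : set (comul H k')"
   using kk by (auto simp: comul3_def)
  then show ?thesis using comul_wf[OF k] comul_wf[of k'] by auto
 qed
 have "(h, f) : set x ==> h :. H \<and> f :. Hd" for h f
  using tensor_wf[OF is_module module_Hd x] by auto
 moreover have "(h, f) : set y ==> h :. H \<and> f :. Hd" for h f
  using tensor_wf[OF is_module module_Hd y] by auto
 ultimately have w: "(h, f) : set x ==> (k, g) : set y ==> (k1, k2, k3) : set (comul3 H k) ==>
   h \<otimes> k2 :. H \<and> dual_act H (T k1) f k3 \<otimes>\<^sub>Hd g :. Hd" for h f k g k1 k2 k3
  using c3[of k k1 k2 k3] by (simp add: dual_act_in)
 show ?thesis
  by (clarsimp simp: w)
qed

lemma bt_mult_def: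
 "x \<otimes>\<^sub>bt y = tens R H Hd [(h \<otimes> k2, dual_act H (T k1) f k3 \<otimes>\<^sub>Hd g). (h, f) \<leftarrow> x, (k, g) \<leftarrow> y, (k1, k2, k3) \<leftarrow> comul3 H k]"
 by (simp add: bowtie_def)

lemma bt_mult_closed [simp]:
 "x :. (tensor R H Hd) ==> y :. (tensor R H Hd) ==> x \<otimes>\<^sub>bt y :. (tensor R H Hd)"
 unfolding bt_mult_def by (rule tens_in[OF bt_mult_wf])

lemma lsum_concat_ssum:
 assumes "module R Q" "over A B t"
  and "!!a b. a :. A ==> b :. B ==> set (F a b) \<subseteq> carrier Q"
 shows "lsum Q (concat (map (%(a, b). F a b) t)) = ssum A B Q t (%a b. lsum Q (F a b))"
proof -
 have "lsum Q (concat (map (%(a, b). F a b) t)) = lsum Q (map (%x. lsum Q (case x of (a, b) \<Rightarrow> F a b)) t)"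
  by (rule abelian_monoid.lsum_concat) (use assms in \<open>fastforce+\<close>)
 also have "... = ssum A B Q t (%a b. lsum Q (F a b))"
  unfolding ssum_wf[OF assms(2)] by (simp add: case_prod_unfold)
 finally show ?thesis .
qed

text \<open>The formula for \<open>star\<close> originates here: the convolution with g splits l,
  and the two actions on f become the sandwich k_3 l S^-1(k_1) inside \<open>lact\<close>. The rest
  is exchanging the order of finite sums.\<close>

lemma hat_mult:
 assumes x: "x :. (tensor R H Hd)" and y: "y :. (tensor R H Hd)" and [simp]: "l :. H"
 shows "hat (x \<otimes>\<^sub>bt y) l = star (hat x) (hat y) l"
proof -
 note xw = tensor_wf[OF is_module module_Hd x] and yw = tensor_wf[OF is_module module_Hd y]
 let ?F = "%h f k g. map (%(k1, k2, k3). ap (dual_act H (T k1) f k3 \<otimes>\<^sub>Hd g) l \<odot> (h \<otimes> k2)) (comul3 H k)"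
 have c3: "lsum H (?F h f k g) = sw H k (%k' k3. sw H k' (%k1 k2. ap (dual_act H (T k1) f k3 \<otimes>\<^sub>Hd g) l \<odot> (h \<otimes> k2)))"
  if [simp]: "h :. H" "f :. Hd" "k :. H" "g :. Hd" for h f k g
  unfolding comul3_def by (subst lsum_comp[OF is_module comul_wf comul_wf]) (simp_all add: dual_act_in)
 have Fw: "set (?F h f k g) \<subseteq> carrier H"
  if "h :. H" "f :. Hd" "k :. H" "g :. Hd" for h f k g
 proof -
  have "set (comul3 H k) \<subseteq> carrier H \<times> carrier H \<times> carrier H"
   unfolding comul3_def by (rule set_comp[OF comul_wf comul_wf]) (use that in simp_all)
  then show ?thesis using that by (fastforce simp: dual_act_in)
 qed
 have "hat (x \<otimes>\<^sub>bt y) l = lsum H (map (%(h, f). ap f l \<odot> h) [(h \<otimes> k2, dual_act H (T k1) f k3 \<otimes>\<^sub>Hd g). (h, f) \<leftarrow> x, (k, g) \<leftarrow> y, (k1, k2, k3) \<leftarrow> comul3 H k])"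
  unfolding hat_def bt_mult_def ssum_wf[OF bt_mult_wf[OF x y], symmetric]
  by (rule ssum_tens[OF is_module is_module module_Hd _ bt_mult_wf[OF x y]]) simp
 also have "... = lsum H (concat (map (%(h, f). concat (map (%(k, g). ?F h f k g) y)) x))"
  by (simp add: map_concat o_def case_prod_unfold)
 also have "... = ssum H Hd H x (%h f. lsum H (concat (map (%(k, g). ?F h f k g) y)))"
  by (rule lsum_concat_ssum[OF is_module xw]) (use yw Fw in fastforce)
 also have "... = ssum H Hd H x (%h f. ssum H Hd H y (%k g. lsum H (?F h f k g)))"
  by (rule ssum_eqI, rule lsum_concat_ssum[OF is_module yw]) (use Fw in auto)
 also have "... = ssum H Hd H x (%h f. ssum H Hd H y (%k g. sw H k (%a r. sw H r (%b c.
   sw H l (%p q. ap g q \<odot> (ap f (c \<otimes> (p \<otimes> T a)) \<odot> (h \<otimes> b)))))))"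
 proof (rule ssum_eqI, rule ssum_eqI)
  fix h f k g assume [simp]: "h :. H" "f :. Hd" "k :. H" "g :. Hd"
  have "lsum H (?F h f k g) = sw H k (%k' c. sw H k' (%a b. sw H l (%p q. ap g q \<odot> (ap f (c \<otimes> (p \<otimes> T a)) \<odot> (h \<otimes> b)))))"
   unfolding c3[OF \<open>h :. H\<close> \<open>f :. Hd\<close> \<open>k :. H\<close> \<open>g :. Hd\<close>]
   by (simp add: Hd_mult_smult dual_act_in ap_dual_act smult_commute)
  also have "... = sw H k (%a r. sw H r (%b c. sw H l (%p q. ap g q \<odot> (ap f (c \<otimes> (p \<otimes> T a)) \<odot> (h \<otimes> b)))))"
   by (rule coas) simp_all
  finally show "lsum H (?F h f k g) = ..." .
 qed
 also have "... = ssum H Hd H x (%h f. ssum H Hd H y (%k g. sw H l (%p q. ap g q \<odot> sw H k (%a r. sw H r (%b c. ap f (c \<otimes> (p \<otimes> T a)) \<odot> (h \<otimes> b))))))"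
 proof (rule ssum_eqI, rule ssum_eqI)
  fix h f k g assume [simp]: "h :. H" "f :. Hd" "k :. H" "g :. Hd"
  have "sw H k (%a r. sw H r (%b c. sw H l (%p q. ap g q \<odot> (ap f (c \<otimes> (p \<otimes> T a)) \<odot> (h \<otimes> b))))) = sw H l (%p q. sw H k (%a r. sw H r (%b c. ap g q \<odot> (ap f (c \<otimes> (p \<otimes> T a)) \<odot> (h \<otimes> b)))))"
   by (rule HOL.trans, rule ssum_eqI, (rule sw_swap; simp), rule sw_swap) simp_all
  then show "sw H k (%a r. sw H r (%b c. sw H l (%p q. ap g q \<odot> (ap f (c \<otimes> (p \<otimes> T a)) \<odot> (h \<otimes> b))))) =
   sw H l (%p q. ap g q \<odot> sw H k (%a r. sw H r (%b c. ap f (c \<otimes> (p \<otimes> T a)) \<odot> (h \<otimes> b))))"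
   by simp
 qed
 also have "... = sw H l (%p q. ssum H Hd H y (%k g. ssum H Hd H x (%h f. ap g q \<odot> sw H k (%a r. sw H r (%b c. ap f (c \<otimes> (p \<otimes> T a)) \<odot> (h \<otimes> b))))))"
  by (rule HOL.trans, rule HOL.trans, rule ssum_eqI, (rule ssum_swap; simp), (rule ssum_swap; simp), rule ssum_eqI, rule ssum_swap) simp_all
 also have "... = sw H l (%p q. ssum H Hd H y (%k g. ap g q \<odot> lact (hat x) k p))"
 proof (rule ssum_eqI, rule ssum_eqI)
  fix p q k g assume [simp]: "p :. H" "q :. H" "k :. H" "g :. Hd"
  have "ssum H Hd H x (%h f. sw H k (%a r. sw H r (%b c. ap f (c \<otimes> (p \<otimes> T a)) \<odot> (h \<otimes> b)))) = sw H k (%a r. sw H r (%b c. ssum H Hd H x (%h f. ap f (c \<otimes> (p \<otimes> T a)) \<odot> (h \<otimes> b))))"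
   by (rule HOL.trans, (rule ssum_swap; simp), rule ssum_eqI, rule ssum_swap) simp_all
  also have "... = lact (hat x) k p"
   unfolding lact_def hat_def by simp
  finally have e: "ssum H Hd H x (%h f. sw H k (%a r. sw H r (%b c. ap f (c \<otimes> (p \<otimes> T a)) \<odot> (h \<otimes> b)))) = ..." .
  have "ssum H Hd H x (%h f. ap g q \<odot> sw H k (%a r. sw H r (%b c. ap f (c \<otimes> (p \<otimes> T a)) \<odot> (h \<otimes> b)))) =
   ap g q \<odot> ssum H Hd H x (%h f. sw H k (%a r. sw H r (%b c. ap f (c \<otimes> (p \<otimes> T a)) \<odot> (h \<otimes> b))))"
   by (rule smult_ssum[symmetric]) simp_all
  then show "ssum H Hd H x (%h f. ap g q \<odot> sw H k (%a r. sw H r (%b c. ap f (c \<otimes> (p \<otimes> T a)) \<odot> (h \<otimes> b)))) = ap g q \<odot> lact (hat x) k p"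
   unfolding e .
 qed
 also have "... = star (hat x) (hat y) l"
  unfolding star_def hat_def[of y] by simp
 finally show ?thesis .
qed

lemma hat_one: "l :. H ==> hat \<one>\<^sub>bt l = ue l"
 by (simp add: bt_sel ue_def ap_def)

end

section \<open>The ring \<open>D(H)\<close>\<close>

context weak_hopf_fgp
begin

abbreviation "HD \<equiv> tensor R H Hd"
abbreviation "K \<equiv> double_kernel R H S"
abbreviation "D \<equiv> double R H S"

text \<open>The linear map of p(x) = x(1 \<bowtie> \<epsilon>), by \<open>hat_one_mult\<close>; two
  elements have the same class in D(H) exactly if their maps \<open>Th\<close> agree on H.\<close>

definition Th where
 "Th x l = lact (hat x) \<one> l"

lemma HD_module: "module R HD"
 by simp

lemma hat_linear' [simp]: "l :. H ==> linear_map R Q HD g ==> linear_map R Q H (%x. hat (g x) l)"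
 by (rule linear_comp[OF hat_linear])

lemma lact_hat_linear [simp]:
 "k :. H ==> l :. H ==> module R Q ==> linear_map R Q HD g ==> linear_map R Q H (%x. lact (hat (g x)) k l)"
 unfolding lact_def by simp

lemma Th_lin0: "lin (Th x)"
 unfolding Th_def[abs_def] by simp

lemmas Th_lin [simp] = Th_lin0 linear_comp[OF Th_lin0]
lemmas Th_closed [simp] = linear_mapD(1)[OF Th_lin0]

lemma Th_linear: "l :. H ==> linear_map R HD H (%x. Th x l)"
 unfolding Th_def by simp

lemma lact_cong: "(!!l. l :. H ==> u l = v l) ==> h :. H ==> l :. H ==> lact u h l = lact v h l"
 unfolding lact_def by simp

lemma star_cong: "(!!l. l :. H ==> u l = u' l) ==> (!!l. l :. H ==> v l = v' l) ==>
  (!!l. l :. H ==> v l :. H) ==> l :. H ==> star u v l = star u' v' l"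
 unfolding star_def by (rule ssum_eqI) (simp add: lact_cong[of u u'])

text \<open>The product is computed on chosen representatives, so its linearity is pulled back along
  the injective map \<open>hat\<close> from that of \<open>star\<close>.\<close>

lemma bt_mult_linear:
 assumes x: "x :. HD"
 shows "linear_map R HD HD (%y. y \<otimes>\<^sub>bt x)" "linear_map R HD HD (%y. x \<otimes>\<^sub>bt y)"
proof -
 have l: "linear_map R HD H (%y. star (hat y) (hat x) l)" "linear_map R HD H (%y. star (hat x) (hat y) l)"
  if "l :. H" for l
  unfolding star_def using that by simp_all
 have h: "linear_map R HD H (%y. hat (y \<otimes>\<^sub>bt x) l)" "linear_map R HD H (%y. hat (x \<otimes>\<^sub>bt y) l)"
  if "l :. H" for l
  by (rule linear_map_cong[OF HD_module hat_mult l(1)], use x that in simp_all)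
   (rule linear_map_cong[OF HD_module hat_mult l(2)], use x that in simp_all)
 have g: "linear_map R HD HD F"
  if F: "!!y. y :. HD ==> F y :. HD"
   and l: "!!l. l :. H ==> linear_map R HD H (%y. hat (F y) l)" for F
 proof (rule linear_mapI)
  fix y z assume y: "y :. HD" and z: "z :. HD"
  show "F (y \<oplus>\<^sub>HD z) = F y \<oplus>\<^sub>HD F z"
   using linear_mapD(2)[OF l y z] linear_mapD(2)[OF hat_linear F F, of _ y z] y z F HD_module
   by (intro hat_inj) simp_all
 next
  fix a y assume a: "a :. R" and y: "y :. HD"
  show "F (a \<odot>\<^sub>HD y) = a \<odot>\<^sub>HD F y"
   using linear_mapD(3)[OF l a y] linear_mapD(3)[OF hat_linear a F, of _ y] a y F HD_module
   by (intro hat_inj) simp_all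
 qed (use F in simp)
 show "linear_map R HD HD (%y. y \<otimes>\<^sub>bt x)" "linear_map R HD HD (%y. x \<otimes>\<^sub>bt y)"
  by (rule g; use x h in simp)+
qed

lemma bt_assoc:
 assumes "x :. HD" "y :. HD" "z :. HD"
 shows "x \<otimes>\<^sub>bt y \<otimes>\<^sub>bt z = x \<otimes>\<^sub>bt (y \<otimes>\<^sub>bt z)"
proof (rule hat_inj)
 fix l assume l: "l :. H"
 have "hat (x \<otimes>\<^sub>bt y \<otimes>\<^sub>bt z) l = star (hat x) (hat (y \<otimes>\<^sub>bt z)) l"
  by (rule HOL.trans, rule HOL.trans, (rule hat_mult; (use assms l in simp)), (rule star_cong; (use assms l hat_mult in simp)), (rule HOL.trans, (rule star_assoc; (use l in simp)), rule star_cong)) (use assms l hat_mult linear_mapD(1)[OF star_lin] in simp_all)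
 also have "... = hat (x \<otimes>\<^sub>bt (y \<otimes>\<^sub>bt z)) l"
  by (rule hat_mult[symmetric]) (use assms l in simp_all)
 finally show "hat (x \<otimes>\<^sub>bt y \<otimes>\<^sub>bt z) l = ..." .
qed (use assms in simp_all)

text \<open>With e the preunit, (ue)(ve) = ((ue)v)e = (u(ev))e = (u(ve))e = ((uv)e)e = (uv)e, by
  \<open>star_lact\<close>, \<open>star_ue\<close>, \<open>ue_star\<close> and
  associativity.\<close>

lemma star_lact_one:
 assumes u: "lin u" and v: "lin v" and l: "l :. H"
 shows "lact (star u v) \<one> l = star (lact u \<one>) (lact v \<one>) l"
proof -
 note [simp] = ue_lin star_lin u v
 have "star (lact u \<one>) (lact v \<one>) l = lact (star (lact u \<one>) v) \<one> l"
  by (rule star_lact[symmetric]) (use l in simp_all)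
 also have "... = lact (star (star u ue) v) \<one> l"
  by (rule lact_cong, rule star_cong) (use l in \<open>simp_all add: star_ue linear_mapD(1)[OF v]\<close>)
 also have "... = lact (star u (star ue v)) \<one> l"
  by (rule lact_cong, rule star_assoc) (use l in simp_all)
 also have "... = lact (star u (lact v \<one>)) \<one> l"
  by (rule lact_cong, rule star_cong) (use l in \<open>simp_all add: ue_star linear_mapD(1)[OF star_lin]\<close>)
 also have "... = lact (lact (star u v) \<one>) \<one> l"
  by (rule lact_cong, rule star_lact[symmetric]) (use l in simp_all)
 also have "... = lact (star u v) \<one> l"
  using lact_mult[of "star u v" \<one> \<one> l] l by simp
 finally show ?thesis ..
qed

lemma Th_mult:
 assumes "x :. HD" "y :. HD" "l :. H"
 shows "Th (x \<otimes>\<^sub>bt y) l = star (Th x) (Th y) l"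
proof -
 have "Th (x \<otimes>\<^sub>bt y) l = lact (star (hat x) (hat y)) \<one> l"
  unfolding Th_def by (rule lact_cong) (use assms hat_mult in simp_all)
 also have "... = star (Th x) (Th y) l"
  using star_lact_one[of "hat x" "hat y" l] assms unfolding Th_def[abs_def] by simp
 finally show ?thesis .
qed

lemma one_bt [simp]: "\<one>\<^sub>bt :. HD"
 by (simp add: bt_sel)

lemma Th_one: "l :. H ==> Th \<one>\<^sub>bt l = lact ue \<one> l"
 unfolding Th_def by (rule lact_cong) (simp_all add: hat_one)

lemma lact_one_one: "lin u ==> l :. H ==> lact (lact u \<one>) \<one> l = lact u \<one> l"
 using lact_mult[of u \<one> \<one> l] by simp

lemma hat_one_mult:
 assumes x: "x :. HD" and l: "l :. H"
 shows "hat (\<one>\<^sub>bt \<otimes>\<^sub>bt x) l = Th x l" "hat (x \<otimes>\<^sub>bt \<one>\<^sub>bt) l = Th x l"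
proof -
 have "hat (\<one>\<^sub>bt \<otimes>\<^sub>bt x) l = star ue (hat x) l"
  by (rule HOL.trans, (rule hat_mult; (use x l in simp)), rule star_cong) (use l hat_one linear_mapD(1)[OF ue_lin] in simp_all)
 also have "... = Th x l"
  unfolding Th_def by (rule ue_star) (use l in simp_all)
 finally show "hat (\<one>\<^sub>bt \<otimes>\<^sub>bt x) l = Th x l" .
 have "hat (x \<otimes>\<^sub>bt \<one>\<^sub>bt) l = star (hat x) ue l"
  by (rule HOL.trans, (rule hat_mult; (use x l in simp)), rule star_cong) (use l hat_one linear_mapD(1)[OF ue_lin] in simp_all)
 also have "... = Th x l"
  unfolding Th_def by (rule star_ue) (use l in simp_all)
 finally show "hat (x \<otimes>\<^sub>bt \<one>\<^sub>bt) l = Th x l" .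
qed

lemma Th_one_mult:
 assumes x: "x :. HD" and l: "l :. H"
 shows "Th (\<one>\<^sub>bt \<otimes>\<^sub>bt x) l = Th x l" "Th (x \<otimes>\<^sub>bt \<one>\<^sub>bt) l = Th x l"
proof -
 have t: "lact (Th x) \<one> l = Th x l"
  using lact_one_one[of "hat x" l] l unfolding Th_def[abs_def] by simp
 have "Th (\<one>\<^sub>bt \<otimes>\<^sub>bt x) l = lact (Th x) \<one> l" "Th (x \<otimes>\<^sub>bt \<one>\<^sub>bt) l = lact (Th x) \<one> l"
  by (subst Th_def, rule lact_cong, use x l hat_one_mult in simp_all)+
 then show "Th (\<one>\<^sub>bt \<otimes>\<^sub>bt x) l = Th x l" "Th (x \<otimes>\<^sub>bt \<one>\<^sub>bt) l = Th x l"
  unfolding t by auto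
qed

lemma kernel_iff: "x : K \<longleftrightarrow> x :. HD \<and> (\<forall>l\<in>carrier H. Th x l = \<zero>)"
proof -
 have z: "hat \<zero>\<^sub>HD l = \<zero>" if "l :. H" for l
  by (rule linear_zero[OF _ _ hat_linear]) (use that in simp_all)
 note t = hat_one_mult(2)
 have "x \<otimes>\<^sub>bt \<one>\<^sub>bt = \<zero>\<^sub>HD \<longleftrightarrow> (\<forall>l\<in>carrier H. Th x l = \<zero>)" if x: "x :. HD"
 proof
  assume "x \<otimes>\<^sub>bt \<one>\<^sub>bt = \<zero>\<^sub>HD"
  then show "\<forall>l\<in>carrier H. Th x l = \<zero>" using z t[OF x] by metis
 next
  assume "\<forall>l\<in>carrier H. Th x l = \<zero>"
  then show "x \<otimes>\<^sub>bt \<one>\<^sub>bt = \<zero>\<^sub>HD"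
   by (intro hat_inj) (use x t z HD_module in \<open>simp_all add: abelian_monoid.zero_closed\<close>)
 qed
 then show ?thesis
  by (auto simp: double_kernel_def a_kernel_def' bt_sel)
qed

definition cl where
 "cl x = K +>\<^bsub>bt\<^esub> x"

lemma HD_group: "abelian_group HD" "abelian_group H"
 by (rule modD(1), rule HD_module) (rule modD(1), rule is_module)

lemma mem_cl:
 assumes x: "x :. HD"
 shows "y : cl x \<longleftrightarrow> y :. HD \<and> (\<forall>l\<in>carrier H. Th y l = Th x l)"
proof -
 interpret HD: abelian_group HD by (rule HD_group)
 interpret H: abelian_group H by (rule HD_group)
 have "y : cl x \<longleftrightarrow> (\<exists>k\<in>K. y = k \<oplus>\<^sub>HD x)"
  by (auto simp: cl_def a_r_coset_def' bt_sel)
 also have "... \<longleftrightarrow> y :. HD \<and> (\<forall>l\<in>carrier H. Th y l = Th x l)"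
 proof
  assume "\<exists>k\<in>K. y = k \<oplus>\<^sub>HD x"
  then show "y :. HD \<and> (\<forall>l\<in>carrier H. Th y l = Th x l)"
   using x by (auto simp: kernel_iff linear_mapD(2)[OF Th_linear])
 next
  assume y: "y :. HD \<and> (\<forall>l\<in>carrier H. Th y l = Th x l)"
  let ?k = "y \<oplus>\<^sub>HD \<ominus>\<^bsub>HD\<^esub> x"
  have e: "y = ?k \<oplus>\<^sub>HD x" using x y by (simp add: HD.a_assoc HD.l_neg)
  have "Th ?k l = \<zero>" if l: "l :. H" for l
  proof -
   have "Th ?k l \<oplus> Th x l = Th (?k \<oplus>\<^sub>HD x) l"
    using x y l by (simp add: linear_mapD(2)[OF Th_linear])
   also have "... = Th x l" using e y l by simp
   finally show ?thesis using l by simp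
  qed
  then show "\<exists>k\<in>K. y = k \<oplus>\<^sub>HD x"
   using x y e by (intro bexI[of _ ?k]) (auto simp: kernel_iff)
 qed
 finally show ?thesis .
qed

lemma cl_eq:
 assumes "x :. HD" "y :. HD"
 shows "cl x = cl y \<longleftrightarrow> (\<forall>l\<in>carrier H. Th x l = Th y l)"
proof
 assume "cl x = cl y"
 then have "x : cl y" using assms by (simp add: mem_cl flip: \<open>cl x = cl y\<close>)
 then show "\<forall>l\<in>carrier H. Th x l = Th y l" using assms by (simp add: mem_cl)
qed (use assms in \<open>auto simp: mem_cl\<close>)

abbreviation "Dr \<equiv> double_ring R H S"

lemma Dr_sel:
 "carrier Dr = cl ` carrier HD" "one Dr = cl \<one>\<^sub>bt" "zero Dr = K" "X \<oplus>\<^sub>Dr Y = set_add bt X Y"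
 "X \<otimes>\<^sub>Dr Y = rcoset_mult bt K X Y" "a \<odot>\<^sub>Dr X = (\<Union>x\<in>X. cl (a \<odot>\<^sub>HD x))"
 by (auto simp: double_ring_def FactRing_def A_RCOSETS_def' cl_def ring.defs module.defs bt_sel)

lemma D_sel: "carrier D = carrier Dr" "zero D = zero Dr" "one D = one Dr" "add D = add Dr"
 "mult D = mult Dr" "smult D = smult Dr"
 by (simp_all add: double_def module.defs bialg.defs)

lemma same_D: "same_module Dr D"
 by (simp add: same_module_def D_sel)

lemma D_add:
 assumes "x :. HD" "y :. HD"
 shows "cl x \<oplus>\<^sub>D cl y = cl (x \<oplus>\<^sub>HD y)"
proof -
 interpret HD: abelian_group HD by (rule HD_group)
 interpret H: abelian_group H by (rule HD_group)
 have "z : cl x <+>\<^bsub>bt\<^esub> cl y \<longleftrightarrow> z : cl (x \<oplus>\<^sub>HD y)" for z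
 proof
  assume "z : cl x <+>\<^bsub>bt\<^esub> cl y"
  then show "z : cl (x \<oplus>\<^sub>HD y)"
   using assms by (auto simp: set_add_def' bt_sel mem_cl linear_mapD(2)[OF Th_linear])
 next
  assume z: "z : cl (x \<oplus>\<^sub>HD y)"
  let ?k = "\<ominus>\<^bsub>HD\<^esub> x \<oplus>\<^sub>HD z"
  have zc: "z :. HD" using z assms by (simp add: mem_cl)
  have e: "z = x \<oplus>\<^sub>HD ?k" using assms zc by (simp add: HD.a_assoc[symmetric] HD.r_neg)
  have "Th ?k l = Th y l" if l: "l :. H" for l
  proof -
   have "Th x l \<oplus> Th ?k l = Th (x \<oplus>\<^sub>HD ?k) l"
    using assms zc l by (simp add: linear_mapD(2)[OF Th_linear])
   also have "... = Th x l \<oplus> Th y l" using e z assms l by (simp add: mem_cl linear_mapD(2)[OF Th_linear])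
   finally show ?thesis using l by simp
  qed
  then have "x : cl x" "?k : cl y" using assms zc by (simp_all add: mem_cl)
  then show "z : cl x <+>\<^bsub>bt\<^esub> cl y"
   using e unfolding set_add_def' bt_sel by blast
 qed
 then show ?thesis by (auto simp: D_sel Dr_sel)
qed

lemma cl_self: "x :. HD ==> x : cl x"
 by (simp add: mem_cl)

text \<open>All terms of the union in \<open>rcoset_mult\<close> coincide, because \<open>Th\<close>
  is multiplicative and determines the class.\<close>

lemma D_mult:
 assumes "x :. HD" "y :. HD"
 shows "cl x \<otimes>\<^sub>D cl y = cl (x \<otimes>\<^sub>bt y)"
proof -
 have "cl (a \<otimes>\<^sub>bt b) = cl (x \<otimes>\<^sub>bt y)" if "a : cl x" "b : cl y" for a b
  using that assms star_cong[of "Th a" "Th x" "Th b" "Th y"] by (simp add: mem_cl cl_eq Th_mult)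
 then have "(\<Union>a\<in>cl x. \<Union>b\<in>cl y. cl (a \<otimes>\<^sub>bt b)) = (\<Union>a\<in>cl x. \<Union>b\<in>cl y. cl (x \<otimes>\<^sub>bt y))"
  by (intro SUP_cong HOL.refl)
 also have "... = cl (x \<otimes>\<^sub>bt y)"
  using cl_self[OF assms(1)] cl_self[OF assms(2)] by blast
 finally have "(\<Union>a\<in>cl x. \<Union>b\<in>cl y. cl (a \<otimes>\<^sub>bt b)) = ..." .
 then show ?thesis by (simp add: D_sel Dr_sel rcoset_mult_def cl_def)
qed

lemma D_smult:
 assumes "x :. HD" "a :. R"
 shows "a \<odot>\<^sub>D cl x = cl (a \<odot>\<^sub>HD x)"
proof -
 have "cl (a \<odot>\<^sub>HD y) = cl (a \<odot>\<^sub>HD x)" if "y : cl x" for y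
  using that assms HD_module by (simp add: mem_cl cl_eq linear_mapD(3)[OF Th_linear])
 then have "(\<Union>y\<in>cl x. cl (a \<odot>\<^sub>HD y)) = (\<Union>y\<in>cl x. cl (a \<odot>\<^sub>HD x))"
  by (intro SUP_cong HOL.refl)
 also have "... = cl (a \<odot>\<^sub>HD x)"
  using cl_self[OF assms(1)] by blast
 finally have "(\<Union>y\<in>cl x. cl (a \<odot>\<^sub>HD y)) = ..." .
 then show ?thesis by (simp add: D_sel Dr_sel)
qed

lemma D_zero: "\<zero>\<^sub>D = cl \<zero>\<^sub>HD"
proof -
 interpret HD: abelian_group HD by (rule HD_group)
 have "Th \<zero>\<^sub>HD l = \<zero>" if "l :. H" for l
  by (rule linear_zero[OF _ _ Th_linear]) (use that in simp_all)
 then have "K = cl \<zero>\<^sub>HD" by (auto simp: mem_cl kernel_iff)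
 then show ?thesis by (simp add: D_sel Dr_sel)
qed

lemma D_carrier: "X :. D \<longleftrightarrow> (\<exists>x\<in>carrier HD. X = cl x)"
 by (auto simp: D_sel Dr_sel)

lemma cl_closed [simp]: "x :. HD ==> cl x :. D"
 by (auto simp: D_carrier)

lemma cl_linear: "linear_map R HD D cl"
 by (rule linear_mapI) (simp_all add: D_add D_smult)

lemma module_D [simp]: "module R D"
proof -
 interpret HD: module R HD by (rule HD_module)
 have "abelian_group D"
 proof (rule abelian_groupI)
  fix X assume "X :. D"
  then obtain x where x: "x :. HD" "X = cl x" by (auto simp: D_carrier)
  show "\<exists>Y\<in>carrier D. Y \<oplus>\<^sub>D X = \<zero>\<^sub>D"
   by (rule bexI[of _ "cl (\<ominus>\<^bsub>HD\<^esub> x)"]) (use x in \<open>simp_all add: D_add D_zero HD.l_neg\<close>)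
  show "\<zero>\<^sub>D \<oplus>\<^sub>D X = X" using x by (simp add: D_add D_zero)
  fix Y assume "Y :. D"
  then obtain y where y: "y :. HD" "Y = cl y" by (auto simp: D_carrier)
  show "X \<oplus>\<^sub>D Y :. D" "X \<oplus>\<^sub>D Y = Y \<oplus>\<^sub>D X"
   using x y by (simp_all add: D_add HD.a_comm)
  fix Z assume "Z :. D"
  then obtain z where "z :. HD" "Z = cl z" by (auto simp: D_carrier)
  then show "X \<oplus>\<^sub>D Y \<oplus>\<^sub>D Z = X \<oplus>\<^sub>D (Y \<oplus>\<^sub>D Z)"
   using x y by (simp add: D_add HD.a_assoc)
 next
  show "\<zero>\<^sub>D :. D" by (simp add: D_zero)
 qed
 then show ?thesis
  by (intro moduleI[OF cring_base])
   (auto simp: D_carrier D_add D_smult HD.smult_l_distr HD.smult_r_distr HD.smult_assoc1)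
qed

lemma D_ring: "ring D"
proof (rule ringI)
 show "abelian_group D" by (rule modD(1), rule module_D)
 show "Group.monoid D"
 proof (rule monoidI)
  fix X Y Z assume "X :. D" "Y :. D"
  then obtain x y where x: "x :. HD" "X = cl x" "y :. HD" "Y = cl y" by (auto simp: D_carrier)
  then show "X \<otimes>\<^sub>D Y :. D" by (simp add: D_mult)
  assume "Z :. D"
  then obtain z where "z :. HD" "Z = cl z" by (auto simp: D_carrier)
  then show "X \<otimes>\<^sub>D Y \<otimes>\<^sub>D Z = X \<otimes>\<^sub>D (Y \<otimes>\<^sub>D Z)" using x by (simp add: D_mult bt_assoc)
 next
  fix X assume "X :. D"
  then obtain x where x: "x :. HD" "X = cl x" by (auto simp: D_carrier)
  show "\<one>\<^sub>D \<otimes>\<^sub>D X = X" "X \<otimes>\<^sub>D \<one>\<^sub>D = X"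
   unfolding D_sel(3) Dr_sel(2) using x by (simp_all add: D_mult cl_eq Th_one_mult)
 qed (simp add: D_sel(3) Dr_sel(2))
next
 fix X Y Z assume "X :. D" "Y :. D" "Z :. D"
 then obtain x y z where x: "x :. HD" "X = cl x" "y :. HD" "Y = cl y" "z :. HD" "Z = cl z"
  by (auto simp: D_carrier)
 show "(X \<oplus>\<^sub>D Y) \<otimes>\<^sub>D Z = X \<otimes>\<^sub>D Z \<oplus>\<^sub>D Y \<otimes>\<^sub>D Z"
  "Z \<otimes>\<^sub>D (X \<oplus>\<^sub>D Y) = Z \<otimes>\<^sub>D X \<oplus>\<^sub>D Z \<otimes>\<^sub>D Y"
  using x linear_mapD(2)[OF bt_mult_linear(1)] linear_mapD(2)[OF bt_mult_linear(2)] HD_module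
  by (simp_all add: D_mult D_add)
qed

lemma D_smult_mult:
 assumes "a :. R" "X :. D" "Y :. D"
 shows "(a \<odot>\<^sub>D X) \<otimes>\<^sub>D Y = a \<odot>\<^sub>D (X \<otimes>\<^sub>D Y)" "X \<otimes>\<^sub>D (a \<odot>\<^sub>D Y) = a \<odot>\<^sub>D (X \<otimes>\<^sub>D Y)"
proof -
 obtain x y where x: "x :. HD" "X = cl x" "y :. HD" "Y = cl y"
  using assms by (auto simp: D_carrier)
 show "(a \<odot>\<^sub>D X) \<otimes>\<^sub>D Y = a \<odot>\<^sub>D (X \<otimes>\<^sub>D Y)" "X \<otimes>\<^sub>D (a \<odot>\<^sub>D Y) = a \<odot>\<^sub>D (X \<otimes>\<^sub>D Y)"
  using x assms(1) linear_mapD(3)[OF bt_mult_linear(1)] linear_mapD(3)[OF bt_mult_linear(2)] HD_module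
  by (simp_all add: D_mult D_smult)
qed

definition cls where
 "cls u = cl (rep u)"

text \<open>The representative that the definitions of \<open>double\<close> and \<open>F_ob\<close>
  pick from a class, as a linear map. For the class of u it is controlled only after
  \<open>lact _ \<one>\<close> (\<open>theta_cls\<close>).\<close>

definition theta where
 "theta X = hat (SOME x. x : X)"

lemma cls_closed [simp]: "lin u ==> cls u :. D"
 by (simp add: cls_def)

lemma Th_rep: "lin u ==> l :. H ==> Th (rep u) l = lact u \<one> l"
 unfolding Th_def by (rule lact_cong) simp_all

lemma cls_eq: "lin u ==> lin v ==> cls u = cls v \<longleftrightarrow> (\<forall>l\<in>carrier H. lact u \<one> l = lact v \<one> l)"
 by (simp add: cls_def cl_eq Th_rep)

lemma cls_cong: "lin v ==> (!!l. l :. H ==> u l = v l) ==> cls u = cls v"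
 by (subst cls_eq) (use linear_map_cong[OF is_module, of u v] lact_cong[of u v] in auto)

lemma some_cl: "x :. HD ==> (SOME y. y : cl x) :. HD"
 "x :. HD ==> l :. H ==> Th (SOME y. y : cl x) l = Th x l"
 using someI_ex[of "%y. y : cl x"] cl_self by (auto simp: mem_cl)

lemma some_D: "X :. D ==> (SOME x. x : X) :. HD"
 using some_cl by (auto simp: D_carrier)

lemma theta_lin [simp]: "lin (theta X)"
 by (simp add: theta_def)

lemma theta_cls: "lin u ==> l :. H ==> lact (theta (cls u)) \<one> l = lact u \<one> l"
 using some_cl(2)[of "rep u" l] by (simp add: theta_def cls_def Th_rep) (simp add: Th_def)

lemma cls_theta: "X :. D ==> cls (theta X) = X"
proof -
 assume "X :. D"
 then obtain x where x: "x :. HD" "X = cl x" by (auto simp: D_carrier)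
 then show ?thesis
  using some_cl[of x] unfolding theta_def cls_def by (simp add: cl_eq Th_rep) (simp add: Th_def)
qed

lemma D_cases:
 assumes "X :. D"
 obtains u where "lin u" "X = cls u"
 using cls_theta[OF assms] theta_lin by metis

lemma rep_linear:
 assumes "module R P" "!!l. l :. H ==> linear_map R P H (%p. u p l)"
 shows "linear_map R P HD (%p. rep (u p))"
 unfolding rep_def using assms by simp

lemma cls_linear:
 assumes "module R P" "!!l. l :. H ==> linear_map R P H (%p. u p l)"
 shows "linear_map R P D (%p. cls (u p))"
 unfolding cls_def by (rule linear_comp[OF cl_linear rep_linear[OF assms]])

lemma cls_mult: "lin u ==> lin v ==> cls u \<otimes>\<^sub>D cls v = cls (star u v)"
proof -
 assume u: "lin u" and v: "lin v"
 have "Th (rep u \<otimes>\<^sub>bt rep v) l = Th (rep (star u v)) l" if l: "l :. H" for l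
 proof -
  have "Th (rep u \<otimes>\<^sub>bt rep v) l = star (lact u \<one>) (lact v \<one>) l"
   using u v l star_cong[of "Th (rep u)" "lact u \<one>" "Th (rep v)" "lact v \<one>"]
   by (simp add: Th_mult Th_rep)
  then show ?thesis using u v l star_lact_one[of u v l] by (simp add: Th_rep star_lin)
 qed
 then show ?thesis using u v by (simp add: cls_def D_mult cl_eq star_lin)
qed

lemma D_one: "\<one>\<^sub>D = cls ue"
 unfolding D_sel(3) Dr_sel(2) cls_def by (simp add: cl_eq Th_one Th_rep ue_lin)

lemma double_class: "h :. H ==> f :. Hd ==> double_class R H S h f = cls (%l. ap f l \<odot> h)"
proof -
 assume h: "h :. H" and f: "f :. Hd"
 have "Th (tn H Hd h f) l = lact (%l. ap f l \<odot> h) \<one> l" if "l :. H" for l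
  unfolding Th_def by (rule lact_cong) (use that h f in simp_all)
 moreover have "double_class R H S h f = cl (tn H Hd h f)" by (simp add: double_class_def cl_def)
 ultimately show ?thesis using h f by (simp add: cls_def cl_eq Th_rep)
qed

lemma cls_ssum:
 assumes "!!a b. a :. A ==> b :. B ==> lin (\<gamma> a b)"
 shows "cls (%l. ssum A B H t (%a b. \<gamma> a b l)) = ssum A B D t (%a b. cls (\<gamma> a b))"
proof -
 note [simp] = assms linear_mapD(1)[OF assms]
 have "rep (%l. ssum A B H t (%a b. \<gamma> a b l)) = ssum H Hd HD db (%e g. ssum A B HD t (%a b. tn H Hd (\<gamma> a b e) g))"
  unfolding rep_def by simp
 also have "... = ssum A B HD t (%a b. rep (\<gamma> a b))"
  unfolding rep_def by (rule ssum_swap) simp_all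
 finally have "rep (%l. ssum A B H t (%a b. \<gamma> a b l)) = ..." .
 then show ?thesis
  unfolding cls_def by (simp add: linear_ssum[OF cl_linear])
qed

lemma cls_db: "lin u ==> cls u = ssum H Hd D db (%e g. cls (%l. ap g l \<odot> u e))"
proof -
 assume u: "lin u"
 note [simp] = linear_mapD(1)[OF u]
 have "cls u = cls (%l. ssum H Hd H db (%e g. ap g l \<odot> u e))"
  using u db_lin[OF is_module _ u] by (intro cls_cong[symmetric]) simp_all
 also have "... = ssum H Hd D db (%e g. cls (%l. ap g l \<odot> u e))"
  by (rule cls_ssum) simp
 finally show ?thesis .
qed

end

section \<open>Yetter-Drinfeld modules as modules over \<open>D(H)\<close>\<close>

context weak_hopf_fgp
begin

lemma ua_cong: "yd_module R H M ==> (!!l. l :. H ==> u l = v l) ==> ua M u m = ua M v m"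
 unfolding ua_def by (rule ssum_eqI) simp

lemma F_sel: "carrier (F_ob R H S M) = carrier M" "zero (F_ob R H S M) = zero M" "add (F_ob R H S M) = add M"
 "smult (F_ob R H S M) = smult M" "mult (F_ob R H S M) = mult M" "one (F_ob R H S M) = one M"
 by (simp_all add: F_ob_def module.defs bmodule.defs)

lemma same_F: "same_module M (F_ob R H S M)"
 by (simp add: same_module_def F_sel)

lemma F_module [simp]: "module R M ==> module R (F_ob R H S M)"
 by (rule same_module_module[OF same_F])

lemma F_act:
 assumes [simp]: "yd_module R H M" "m :. M" and X: "X :. D"
 shows "act (F_ob R H S M) X m = ua M (theta X) m"
proof -
 let ?x = "SOME x. x : X"
 have x: "?x :. HD" by (rule some_D[OF X])
 have "act (F_ob R H S M) X m = lsum M (concat (map (%(h, f). map (%(m0, m1). f m1 \<odot>\<^sub>M act M h m0) (coact M m)) ?x))"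
  using X by (simp add: F_ob_def module.defs bmodule.defs)
 also have "... = ssum H Hd M ?x (%h f. co M M m (%x k. ap f k \<odot>\<^sub>M act M h x))"
  by (subst lsum_concat_ssum[OF _ tensor_wf[OF is_module module_Hd x]])
   (use coact_wf[of M m] in \<open>auto simp: ssum_wf[OF coact_wf] ap_def intro!: ssum_cong\<close>)
 also have "... = co M M m (%y k. ssum H Hd M ?x (%h f. ap f k \<odot>\<^sub>M act M h y))"
  by (rule ssum_swap) simp_all
 also have "... = ua M (theta X) m"
  unfolding ua_def theta_def hat_def by simp
 finally show ?thesis .
qed

text \<open>Independence of the representative: \<open>theta (cls u)\<close> and u agree after
  \<open>lact _ \<one>\<close>, which does not change the action
  (\<open>ua_lact_one\<close>).\<close>

lemma F_cls:
 assumes [simp]: "yd_module R H M" "m :. M" and u: "lin u"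
 shows "act (F_ob R H S M) (cls u) m = ua M u m"
proof -
 have "act (F_ob R H S M) (cls u) m = ua M (lact (theta (cls u)) \<one>) m"
  using u by (simp add: F_act ua_lact_one)
 also have "... = ua M (lact u \<one>) m"
  by (rule ua_cong) (simp_all add: theta_cls u)
 finally show ?thesis using u by (simp add: ua_lact_one)
qed

lemma D_linearI:
 assumes "linear_map R HD P (%x. f (cl x))"
 shows "linear_map R D P f"
proof (rule linear_mapI)
 note l = linear_mapD[OF assms]
 show "f X :. P" if "X :. D" for X
  using that l(1) by (auto simp: D_carrier)
 show "f (X \<oplus>\<^sub>D Y) = f X \<oplus>\<^sub>P f Y" if "X :. D" "Y :. D" for X Y
  using that l(2) by (auto simp: D_carrier D_add)
 show "f (a \<odot>\<^sub>D X) = a \<odot>\<^sub>P f X" if "a :. R" "X :. D" for a X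
  using that l(3) by (auto simp: D_carrier D_smult)
qed

lemma cls_hat: "x :. HD ==> cls (hat x) = cl x"
 by (simp add: cls_def rep_hat)

lemma F_left [simp]:
 assumes [simp]: "yd_module R H M"
 shows "left_module R D (F_ob R H S M)"
proof -
 let ?F = "F_ob R H S M"
 show ?thesis
  unfolding left_module_def F_sel
 proof (intro conjI ballI)
  fix X assume X: "X :. D"
  show "linear_map R ?F ?F (act ?F X)"
   unfolding same_module_linear[OF same_F same_F, symmetric]
   by (rule linear_map_cong[OF _ F_act[OF assms _ X]]) (simp_all add: ua_linear)
 next
  fix m assume m: "m :. M"
  have "linear_map R HD M (%x. ua M (hat x) m)"
   unfolding ua_def using m by simp
  then have "linear_map R HD M (%x. act ?F (cl x) m)"
   by (rule linear_map_cong[OF HD_module, rotated]) (use m in \<open>simp add: F_cls flip: cls_hat\<close>)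
  then show "linear_map R D ?F (%X. act ?F X m)"
   unfolding same_module_linear[OF same_module_refl same_F, symmetric] by (rule D_linearI)
 next
  fix X Y m assume X: "X :. D" and Y: "Y :. D" and m: "m :. M"
  then obtain u v where u: "lin u" "X = cls u" "lin v" "Y = cls v" by (metis D_cases)
  then show "act ?F (X \<otimes>\<^sub>D Y) m = act ?F X (act ?F Y m)"
   using m by (simp add: F_cls cls_mult star_lin ua_star linear_mapD(1)[OF ua_linear])
 next
  fix m assume "m :. M"
  then show "act ?F \<one>\<^sub>D m = m" by (simp add: D_one F_cls ue_lin ua_ue)
 qed simp
qed

lemma ap_one [simp]: "h :. H ==> ap \<one>\<^sub>Hd h = counit H h"
 by (simp add: ap_def)

lemma ssum_smult_t [simp]:
 assumes "module R P" "module R M" "module R N" "bilin R M N P bb" "a :. R" "t :. (tensor R M N)"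
 shows "ssum M N P (a \<odot>\<^bsub>tensor R M N\<^esub> t) bb = a \<odot>\<^sub>P ssum M N P t bb"
 by (rule linear_mapD(3)[OF linear_tens_ssum[OF assms(1-4)] assms(5,6)])

text \<open>\<open>iE\<close> and \<open>iF\<close> are the algebra maps sending h to
  [h \<bowtie> \<epsilon>] and g to [1 \<bowtie> g]. Their products span D(H)
  (\<open>cls_expand\<close>), so a D(H)-module is determined by the actions of H and of H^* that
  they induce.\<close>

definition iE where
 "iE h = cls (%l. counit H l \<odot> h)"

definition iF where
 "iF g = cls (%l. ap g l \<odot> \<one>)"

lemma iE_lin0: "linear_map R H D iE"
 unfolding iE_def[abs_def] by (rule cls_linear) simp_all

lemma iF_lin0: "linear_map R Hd D iF"
 unfolding iF_def[abs_def] by (rule cls_linear) simp_all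

lemmas iE_lin [simp] = linear_comp[OF iE_lin0]
lemmas iF_lin [simp] = linear_comp[OF iF_lin0]
lemmas iE_closed [simp] = linear_mapD(1)[OF iE_lin0]
lemmas iF_closed [simp] = linear_mapD(1)[OF iF_lin0]
lemmas iE_push [simp] = linear_ssum[OF iE_lin0 is_module module_D] linear_mapD(3)[OF iE_lin0]

lemma cls_iE: "lin u ==> h :. H ==> cls u \<otimes>\<^sub>D iE h = cls (lact u h)"
proof -
 assume u: "lin u" and h: "h :. H"
 have "cls u \<otimes>\<^sub>D iE h = cls (star u (%l. counit H l \<odot> h))"
  unfolding iE_def using u h by (simp add: cls_mult)
 also have "... = cls (lact u h)"
  by (rule cls_cong) (use u h cou_r[of H _ "%x. lact u h x"] in \<open>simp_all add: star_def\<close>)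
 finally show ?thesis .
qed

lemma cls_iF:
 assumes u: "lin u" and g: "g :. Hd"
 shows "cls u \<otimes>\<^sub>D iF g = cls (dot u g)"
proof -
 have d: "lin (dot u g)" if "lin u" for u using that g by (intro dot_lin Hd_linear)
 have "cls u \<otimes>\<^sub>D iF g = cls (star u (%l. ap g l \<odot> \<one>))"
  unfolding iF_def using u g by (simp add: cls_mult)
 also have "... = cls (dot (lact u \<one>) g)"
  by (rule cls_cong) (use u g d in \<open>simp_all add: star_def dot_def ap_def\<close>)
 also have "... = cls (dot u g)"
  using u g d by (subst cls_eq) (simp_all add: dot_lact Hd_linear)
 finally show ?thesis .
qed

lemma iE_iF:
 assumes [simp]: "h :. H" "g :. Hd"
 shows "iE h \<otimes>\<^sub>D iF g = cls (%l. ap g l \<odot> h)"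
proof -
 have "iE h \<otimes>\<^sub>D iF g = cls (dot (%l. counit H l \<odot> h) g)"
  unfolding iE_def by (rule cls_iF) simp_all
 also have "... = cls (%l. ap g l \<odot> h)"
 proof (rule cls_cong)
  fix l assume [simp]: "l :. H"
  have "dot (%l. counit H l \<odot> h) g l = sw H l (%a b. ap g b \<odot> (counit H a \<odot> h))"
   by (simp only: dot_def ap_def)
  also have "... = ap g l \<odot> h"
   by (rule HOL.trans, rule ssum_eqI, (rule smult_commute; simp), rule cou_l) simp_all
  finally show "dot (%l. counit H l \<odot> h) g l = ..." .
 qed simp
 finally show ?thesis .
qed

lemma iF_mult:
 assumes [simp]: "f :. Hd" "g :. Hd"
 shows "iF f \<otimes>\<^sub>D iF g = iF (f \<otimes>\<^sub>Hd g)"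
proof -
 have "iF f \<otimes>\<^sub>D iF g = cls (dot (%l. ap f l \<odot> \<one>) g)"
  unfolding iF_def[of f] by (rule cls_iF) simp_all
 also have "... = iF (f \<otimes>\<^sub>Hd g)"
  unfolding iF_def
 proof (rule cls_cong)
  fix l assume [simp]: "l :. H"
  have "dot (%l. ap f l \<odot> \<one>) g l = sw H l (%a b. ap g b \<odot> (ap f a \<odot> \<one>))"
   by (simp only: dot_def ap_def)
  also have "... = ap (f \<otimes>\<^sub>Hd g) l \<odot> \<one>"
   by (rule HOL.trans, rule ssum_eqI, (rule smult_commute; simp), rule Hd_mult_smult[symmetric]) simp_all
  finally show "dot (%l. ap f l \<odot> \<one>) g l = ..." .
 qed simp
 finally show ?thesis .
qed

text \<open>In H \<bowtie> H^* the product of h \<bowtie> \<epsilon> and k \<bowtie> \<epsilon> need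
  not be hk \<bowtie> \<epsilon>; by \<open>lact_ue\<close> the two agree after multiplication by
  the preunit.\<close>

lemma iE_mult:
 assumes [simp]: "h :. H" "k :. H"
 shows "iE h \<otimes>\<^sub>D iE k = iE (h \<otimes> k)"
proof -
 have *: "lact (%l. counit H l \<odot> h) k l = h \<otimes> lact ue k l" if [simp]: "h :. H" "k :. H" "l :. H" for h k l
  unfolding lact_def ue_def by simp
 have "iE h \<otimes>\<^sub>D iE k = cls (lact (%l. counit H l \<odot> h) k)"
  unfolding iE_def[of h] by (rule cls_iE) simp_all
 also have "... = iE (h \<otimes> k)"
 proof -
  have "lact (lact (%l. counit H l \<odot> h) k) \<one> l = lact (%l. counit H l \<odot> (h \<otimes> k)) \<one> l" if [simp]: "l :. H" for l
  proof -
   have "lact (lact (%l. counit H l \<odot> h) k) \<one> l = h \<otimes> lact ue k l"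
    by (subst lact_mult) (simp_all add: *)
   also have "... = h \<otimes> (k \<otimes> lact ue \<one> l)" by (subst lact_ue) simp_all
   finally show ?thesis using ue_lin by (simp add: * linear_mapD(1))
  qed
  then show ?thesis unfolding iE_def by (subst cls_eq) simp_all
 qed
 finally show ?thesis .
qed

lemma iE_one: "iE \<one> = \<one>\<^sub>D"
 unfolding D_one iE_def ue_def[abs_def] ..

lemma iF_one: "iF \<one>\<^sub>Hd = \<one>\<^sub>D"
 unfolding D_one iF_def by (rule cls_cong) (simp_all add: ue_lin ue_def)

lemma cls_expand: "lin u ==> cls u = ssum H Hd D db (%e g. iE (u e) \<otimes>\<^sub>D iF g)"
 using cls_db[of u] by (simp add: iE_iF linear_mapD(1))

lemma F_iE:
 assumes [simp]: "yd_module R H M" "m :. M" "h :. H"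
 shows "act (F_ob R H S M) (iE h) m = act M h m"
 using co_counit[of M M m "%x. act M h x"] unfolding iE_def by (simp add: F_cls ua_def)

lemma F_iF:
 assumes [simp]: "yd_module R H M" "m :. M" "g :. Hd"
 shows "act (F_ob R H S M) (iF g) m = co M M m (%x k. ap g k \<odot>\<^sub>M x)"
 unfolding iF_def by (simp add: F_cls ua_def)

lemma F_double_class:
 assumes [simp]: "yd_module R H M" "m :. M" "h :. H" "f :. Hd"
 shows "act (F_ob R H S M) (double_class R H S h f) m = lsum M (map (%(x, k). f k \<odot>\<^sub>M act M h x) (coact M m))"
 by (simp add: double_class F_cls ua_def ssum_wf[OF coact_wf]) (simp add: ap_def)

section \<open>The inverse functor\<close>

definition G_ob where
 "G_ob M = bmodule.extend
   (module.extend (module.truncate M) (bmodule.fields (\<lambda>h\<in>carrier H. \<lambda>m\<in>carrier M. act M (iE h) m)))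
   (ydmodule.fields (\<lambda>m\<in>carrier M. ssum H Hd (tensor R M H) db (%e g. tn M H (act M (iF g) m) e)))"

lemma G_sel: "carrier (G_ob M) = carrier M" "zero (G_ob M) = zero M" "add (G_ob M) = add M"
 "smult (G_ob M) = smult M" "mult (G_ob M) = mult M" "one (G_ob M) = one M"
 by (simp_all add: G_ob_def module.defs bmodule.defs ydmodule.defs)

lemma G_act: "h :. H ==> m :. M ==> act (G_ob M) h m = act M (iE h) m"
 by (simp add: G_ob_def module.defs bmodule.defs ydmodule.defs)

lemma G_coact0: "m :. M ==> coact (G_ob M) m = ssum H Hd (tensor R M H) db (%e g. tn M H (act M (iF g) m) e)"
 by (simp add: G_ob_def module.defs bmodule.defs ydmodule.defs)

lemma same_G: "same_module M (G_ob M)"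
 by (simp add: same_module_def G_sel)

text \<open>Contracting the dual basis with g gives back g (\<open>db_dual\<close>). Together with
  \<open>tensor_dual_ext\<close> this characterizes the coaction of \<open>G_ob M\<close> by the
  action of H^*.\<close>

lemma G_co_ext:
 assumes [simp]: "left_module R D M" "m :. M" and g: "g :. Hd"
 shows "ssum M H M (coact (G_ob M) m) (%x k. ap g k \<odot>\<^sub>M x) = act M (iF g) m"
proof -
 note [simp] = left_moduleD(1)[OF assms(1)] act_lin[OF assms(1)] act_push[OF assms(1) module_D]
 have "ssum M H M (coact (G_ob M) m) (%x k. ap g k \<odot>\<^sub>M x) = ssum H Hd M db (%e \<gamma>. ap g e \<odot>\<^sub>M act M (iF \<gamma>) m)"
  using g by (simp add: G_coact0)
 also have "... = act M (iF (ssum H Hd Hd db (%e \<gamma>. ap g e \<odot>\<^sub>Hd \<gamma>))) m"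
  using g by (simp add: linear_ssum[OF iF_lin0] linear_mapD(3)[OF iF_lin0])
 finally show ?thesis using g by (simp add: db_dual)
qed

lemma G_ua:
 assumes [simp]: "left_module R D M" "m :. M" and u: "lin u"
 shows "act M (cls u) m = ssum M H M (coact (G_ob M) m) (%x k. act M (iE (u k)) x)"
proof -
 note [simp] = left_moduleD(1)[OF assms(1)] act_lin[OF assms(1)] act_push[OF assms(1) module_D]
  linear_comp[OF u] linear_mapD(1)[OF u] ring.ring_simprules(5)[OF D_ring]
 have "act M (cls u) m = ssum H Hd M db (%e g. act M (iE (u e)) (act M (iF g) m))"
  unfolding cls_expand[OF u] by (simp add: left_moduleD(4)[OF assms(1)])
 also have "... = ssum M H M (coact (G_ob M) m) (%x k. act M (iE (u k)) x)"
  by (simp add: G_coact0)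
 finally show ?thesis .
qed

text \<open>Tested with functionals, each axiom becomes a relation in D(H): coassociativity is
  multiplicativity of \<open>iF\<close>, counitality is \<open>iF_one\<close>, and the formula for
  the coaction of hm is the relation between \<open>iF f\<close> and \<open>iE h\<close> contained
  in \<open>cls_iE\<close>.\<close>

lemma G_yd [simp]:
 assumes M [simp]: "left_module R D M"
 shows "yd_module R H (G_ob M)"
proof -
 let ?G = "G_ob M"
 note [simp] = left_moduleD(1)[OF M] act_lin[OF M] act_push[OF M module_D]
  ring.ring_simprules(5)[OF D_ring]
 note assoc = left_moduleD(4)[OF M]
 have tG: "tens R ?G H = tens R M H" "tensor R ?G H = tensor R M H"
  by (rule same_tens[OF same_G same_module_refl, symmetric]) (rule same_tensor[OF same_G same_module_refl, symmetric])
 have sG: "ssum ?G H P t bb = ssum M H P t bb" "ssum A B ?G t \<gamma> = ssum A B M t \<gamma>" for A B P t bb \<gamma>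
  by (simp_all add: ssum_def G_sel lsum_def)
 have mG [simp]: "module R ?G" by (rule same_module_module[OF same_G]) simp
 have Gl: "left_module R H ?G"
  unfolding left_module_def G_sel
 proof (intro conjI ballI)
  fix h assume h: "h :. H"
  show "linear_map R ?G ?G (act ?G h)"
   unfolding same_module_linear[OF same_G same_G, symmetric]
   by (rule linear_map_cong[of _ _ "act M (iE h)"]) (use h in \<open>simp_all add: G_act left_moduleD(2)[OF M]\<close>)
 next
  fix m assume m: "m :. M"
  show "linear_map R H ?G (%h. act ?G h m)"
   unfolding same_module_linear[OF same_module_refl same_G, symmetric]
   by (rule linear_map_cong[of _ _ "%h. act M (iE h) m"]) (use m in \<open>simp_all add: G_act is_module\<close>)
 next
  fix h k m assume "h :. H" "k :. H" "m :. M"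
  then show "act ?G (h \<otimes> k) m = act ?G h (act ?G k m)"
   by (simp add: G_act assoc flip: iE_mult)
 qed (simp_all add: G_act iE_one left_moduleD(5)[OF M])
 have Glin: "linear_map R M (tensor R M H) (coact ?G)"
  by (rule linear_map_cong[OF _ G_coact0]) simp_all
 note [simp] = linear_comp[OF Glin] linear_mapD(1)[OF Glin]
 show ?thesis
 proof (rule yd_moduleI[OF Gl])
  show "linear_map R ?G (tensor R ?G H) (coact ?G)"
   unfolding tG same_module_linear[OF same_G same_module_refl, symmetric] by (rule Glin)
 next
  fix m assume "m :. ?G"
  then have m [simp]: "m :. M" by (simp add: G_sel)
  let ?P = "tensor R (tensor R M H) H" and ?Q = "tensor R M H"
  show "co ?G (tensor R (tensor R ?G H) H) m (%x b. co ?G (tensor R (tensor R ?G H) H) x (%y a. tn (tensor R ?G H) H (tn ?G H y a) b)) =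
    co ?G (tensor R (tensor R ?G H) H) m (%x h. sw (tensor R (tensor R ?G H) H) h (%a b. tn (tensor R ?G H) H (tn ?G H x a) b))"
   unfolding tG sG
  proof (rule tensor_dual_ext[of ?Q])
   fix f assume f [simp]: "f :. Hd"
   show "ssum ?Q H ?Q (ssum M H ?P (coact ?G m) (%x b. ssum M H ?P (coact ?G x) (%y a. tn ?Q H (tn M H y a) b))) (%x k. ap f k \<odot>\<^sub>?Q x) =
     ssum ?Q H ?Q (ssum M H ?P (coact ?G m) (%x h. sw ?P h (%a b. tn ?Q H (tn M H x a) b))) (%x k. ap f k \<odot>\<^sub>?Q x)"
   proof (rule tensor_dual_ext[of M])
    fix f' assume f' [simp]: "f' :. Hd"
    have "ssum M H M (coact ?G m) (%x b. ap f b \<odot>\<^sub>M ssum M H M (coact ?G x) (%y a. ap f' a \<odot>\<^sub>M y)) =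
      ssum M H M (coact ?G m) (%x b. ap f b \<odot>\<^sub>M act M (iF f') x)"
     by (rule ssum_eqI, subst G_co_ext) simp_all
    also have "... = act M (iF f') (ssum M H M (coact ?G m) (%x b. ap f b \<odot>\<^sub>M x))"
     by simp
    also have "... = act M (iF f') (act M (iF f) m)" by (subst G_co_ext) simp_all
    also have "... = act M (iF (f' \<otimes>\<^sub>Hd f)) m" by (simp add: assoc flip: iF_mult)
    also have "... = ssum M H M (coact ?G m) (%x b. ap (f' \<otimes>\<^sub>Hd f) b \<odot>\<^sub>M x)" by (subst G_co_ext) simp_all
    finally have e: "ssum M H M (coact ?G m) (%x b. ap f b \<odot>\<^sub>M ssum M H M (coact ?G x) (%y a. ap f' a \<odot>\<^sub>M y)) = ..." .
    show "ssum M H M (ssum ?Q H ?Q (ssum M H ?P (coact ?G m) (%x b. ssum M H ?P (coact ?G x) (%y a. tn ?Q H (tn M H y a) b))) (%x k. ap f k \<odot>\<^sub>?Q x)) (%x k. ap f' k \<odot>\<^sub>M x) =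
     ssum M H M (ssum ?Q H ?Q (ssum M H ?P (coact ?G m) (%x h. sw ?P h (%a b. tn ?Q H (tn M H x a) b))) (%x k. ap f k \<odot>\<^sub>?Q x)) (%x k. ap f' k \<odot>\<^sub>M x)"
     using e by (simp add: Hd_mult_smult smult_commute)
   qed simp_all
  qed simp_all
  show "co ?G ?G m (%x h. counit H h \<odot>\<^sub>?G x) = m"
   unfolding sG G_sel using G_co_ext[OF M m Hd_one(1)] by (simp add: ap_def iF_one left_moduleD(5)[OF M])
 next
  fix h m assume h [simp]: "h :. H" and "m :. ?G"
  then have m [simp]: "m :. M" by (simp add: G_sel)
  let ?Q = "tensor R M H"
  have "coact ?G (act M (iE h) m) = sw ?Q h (%a r. sw ?Q r (%b c. ssum M H ?Q (coact ?G m) (%x k. tn M H (act M (iE b) x) (c \<otimes> (k \<otimes> T a)))))"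
  proof (rule tensor_dual_ext[of M])
   fix f assume f [simp]: "f :. Hd"
   let ?u = "%l. ap f l \<odot> \<one>"
   have "ssum M H M (coact ?G (act M (iE h) m)) (%x k. ap f k \<odot>\<^sub>M x) = act M (iF f) (act M (iE h) m)"
    by (subst G_co_ext) simp_all
   also have "... = act M (cls (lact ?u h)) m"
    unfolding iF_def by (simp add: assoc flip: cls_iE)
   also have "... = ssum M H M (coact ?G m) (%x k. act M (iE (lact ?u h k)) x)"
    by (rule G_ua) simp_all
   also have "... = ssum M H M (coact ?G m) (%x k. sw M h (%a r. sw M r (%b c. ap f (c \<otimes> (k \<otimes> T a)) \<odot>\<^sub>M act M (iE b) x)))"
    unfolding lact_def by simp
   also have "... = ssum M H M (sw ?Q h (%a r. sw ?Q r (%b c. ssum M H ?Q (coact ?G m) (%x k. tn M H (act M (iE b) x) (c \<otimes> (k \<otimes> T a)))))) (%x k. ap f k \<odot>\<^sub>M x)"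
    by (rule HOL.trans, rule HOL.trans, (rule ssum_swap; simp), rule ssum_eqI, (rule ssum_swap; simp)) simp
   finally show "ssum M H M (coact ?G (act M (iE h) m)) (%x k. ap f k \<odot>\<^sub>M x) = ..." .
  qed simp_all
  then show "coact ?G (act ?G h m) = sw (tensor R ?G H) h (%a r. sw (tensor R ?G H) r (%b c. co ?G (tensor R ?G H) m (%x k. tn ?G H (act ?G b x) (c \<otimes> (k \<otimes> T a)))))"
   unfolding tG sG by (simp add: G_act)
 qed
qed

lemma normal_F: "normal_module R M ==> normal_module R (F_ob R H S M)"
 unfolding normal_module_def F_sel using F_module by metis

lemma normal_G: "normal_module R M ==> normal_module R (G_ob M)"
 unfolding normal_module_def G_sel using same_module_module[OF same_G] by metis

lemma F_obj: "M : yd_objects R H ==> F_ob R H S M : module_objects R D"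
 unfolding yd_objects_def module_objects_def
 by (auto simp: normal_F F_sel) (auto simp: F_ob_def module.defs bmodule.defs restrict_def fun_eq_iff)

lemma G_obj: "M : module_objects R D ==> G_ob M : yd_objects R H"
proof -
 assume M: "M : module_objects R D"
 then have "left_module R D M" "normal_module R M" by (auto simp: module_objects_def)
 moreover have "act (G_ob M) = (\<lambda>h\<in>carrier H. \<lambda>m\<in>carrier (G_ob M). act (G_ob M) h m)"
  unfolding G_sel by (simp add: G_ob_def module.defs bmodule.defs ydmodule.defs cong: restrict_cong)
 moreover have "coact (G_ob M) : extensional (carrier (G_ob M))"
  unfolding G_sel by (simp add: G_ob_def module.defs bmodule.defs ydmodule.defs)
 ultimately show ?thesis by (simp add: yd_objects_def normal_G)
qed

lemma F_G:
 assumes "M : module_objects R D"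
 shows "F_ob R H S (G_ob M) = M"
proof -
 have M [simp]: "left_module R D M" and e: "act M = (\<lambda>b\<in>carrier D. \<lambda>m\<in>carrier M. act M b m)"
  using assms by (auto simp: module_objects_def)
 have a: "act (F_ob R H S (G_ob M)) X m = act M X m" if X: "X :. D" and m: "m :. M" for X m
 proof -
  obtain u where u: "lin u" "X = cls u" by (rule D_cases[OF X])
  have "act (F_ob R H S (G_ob M)) X m = ua (G_ob M) u m"
   using m u by (simp add: F_cls G_sel)
  also have "... = ssum M H M (coact (G_ob M) m) (%x k. act M (iE (u k)) x)"
  proof -
   have "ua (G_ob M) u m = ssum M H M (coact (G_ob M) m) (%x k. act (G_ob M) (u k) x)"
    by (simp add: ua_def ssum_def G_sel lsum_def)
   then show ?thesis by (simp add: G_act linear_mapD(1)[OF u(1)])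
  qed
  also have "... = act M X m" using G_ua[OF M m u(1)] u(2) by simp
  finally show ?thesis .
 qed
 have "act (F_ob R H S (G_ob M)) = act M"
 proof -
  have "act (F_ob R H S (G_ob M)) = (\<lambda>X\<in>carrier D. \<lambda>m\<in>carrier M. act (F_ob R H S (G_ob M)) X m)"
   using F_obj[OF G_obj[OF assms]] unfolding module_objects_def mem_Collect_eq F_sel G_sel by (elim conjE)
  also have "... = act M" using a by (subst e) (simp cong: restrict_cong)
  finally show ?thesis .
 qed
 then show ?thesis
  by (intro bmodule.equality) (simp_all add: F_sel G_sel)
qed

lemma G_F:
 assumes "M : yd_objects R H"
 shows "G_ob (F_ob R H S M) = M"
proof -
 let ?F = "F_ob R H S M"
 have M [simp]: "yd_module R H M" and e: "act M = (\<lambda>b\<in>carrier H. \<lambda>m\<in>carrier M. act M b m)" "coact M : extensional (carrier M)"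
  using assms by (auto simp: yd_objects_def)
 have tF: "tens R ?F H = tens R M H" "tensor R ?F H = tensor R M H"
  by (rule same_tens[OF same_F same_module_refl, symmetric]) (rule same_tensor[OF same_F same_module_refl, symmetric])
 have "coact (G_ob ?F) m = coact M m" if m: "m :. M" for m
 proof (rule tensor_dual_ext[of M])
  have "coact (G_ob ?F) m :. (tensor R (G_ob ?F) H)"
   using m by (intro coact_closed) (simp_all add: G_sel F_sel)
  then show "coact (G_ob ?F) m :. (tensor R M H)"
   using same_tensor[OF same_G[of ?F] same_module_refl[of H]] tF by simp
  fix f assume f: "f :. Hd"
  have "ssum M H M (coact (G_ob ?F) m) (%x k. ap f k \<odot>\<^sub>M x) = ssum ?F H ?F (coact (G_ob ?F) m) (%x k. ap f k \<odot>\<^sub>?F x)"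
   by (simp add: ssum_def F_sel lsum_def)
  also have "... = ssum M H M (coact M m) (%x k. ap f k \<odot>\<^sub>M x)"
   using m f by (subst G_co_ext) (simp_all add: F_sel F_iF)
  finally show "ssum M H M (coact (G_ob ?F) m) (%x k. ap f k \<odot>\<^sub>M x) = ..." .
 qed (use m in simp_all)
 then have c: "coact (G_ob ?F) = coact M"
  by (intro extensionalityI[OF _ e(2)]) (simp_all add: G_ob_def module.defs bmodule.defs ydmodule.defs F_ob_def)
 have "act (G_ob ?F) = act M"
  by (subst e(1)) (auto simp: G_ob_def module.defs bmodule.defs ydmodule.defs F_sel fun_eq_iff F_iE)
 with c show ?thesis
  by (intro ydmodule.equality) (simp_all add: F_sel G_sel)
qed

lemma ssum_map_fst:
 assumes t: "over M H t" and f: "!!x. x :. M ==> f x :. N"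
 shows "ssum N H P (map (%(x, k). (f x, k)) t) bb = ssum M H P t (%x k. bb (f x) k)"
proof -
 have w: "set (map (%(x, k). (f x, k)) t) \<subseteq> carrier N \<times> carrier H"
  using t f by auto
 show ?thesis
  unfolding ssum_wf[OF w] ssum_wf[OF t] by (simp add: o_def case_prod_unfold)
qed

lemma co_colinear:
 assumes [simp]: "yd_module R H M" "yd_module R H N" "module R P" "m :. M"
  and f: "linear_map R M N f" "right_colinear R H M N f" and bb: "bilin R N H P bb"
 shows "co N P (f m) bb = co M P m (%x k. bb (f x) k)"
proof -
 note [simp] = linear_mapD(1)[OF f(1)]
 have "coact N (f m) = tens R N H (map (%(x, k). (f x, k)) (coact M m))"
  using f(2) by (simp add: right_colinear_def)
 moreover have w: "set (map (%(x, k). (f x, k)) (coact M m)) \<subseteq> carrier N \<times> carrier H"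
  using coact_wf[of M m] by auto
 ultimately have "co N P (f m) bb = ssum N H P (map (%(x, k). (f x, k)) (coact M m)) bb"
  using ssum_tens[OF _ _ is_module bb w] by simp
 then show ?thesis
  by (simp only: ssum_map_fst[OF coact_wf[OF assms(1,4)] linear_mapD(1)[OF f(1)]])
qed

text \<open>One direction tests with \<open>iE\<close> and \<open>iF\<close>, the latter separating
  coactions by \<open>tensor_dual_ext\<close>; the other follows from the form u(m_1) m_0 of the
  action of a class.\<close>

lemma F_linear_iff:
 assumes [simp]: "yd_module R H M" "yd_module R H N"
 shows "left_linear R D (F_ob R H S M) (F_ob R H S N) f \<longleftrightarrow> left_linear R H M N f \<and> right_colinear R H M N f"
proof -
 let ?FM = "F_ob R H S M" and ?FN = "F_ob R H S N"
 have *: ?thesis if f: "linear_map R M N f"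
 proof
  note [simp] = linear_mapD(1)[OF f] linear_comp[OF f]
  assume "left_linear R D ?FM ?FN f"
  then have a: "f (act ?FM X m) = act ?FN X (f m)" if "X :. D" "m :. M" for X m
   using that by (simp add: left_linear_def F_sel)
  have "f (act M h m) = act N h (f m)" if "h :. H" "m :. M" for h m
   using a[of "iE h" m] that by (simp add: F_iE)
  moreover have "coact N (f m) = tens R N H (map (%(x, k). (f x, k)) (coact M m))" if m: "m :. M" for m
  proof (rule tensor_dual_ext[of N])
   have w: "set (map (%(x, k). (f x, k)) (coact M m)) \<subseteq> carrier N \<times> carrier H"
    using coact_wf[of M m] m by auto
   show "tens R N H (map (%(x, k). (f x, k)) (coact M m)) :. (tensor R N H)"
    using tens_in[OF w] .
   fix g assume g: "g :. Hd"
   have "ssum N H N (coact N (f m)) (%x k. ap g k \<odot>\<^sub>N x) = act ?FN (iF g) (f m)"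
    using m g by (simp add: F_iF)
   also have "... = f (act ?FM (iF g) m)" using a m g by simp
   also have "... = ssum M H N (coact M m) (%x k. ap g k \<odot>\<^sub>N f x)"
    using m g by (simp add: F_iF linear_ssum[OF f] linear_mapD(3)[OF f])
   also have "... = ssum N H N (tens R N H (map (%(x, k). (f x, k)) (coact M m))) (%x k. ap g k \<odot>\<^sub>N x)"
    using m g by (subst ssum_tens[OF _ _ is_module _ w])
      (simp_all add: ssum_map_fst[OF coact_wf[OF assms(1) m] linear_mapD(1)[OF f]])
   finally show "ssum N H N (coact N (f m)) (%x k. ap g k \<odot>\<^sub>N x) = ..." .
  qed (use m in simp_all)
  ultimately show "left_linear R H M N f \<and> right_colinear R H M N f"
   using f by (simp add: left_linear_def right_colinear_def)
 next
  note [simp] = linear_mapD(1)[OF f] linear_comp[OF f]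
  assume fl: "left_linear R H M N f \<and> right_colinear R H M N f"
  then have fa: "f (act M h m) = act N h (f m)" if "h :. H" "m :. M" for h m
   using that by (simp add: left_linear_def)
  have "f (act ?FM X m) = act ?FN X (f m)" if X: "X :. D" and m: "m :. M" for X m
  proof -
   obtain u where u: "lin u" "X = cls u" by (rule D_cases[OF X])
   note [simp] = linear_comp[OF u(1)] linear_mapD(1)[OF u(1)]
   have "f (act ?FM X m) = co M N m (%x k. act N (u k) (f x))"
    using m u by (simp add: F_cls ua_def linear_ssum[OF f] fa)
   also have "... = co N N (f m) (%x k. act N (u k) x)"
    using m f fl by (subst co_colinear[of M N]) simp_all
   finally show ?thesis using m u by (simp add: F_cls ua_def)
  qed
  then show "left_linear R D ?FM ?FN f"
   using f by (simp add: left_linear_def F_sel same_module_linear[OF same_F same_F, symmetric])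
 qed
 show ?thesis
 proof (cases "linear_map R M N f")
  case False
  then show ?thesis by (simp add: left_linear_def same_module_linear[OF same_F same_F, symmetric])
 next
  case True
  then show ?thesis by (rule *)
 qed
qed

end

section \<open>The coalgebra \<open>D(H)\<close>\<close>

context weak_hopf_fgp
begin

abbreviation "HH \<equiv> tensor R Hd Hd"

text \<open>By the dual basis, H^* \<otimes> H^* embeds into the bilinear forms on H; this makes the
  description in \<open>dual_comul\<close> unique.\<close>

lemma dual_comul_unique:
 assumes t: "t :. HH" and u: "u :. HH"
  and eq: "!!h k. h :. H ==> k :. H ==> ssum Hd Hd (ground R) t (%f g. ap f h \<odot>\<^bsub>ground R\<^esub> ap g k) =
   ssum Hd Hd (ground R) u (%f g. ap f h \<odot>\<^bsub>ground R\<^esub> ap g k)"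
 shows "t = u"
proof -
 have *: "t = ssum H Hd HH db (%e \<gamma>. tn Hd Hd \<gamma> (ssum Hd Hd Hd t (%f g. ap f e \<odot>\<^sub>Hd g)))" if t: "t :. HH" for t
 proof -
  have "t = ssum Hd Hd HH t (%f g. tn Hd Hd (ssum H Hd Hd db (%e \<gamma>. ap f e \<odot>\<^sub>Hd \<gamma>)) g)"
   using tensor_elem[OF module_Hd module_Hd t] by (simp add: db_dual)
  also have "... = ssum H Hd HH db (%e \<gamma>. ssum Hd Hd HH t (%f g. ap f e \<odot>\<^sub>HH tn Hd Hd \<gamma> g))"
   by (rule HOL.trans[rotated], (rule ssum_swap; simp)) simp
  finally show ?thesis by simp
 qed
 have "ssum Hd Hd Hd t (%f g. ap f e \<odot>\<^sub>Hd g) = ssum Hd Hd Hd u (%f g. ap f e \<odot>\<^sub>Hd g)" if e: "e :. H" for e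
 proof (rule Hd_ext)
  have ev: "ap (ssum Hd Hd Hd t (%f g. ap f e \<odot>\<^sub>Hd g)) k = ssum Hd Hd (ground R) t (%f g. ap f e \<odot>\<^bsub>ground R\<^esub> ap g k)"
   if k: "k :. H" for k t
  proof -
   have l: "linear_map R Hd (ground R) (%f. ap f k)" using k by simp
   have "ap (ssum Hd Hd Hd t (%f g. ap f e \<odot>\<^sub>Hd g)) k = ssum Hd Hd (ground R) t (%f g. ap f e \<odot>\<^bsub>ground R\<^esub> ap g k)"
    by (rule HOL.trans, (rule linear_ssum[OF l]; (use e module_ground in simp)), rule ssum_eqI, rule linear_mapD(3)[OF l]) (use e in simp_all)
   then show ?thesis .
  qed
  show "ssum Hd Hd Hd t (%f g. ap f e \<odot>\<^sub>Hd g) k = ssum Hd Hd Hd u (%f g. ap f e \<odot>\<^sub>Hd g) k"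
   if k: "k :. H" for k
   using ev[OF k, of t] ev[OF k, of u] eq[OF e k] by (simp add: ap_def)
 qed (use e in simp_all)
 then show ?thesis using *[OF t] *[OF u] by simp
qed

text \<open>This is f \<leftharpoonup> e. The comultiplication of f is the sum of all g \<otimes> (f
  \<leftharpoonup> e), with (e, g) running over the dual basis.\<close>

definition shift where
 "shift f e = (\<lambda>k\<in>carrier H. f (e \<otimes> k))"

lemma shift_ap: "k :. H ==> ap (shift f e) k = ap f (e \<otimes> k)"
 by (simp add: shift_def ap_def)

lemma bilin_shift: "bilin R Hd H Hd shift"
proof (rule bilinI)
 have c: "shift f e :. Hd" if "f :. Hd" "e :. H" for f e
  unfolding shift_def by (rule restrict_in_Hd, rule linear_comp[OF Hd_linear]) (use that in simp_all)
 have l: "f (x \<oplus> y) = f x \<oplus>\<^sub>R f y" "a :. R ==> f (a \<odot> x) = a \<otimes>\<^sub>R f x"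
  if "f :. Hd" "x :. H" "y :. H" for f x y a
  using linear_mapD[OF Hd_linear[OF that(1)]] that by (simp_all add: ground_def)
 show "linear_map R Hd Hd (%f. shift f e)" if "e :. H" for e
  using that c by (intro linear_mapI) (auto simp: shift_def Hd_sel(3,4) intro!: restrict_ext)
 show "linear_map R H Hd (shift f)" if "f :. Hd" for f
 proof (intro linear_mapI)
  fix x y a assume x: "x :. H" and y: "y :. H"
  have "(x \<oplus> y) \<otimes> k = x \<otimes> k \<oplus> y \<otimes> k" if "k :. H" for k
   using x y that is_ring by (simp add: ring.ring_simprules)
  then show "shift f (x \<oplus> y) = shift f x \<oplus>\<^sub>Hd shift f y"
   using that x y by (auto simp: shift_def Hd_sel(3) l intro!: restrict_ext)
 next
  fix a x assume "a :. R" "x :. H"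
  then show "shift f (a \<odot> x) = a \<odot>\<^sub>Hd shift f x"
   using that smult_mult[of a x] by (auto simp: shift_def Hd_sel(4) l intro!: restrict_ext)
 qed (use c that in simp)
qed

lemmas shift_lin [simp] = bilin_lin[OF bilin_shift]

lemma dual_comul:
 assumes f: "f :. Hd"
 shows "dual_comul R H f = ssum H Hd HH db (%e g. tn Hd Hd g (shift f e))"
proof -
 let ?t = "ssum H Hd HH db (%e g. tn Hd Hd g (shift f e))"
 note R = cring.cring_simprules[OF cring_base]
 have conv: "lsum R (map (%(f1, f2). f1 h \<otimes>\<^sub>R f2 k) t) = ssum Hd Hd (ground R) t (%f g. ap f h \<odot>\<^bsub>ground R\<^esub> ap g k)"
  if "t :. HH" for t h k
  unfolding ssum_wf[OF tensor_wf[OF module_Hd module_Hd that]] lsum_R by (simp add: ap_def ground_def)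
 have t: "?t :. HH" using f by simp
 have "lsum R (map (%(f1, f2). f1 h \<otimes>\<^sub>R f2 k) ?t) = f (h \<otimes> k)" if [simp]: "h :. H" "k :. H" for h k
 proof -
  have "lsum R (map (%(f1, f2). f1 h \<otimes>\<^sub>R f2 k) ?t) = ssum H Hd (ground R) db (%e g. ap g h \<odot>\<^bsub>ground R\<^esub> ap f (e \<otimes> k))"
   unfolding conv[OF t] using f module_ground by (simp add: shift_ap)
  also have "... = ap f (h \<otimes> k)"
   by (rule db_lin) (use f module_ground in simp_all)
  finally show ?thesis by (simp add: ap_def)
 qed
 then show ?thesis
  unfolding dual_comul_def
  using t by (intro the_equality) (auto intro!: dual_comul_unique simp flip: conv)
qed

lemma dual_comul_closed [simp]: "f :. Hd ==> dual_comul R H f :. HH"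
 by (simp add: dual_comul)

lemma dual_comul_wf: "f :. Hd ==> set (dual_comul R H f) \<subseteq> carrier Hd \<times> carrier Hd"
 by (rule tensor_wf) simp_all

lemma ssum_dual_comul:
 assumes "f :. Hd" "h :. H" "k :. H" "module R P" "p :. P"
 shows "ssum Hd Hd P (dual_comul R H f) (%f1 f2. ap f1 h \<odot>\<^sub>P (ap f2 k \<odot>\<^sub>P p)) = ap f (h \<otimes> k) \<odot>\<^sub>P p"
 using assms db_lin[OF assms(4,2), of "%e. ap f (e \<otimes> k) \<odot>\<^sub>P p"] by (simp add: dual_comul shift_ap)

lemma iEF_closed [simp]: "X :. D ==> Y :. D ==> X \<otimes>\<^sub>D Y :. D"
 using ring.ring_simprules(5)[OF D_ring] .

lemma bilin_D_mult: "bilin R D D D (mult D)"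
 using D_ring by (intro bilinI linear_mapI) (auto simp: D_smult_mult ring.ring_simprules)

lemmas D_mult_lin [simp] = bilin_lin(1,2)[OF bilin_D_mult]
lemmas D_mult_push [simp] = bilin_push[OF bilin_D_mult module_D module_D module_D]

lemma comul_D_closed:
 assumes X: "X :. D"
 shows "comul D X :. (tensor R D D)" (is ?c)
  and "module R P ==> bilin R D D P bb ==> ssum D D P (comul D X) bb =
   ssum H Hd P (SOME x. x : X) (%h f. sw P h (%a b. ssum Hd Hd P (dual_comul R H f)
    (%f1 f2. bb (iE b \<otimes>\<^sub>D iF f1) (iE a \<otimes>\<^sub>D iF f2))))" (is "_ ==> _ ==> ?s")
proof -
 let ?x = "SOME x. x : X" and ?Q = "tensor R D D"
 have x: "?x :. HD" by (rule some_D[OF X])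
 have "comul D X = tens R Dr Dr (concat (map (%(h, f). concat (map (%(a, b). map (%(f1, f2).
   (double_class R H S b f1, double_class R H S a f2)) (dual_comul R H f)) (comul H h))) ?x))"
  by (simp add: double_def module.defs bialg.defs)
 also have "... = tens R D D (concat (map (%(h, f). concat (map (%(a, b). map (%(f1, f2).
   (double_class R H S b f1, double_class R H S a f2)) (dual_comul R H f)) (comul H h))) ?x))"
  by (simp add: same_tens[OF same_D same_D])
 also have "... = ssum H Hd ?Q ?x (%h f. sw ?Q h (%a b. ssum Hd Hd ?Q (dual_comul R H f)
   (%f1 f2. tn D D (iE b \<otimes>\<^sub>D iF f1) (iE a \<otimes>\<^sub>D iF f2))))"
  by (rule HOL.trans, (rule tens_comp3_ssum[OF module_D module_D tensor_wf[OF is_module module_Hd x] comul_wf dual_comul_wf]; simp add: double_class)) (simp add: double_class iE_iF)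
 finally have c: "comul D X = ..." .
 show ?c unfolding c by simp
 assume [simp]: "module R P" "bilin R D D P bb"
 show ?s unfolding c by simp
qed

lemma comul_D_wf: "X :. D ==> set (comul D X) \<subseteq> carrier D \<times> carrier D"
 by (rule tensor_wf[OF module_D module_D comul_D_closed(1)])

lemma ssum_G: "ssum (G_ob A) H P t bb = ssum A H P t bb"
 by (simp add: ssum_def G_sel)

text \<open>
 The action of \<open>\<Delta>(X)\<close> on \<open>M \<otimes> N\<close>, for Yetter-Drinfeld modules \<open>M\<close>, \<open>N\<close> and \<open>X\<close> represented by \<open>u\<close>.
\<close>

definition V where
 "V P M N bb m n u = co M P m (%x k. co N P n (%y l. sw P (u (k \<otimes> l)) (%q r. bb (act M r x) (act N q y))))"

lemma V_cong0: "(!!l. l :. H ==> u l = v l) ==> V P M N bb m n u = V P M N bb m n v"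
 unfolding V_def by (rule ssum_eqI, rule ssum_eqI) simp

text \<open>Well-definedness of \<Delta> on classes, as far as its action on modules goes:
  \<open>co_co_act\<close>, with N before M, collects the legs of 1 that \<open>lact\<close>
  produces, \<open>co_co_one\<close> leaves a single \<Delta>(1), and the action of u(kl) absorbs
  it.\<close>

lemma V_lact:
 assumes [simp]: "yd_module R H M" "yd_module R H N" "module R P" "m :. M" "n :. N"
  and bb [simp]: "bilin R M N P bb" and u: "lin u"
 shows "V P M N bb m n (lact u \<one>) = V P M N bb m n u"
proof -
 note [simp] = linear_comp[OF u] linear_mapD(1)[OF u] bilin_lin[OF bb]
 let ?\<gamma> = "%y x z. sw P (u z) (%q r. bb (act M r x) (act N q y))"
 have tri: "trilin R N M H P ?\<gamma>" by simp
 have "V P M N bb m n (lact u \<one>) = co M P m (%x k. co N P n (%y l. sw P \<one> (%a r. sw P r (%s d. sw P s (%b c.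
   ?\<gamma> (act N b y) (act M c x) (d \<otimes> (k \<otimes> l \<otimes> T a)))))))"
  unfolding V_def lact_def
 proof (rule ssum_eqI, rule ssum_eqI)
  fix x k y l assume [simp]: "x :. M" "k :. H" "y :. N" "l :. H"
  show "sw P (sw H \<one> (%a r. sw H r (%b c. u (c \<otimes> (k \<otimes> l \<otimes> T a)) \<otimes> b))) (%q r. bb (act M r x) (act N q y)) =
   sw P \<one> (%a r. sw P r (%s d. sw P s (%b c. ?\<gamma> (act N b y) (act M c x) (d \<otimes> (k \<otimes> l \<otimes> T a)))))"
  proof -
   have "sw P (v \<otimes> b) (%q r. bb (act M r x) (act N q y)) =
    sw P b (%p c. sw P v (%q r. bb (act M r (act M c x)) (act N q (act N p y))))"
    if "v :. H" "b :. H" for v b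
    using that by (simp add: sw_mult sw_swap[of P _ v b])
   then show ?thesis by simp
  qed
 qed
 also have "... = co N P n (%y l. co M P m (%x k. sw P \<one> (%a r. sw P r (%s d. sw P s (%b c.
   ?\<gamma> (act N b y) (act M c x) (d \<otimes> (k \<otimes> l \<otimes> T a)))))))"
  by (rule ssum_swap) simp_all
 also have "... = sw P \<one> (%a r. sw P r (%s d. sw P s (%b c. co N P n (%y l. co M P m (%x k.
   ?\<gamma> (act N b y) (act M c x) (d \<otimes> (k \<otimes> (l \<otimes> T a))))))))"
 proof -
  have 1: "co M P m (%x k. sw P \<one> (%a r. sw P r (%s d. sw P s (%b c. ?\<gamma> (act N b y) (act M c x) (d \<otimes> (k \<otimes> l \<otimes> T a)))))) =
   sw P \<one> (%a r. sw P r (%s d. sw P s (%b c. co M P m (%x k. ?\<gamma> (act N b y) (act M c x) (d \<otimes> (k \<otimes> (l \<otimes> T a)))))))"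
   if [simp]: "y :. N" "l :. H" for y l
   by (subst co_swap, simp, simp, rule ssum_eqI, subst co_swap, simp, simp,
     rule ssum_eqI, subst co_swap, simp, simp) simp
  have "co N P n (%y l. co M P m (%x k. sw P \<one> (%a r. sw P r (%s d. sw P s (%b c.
    ?\<gamma> (act N b y) (act M c x) (d \<otimes> (k \<otimes> l \<otimes> T a))))))) =
   co N P n (%y l. sw P \<one> (%a r. sw P r (%s d. sw P s (%b c. co M P m (%x k.
    ?\<gamma> (act N b y) (act M c x) (d \<otimes> (k \<otimes> (l \<otimes> T a))))))))"
   by (rule ssum_eqI, rule 1)
  also have "... = sw P \<one> (%a r. sw P r (%s d. sw P s (%b c. co N P n (%y l. co M P m (%x k.
   ?\<gamma> (act N b y) (act M c x) (d \<otimes> (k \<otimes> (l \<otimes> T a))))))))"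
   by (subst co_swap, simp, simp, rule ssum_eqI, subst co_swap, simp, simp,
     rule ssum_eqI, subst co_swap, simp, simp) simp
  finally show ?thesis .
 qed
 also have "... = co N P n (%y l. co M P m (%x k. sw P \<one> (%a b. ?\<gamma> (act N a y) (act M b x) (k \<otimes> l))))"
  by (rule HOL.trans, rule HOL.trans, (rule co_co_act[symmetric]; simp add: tri), (rule co_co_one; simp add: tri), subst co_swap[symmetric], simp, simp, rule ssum_eqI, subst co_swap[symmetric], simp, simp) simp
 also have "... = co N P n (%y l. co M P m (%x k. ?\<gamma> y x (k \<otimes> l)))"
 proof (rule ssum_eqI, rule ssum_eqI)
  fix x k y l assume [simp]: "x :. M" "k :. H" "y :. N" "l :. H"
  have "sw P \<one> (%a b. ?\<gamma> (act N a y) (act M b x) (k \<otimes> l)) = sw P (u (k \<otimes> l) \<otimes> \<one>) (%q r. bb (act M r x) (act N q y))"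
   by (subst sw_mult, simp_all only: assms H_ring) (simp_all add: sw_swap[of P _ "u (k \<otimes> l)" \<one>])
  then show "sw P \<one> (%a b. ?\<gamma> (act N a y) (act M b x) (k \<otimes> l)) = ?\<gamma> y x (k \<otimes> l)" by simp
 qed
 also have "... = V P M N bb m n u"
  unfolding V_def by (rule ssum_swap) simp_all
 finally show ?thesis .
qed

lemma V_theta:
 assumes "yd_module R H M" "yd_module R H N" "module R P" "m :. M" "n :. N" "bilin R M N P bb" "lin u"
 shows "V P M N bb m n (theta (cls u)) = V P M N bb m n u"
proof -
 have "V P M N bb m n (lact (theta (cls u)) \<one>) = V P M N bb m n (lact u \<one>)"
  by (rule V_cong0) (simp add: theta_cls assms)
 then show ?thesis
  using V_lact[OF assms(1-6), of u] V_lact[OF assms(1-6), of "theta (cls u)"] assms(7) by simp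
qed

text \<open>Each factor of \<Delta>(X) is \<open>iE\<close> times \<open>iF\<close>. The
  \<open>iF\<close> parts become the coactions of \<open>G_ob\<close>, and the comultiplication of
  H^*, being dual to multiplication, evaluates f at the product of the two coaction legs.\<close>

lemma comul_D_act:
 assumes A [simp]: "left_module R D A" and B [simp]: "left_module R D B"
  and [simp]: "X :. D" "module R P" "a :. A" "b :. B" and bb: "bilin R A B P bb"
 shows "ssum D D P (comul D X) (%Y Z. bb (act A Y a) (act B Z b)) = V P (G_ob A) (G_ob B) bb a b (theta X)"
proof -
 note [simp] = left_moduleD(1)[OF A] act_lin[OF A] act_push[OF A module_D]
  left_moduleD(1)[OF B] act_lin[OF B] act_push[OF B module_D] bilin_lin[OF bb] bilin_push[OF bb]
 have cc [simp]: "linear_map R Q M g ==> linear_map R Q M (%x. g x)" for Q M g .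
 let ?A = "coact (G_ob A) a" and ?B = "coact (G_ob B) b" and ?x = "SOME x. x : X"
 let ?g = "%p q k l. bb (act A (iE q) k) (act B (iE p) l)"
 have "ssum D D P (comul D X) (%Y Z. bb (act A Y a) (act B Z b)) =
  ssum H Hd P ?x (%h f. sw P h (%p q. ssum Hd Hd P (dual_comul R H f) (%f1 f2. ?g p q (act A (iF f1) a) (act B (iF f2) b))))"
  by (subst comul_D_closed(2)) (simp_all add: left_moduleD(4)[OF A] left_moduleD(4)[OF B])
 also have "... = ssum H Hd P ?x (%h f. sw P h (%p q. ssum A H P ?A (%x k. ssum B H P ?B (%y l. ap f (k \<otimes> l) \<odot>\<^sub>P ?g p q x y))))"
 proof (rule ssum_eqI, rule ssum_eqI)
  fix h f p q assume [simp]: "h :. H" "f :. Hd" "p :. H" "q :. H"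
  let ?d = "dual_comul R H f"
  have "ssum Hd Hd P ?d (%f1 f2. ?g p q (act A (iF f1) a) (act B (iF f2) b)) =
   ssum Hd Hd P ?d (%f1 f2. ssum A H P ?A (%x k. ssum B H P ?B (%y l. ap f1 k \<odot>\<^sub>P (ap f2 l \<odot>\<^sub>P ?g p q x y))))"
   by (rule ssum_eqI, simp flip: G_co_ext, subst ssum_swap) (simp_all add: smult_commute)
  also have "... = ssum A H P ?A (%x k. ssum B H P ?B (%y l. ap f (k \<otimes> l) \<odot>\<^sub>P ?g p q x y))"
   by (rule HOL.trans, rule HOL.trans, (rule ssum_swap; simp), rule ssum_eqI, (rule ssum_swap; simp), rule ssum_eqI, rule ssum_eqI, rule ssum_dual_comul) simp_all
  finally show "ssum Hd Hd P ?d (%f1 f2. ?g p q (act A (iF f1) a) (act B (iF f2) b)) = ..." .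
 qed
 also have "... = ssum A H P ?A (%x k. ssum B H P ?B (%y l. ssum H Hd P ?x (%h f. sw P h (%p q. ap f (k \<otimes> l) \<odot>\<^sub>P ?g p q x y))))"
  by (rule HOL.trans, rule HOL.trans, rule ssum_eqI, (rule ssum_swap; simp), (rule ssum_swap; simp), (rule HOL.trans, rule ssum_eqI, rule ssum_eqI, (rule ssum_swap; simp), rule ssum_eqI, rule ssum_swap)) simp_all
 also have "... = ssum A H P ?A (%x k. ssum B H P ?B (%y l. sw P (theta X (k \<otimes> l)) (%p q. ?g p q x y)))"
  unfolding theta_def hat_def by simp
 also have "... = V P (G_ob A) (G_ob B) bb a b (theta X)"
  unfolding V_def ssum_G by (simp add: G_act)
 finally show ?thesis .
qed

lemma comul_D_cls:
 assumes A: "left_module R D A" and B: "left_module R D B"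
  and P: "module R P" "a :. A" "b :. B" and bb: "bilin R A B P bb" and u: "lin u"
 shows "ssum D D P (comul D (cls u)) (%Y Z. bb (act A Y a) (act B Z b)) = V P (G_ob A) (G_ob B) bb a b u"
proof -
 have "bilin R (G_ob A) (G_ob B) P bb"
  using bb by (simp add: bilin_def G_sel same_module_linear[OF same_G same_module_refl, symmetric])
 then show ?thesis
  using assms by (simp add: comul_D_act V_theta G_sel)
qed

text \<open>With the counit in place of f, \<open>co_co_counit\<close> yields \<Delta>(1), which
  \<Delta>(h) absorbs; what is left is \<Delta>(h) with its legs exchanged. At h = 1 this identifies
  the projection of D(H) with the flipped projection of H.\<close>

lemma comul_D_iE:
 assumes A [simp]: "left_module R D A" and B [simp]: "left_module R D B"
  and [simp]: "module R P" "a :. A" "b :. B" "h :. H" and bb: "bilin R A B P bb"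
 shows "ssum D D P (comul D (iE h)) (%Y Z. bb (act A Y a) (act B Z b)) = sw P h (%q r. bb (act A (iE r) a) (act B (iE q) b))"
proof -
 let ?A = "G_ob A" and ?B = "G_ob B"
 have bb': "bilin R ?A ?B P bb"
  using bb by (simp add: bilin_def G_sel same_module_linear[OF same_G same_module_refl, symmetric])
 have [simp]: "a :. ?A" "b :. ?B" by (simp_all add: G_sel)
 note [simp] = bilin_lin[OF bb']
 have "ssum D D P (comul D (iE h)) (%Y Z. bb (act A Y a) (act B Z b)) = V P ?A ?B bb a b (%l. counit H l \<odot> h)"
  unfolding iE_def by (rule comul_D_cls) (simp_all add: bb)
 also have "... = co ?B P b (%y l. co ?A P a (%x k. counit H (k \<otimes> l) \<odot>\<^sub>P sw P h (%q r. bb (act ?A r x) (act ?B q y))))"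
  unfolding V_def by (subst ssum_swap) simp_all
 also have "... = sw P (h \<otimes> \<one>) (%q r. bb (act ?A r a) (act ?B q b))"
  by (rule HOL.trans, (rule co_co_counit; simp), subst sw_mult, simp_all only: H_ring) (simp_all add: sw_swap[of P _ h \<one>])
 also have "... = sw P h (%q r. bb (act A (iE r) a) (act B (iE q) b))"
  by (simp add: G_act)
 finally show ?thesis .
qed

lemma regular_sel: "carrier (regular D) = carrier D" "act (regular D) = mult D" "same_module D (regular D)"
 by (simp_all add: regular_def same_module_def)

lemma regular_left: "left_module R D (regular D)"
proof -
 have m: "module R (regular D)" by (rule same_module_module[OF regular_sel(3)]) simp
 note l = same_module_linear[OF regular_sel(3) regular_sel(3), symmetric] same_module_linear[OF same_module_refl regular_sel(3), symmetric]
 show ?thesis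
  unfolding left_module_def regular_sel
 proof (intro conjI ballI m)
  fix X assume X: "X :. D"
  show "linear_map R (regular D) (regular D) (mult D X)"
   unfolding l(1) using X D_mult_lin(2)[of X D "%x. x"] by simp
  show "linear_map R D (regular D) (%Y. Y \<otimes>\<^sub>D X)"
   unfolding same_module_linear[OF same_module_refl regular_sel(3), symmetric] using X by simp
 qed (use D_ring in \<open>auto simp: ring.is_monoid monoid.m_assoc ring.ring_simprules\<close>)
qed

text \<open>\<Delta>(X) is recovered from its action on 1 \<otimes> 1 in the regular module. There
  \<open>comul_D_cls\<close> gives an expression that is visibly linear, unlike the definition with
  its chosen representative.\<close>

lemma comul_D_linear: "linear_map R D (tensor R D D) (comul D)"
proof (rule D_linearI)
 let ?Q = "tensor R D D" and ?G = "G_ob (regular D)"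
 have D1 [simp]: "\<one>\<^sub>D :. D" "X :. D ==> X \<otimes>\<^sub>D \<one>\<^sub>D = X" for X
  using D_ring by (simp_all add: ring.ring_simprules ring.is_monoid monoid.r_one)
 have yd [simp]: "yd_module R H ?G" by (rule G_yd[OF regular_left])
 have b [simp]: "bilin R ?G ?G ?Q (tn D D)"
  using bilin_tn[OF module_D module_D]
  by (simp add: bilin_def G_sel regular_sel same_module_linear[OF same_G same_module_refl, symmetric]
    same_module_linear[OF regular_sel(3) same_module_refl, symmetric])
 note [simp] = bilin_lin[OF b]
 have [simp]: "\<one>\<^sub>D :. ?G" by (simp add: G_sel regular_sel)
 have ssD: "ssum D D ?Q t bb = ssum (regular D) (regular D) ?Q t bb" for t bb by (simp add: ssum_def regular_sel)
 have e: "comul D (cl x) = V ?Q ?G ?G (tn D D) \<one>\<^sub>D \<one>\<^sub>D (hat x)" if x: "x :. HD" for x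
 proof -
  have "comul D (cl x) = ssum D D ?Q (comul D (cls (hat x))) (%Y Z. tn D D (act (regular D) Y \<one>\<^sub>D) (act (regular D) Z \<one>\<^sub>D))"
   using x tensor_elem[OF module_D module_D comul_D_closed(1), of "cl x"] by (simp add: regular_sel cls_hat)
  also have "... = V ?Q ?G ?G (tn D D) \<one>\<^sub>D \<one>\<^sub>D (hat x)"
   by (rule comul_D_cls[OF regular_left regular_left])
    (use bilin_tn[OF module_D module_D] in \<open>simp_all add: regular_sel bilin_def same_module_linear[OF regular_sel(3) same_module_refl, symmetric]\<close>)
  finally show ?thesis .
 qed
 have l: "linear_map R HD ?Q (%x. V ?Q ?G ?G (tn D D) \<one>\<^sub>D \<one>\<^sub>D (hat x))"
  unfolding V_def by simp
 show "linear_map R HD ?Q (%x. comul D (cl x))"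
  by (rule linear_map_cong[OF HD_module e l])
qed

lemma counit_D:
 assumes X: "X :. D"
 shows "counit D X = sw (ground R) \<one> (%a b. counit H (theta X b \<otimes> a))"
proof -
 let ?x = "SOME x. x : X"
 note [simp] = module_ground
 have [simp]: "a \<odot>\<^bsub>ground R\<^esub> b :. R" if "a :. R" "b :. R" for a b
  using that by (simp add: ground_def cring.cring_simprules[OF cring_base])
 have x: "?x :. HD" by (rule some_D[OF X])
 have "counit D X = lsum (ground R) (concat (map (%(h, f). map (%(a, b). f b \<otimes>\<^sub>R counit H (h \<otimes> a)) (comul H \<one>)) ?x))"
  by (simp add: double_def module.defs bialg.defs lsum_R)
 also have "... = ssum H Hd (ground R) ?x (%h f. sw (ground R) \<one> (%a b. ap f b \<odot>\<^bsub>ground R\<^esub> counit H (h \<otimes> a)))"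
 proof (subst lsum_concat_ssum[OF module_ground tensor_wf[OF is_module module_Hd x]])
  fix h f assume "h :. H" "f :. Hd"
  then show "set (map (%(a, b). f b \<otimes>\<^sub>R counit H (h \<otimes> a)) (comul H \<one>)) \<subseteq> carrier (ground R)"
   using comul_wf[of \<one>] by (auto simp: ground_def cring.cring_simprules[OF cring_base])
 qed (simp add: ssum_wf[OF comul_wf] ap_def, simp add: ground_def)
 also have "... = sw (ground R) \<one> (%a b. ssum H Hd (ground R) ?x (%h f. ap f b \<odot>\<^bsub>ground R\<^esub> counit H (h \<otimes> a)))"
  by (rule ssum_swap) simp_all
 also have "... = sw (ground R) \<one> (%a b. counit H (theta X b \<otimes> a))"
  unfolding theta_def hat_def
  by (simp add: linear_ssum[OF counit_linear] linear_mapD(3)[OF counit_linear])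
 finally show ?thesis .
qed

end

context diag_tensor_T
begin

text \<open>The inverse \<open>r\<close> is the formula with the bracketing reversed. That it undoes
  \<open>asm\<close> is checked on generators; the other composite follows because
  \<open>asm\<close> maps generators to generators.\<close>

lemma asm_bij:
 assumes [simp]: "obj M" "obj N" "obj P"
 shows "bij_betw (asm M N P) (carrier (TT (TT M N) P)) (carrier (TT M (TT N P)))"
proof -
 let ?A = "TT (TT M N) P" and ?B = "TT M (TT N P)"
 let ?t = "%m n p. pt (TT M N) P (pt M N m n) p"
 define r where "r y = ssum M (TT N P) ?A (summands y) (%m z. ssum N P ?A (summands z) (%n p. ?t m n p))" for y
 note al = asm_linear[OF assms]
 have rl: "linear_map R ?B ?A r"
  unfolding r_def by simp
 have tri: "trilin R M N P ?A ?t" by simp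
 have s: "summands (act (TT N P) b (pt N P n p)) = sB (tensor R N P) b (%c d. tn N P (act N c n) (act P d p))"
  if "b :. B" "n :. N" "p :. P" for b n p using that by (simp add: TT_act summands_act)
 have "r (asm M N P (?t m n p)) = ?t m n p" if [simp]: "m :. M" "n :. N" "p :. P" for m n p
 proof -
  have "r (asm M N P (?t m n p)) = sB ?A \<one>\<^sub>B (%a b. sB ?A b (%c d. ?t (act M a m) (act N c n) (act P d p)))"
   unfolding r_def by (simp add: asm_pt pt_one s)
  also have "... = sB ?A \<one>\<^sub>B (%a b. sB ?A a (%c d. ?t (act M c m) (act N d n) (act P b p)))"
   using tens3_comp_eq[OF _ _ _ _ tri coas_one comul_B_wf comul_B_wf comul_B_wf comul_B_wf] by simp
  also have "... = act ?A \<one>\<^sub>B (?t m n p)"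
   by (simp add: TT_act_pt del: act_B_one pt_simps)
  finally show ?thesis by simp
 qed
 then have ra: "r (asm M N P x) = x" if "x :. ?A" for x
  by (intro TT_ext2[OF assms _ _ _ _ that, where Q = ?A and f = "%x. r (asm M N P x)"]) (simp_all add: linear_comp[OF rl al])
 have "asm M N P (r (pt M (TT N P) m (pt N P n p))) = pt M (TT N P) m (pt N P n p)"
  if [simp]: "m :. M" "n :. N" "p :. P" for m n p
  using ra[of "?t m n p"] by (simp flip: asm_pt)
 then have ar: "asm M N P (r y) = y" if "y :. ?B" for y
  by (intro TT_ext2'[OF assms _ _ _ _ that, where Q = ?B and f = "%y. asm M N P (r y)"]) (simp_all add: linear_comp[OF al rl])
 show ?thesis
  by (rule bij_betw_byWitness[where f' = r]) (use ra ar linear_mapD(1)[OF al] linear_mapD(1)[OF rl] in auto)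
qed

end

section \<open>Modules over \<open>D(H)\<close>\<close>

locale double_univ = weak_hopf_fgp R H S + yd_univ R H S \<iota>
 for R :: "('k, 'r) ring_scheme" and H :: "('k, 'h, 'e) bialg_scheme" (structure) and S
  and \<iota> :: "'h \<Rightarrow> 'x universe" +
 fixes \<delta> :: "('h \<times> ('h \<Rightarrow> 'k)) list set \<Rightarrow> 'x universe"
 assumes inj_delta: "inj_on \<delta> (carrier D)"

definition (in base) flp where
 "flp A B t = ssum A B (tensor R B A) t (%a b. tn B A b a)"

lemma (in base) flp:
 assumes [simp]: "module R A" "module R B"
 shows "linear_map R Q (tensor R A B) g ==> linear_map R Q (tensor R B A) (%x. flp A B (g x))"
  "a :. A ==> b :. B ==> flp A B (tn A B a b) = tn B A b a"
  "t :. (tensor R A B) ==> flp A B t :. (tensor R B A)"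
  "t :. (tensor R A B) ==> flp B A (flp A B t) = t"
proof -
 show l: "linear_map R Q (tensor R A B) g ==> linear_map R Q (tensor R B A) (%x. flp A B (g x))" for Q and g :: "'z \<Rightarrow> _"
  unfolding flp_def by simp
 show t: "a :. A ==> b :. B ==> flp A B (tn A B a b) = tn B A b a" for a b
  unfolding flp_def by simp
 show "t :. (tensor R A B) ==> flp A B t :. (tensor R B A)"
  unfolding flp_def by simp
 show "flp B A (flp A B t) = t" if "t :. (tensor R A B)"
  by (rule linear_eq_tensor[OF _ _ _ _ _ _ that, where P = "tensor R A B" and f = "%t. flp B A (flp A B t)"])
   (simp_all add: flp_def)
qed

context weak_hopf_fgp
begin

lemma G_tens: "tens R (G_ob A) (G_ob B) = tens R A B" "tensor R (G_ob A) (G_ob B) = tensor R A B"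
 by (rule same_tens[OF same_G same_G, symmetric]) (rule same_tensor[OF same_G same_G, symmetric])

lemma diag_D_ssum:
 assumes A [simp]: "left_module R D A" and B [simp]: "left_module R D B" and X: "X :. D"
  and t: "t :. (tensor R A B)"
 shows "diag_act R D A B X t = ssum D D (tensor R A B) (comul D X) (%Y Z. ssum A B (tensor R A B) t (%a b. tn A B (act A Y a) (act B Z b)))"
proof -
 note [simp] = left_moduleD(1)[OF A] act_lin[OF A] left_moduleD(1)[OF B] act_lin[OF B]
 show ?thesis
  unfolding diag_act_def by (rule tens_comp_ssum[OF _ _ comul_D_wf[OF X]]) (use tensor_wf[OF _ _ t] in simp_all)
qed

end

context double_univ
begin

text \<open>On pure tensors both sides reduce to \<open>V\<close>, so \<Delta>(X) acts as X does on
  the Yetter-Drinfeld module N \<otimes>_t M, seen through the flip. Multiplicativity of the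
  diagonal action of D(H) is thereby inherited from \<open>F_left\<close>, without computing
  \<Delta>(XY).\<close>

lemma diag_D:
 fixes A B :: "('k, ('h \<times> ('h \<Rightarrow> 'k)) list set, 'x universe) bmodule"
 assumes A [simp]: "left_module R D A" and B [simp]: "left_module R D B" and X: "X :. D"
  and t: "t :. (tensor R A B)"
 shows "diag_act R D A B X t = flp B A (summands (act (F_ob R H S (yT (G_ob B) (G_ob A))) X
  (Tens (diag_act R H (G_ob B) (G_ob A) \<one> (flp A B t)))))"
proof -
 let ?M = "G_ob A" and ?N = "G_ob B" and ?Q = "tensor R A B"
 let ?T = "yT ?N ?M"
 note [simp] = left_moduleD(1)[OF A] act_lin[OF A] left_moduleD(1)[OF B] act_lin[OF B]
 obtain u where u: "lin u" "X = cls u" using D_cases[OF X] .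
 note [simp] = linear_comp[OF u(1)] linear_mapD(1)[OF u(1)]
 have proj: "linear_map R Q (tensor R B A) g ==> linear_map R Q ?T (%x. Tens (diag_act R H ?N ?M \<one> (g x)))" for Q and g :: "'z \<Rightarrow> _"
  using YT.TT_proj_linear[of ?N ?M] by (auto simp: G_tens intro: linear_comp)
 have suml: "linear_map R ?T (tensor R B A) summands"
  using YT.TT_summands_linear[of ?N ?M] by (simp add: G_tens)
 have actl: "linear_map R Q ?T g ==> linear_map R Q ?T (%x. act (F_ob R H S ?T) X (g x))" for Q and g :: "'z \<Rightarrow> _"
  using left_moduleD(2)[OF F_left X, of ?T] same_module_linear[OF same_F[of ?T] same_F[of ?T]]
  by (auto intro: linear_comp)
 show ?thesis
 proof (rule linear_eq_tensor[OF _ _ _ _ _ _ t, where P = ?Q and f = "diag_act R D A B X"])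
  show "linear_map R ?Q ?Q (diag_act R D A B X)"
   by (rule linear_map_cong[OF _ diag_D_ssum[OF A B X]]) simp_all
  show "linear_map R ?Q ?Q (%t. flp B A (summands (act (F_ob R H S ?T) X (Tens (diag_act R H ?N ?M \<one> (flp A B t))))))"
   by (intro flp(1) linear_comp[OF suml] actl proj) simp_all
  fix a b assume [simp]: "a :. A" "b :. B"
  have [simp]: "a :. ?M" "b :. ?N" by (simp_all add: G_sel)
  have tT: "tens R (tens_mod R H ?N ?M) H = tens R ?T H" "tensor R (tens_mod R H ?N ?M) H = tensor R ?T H"
   by (rule same_tens same_tensor; simp add: yT_sel)+
  let ?f = "%x y q r. tn A B (act A (iE r) x) (act B (iE q) y)"
  have "diag_act R D A B X (tn A B a b) = ssum D D ?Q (comul D X) (%Y Z. tn A B (act A Y a) (act B Z b))"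
   using X by (simp add: diag_D_ssum)
  also have "... = V ?Q ?M ?N (tn A B) a b u"
   unfolding u(2) by (rule comul_D_cls) (simp_all add: u bilin_tn)
  finally have 1: "diag_act R D A B X (tn A B a b) = ..." .
  have c: "coact ?T (pt ?N ?M b a) = co ?N (tensor R ?T H) b (%y l. co ?M (tensor R ?T H) a (%x k. tn ?T H (pt ?N ?M y x) (k \<otimes> l)))"
   using yT_coact_pt[of ?N ?M b a] unfolding tT by simp
  have "act (F_ob R H S ?T) X (pt ?N ?M b a) = co ?N ?T b (%y l. co ?M ?T a (%x k. act ?T (u (k \<otimes> l)) (pt ?N ?M y x)))"
   unfolding u(2) by (subst F_cls) (simp_all add: u ua_def c)
  then have "summands (act (F_ob R H S ?T) X (pt ?N ?M b a)) = co ?N (tensor R ?N ?M) b (%y l. co ?M (tensor R ?N ?M) a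
    (%x k. summands (act ?T (u (k \<otimes> l)) (pt ?N ?M y x))))"
   by simp
  also have "... = ssum B H (tensor R B A) (coact ?N b) (%y l. ssum A H (tensor R B A) (coact ?M a)
    (%x k. sw (tensor R B A) (u (k \<otimes> l)) (%q r. tn B A (act B (iE q) y) (act A (iE r) x))))"
   unfolding ssum_G G_tens
  proof (rule ssum_eqI, rule ssum_eqI)
   fix y l x k assume [simp]: "y :. B" "l :. H" "x :. A" "k :. H"
   show "summands (act ?T (u (k \<otimes> l)) (pt ?N ?M y x)) =
     sw (tensor R B A) (u (k \<otimes> l)) (%q r. tn B A (act B (iE q) y) (act A (iE r) x))"
    using YT.summands_act[of ?N ?M "u (k \<otimes> l)" y x] unfolding yT_sel(2) G_tens by (simp add: G_sel G_act)
  qed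
  finally have "flp B A (summands (act (F_ob R H S ?T) X (pt ?N ?M b a))) = ssum B H ?Q (coact ?N b) (%y l. ssum A H ?Q (coact ?M a)
    (%x k. sw ?Q (u (k \<otimes> l)) (?f x y)))"
   unfolding flp_def by simp
  also have "... = ssum A H ?Q (coact ?M a) (%x k. ssum B H ?Q (coact ?N b) (%y l. sw ?Q (u (k \<otimes> l)) (?f x y)))"
   by (rule ssum_swap) simp_all
  also have "... = V ?Q ?M ?N (tn A B) a b u"
   unfolding V_def ssum_G by (simp add: G_act)
  finally show "diag_act R D A B X (tn A B a b) =
   flp B A (summands (act (F_ob R H S ?T) X (Tens (diag_act R H ?N ?M \<one> (flp A B (tn A B a b))))))"
   using 1 YT.pt_proj[of ?N ?M b a] by (simp add: flp(2) G_tens)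
 qed simp_all
qed

end

sublocale double_univ \<subseteq> DT: diag_tensor R D
 "left_module R D :: ('k, ('h \<times> ('h \<Rightarrow> 'k)) list set, 'x universe) bmodule \<Rightarrow> bool"
proof (intro diag_tensor.intro diag_tensor_axioms.intro)
 fix A B :: "('k, ('h \<times> ('h \<Rightarrow> 'k)) list set, 'x universe) bmodule" and X Y t
 assume A [simp]: "left_module R D A" and B [simp]: "left_module R D B" and X [simp]: "X :. D" and Y [simp]: "Y :. D"
  and t [simp]: "t :. (tensor R A B)"
 let ?M = "G_ob A" and ?N = "G_ob B"
 let ?T = "yT ?N ?M"
 let ?w = "Tens (diag_act R H ?N ?M \<one> (flp A B t))"
 note [simp] = left_moduleD(1)[OF A] left_moduleD(1)[OF B]
 have w: "?w :. ?T"
  using linear_mapD(1)[OF YT.TT_proj_linear[of ?N ?M], of "flp A B t"] by (simp add: G_tens flp(3))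
 have actc: "act (F_ob R H S ?T) X x :. ?T" if "X :. D" "x :. ?T" for X x
  using linear_mapD(1)[OF left_moduleD(2)[OF F_left that(1), of ?T]] that by (simp add: F_sel)
 define z where "z = act (F_ob R H S ?T) Y ?w"
 have z: "z :. ?T" unfolding z_def by (rule actc[OF Y w])
 have sz: "summands z :. (tensor R B A)"
  using linear_mapD(1)[OF YT.TT_summands_linear[of ?N ?M] z] by (simp add: G_tens)
 have "Tens (diag_act R H ?N ?M \<one> (flp A B (diag_act R D A B Y t))) = z"
  using YT.TT_summands[of ?N ?M z] z sz unfolding diag_D[OF A B Y t] z_def[symmetric] by (simp add: flp(4))
 moreover have "diag_act R D A B Y t :. (tensor R A B)"
  unfolding diag_D[OF A B Y t] z_def[symmetric] by (rule flp(3)) (simp_all add: sz)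
 ultimately have "diag_act R D A B X (diag_act R D A B Y t) = flp B A (summands (act (F_ob R H S ?T) X z))"
  by (subst diag_D) simp_all
 also have "act (F_ob R H S ?T) X z = act (F_ob R H S ?T) (X \<otimes>\<^sub>D Y) ?w"
  unfolding z_def using w by (subst left_moduleD(4)[OF F_left]) (simp_all add: F_sel)
 also have "flp B A (summands ...) = diag_act R D A B (X \<otimes>\<^sub>D Y) t"
  by (subst diag_D) simp_all
 finally show "diag_act R D A B X (diag_act R D A B Y t) = diag_act R D A B (X \<otimes>\<^sub>D Y) t" .
qed (simp_all add: base_axioms D_ring comul_D_linear)

text \<open>By \<open>comul_D_iE\<close> the iterated comultiplications of 1 in D(H) act through the
  legs of \<Delta>^2(1) of H in reversed order, so \<open>coas_one\<close> is coassociativity in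
  H.\<close>

sublocale double_univ \<subseteq> DT: diag_tensor_T R D
 "left_module R D :: ('k, ('h \<times> ('h \<Rightarrow> 'k)) list set, 'x universe) bmodule \<Rightarrow> bool" "tens_mod R D"
proof
 fix A B C :: "('k, ('h \<times> ('h \<Rightarrow> 'k)) list set, 'x universe) bmodule" and a b c
 assume [simp]: "left_module R D A" "left_module R D B"
 show "same_module (tens_mod R D A B) (tens_mod R D A B)" "act (tens_mod R D A B) = act (tens_mod R D A B)"
  "left_module R D (tens_mod R D A B)"
  by simp_all
 assume [simp]: "left_module R D C" "a :. A" "b :. B" "c :. C"
 let ?Q = "tensor R (tensor R A B) C"
 let ?t = "%a b c. tn (tensor R A B) C (tn A B a b) c"
 have i: "ssum D D P (comul D \<one>\<^sub>D) (%Y Z. bb (act A' Y a') (act B' Z b')) = sw P \<one> (%q r. bb (act A' (iE r) a') (act B' (iE q) b'))"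
  if "left_module R D A'" "left_module R D B'" "module R P" "a' :. A'" "b' :. B'" "bilin R A' B' P bb"
  for A' B' :: "('k, ('h \<times> ('h \<Rightarrow> 'k)) list set, 'x universe) bmodule" and P :: "('k, 'z) module" and a' b' bb
  using comul_D_iE[OF that(1,2,3,4,5) _ that(6), of \<one>] by (simp add: iE_one)
 have "tens3 R A B C [(act A a1 a, act B a2 b, act C Z c). (Y, Z) \<leftarrow> comul D \<one>\<^sub>D, (a1, a2) \<leftarrow> comul D Y] =
   ssum D D ?Q (comul D \<one>\<^sub>D) (%Y Z. ssum D D ?Q (comul D Y) (%a1 a2. ?t (act A a1 a) (act B a2 b) (act C Z c)))"
  by (rule tens3_comp_ssum) (use comul_D_wf in simp_all)
 also have "... = ssum D D ?Q (comul D \<one>\<^sub>D) (%Y Z. ssum A B ?Q (summands (act (tens_mod R D A B) Y (DT.pt A B a b)))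
   (%a b. ?t a b (act C Z c)))"
  by (rule ssum_eqI) (simp add: DT.summands_act)
 also have "... = sw ?Q \<one> (%q r. sw ?Q r (%q' r'. ?t (act A (iE r') a) (act B (iE q') b) (act C (iE q) c)))"
  by (rule HOL.trans, (rule i; simp), rule ssum_eqI) (simp add: DT.summands_act, rule comul_D_iE, simp_all)
 also have "... = sw ?Q \<one> (%q r. ssum B C ?Q (summands (act (tens_mod R D B C) (iE q) (DT.pt B C b c))) (%b c. ?t (act A (iE r) a) b c))"
  by (rule HOL.trans, (rule coas[symmetric]; simp), rule ssum_eqI) (simp add: DT.summands_act, rule comul_D_iE[symmetric], simp_all)
 also have "... = ssum D D ?Q (comul D \<one>\<^sub>D) (%Y Z. ssum D D ?Q (comul D Z) (%b1 b2. ?t (act A Y a) (act B b1 b) (act C b2 c)))"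
  by (rule HOL.trans, (rule i[symmetric]; simp), rule ssum_eqI) (simp add: DT.summands_act)
 also have "... = tens3 R A B C [(act A Y a, act B b1 b, act C b2 c). (Y, Z) \<leftarrow> comul D \<one>\<^sub>D, (b1, b2) \<leftarrow> comul D Z]"
  by (rule tens3_comp_ssum[symmetric]) (use comul_D_wf in simp_all)
 finally show "tens3 R A B C [(act A a1 a, act B a2 b, act C Z c). (Y, Z) \<leftarrow> comul D \<one>\<^sub>D, (a1, a2) \<leftarrow> comul D Y] = ..." .
qed

section \<open>The unit object and the counital maps of D(H)\<close>

context double_univ
begin

abbreviation "FU \<equiv> F_ob R H S yU"

text \<open>X acting on the element 1 of H_t. It serves as a counital map from D(H) to H_t: by
  \<open>eps_D\<close>, the map \<open>eps_s_bar\<close> of D(H) is \<open>iE\<close> after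
  \<open>chi\<close>.\<close>

definition chi where
 "chi X = uI (act FU X (\<iota> \<one>))"

lemma FU_left [simp]: "left_module R D FU"
 by simp

lemma FU_carrier: "carrier FU = carrier mU"
 by (simp add: F_sel yU_sel)

lemma same_FU: "same_module mU FU"
 using yU_sel(1) same_F[of yU] by (simp add: same_module_def)

lemma u1 [simp]: "\<iota> \<one> :. mU" "uI (\<iota> \<one>) = \<one>"
 using iet_closed[of \<one>] uI_iet[of \<one>] by simp_all

lemma FU_act_closed [simp]: "X :. D ==> x :. mU ==> act FU X x :. mU"
 using linear_mapD(1)[OF left_moduleD(2)[OF FU_left]] by (simp add: FU_carrier)

lemma chi_linear0: "linear_map R D H chi"
proof -
 have "linear_map R D mU (%X. act FU X (\<iota> \<one>))"
  using left_moduleD(3)[OF FU_left, of "\<iota> \<one>"]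
  by (simp add: FU_carrier same_module_linear[OF same_module_refl same_FU, symmetric])
 then show ?thesis unfolding chi_def[abs_def] by simp
qed

lemmas chi_linear [simp] = linear_comp[OF chi_linear0]

lemma chi_Ht [simp]: "X :. D ==> chi X : Ht"
 unfolding chi_def by simp

lemma chi_closed [simp]: "X :. D ==> chi X :. H"
 using HtD(1) by simp

lemma FU_iE: "h :. H ==> x :. mU ==> act FU (iE h) x = act mU h x"
 by (simp add: F_iE yU_sel)

lemma chi_iE: "h :. H ==> chi (iE h) = et h"
 unfolding chi_def by (simp add: FU_iE del: uI_act(2))

lemma iota_chi: "X :. D ==> \<iota> (chi X) = act FU X (\<iota> \<one>)"
 unfolding chi_def by (rule UN.unit_elem(2)) simp

lemma chi_mult: "X :. D ==> Y :. D ==> chi (X \<otimes>\<^sub>D Y) = uI (act FU X (\<iota> (chi Y)))"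
 by (simp add: chi_def[of "X \<otimes>\<^sub>D Y"] iota_chi left_moduleD(4)[OF FU_left] FU_carrier)

text \<open>On the element 1 of H_t, \<open>iE (esb (chi Y))\<close> acts as et(esb(chi Y)) = chi Y,
  just as Y does.\<close>

lemma chi_mult_iE: "X :. D ==> Y :. D ==> chi (X \<otimes>\<^sub>D iE (esb (chi Y))) = chi (X \<otimes>\<^sub>D Y)"
 by (simp add: chi_mult chi_iE eps_eps(7)[of \<one>])

text \<open>The coaction of 1 in H_t comes from \<Delta>(1), so chi(X) is et(u(S^-1(1_1)) 1_2) with
  u representing X. The counit removes \<open>et\<close>, and the symmetry of \<Delta>(1) under S^-1
  leads to the formula for the counit of D(H).\<close>

lemma counit_D_chi:
 assumes X [simp]: "X :. D" and [simp]: "module R P" "p :. P"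
 shows "counit D X \<odot>\<^sub>P p = counit H (chi X) \<odot>\<^sub>P p"
proof -
 let ?u = "theta X"
 note [simp] = linear_comp[OF theta_lin] linear_mapD(1)[OF theta_lin]
 have b: "bilin R H H P (%a b. counit H (?u a \<otimes> b) \<odot>\<^sub>P p)" "bilin R H H P (%a b. counit H (?u b \<otimes> a) \<odot>\<^sub>P p)"
  "bilin R H H P (%a b. counit H (?u (T a) \<otimes> T b) \<odot>\<^sub>P p)"
  by simp_all
 have "chi X = sw H \<one> (%a b. et (?u (T a) \<otimes> b))"
  unfolding chi_def by (subst F_act) (simp_all add: linear_ssum[OF UN.unit_linear(2)] yU_sel ua_def yU_coact ssum_same[OF yU_sel(1), symmetric] eps_eps
    ssum_def[of yU] yU_sel(3) flip: ssum_def)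
 then have "counit H (chi X) \<odot>\<^sub>P p = sw P \<one> (%a b. counit H (\<one> \<otimes> et (?u (T a) \<otimes> b)) \<odot>\<^sub>P p)"
  by simp
 also have "... = sw P \<one> (%a b. counit H (?u (T a) \<otimes> esb b) \<odot>\<^sub>P p)"
  by (simp del: H_ring(3) H_ring(4)) simp
 also have "... = sw P \<one> (%a b. counit H (?u (T a) \<otimes> T (et b)) \<odot>\<^sub>P p)"
  by (simp add: T_et)
 also have "... = sw P \<one> (%a b. counit H (?u (T a) \<otimes> T b) \<odot>\<^sub>P p)"
  by (rule W1(1)[OF _ b(3)]) simp
 also have "... = sw P \<one> (%a b. counit H (?u b \<otimes> a) \<odot>\<^sub>P p)"
  using S_comul_one'[OF _ b(2)] by simp
 also have "... = counit D X \<odot>\<^sub>P p"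
 proof -
  have l: "linear_map R (ground R) P (%r. r \<odot>\<^sub>P p)" using module_ground by simp
  show ?thesis
   unfolding counit_D[OF X] by (rule linear_ssum[OF l, symmetric]) (simp_all add: module_ground)
 qed
 finally show ?thesis ..
qed

text \<open>The defining sum over \<Delta>(1) is an action of \<Delta>(1) on the unit object and the
  regular module, so \<open>comul_D_iE\<close> rewrites it as a sum over \<Delta>(1) of H. The
  exchange of legs turns \<open>eps_t\<close> into \<open>esb\<close>, and \<open>eps_s_bar\<close>
  into \<open>et\<close>, which fixes chi(X).\<close>

lemma eps_D:
 assumes X [simp]: "X :. D"
 shows "eps_t D X = iE (esb (chi X))" "eps_s_bar D X = iE (chi X)"
proof -
 have x [simp]: "act FU X (\<iota> \<one>) :. FU" by (simp add: FU_carrier)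
 have D1 [simp]: "\<one>\<^sub>D :. D" "Y :. D ==> Y \<otimes>\<^sub>D \<one>\<^sub>D = Y" for Y
  using D_ring by (simp_all add: ring.ring_simprules ring.is_monoid monoid.r_one)
 have r [simp]: "\<one>\<^sub>D :. (regular D)" by (simp add: regular_sel)
 have ch: "counit D (Y \<otimes>\<^sub>D X) \<odot>\<^sub>D Z = counit H (uI (act FU Y (act FU X (\<iota> \<one>)))) \<odot>\<^sub>D act (regular D) Z \<one>\<^sub>D"
  if "Y :. D" "Z :. D" for Y Z
  using that by (simp add: counit_D_chi chi_mult iota_chi regular_sel)
 have b: "bilin R FU (regular D) D (%y Z. counit H (uI y) \<odot>\<^sub>D Z)"
  by (rule bilinI) (simp_all add: regular_sel FU_carrier same_module_linear[OF same_FU same_module_refl, symmetric]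
    same_module_linear[OF regular_sel(3) same_module_refl, symmetric])
 have b': "bilin R (regular D) FU D (%Z y. counit H (uI y) \<odot>\<^sub>D Z)"
  using b by (simp add: bilin_def)
 have e: "counit H (uI (act FU (iE h) (act FU X (\<iota> \<one>)))) \<odot>\<^sub>D Y = counit H (h \<otimes> chi X) \<odot>\<^sub>D Y"
  if "h :. H" "Y :. D" for h Y
 proof -
  have "counit H (\<one> \<otimes> et (h \<otimes> chi X)) \<odot>\<^sub>D Y = counit H (\<one> \<otimes> (h \<otimes> chi X)) \<odot>\<^sub>D Y"
   using that by (intro counit_eps(1)) simp_all
  then show ?thesis using that by (simp add: FU_iE chi_def[symmetric] del: uI_act(2))
 qed
 have "eps_t D X = ssum D D D (comul D \<one>\<^sub>D) (%Y Z. counit D (Y \<otimes>\<^sub>D X) \<odot>\<^sub>D Z)"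
  unfolding eps_t_def by (simp add: ssum_wf[OF comul_D_wf])
 also have "... = ssum D D D (comul D (iE \<one>)) (%Y Z. counit H (uI (act FU Y (act FU X (\<iota> \<one>)))) \<odot>\<^sub>D act (regular D) Z \<one>\<^sub>D)"
  unfolding iE_one by (rule ssum_eqI, rule ch)
 also have "... = sw D \<one> (%q r. counit H (r \<otimes> chi X) \<odot>\<^sub>D iE q)"
  by (rule HOL.trans, (rule comul_D_iE[OF FU_left regular_left _ x r _ b]; simp), rule ssum_eqI) (simp add: e regular_sel)
 also have "... = iE (esb (chi X))" unfolding eps_sw by simp
 finally show "eps_t D X = ..." .
 have "eps_s_bar D X = ssum D D D (comul D \<one>\<^sub>D) (%Y Z. counit D (Z \<otimes>\<^sub>D X) \<odot>\<^sub>D Y)"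
  unfolding eps_s_bar_def by (simp add: ssum_wf[OF comul_D_wf])
 also have "... = ssum D D D (comul D (iE \<one>)) (%Y Z. counit H (uI (act FU Z (act FU X (\<iota> \<one>)))) \<odot>\<^sub>D act (regular D) Y \<one>\<^sub>D)"
  unfolding iE_one by (rule ssum_eqI, rule ch)
 also have "... = sw D \<one> (%q r. counit H (q \<otimes> chi X) \<odot>\<^sub>D iE r)"
  by (rule HOL.trans, (rule comul_D_iE[OF regular_left FU_left _ r x _ b']; simp), rule ssum_eqI) (simp add: e regular_sel)
 also have "... = iE (et (chi X))" unfolding eps_sw by simp
 finally show "eps_s_bar D X = iE (chi X)" by simp
qed

end

sublocale double_univ \<subseteq> UD: unit_alg R D \<delta>
proof (intro unit_alg.intro unit_alg_axioms.intro)
 show "linear_map R D D (eps_t D)"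
  by (rule linear_map_cong[OF module_D eps_D(1)]) simp_all
qed (simp_all add: base_axioms D_ring inj_delta D_smult_mult eps_D chi_mult_iE)

section \<open>Monoidal categories of modules\<close>

text \<open>The two categories differ in their objects and in the predicate \<open>hom\<close>.
  Closure under \<open>hom_inv\<close> makes every bijective arrow an isomorphism, which is how all
  constraints are seen to be invertible.\<close>

locale concrete_category = base R
 for R :: "('k, 'r) ring_scheme" +
 fixes C :: "(('k, 'b, 'u, 'm) bmodule_scheme, (('k, 'b, 'u, 'm) bmodule_scheme, 'u) arrow) moncat" (structure)
  and hom :: "('k, 'b, 'u, 'm) bmodule_scheme \<Rightarrow> ('k, 'b, 'u, 'm) bmodule_scheme \<Rightarrow> ('u \<Rightarrow> 'u) \<Rightarrow> bool"
 assumes sel: "Ar C = {(M, f, N). M : Ob C \<and> N : Ob C \<and> hom M N f \<and> f : extensional (carrier M)}"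
   "Dom C = (%(M, f, N). M)" "Cod C = (%(M, f, N). N)" "Id C = id_arrow" "Cmp C = comp_arrow"
  and ob_module: "M : Ob C ==> module R M"
  and hom_linear: "M : Ob C ==> N : Ob C ==> hom M N f ==> linear_map R M N f"
  and hom_cong: "M : Ob C ==> N : Ob C ==> hom M N f ==> (!!x. x :. M ==> g x = f x) ==> hom M N g"
  and hom_id: "M : Ob C ==> hom M M (%x. x)"
  and hom_comp: "M : Ob C ==> N : Ob C ==> P : Ob C ==> hom M N f ==> hom N P g ==> hom M P (%x. g (f x))"
  and hom_inv: "M : Ob C ==> N : Ob C ==> hom M N f ==> bij_betw f (carrier M) (carrier N) ==> hom N M (inv_into (carrier M) f)"
begin

declare ob_module [simp]

abbreviation "dm F \<equiv> fst F"
abbreviation "ar F \<equiv> fst (snd F)"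
abbreviation "cd F \<equiv> snd (snd F)"

lemma Hom_iff: "F : Hom C M N \<longleftrightarrow> F : Ar C \<and> dm F = M \<and> cd F = N"
 by (cases F) (auto simp: Hom_def sel)

lemma Ar_iff: "F : Ar C \<longleftrightarrow> dm F : Ob C \<and> cd F : Ob C \<and> hom (dm F) (cd F) (ar F) \<and> ar F : extensional (carrier (dm F))"
 by (cases F) (auto simp: sel)

lemma Ar_D [simp]:
 assumes "F : Ar C"
 shows "dm F : Ob C" "cd F : Ob C" "hom (dm F) (cd F) (ar F)"
 using assms by (auto simp: Ar_iff)

lemma Ar_linear [simp]:
 assumes "F : Ar C"
 shows "linear_map R Q (dm F) g ==> cd F = N ==> linear_map R Q N (%x. ar F (g x))"
  "x :. (dm F) ==> cd F = N ==> ar F x :. N"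
proof -
 have l: "linear_map R (dm F) (cd F) (ar F)" using assms by (intro hom_linear) simp_all
 show "linear_map R Q (dm F) g ==> cd F = N ==> linear_map R Q N (%x. ar F (g x))"
  using linear_comp[OF l] by blast
 show "x :. (dm F) ==> cd F = N ==> ar F x :. N"
  using linear_mapD(1)[OF l] by blast
qed

lemma Ar_linear0: "F : Ar C ==> linear_map R (dm F) (cd F) (ar F)"
 by (intro hom_linear) simp_all

lemma arr_hom: "M : Ob C ==> N : Ob C ==> hom M N f ==> (M, restrict f (carrier M), N) : Ar C"
 using hom_cong[of M N f "restrict f (carrier M)"] by (simp add: Ar_iff)

lemma hom_ext:
 assumes "F : Ar C" "G : Ar C" "dm F = dm G" "cd F = cd G" "!!x. x :. (dm F) ==> ar F x = ar G x"
 shows "F = G"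
proof -
 have "ar F : extensional (carrier (dm F))" "ar G : extensional (carrier (dm F))"
  using assms(1-3) unfolding Ar_iff by auto
 then have "ar F = ar G" by (rule extensionalityI) (rule assms(5))
 then show ?thesis using assms(3,4) by (intro prod_eqI) auto
qed

lemma comp_Ar [simp]:
 "dm (G \<cdot> F) = dm F" "cd (G \<cdot> F) = cd G" "x :. (dm F) ==> ar (G \<cdot> F) x = ar G (ar F x)"
 "F : Ar C ==> G : Ar C ==> cd F = dm G ==> G \<cdot> F : Ar C"
proof -
 show s: "dm (G \<cdot> F) = dm F" "cd (G \<cdot> F) = cd G" "x :. (dm F) ==> ar (G \<cdot> F) x = ar G (ar F x)" for x
  by (cases F, cases G, simp add: sel compose_def)+
 assume F: "F : Ar C" and G: "G : Ar C" and e: "cd F = dm G"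
 have "hom (dm F) (cd G) (%x. ar G (ar F x))"
  by (rule hom_comp[of _ "cd F"]) (use F G in \<open>simp_all, simp add: e\<close>)
 then have "hom (dm F) (cd G) (ar (G \<cdot> F))"
  by (rule hom_cong[rotated 2]) (use F G s in simp_all)
 moreover have "ar (G \<cdot> F) : extensional (carrier (dm F))"
  by (cases F, cases G) (simp add: sel)
 ultimately show "G \<cdot> F : Ar C"
  unfolding Ar_iff[of "G \<cdot> F"] s(1,2) using Ar_D(1)[OF F] Ar_D(2)[OF G] by blast
qed

lemma id_Ar [simp]: "M : Ob C ==> Id C M : Ar C" "dm (Id C M) = M" "cd (Id C M) = M"
 "x :. M ==> ar (Id C M) x = x"
 using arr_hom[OF _ _ hom_id] by (simp_all add: sel id_arrow_def)

lemma iso_hom: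
 assumes F [simp]: "F : Ar C" and b: "bij_betw (ar F) (carrier (dm F)) (carrier (cd F))"
 shows "inverse_arrows C F (cd F, restrict (inv_into (carrier (dm F)) (ar F)) (carrier (cd F)), dm F)"
proof -
 let ?G = "(cd F, restrict (inv_into (carrier (dm F)) (ar F)) (carrier (cd F)), dm F)"
 have G [simp]: "?G : Ar C" by (rule arr_hom[OF _ _ hom_inv]) (simp_all add: b)
 have i: "inj_on (ar F) (carrier (dm F))" "ar F ` carrier (dm F) = carrier (cd F)" using b by (auto simp: bij_betw_def)
 have "?G \<cdot> F = Id C (dm F)"
  by (rule hom_ext) (simp_all add: i inv_into_f_f)
 moreover have "F \<cdot> ?G = Id C (cd F)"
  by (rule hom_ext) (simp_all add: i f_inv_into_f inv_into_into)
 ultimately show ?thesis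
  by (simp add: inverse_arrows_def Hom_iff) (simp add: sel case_prod_unfold)
qed

lemma iso_arrowI: "F : Ar C ==> bij_betw (ar F) (carrier (dm F)) (carrier (cd F)) ==> iso_arrow C F"
 using iso_hom unfolding iso_arrow_def by blast

lemma bij_restrict: "bij_betw f (carrier M) X ==> bij_betw (restrict f (carrier M)) (carrier M) X"
 by (subst bij_betw_cong[of _ _ f]) simp_all

lemma inv_arrow_eq:
 assumes G: "inverse_arrows C F G"
 shows "inv_arrow C F = G"
 unfolding inv_arrow_def
proof (rule the_equality, rule G)
 fix G' assume G': "inverse_arrows C F G'"
 have [simp]: "F : Ar C" using G by (simp add: inverse_arrows_def)
 have s: "Dom C F = dm F" "Cod C F = cd F" by (simp_all add: sel case_prod_unfold)
 have [simp]: "G : Ar C" "G' : Ar C" "dm G = cd F" "cd G = dm F" "dm G' = cd F" "cd G' = dm F"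
  using G G' by (simp_all add: inverse_arrows_def Hom_iff s)
 have e: "ar G (ar F x) = x" if "x :. (dm F)" for x
  using G that comp_Ar(3)[of x F G] by (simp add: inverse_arrows_def s)
 have e': "ar F (ar G' x) = x" if "x :. (cd F)" for x
  using G' that comp_Ar(3)[of x G' F] by (simp add: inverse_arrows_def s)
 show "G' = G"
 proof (rule hom_ext)
  fix x assume "x :. (dm G')"
  then show "ar G' x = ar G x" using e[of "ar G' x"] e'[of x] by simp
 qed simp_all
qed

end

text \<open>
 A monoidal structure on a category of modules whose tensor products are generated by the elements
 \<open>pt M N m n\<close>: all coherence conditions are verified on generators, and the action of the unit
 object is given by \<open>la\<close> (from the left) and \<open>ra\<close> (from the right).
\<close>

locale concrete_monoidal = concrete_category R C hom
 for R :: "('k, 'r) ring_scheme" and C :: "(('k, 'b, 'u, 'm) bmodule_scheme, (('k, 'b, 'u, 'm) bmodule_scheme, 'u) arrow) moncat" (structure)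
  and hom :: "('k, 'b, 'u, 'm) bmodule_scheme \<Rightarrow> ('k, 'b, 'u, 'm) bmodule_scheme \<Rightarrow> ('u \<Rightarrow> 'u) \<Rightarrow> bool" +
 fixes pt :: "('k, 'b, 'u, 'm) bmodule_scheme \<Rightarrow> ('k, 'b, 'u, 'm) bmodule_scheme \<Rightarrow> 'u \<Rightarrow> 'u \<Rightarrow> 'u"
  and la ra :: "('k, 'b, 'u, 'm) bmodule_scheme \<Rightarrow> 'u \<Rightarrow> 'u \<Rightarrow> 'u"
 assumes tens_ob [simp]: "M : Ob C ==> N : Ob C ==> M \<boxtimes> N : Ob C"
  and unit_ob [simp]: "Unit C : Ob C"
  and pt_bilin: "M : Ob C ==> N : Ob C ==> bilin R M N (M \<boxtimes> N) (pt M N)"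
  and pt_ext: "M : Ob C ==> N : Ob C ==> P : Ob C ==> linear_map R (M \<boxtimes> N) P f ==> linear_map R (M \<boxtimes> N) P g ==>
   (!!m n. m :. M ==> n :. N ==> f (pt M N m n) = g (pt M N m n)) ==> x :. (M \<boxtimes> N) ==> f x = g x"
  and tens_arr: "M : Ob C ==> N : Ob C ==> M' : Ob C ==> N' : Ob C ==> hom M M' f ==> hom N N' g ==>
   \<exists>t. (M, f, M') \<star> (N, g, N') = (M \<boxtimes> N, restrict t (carrier (M \<boxtimes> N)), M' \<boxtimes> N') \<and> hom (M \<boxtimes> N) (M' \<boxtimes> N') t \<and>
    (\<forall>m\<in>carrier M. \<forall>n\<in>carrier N. t (pt M N m n) = pt M' N' (f m) (g n))"
  and assoc_arr: "M : Ob C ==> N : Ob C ==> P : Ob C ==>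
   \<exists>a. Assoc C M N P = (M \<boxtimes> N \<boxtimes> P, restrict a (carrier (M \<boxtimes> N \<boxtimes> P)), M \<boxtimes> (N \<boxtimes> P)) \<and> hom (M \<boxtimes> N \<boxtimes> P) (M \<boxtimes> (N \<boxtimes> P)) a \<and>
    bij_betw a (carrier (M \<boxtimes> N \<boxtimes> P)) (carrier (M \<boxtimes> (N \<boxtimes> P))) \<and>
    (\<forall>m\<in>carrier M. \<forall>n\<in>carrier N. \<forall>p\<in>carrier P. a (pt (M \<boxtimes> N) P (pt M N m n) p) = pt M (N \<boxtimes> P) m (pt N P n p))"
  and lunit_arr: "M : Ob C ==>
   \<exists>l. Lunit C M = (Unit C \<boxtimes> M, restrict l (carrier (Unit C \<boxtimes> M)), M) \<and> hom (Unit C \<boxtimes> M) M l \<and>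
    bij_betw l (carrier (Unit C \<boxtimes> M)) (carrier M) \<and>
    (\<forall>z\<in>carrier (Unit C). \<forall>m\<in>carrier M. l (pt (Unit C) M z m) = la M z m)"
  and runit_arr: "M : Ob C ==>
   \<exists>r. Runit C M = (M \<boxtimes> Unit C, restrict r (carrier (M \<boxtimes> Unit C)), M) \<and> hom (M \<boxtimes> Unit C) M r \<and>
    bij_betw r (carrier (M \<boxtimes> Unit C)) (carrier M) \<and>
    (\<forall>m\<in>carrier M. \<forall>z\<in>carrier (Unit C). r (pt M (Unit C) m z) = ra M z m)"
  and la_nat: "M : Ob C ==> N : Ob C ==> hom M N f ==> z :. (Unit C) ==> m :. M ==> f (la M z m) = la N z (f m)"
  and ra_nat: "M : Ob C ==> N : Ob C ==> hom M N f ==> z :. (Unit C) ==> m :. M ==> f (ra M z m) = ra N z (f m)"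
  and pt_unit: "M : Ob C ==> N : Ob C ==> m :. M ==> z :. (Unit C) ==> n :. N ==>
   pt M N m (la N z n) = pt M N (ra M z m) n"
begin

lemmas [simp] = bilin_lin[OF pt_bilin]

lemma tens_Ar [simp]:
 assumes "F : Ar C" "G : Ar C"
 shows "F \<star> G : Ar C" "dm (F \<star> G) = dm F \<boxtimes> dm G" "cd (F \<star> G) = cd F \<boxtimes> cd G"
  "dm F = M ==> dm G = N ==> m :. M ==> n :. N ==> ar (F \<star> G) (pt M N m n) = pt (cd F) (cd G) (ar F m) (ar G n)"
proof -
 obtain t where t: "(dm F, ar F, cd F) \<star> (dm G, ar G, cd G) = (dm F \<boxtimes> dm G, restrict t (carrier (dm F \<boxtimes> dm G)), cd F \<boxtimes> cd G)"
  "hom (dm F \<boxtimes> dm G) (cd F \<boxtimes> cd G) t"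
  "\<forall>m\<in>carrier (dm F). \<forall>n\<in>carrier (dm G). t (pt (dm F) (dm G) m n) = pt (cd F) (cd G) (ar F m) (ar G n)"
  using tens_arr[of "dm F" "dm G" "cd F" "cd G" "ar F" "ar G"] assms by auto
 then have e: "F \<star> G = (dm F \<boxtimes> dm G, restrict t (carrier (dm F \<boxtimes> dm G)), cd F \<boxtimes> cd G)" by simp
 show "F \<star> G : Ar C" unfolding e using assms t(2) by (intro arr_hom) simp_all
 show "dm (F \<star> G) = dm F \<boxtimes> dm G" "cd (F \<star> G) = cd F \<boxtimes> cd G" by (simp_all add: e)
 show "dm F = M ==> dm G = N ==> m :. M ==> n :. N ==> ar (F \<star> G) (pt M N m n) = pt (cd F) (cd G) (ar F m) (ar G n)"
  using e t(3) assms by auto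
qed

lemma assoc_Hom:
 assumes [simp]: "M : Ob C" "N : Ob C" "P : Ob C"
 shows "Assoc C M N P : Ar C" "dm (Assoc C M N P) = M \<boxtimes> N \<boxtimes> P" "cd (Assoc C M N P) = M \<boxtimes> (N \<boxtimes> P)"
  "bij_betw (ar (Assoc C M N P)) (carrier (M \<boxtimes> N \<boxtimes> P)) (carrier (M \<boxtimes> (N \<boxtimes> P)))"
  "m :. M ==> n :. N ==> p :. P ==>
   ar (Assoc C M N P) (pt (M \<boxtimes> N) P (pt M N m n) p) = pt M (N \<boxtimes> P) m (pt N P n p)"
proof -
 obtain a where a: "Assoc C M N P = (M \<boxtimes> N \<boxtimes> P, restrict a (carrier (M \<boxtimes> N \<boxtimes> P)), M \<boxtimes> (N \<boxtimes> P))"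
  "hom (M \<boxtimes> N \<boxtimes> P) (M \<boxtimes> (N \<boxtimes> P)) a" "bij_betw a (carrier (M \<boxtimes> N \<boxtimes> P)) (carrier (M \<boxtimes> (N \<boxtimes> P)))"
  "\<forall>m\<in>carrier M. \<forall>n\<in>carrier N. \<forall>p\<in>carrier P. a (pt (M \<boxtimes> N) P (pt M N m n) p) = pt M (N \<boxtimes> P) m (pt N P n p)"
  using assoc_arr[OF assms] by blast
 show "Assoc C M N P : Ar C" "dm (Assoc C M N P) = M \<boxtimes> N \<boxtimes> P" "cd (Assoc C M N P) = M \<boxtimes> (N \<boxtimes> P)"
  unfolding a(1) using a(2) by (auto intro!: arr_hom)
 show "bij_betw (ar (Assoc C M N P)) (carrier (M \<boxtimes> N \<boxtimes> P)) (carrier (M \<boxtimes> (N \<boxtimes> P)))"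
  using bij_restrict[OF a(3)] by (simp add: a(1))
 show "m :. M ==> n :. N ==> p :. P ==>
   ar (Assoc C M N P) (pt (M \<boxtimes> N) P (pt M N m n) p) = pt M (N \<boxtimes> P) m (pt N P n p)"
  using a by simp
qed

lemma lunit_Hom:
 assumes [simp]: "M : Ob C"
 shows "Lunit C M : Ar C" "dm (Lunit C M) = Unit C \<boxtimes> M" "cd (Lunit C M) = M" "bij_betw (ar (Lunit C M)) (carrier (Unit C \<boxtimes> M)) (carrier M)"
  "z :. (Unit C) ==> m :. M ==> ar (Lunit C M) (pt (Unit C) M z m) = la M z m"
 using lunit_arr[OF assms] arr_hom[of "Unit C \<boxtimes> M" M] bij_restrict by auto

lemma runit_Hom:
 assumes [simp]: "M : Ob C"
 shows "Runit C M : Ar C" "dm (Runit C M) = M \<boxtimes> Unit C" "cd (Runit C M) = M" "bij_betw (ar (Runit C M)) (carrier (M \<boxtimes> Unit C)) (carrier M)"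
  "z :. (Unit C) ==> m :. M ==> ar (Runit C M) (pt M (Unit C) m z) = ra M z m"
 using runit_arr[OF assms] arr_hom[of "M \<boxtimes> Unit C" M] bij_restrict by auto

lemmas [simp] = assoc_Hom(1-3,5) lunit_Hom(1-3,5) runit_Hom(1-3,5)

lemma eq2:
 assumes [simp]: "F : Ar C" "G : Ar C" "M : Ob C" "N : Ob C"
  and e [simp]: "dm F = M \<boxtimes> N" "dm G = M \<boxtimes> N" "cd F = cd G"
  and eq: "!!m n. m :. M ==> n :. N ==> ar F (pt M N m n) = ar G (pt M N m n)"
 shows "F = G"
proof (rule hom_ext)
 have l: "linear_map R (M \<boxtimes> N) (cd G) (ar F)" "linear_map R (M \<boxtimes> N) (cd G) (ar G)"
  using Ar_linear0[OF assms(1)] Ar_linear0[OF assms(2)] unfolding e by blast+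
 fix x assume "x :. (dm F)"
 then show "ar F x = ar G x"
  unfolding e by (rule pt_ext[OF assms(3,4) Ar_D(2)[OF assms(2)] l, rotated]) (rule eq)
qed simp_all

lemma pt_ext3:
 assumes [simp]: "M : Ob C" "N : Ob C" "Q : Ob C" "P : Ob C"
  and f: "linear_map R (M \<boxtimes> N \<boxtimes> Q) P f" and g: "linear_map R (M \<boxtimes> N \<boxtimes> Q) P g"
  and eq: "!!m n q. m :. M ==> n :. N ==> q :. Q ==>
   f (pt (M \<boxtimes> N) Q (pt M N m n) q) = g (pt (M \<boxtimes> N) Q (pt M N m n) q)"
  and x: "x :. (M \<boxtimes> N \<boxtimes> Q)"
 shows "f x = g x"
proof (rule pt_ext[OF _ _ _ f g _ x])
 fix u q assume u: "u :. (M \<boxtimes> N)" and [simp]: "q :. Q"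
 show "f (pt (M \<boxtimes> N) Q u q) = g (pt (M \<boxtimes> N) Q u q)"
  by (rule pt_ext[where P = P and f = "%u. f (pt (M \<boxtimes> N) Q u q)" and g = "%u. g (pt (M \<boxtimes> N) Q u q)"])
   (use u eq in \<open>auto intro: linear_comp[OF f] linear_comp[OF g]\<close>)
qed simp_all

lemma eq3:
 assumes [simp]: "F : Ar C" "G : Ar C" "M : Ob C" "N : Ob C" "Q : Ob C"
  and e [simp]: "dm F = M \<boxtimes> N \<boxtimes> Q" "dm G = M \<boxtimes> N \<boxtimes> Q" "cd F = cd G"
  and eq: "!!m n q. m :. M ==> n :. N ==> q :. Q ==>
   ar F (pt (M \<boxtimes> N) Q (pt M N m n) q) = ar G (pt (M \<boxtimes> N) Q (pt M N m n) q)"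
 shows "F = G"
proof (rule hom_ext)
 have l: "linear_map R (M \<boxtimes> N \<boxtimes> Q) (cd G) (ar F)" "linear_map R (M \<boxtimes> N \<boxtimes> Q) (cd G) (ar G)"
  using Ar_linear0[OF assms(1)] Ar_linear0[OF assms(2)] unfolding e by blast+
 fix x assume "x :. (dm F)"
 then show "ar F x = ar G x"
  unfolding e by (rule pt_ext3[OF assms(3,4,5) Ar_D(2)[OF assms(2)] l, rotated]) (rule eq)
qed simp_all

lemma eq4:
 assumes [simp]: "F : Ar C" "G : Ar C" "M : Ob C" "N : Ob C" "Q : Ob C" "Q' : Ob C"
  and e [simp]: "dm F = M \<boxtimes> N \<boxtimes> Q \<boxtimes> Q'" "dm G = M \<boxtimes> N \<boxtimes> Q \<boxtimes> Q'" "cd F = cd G"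
  and eq: "!!m n q q'. m :. M ==> n :. N ==> q :. Q ==> q' :. Q' ==>
   ar F (pt (M \<boxtimes> N \<boxtimes> Q) Q' (pt (M \<boxtimes> N) Q (pt M N m n) q) q') = ar G (pt (M \<boxtimes> N \<boxtimes> Q) Q' (pt (M \<boxtimes> N) Q (pt M N m n) q) q')"
 shows "F = G"
proof (rule eq2[of _ _ "M \<boxtimes> N \<boxtimes> Q" Q'])
 fix u q' assume u: "u :. (M \<boxtimes> N \<boxtimes> Q)" and [simp]: "q' :. Q'"
 let ?f = "%F u. ar F (pt (M \<boxtimes> N \<boxtimes> Q) Q' u q')"
 show "?f F u = ?f G u"
  by (rule pt_ext3[of M N Q "cd G" "?f F" "?f G"]) (simp_all add: eq u)
qed simp_all

lemma monoidal: "monoidal_category C"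
proof
 fix F assume "F : Ar C"
 then show "Dom C F : Ob C \<and> Cod C F : Ob C" by (auto simp: sel)
next
 fix M N P Q F G H
 assume F: "F : Hom C M N"
 note [simp] = F[unfolded Hom_iff, THEN conjunct1] F[unfolded Hom_iff, THEN conjunct2]
 show "F \<cdot> Id C M = F" by (rule hom_ext) (use Ar_D[of F] in simp_all)
 show "Id C N \<cdot> F = F" by (rule hom_ext) (use Ar_D[of F] in simp_all)
 assume G: "G : Hom C N P"
 note [simp] = G[unfolded Hom_iff, THEN conjunct1] G[unfolded Hom_iff, THEN conjunct2]
 show "G \<cdot> F : Hom C M P" by (simp add: Hom_iff)
 assume H: "H : Hom C P Q"
 note [simp] = H[unfolded Hom_iff, THEN conjunct1] H[unfolded Hom_iff, THEN conjunct2]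
 show "H \<cdot> G \<cdot> F = H \<cdot> (G \<cdot> F)"
  by (rule hom_ext) simp_all
next
 fix F F' G G' A A' A'' B B' B''
 assume F: "F : Hom C A A'" "F' : Hom C A' A''" and G: "G : Hom C B B'" "G' : Hom C B' B''"
 then show "(F' \<cdot> F) \<star> (G' \<cdot> G) = (F' \<star> G') \<cdot> (F \<star> G)"
  unfolding Hom_iff using Ar_D[of F] Ar_D[of G] by (intro eq2[of _ _ A B]) simp_all
next
 fix A A' B B' D D' F G H
 assume F: "F : Hom C A A'" and G: "G : Hom C B B'" and H: "H : Hom C D D'"
 then show "Assoc C A' B' D' \<cdot> (F \<star> G \<star> H) = (F \<star> (G \<star> H)) \<cdot> Assoc C A B D"
  unfolding Hom_iff using Ar_D[of F] Ar_D[of G] Ar_D[of H] by (intro eq3[of _ _ A B D]) simp_all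
next
 fix A B F assume F: "F : Hom C A B"
 then have [simp]: "A : Ob C" "B : Ob C" "hom A B (ar F)" using Ar_D[of F] by (auto simp: Hom_iff)
 have [simp]: "ar F (la A z m) = la B z (ar F m)" "ar F (ra A z m) = ra B z (ar F m)"
  if "z :. (Unit C)" "m :. A" for z m
  using that by (auto intro: la_nat ra_nat)
 show "Lunit C B \<cdot> (Id C (Unit C) \<star> F) = F \<cdot> Lunit C A"
  using F unfolding Hom_iff by (intro eq2[of _ _ "Unit C" A]) (simp_all add: la_nat)
 show "Runit C B \<cdot> (F \<star> Id C (Unit C)) = F \<cdot> Runit C A"
  using F unfolding Hom_iff by (intro eq2[of _ _ A "Unit C"]) (simp_all add: ra_nat)
next
 fix A B D E assume [simp]: "A : Ob C" "B : Ob C" "D : Ob C" "E : Ob C"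
 show "Assoc C A B (D \<boxtimes> E) \<cdot> Assoc C (A \<boxtimes> B) D E = (Id C A \<star> Assoc C B D E) \<cdot> (Assoc C A (B \<boxtimes> D) E \<cdot> (Assoc C A B D \<star> Id C E))"
  by (rule eq4[of _ _ A B D E]) simp_all
next
 fix A B assume [simp]: "A : Ob C" "B : Ob C"
 show "(Id C A \<star> Lunit C B) \<cdot> Assoc C A (Unit C) B = Runit C A \<star> Id C B"
  by (rule eq3[of _ _ A "Unit C" B]) (simp_all add: pt_unit)
 show "Id C A \<star> Id C B = Id C (A \<boxtimes> B)"
  by (rule eq2[of _ _ A B]) simp_all
qed (auto simp: Hom_iff intro!: iso_arrowI assoc_Hom lunit_Hom runit_Hom)

end

section \<open>The category of Yetter-Drinfeld modules\<close>

context base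
begin

lemma ll_D:
 assumes "left_linear R B M N f"
 shows "linear_map R M N f" "!!Q g. linear_map R Q M g ==> linear_map R Q N (%x. f (g x))" "!!m. m :. M ==> f m :. N"
  "!!b m. b :. B ==> m :. M ==> f (act M b m) = act N b (f m)"
 using assms linear_comp[of M N f] linear_mapD(1)[of M N f] by (auto simp: left_linear_def)

lemma ll_cong:
 assumes "left_module R B M" "left_linear R B M N f" "!!x. x :. M ==> g x = f x"
 shows "left_linear R B M N g"
proof -
 note [simp] = left_moduleD(1)[OF assms(1)] ll_D[OF assms(2)] linear_mapD(1)[OF left_moduleD(2)[OF assms(1)]]
 have "linear_map R M N g" by (rule linear_map_cong[OF _ assms(3)]) simp_all
 then show ?thesis by (simp add: left_linear_def assms(3))
qed

lemma ll_id: "left_linear R B M M (%x. x)"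
 by (simp add: left_linear_def)

lemma ll_comp: "left_linear R B M N f ==> left_linear R B N P g ==> left_linear R B M P (%x. g (f x))"
proof -
 assume f: "left_linear R B M N f" and g: "left_linear R B N P g"
 show ?thesis
  unfolding left_linear_def using ll_D(2)[OF g ll_D(1)[OF f]] by (simp add: ll_D(3,4)[OF f] ll_D(4)[OF g])
qed

lemma ll_inv:
 assumes M: "left_module R B M" and f: "left_linear R B M N f" and b: "bij_betw f (carrier M) (carrier N)"
 shows "left_linear R B N M (inv_into (carrier M) f)"
proof -
 let ?g = "inv_into (carrier M) f"
 note [simp] = ll_D[OF f]
 have g: "?g y :. M \<and> f (?g y) = y" if "y :. N" for y
  using that b inv_into_into[of y f "carrier M"] f_inv_into_f[of y f "carrier M"] by (auto simp: bij_betw_def)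
 have i: "?g (f x) = x" if "x :. M" for x
  using that b by (simp add: bij_betw_def inv_into_f_f)
 have m: "module R M" by (rule left_moduleD(1)[OF M])
 have a: "act M b x :. M" if "b :. B" "x :. M" for b x
  using linear_mapD(1)[OF left_moduleD(2)[OF M]] that by blast
 have e: "?g y = x" if "y :. N" "x :. M" "f x = y" for x y
  using i[OF that(2)] that(3) by simp
 note l = linear_mapD[OF ll_D(1)[OF f]]
 show ?thesis
  unfolding left_linear_def
 proof (intro conjI ballI linear_mapI)
  fix x y assume xy: "x :. N" "y :. N"
  have "f (?g x \<oplus>\<^sub>M ?g y) = x \<oplus>\<^sub>N y" using xy g l(2) by simp
  with i[of "?g x \<oplus>\<^sub>M ?g y"] show "?g (x \<oplus>\<^sub>N y) = ?g x \<oplus>\<^sub>M ?g y" using xy g m by simp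
 next
  fix r x assume rx: "r :. R" "x :. N"
  have "f (r \<odot>\<^sub>M ?g x) = r \<odot>\<^sub>N x" using rx g l(3) by simp
  with i[of "r \<odot>\<^sub>M ?g x"] show "?g (r \<odot>\<^sub>N x) = r \<odot>\<^sub>M ?g x" using rx g m by simp
 next
  fix c x assume cx: "c :. B" "x :. N"
  have "f (act M c (?g x)) = act N c x" using cx g by simp
  with i[of "act M c (?g x)"] show "?g (act N c x) = act M c (?g x)" using cx g a by simp
 qed (use g in simp)
qed

end

text \<open>Relates a formula evaluated on an arbitrary preimage, as in \<open>lunit_arrow\<close>,
  to a linear map known on generators; independence of the preimage is implied by the existence of
  \<open>g\<close>.\<close>

lemma (in diag_tensor) unproject_linear:
 assumes "obj M" "obj N" "module R P" "bilin R M N P bb" "linear_map R (TM M N) P g" "x :. (TM M N)"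
  and "!!m n. m :. M ==> n :. N ==> g (pt M N m n) = bb m n"
 shows "lsum P (map (%(m, n). bb m n) (unproject R B M N x)) = g x"
proof -
 let ?t = "unproject R B M N x"
 have "\<exists>t. t :. (tensor R M N) \<and> x = Tens (dg M N \<one>\<^sub>B t)"
  using assms by (metis summands_TM summands_closed)
 then have t: "?t :. (tensor R M N) \<and> x = Tens (dg M N \<one>\<^sub>B ?t)"
  unfolding unproject_def by (rule someI_ex)
 then have wf: "set ?t \<subseteq> carrier M \<times> carrier N"
  using assms by (intro tensor_wf) auto
 have "g x = g (ssum M N (TM M N) ?t (pt M N))"
  using t proj_ssum[OF assms(1,2) wf] by simp
 also have "... = ssum M N P ?t bb"
  using assms by (simp add: linear_ssum[OF assms(5)])
 finally show ?thesis by (simp add: ssum_wf[OF wf])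
qed

lemma (in diag_tensor) tmap_bij:
 assumes [simp]: "obj M" "obj N" "obj M'" "obj N'"
  and f: "left_linear R B M M' f" "bij_betw f (carrier M) (carrier M')" and g: "left_linear R B N N' g" "bij_betw g (carrier N) (carrier N')"
 shows "bij_betw (tmap M' N' f g) (carrier (TM M N)) (carrier (TM M' N'))"
proof -
 let ?f = "inv_into (carrier M) f" and ?g = "inv_into (carrier N) g"
 have f': "left_linear R B M' M ?f" by (rule ll_inv[OF obj_left f]) simp
 have g': "left_linear R B N' N ?g" by (rule ll_inv[OF obj_left g]) simp
 note t = tmap_linear[OF assms(1-4) f(1) g(1)] and t' = tmap_linear[OF assms(3,4,1,2) f' g']
 note [simp] = ll_D(3)[OF f(1)] ll_D(3)[OF g(1)] ll_D(3)[OF f'] ll_D(3)[OF g'] tmap_pt[OF assms(1-4) f(1) g(1)] tmap_pt[OF assms(3,4,1,2) f' g']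
 have e: "?f (f m) = m" if "m :. M" for m using that f(2) by (simp add: bij_betw_def)
 have e': "f (?f m) = m" if "m :. M'" for m using that f(2) by (simp add: bij_betw_def f_inv_into_f)
 have d: "?g (g m) = m" if "m :. N" for m using that g(2) by (simp add: bij_betw_def)
 have d': "g (?g m) = m" if "m :. N'" for m using that g(2) by (simp add: bij_betw_def f_inv_into_f)
 have 1: "tmap M N ?f ?g (tmap M' N' f g x) = x" if "x :. (TM M N)" for x
  by (rule TM_ext[OF _ _ _ _ _ _ that, where P = "TM M N" and f = "%x. tmap M N ?f ?g (tmap M' N' f g x)"])
   (use ll_D(1)[OF ll_comp[OF t t']] in \<open>simp_all add: e d\<close>)
 have 2: "tmap M' N' f g (tmap M N ?f ?g x) = x" if "x :. (TM M' N')" for x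
  by (rule TM_ext[OF _ _ _ _ _ _ that, where P = "TM M' N'" and f = "%x. tmap M' N' f g (tmap M N ?f ?g x)"])
   (use ll_D(1)[OF ll_comp[OF t' t]] in \<open>simp_all add: e' d'\<close>)
 show ?thesis
  by (rule bij_betw_byWitness[where f' = "tmap M N ?f ?g"]) (use 1 2 ll_D(3)[OF t] ll_D(3)[OF t'] in auto)
qed

lemma (in weak_hopf_fgp) colinearI:
 assumes [simp]: "yd_module R H M" and f: "linear_map R M N f" and N: "module R N"
  and e: "!!x. x :. M ==> coact N (f x) = co M (tensor R N H) x (%y k. tn N H (f y) k)"
 shows "right_colinear R H M N f"
 unfolding right_colinear_def
proof
 fix x assume x: "x :. M"
 show "coact N (f x) = tens R N H (map (%(y, k). (f y, k)) (coact M x))"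
  unfolding e[OF x] by (rule tens_map_ssum[symmetric]) (use N x linear_mapD(1)[OF f] coact_wf[of M x] in auto)
qed

context double_univ
begin

abbreviation "Y \<equiv> yd_objects R H :: ('k, 'h, 'x universe) ydmodule set"
abbreviation "hY M N \<equiv> left_linear R D (F_ob R H S M) (F_ob R H S N)"

lemma Y_yd [simp]: "M : Y ==> yd_module R H M"
 by (simp add: yd_objects_def)

lemma hY: "M : Y ==> N : Y ==> hY M N f \<longleftrightarrow> left_linear R H M N f \<and> right_colinear R H M N f"
 by (simp add: F_linear_iff)

lemma hY_linear: "hY M N f ==> linear_map R M N f"
 by (simp add: left_linear_def same_module_linear[OF same_F same_F, symmetric])

lemma yT_Y [simp]:
 assumes "M : Y" "N : Y"
 shows "yT M N : Y"
proof -
 have n: "normal_module R (yT M N)"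
  using YT.TM_normal[of M N] YT.TT_obj[of M N] assms
  by (simp add: normal_module_def tens_yd_def bmodule.defs ydmodule.defs)
 have a: "act (yT M N) = (\<lambda>b\<in>carrier H. \<lambda>m\<in>carrier (yT M N). act (yT M N) b m)"
  by (simp add: yT_sel YT.TM_sel cong: restrict_cong)
 have c: "coact (yT M N) : extensional (carrier (yT M N))"
  by (simp add: tens_yd_def bmodule.defs ydmodule.defs)
 show ?thesis
  unfolding yd_objects_def by (intro CollectI conjI n a c yT_yd; use assms in simp)
qed

lemma yU_Y [simp]: "yU : Y"
proof -
 have n: "normal_module R yU"
  using UN.unit_normal left_moduleD(1)[OF yd_left[OF yU_yd]]
  by (simp add: normal_module_def unit_yd_def bmodule.defs ydmodule.defs)
 have a: "act yU = (\<lambda>b\<in>carrier H. \<lambda>m\<in>carrier yU. act yU b m)"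
  unfolding yU_sel by (rule UN.unit_sel(4))
 have c: "coact yU : extensional (carrier yU)"
  by (simp add: unit_yd_def bmodule.defs ydmodule.defs)
 show ?thesis
  unfolding yd_objects_def by (intro CollectI conjI n a c yU_yd)
qed

lemma co_pt:
 fixes M N :: "('k, 'h, 'x universe) ydmodule"
 assumes [simp]: "yd_module R H M" "yd_module R H N" "m :. M" "n :. N" "module R P" and bb [simp]: "bilin R (yT M N) H P bb"
 shows "co (yT M N) P (pt M N m n) bb = co M P m (%x k. co N P n (%y l. bb (pt M N x y) (l \<otimes> k)))"
proof -
 note [simp] = bilin_lin[OF bb]
 have tT: "tens R (tens_mod R H M N) H = tens R (yT M N) H" "tensor R (tens_mod R H M N) H = tensor R (yT M N) H"
  by (rule same_tens same_tensor; simp add: yT_sel)+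
 show ?thesis unfolding yT_coact_pt[OF assms(1-4)] tT by simp
qed

lemma yT_ll: "left_linear R H (tens_mod R H M N) (tens_mod R H M' N') f = left_linear R H (yT M N) (yT M' N') f"
 by (simp add: left_linear_def yT_sel same_module_linear[OF yT_sel(1) yT_sel(1)])

lemma Y_tens:
 assumes [simp]: "M : Y" "N : Y" "M' : Y" "N' : Y" and f: "hY M M' f" and g: "hY N N' g"
 shows "hY (yT M N) (yT M' N') (YT.tmap M' N' f g)"
proof -
 have F: "left_linear R H M M' f" "right_colinear R H M M' f" and G: "left_linear R H N N' g" "right_colinear R H N N' g"
  using f g by (auto simp: hY)
 have t: "left_linear R H (yT M N) (yT M' N') (YT.tmap M' N' f g)"
  using YT.tmap_linear[OF _ _ _ _ F(1) G(1)] unfolding yT_ll by simp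
 note [simp] = ll_D(3)[OF F(1)] ll_D(3)[OF G(1)] YT.tmap_pt[OF _ _ _ _ F(1) G(1)] ll_D(2,3)[OF t]
 let ?Q = "tensor R (yT M' N') H" and ?t = "YT.tmap M' N' f g"
 have "right_colinear R H (yT M N) (yT M' N') ?t"
 proof (rule colinearI)
  show "linear_map R (yT M N) (yT M' N') ?t" by (rule ll_D(1)[OF t])
  fix x assume x: "x :. (yT M N)"
  show "coact (yT M' N') (?t x) = co (yT M N) ?Q x (%y k. tn (yT M' N') H (?t y) k)"
  proof (rule YT.TT_ext[OF _ _ _ _ _ _ x, where P = ?Q and f = "%x. coact (yT M' N') (?t x)"])
   fix m n assume [simp]: "m :. M" "n :. N"
   have "coact (yT M' N') (?t (pt M N m n)) = co M' ?Q (f m) (%x k. co N' ?Q (g n) (%y l. tn (yT M' N') H (pt M' N' x y) (l \<otimes> k)))"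
    by (rule HOL.trans[rotated], (rule co_pt; simp)) (simp add: tensor_elem)
   also have "... = co M ?Q m (%x k. co N ?Q n (%y l. tn (yT M' N') H (pt M' N' (f x) (g y)) (l \<otimes> k)))"
    using F G by (simp add: co_colinear[of M M'] co_colinear[of N N'] ll_D(1)[OF F(1)] ll_D(1)[OF G(1)])
   also have "... = co (yT M N) ?Q (pt M N m n) (%y k. tn (yT M' N') H (?t y) k)"
    by (subst co_pt) simp_all
   finally show "coact (yT M' N') (?t (pt M N m n)) = ..." .
  qed simp_all
 qed simp_all
 then show ?thesis using t by (simp add: hY)
qed

lemma Y_assoc:
 assumes [simp]: "M : Y" "N : Y" "P : Y"
 shows "hY (yT (yT M N) P) (yT M (yT N P)) (YT.asm M N P)"
proof -
 let ?A = "yT (yT M N) P" and ?B = "yT M (yT N P)" and ?a = "YT.asm M N P"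
 note l = YT.asm_linear[of M N P]
 note [simp] = linear_comp[OF l] linear_mapD(1)[OF l] YT.asm_pt
 let ?Q = "tensor R ?B H"
 have "?a (act ?A h x) = act ?B h (?a x)" if h [simp]: "h :. H" and x: "x :. ?A" for h x
 proof (rule YT.TT_ext2[OF _ _ _ _ _ _ _ x, where Q = ?B and f = "%x. ?a (act ?A h x)"])
  fix m n p assume [simp]: "m :. M" "n :. N" "p :. P"
  have "?a (act ?A h (pt (yT M N) P (pt M N m n) p)) =
   sw ?B h (%a b. sw ?B a (%c d. pt M (yT N P) (act M c m) (pt N P (act N d n) (act P b p))))"
   by (simp add: YT.TT_act_pt linear_ssum[OF l] del: YT.pt_simps)
  also have "... = act ?B h (?a (pt (yT M N) P (pt M N m n) p))"
   by (rule HOL.trans, (rule coas; simp)) (simp add: YT.TT_act_pt del: YT.pt_simps)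
  finally show "?a (act ?A h (pt (yT M N) P (pt M N m n) p)) = ..." .
 qed simp_all
 then have "left_linear R H ?A ?B ?a" using l by (simp add: left_linear_def)
 moreover have "right_colinear R H ?A ?B ?a"
 proof (rule colinearI)
  fix x assume x: "x :. ?A"
  show "coact ?B (?a x) = co ?A ?Q x (%y k. tn ?B H (?a y) k)"
  proof (rule YT.TT_ext2[OF _ _ _ _ _ _ _ x, where Q = ?Q and f = "%x. coact ?B (?a x)"])
   fix m n p assume [simp]: "m :. M" "n :. N" "p :. P"
   have "coact ?B (?a (pt (yT M N) P (pt M N m n) p)) = co ?B ?Q (pt M (yT N P) m (pt N P n p)) (tn ?B H)"
    by (simp add: tensor_elem)
   also have "... = co ?A ?Q (pt (yT M N) P (pt M N m n) p) (%y k. tn ?B H (?a y) k)"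
    by (simp add: co_pt co_pt)
   finally show "coact ?B (?a (pt (yT M N) P (pt M N m n) p)) = ..." .
  qed simp_all
 qed (use l in simp_all)
 ultimately show ?thesis by (simp add: hY)
qed

lemma yU_bilin:
 assumes "module R P"
 shows "bilin R yU M P bb = bilin R mU M P bb" "bilin R M yU P bb = bilin R M mU P bb"
 by (simp_all add: bilin_def yU_sel same_module_linear[OF yU_sel(1) same_module_refl])

lemma yU_co: "x :. mU ==> module R P ==> bilin R mU H P bb ==> co yU P x bb = sw P (uI x) (%a b. bb (\<iota> (et b)) (T a))"
proof -
 assume [simp]: "x :. mU" "module R P" and bb [simp]: "bilin R mU H P bb"
 have "co yU P x bb = ssum mU H P (coact yU x) bb" by (simp add: ssum_def yU_sel)
 also have "... = sw P (uI x) (%a b. bb (\<iota> (et b)) (T a))" unfolding yU_coact[OF \<open>x :. mU\<close>] by simp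
 finally show ?thesis .
qed

definition lY where "lY M = YT.lft yU M M (%z m. act M (uI z) m)"
definition rY where "rY M = YT.lft M yU M (%m z. act M (esb (uI z)) m)"

lemma lY:
 assumes [simp]: "M : Y"
 shows "z :. yU ==> m :. M ==> lY M (pt yU M z m) = act M (uI z) m" (is "_ ==> _ ==> ?pt z m")
  "hY (yT yU M) M (lY M)" "bij_betw (lY M) (carrier (yT yU M)) (carrier M)"
proof -
 let ?A = "yT yU M" and ?Q = "tensor R M H"
 have bl: "bilin R yU M M (%z m. act M (uI z) m)" by (simp add: yU_bilin)
 have ml: "act M (h \<otimes> k) m = act M h (act M k m)" if "h :. H" "k :. H" "m :. M" for h k m
  using that by simp
 have em: "sw M h (%a b. act M (et (a \<otimes> uI z)) (act M b m)) = act M h (act M (uI z) m)"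
  if [simp]: "h :. H" "z :. mU" "m :. M" for h z m
  using sw_et_mult[of M h "uI z" "%h. act M h m"] by simp
 have "YT.balanced yU M M (%z m. act M (uI z) m)"
  unfolding YT.balanced_def using bl em[of \<one>] by (simp add: yU_sel del: uI_act(2))
 then have ptl: "?pt z m" if "z :. yU" "m :. M" for z m
  unfolding lY_def using that by (intro YT.lft_pt) simp_all
 have l: "linear_map R ?A M (lY M)" unfolding lY_def by (rule YT.TT_lft_linear) (simp_all add: bl)
 note [simp] = linear_comp[OF l] linear_mapD(1)[OF l] ptl
 have [simp]: "z :. yU ==> z :. mU" "\<iota> \<one> :. yU" for z by (simp_all add: yU_sel)
 have acl: "act yU h z :. yU" if "h :. H" "z :. yU" for h z using that by simp
 have "lY M (act ?A h x) = act M h (lY M x)" if [simp]: "h :. H" and x: "x :. ?A" for h x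
 proof (rule YT.TT_ext[OF _ _ _ _ _ _ x, where P = M and f = "%x. lY M (act ?A h x)"])
  fix z m assume [simp]: "z :. yU" "m :. M"
  have "lY M (act ?A h (pt yU M z m)) = sw M h (%a b. act M (uI (act yU a z)) (act M b m))"
   by (simp add: YT.TT_act_pt linear_ssum[OF l] del: YT.pt_simps uI_act)
  also have "... = act M h (lY M (pt yU M z m))"
   using em[of h z m] by (simp add: yU_sel(2) del: uI_act(2))
  finally show "lY M (act ?A h (pt yU M z m)) = ..." .
 qed simp_all
 then have L: "left_linear R H ?A M (lY M)" using l by (simp add: left_linear_def)
 have "right_colinear R H ?A M (lY M)"
 proof (rule colinearI)
  fix x assume x: "x :. ?A"
  show "coact M (lY M x) = co ?A ?Q x (%y k. tn M H (lY M y) k)"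
  proof (rule YT.TT_ext[OF _ _ _ _ _ _ x, where P = ?Q and f = "%x. coact M (lY M x)"])
   fix z m assume [simp]: "z :. yU" "m :. M"
   have "coact M (lY M (pt yU M z m)) = co M ?Q (act M (uI z) m) (tn M H)"
    by (simp add: tensor_elem)
   also have "... = co yU ?Q z (%w l. co M ?Q m (%x k. tn M H (act M (uI w) x) (k \<otimes> l)))"
    by (rule HOL.trans, rule HOL.trans, (rule co_act_Ht; simp), (rule sw_Ht_et[symmetric]; simp), subst yU_co) simp_all
   also have "... = co ?A ?Q (pt yU M z m) (%y k. tn M H (lY M y) k)"
    by (subst co_pt) (simp_all cong: ssum_cong)
   finally show "coact M (lY M (pt yU M z m)) = ..." .
  qed simp_all
 qed (use l in simp_all)
 then show "hY ?A M (lY M)" using L by (simp add: hY)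
 \<comment> \<open>The inverse sends m to \<Delta>(1)(1 \<otimes> m); on generators
   \<open>sw_one_et\<close> moves z back to the first factor.\<close>
 have i: "pt yU M (\<iota> \<one>) (lY M x) = x" if x: "x :. ?A" for x
 proof (rule YT.TT_ext[OF _ _ _ _ _ _ x, where P = ?A and f = "%x. pt yU M (\<iota> \<one>) (lY M x)"])
  fix z m assume z [simp]: "z :. yU" and [simp]: "m :. M"
  then have [simp]: "z :. mU" by (simp only: yU_sel)
  have "pt yU M (\<iota> \<one>) (act M (uI z) m) = act ?A \<one> (pt yU M (\<iota> \<one>) (act M (uI z) m))" by simp
  also have "... = sw ?A \<one> (%a b. pt yU M (\<iota> (et a)) (act M (b \<otimes> uI z) m))"
   by (subst YT.TT_act_pt) (simp_all add: yU_sel)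
  also have "... = sw ?A \<one> (%a b. pt yU M (\<iota> (et (a \<otimes> uI z))) (act M b m))"
  proof -
   have "bilin R H H ?A (%w b. pt yU M (\<iota> (et w)) (act M b m))"
    by (intro bilinI) (simp_all add: yU_sel(3) same_module_linear[OF same_module_refl yU_sel(1), symmetric])
   then show ?thesis using sw_one_et[of ?A "uI z" "%w b. pt yU M (\<iota> (et w)) (act M b m)"] by (simp add: eps_eps(6)[of \<one>])
  qed
  also have "... = act ?A \<one> (pt yU M z m)"
   by (subst YT.TT_act_pt) (simp_all add: yU_sel)
  finally show "pt yU M (\<iota> \<one>) (lY M (pt yU M z m)) = pt yU M z m" by simp
 qed simp_all
 show "bij_betw (lY M) (carrier ?A) (carrier M)"
  by (rule bij_betw_byWitness[where f' = "pt yU M (\<iota> \<one>)"]) (auto simp: i)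
 show "z :. yU ==> m :. M ==> ?pt z m" by (rule ptl)
qed

lemma rY:
 assumes [simp]: "M : Y"
 shows "z :. yU ==> m :. M ==> rY M (pt M yU m z) = act M (esb (uI z)) m" (is "_ ==> _ ==> ?pt z m")
  "hY (yT M yU) M (rY M)" "bij_betw (rY M) (carrier (yT M yU)) (carrier M)"
proof -
 let ?A = "yT M yU" and ?Q = "tensor R M H"
 have bl: "bilin R M yU M (%m z. act M (esb (uI z)) m)" by (simp add: yU_bilin)
 have em: "sw M h (%a b. act M (esb (et (b \<otimes> uI z))) (act M a m)) = act M h (act M (esb (uI z)) m)"
  if [simp]: "h :. H" "z :. mU" "m :. M" for h z m
  using sw_esb_mult[of M h "uI z" "%h. act M h m"] by (simp add: eps_eps(9)[of \<one>])
 have "YT.balanced M yU M (%m z. act M (esb (uI z)) m)"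
  unfolding YT.balanced_def using bl em[of \<one>] by (simp add: yU_sel del: uI_act(2))
 then have ptl: "?pt z m" if "z :. yU" "m :. M" for z m
  unfolding rY_def using that by (intro YT.lft_pt) simp_all
 have l: "linear_map R ?A M (rY M)" unfolding rY_def by (rule YT.TT_lft_linear) (simp_all add: bl)
 note [simp] = linear_comp[OF l] linear_mapD(1)[OF l] ptl
 have [simp]: "z :. yU ==> z :. mU" "\<iota> \<one> :. yU" for z by (simp_all add: yU_sel)
 have "rY M (act ?A h x) = act M h (rY M x)" if [simp]: "h :. H" and x: "x :. ?A" for h x
 proof (rule YT.TT_ext[OF _ _ _ _ _ _ x, where P = M and f = "%x. rY M (act ?A h x)"])
  fix m z assume [simp]: "m :. M" "z :. yU"
  have "rY M (act ?A h (pt M yU m z)) = sw M h (%a b. act M (esb (uI (act yU b z))) (act M a m))"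
   by (simp add: YT.TT_act_pt linear_ssum[OF l] del: YT.pt_simps uI_act)
  also have "... = act M h (rY M (pt M yU m z))"
   using em[of h z m] by (simp add: yU_sel(2) del: uI_act(2))
  finally show "rY M (act ?A h (pt M yU m z)) = ..." .
 qed simp_all
 then have L: "left_linear R H ?A M (rY M)" using l by (simp add: left_linear_def)
 have "right_colinear R H ?A M (rY M)"
 proof (rule colinearI)
  fix x assume x: "x :. ?A"
  show "coact M (rY M x) = co ?A ?Q x (%y k. tn M H (rY M y) k)"
  proof (rule YT.TT_ext[OF _ _ _ _ _ _ x, where P = ?Q and f = "%x. coact M (rY M x)"])
   fix m z assume [simp]: "m :. M" "z :. yU"
   have "coact M (rY M (pt M yU m z)) = co M ?Q (act M (esb (uI z)) m) (tn M H)"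
    by (simp add: tensor_elem)
   also have "... = co M ?Q m (%x k. co yU ?Q z (%w l. tn M H (act M (esb (uI w)) x) (l \<otimes> k)))"
    by (rule HOL.trans, rule HOL.trans, (rule co_act_Hs; simp), (rule co_unit_r[symmetric]; simp), rule ssum_eqI, subst yU_co) (simp_all add: eps_eps(9)[of \<one>])
   also have "... = co ?A ?Q (pt M yU m z) (%y k. tn M H (rY M y) k)"
    by (subst co_pt) (simp_all cong: ssum_cong)
   finally show "coact M (rY M (pt M yU m z)) = ..." .
  qed simp_all
 qed (use l in simp_all)
 then show "hY ?A M (rY M)" using L by (simp add: hY)
 have e1: "esb \<one> = \<one>" unfolding T_Ht[OF one_in(1), symmetric] by simp
 \<comment> \<open>The inverse sends m to \<Delta>(1)(m \<otimes> 1); on generators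
   \<open>sw_one_esb_et\<close> moves z back to the second factor.\<close>
 have i: "pt M yU (rY M x) (\<iota> \<one>) = x" if x: "x :. ?A" for x
 proof (rule YT.TT_ext[OF _ _ _ _ _ _ x, where P = ?A and f = "%x. pt M yU (rY M x) (\<iota> \<one>)"])
  fix m z assume [simp]: "m :. M" and z [simp]: "z :. yU"
  then have [simp]: "z :. mU" by (simp only: yU_sel)
  have "pt M yU (act M (esb (uI z)) m) (\<iota> \<one>) = act ?A \<one> (pt M yU (act M (esb (uI z)) m) (\<iota> \<one>))" by simp
  also have "... = sw ?A \<one> (%a b. pt M yU (act M (a \<otimes> esb (uI z)) m) (\<iota> (et b)))"
   by (subst YT.TT_act_pt) (simp_all add: yU_sel)
  also have "... = sw ?A \<one> (%a b. pt M yU (act M a m) (\<iota> (et (b \<otimes> uI z))))"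
  proof -
   have "bilin R H H ?A (%a w. pt M yU (act M a m) (\<iota> (et w)))"
    by (intro bilinI) (simp_all add: yU_sel(3) same_module_linear[OF same_module_refl yU_sel(1), symmetric])
   then show ?thesis using sw_one_esb_et[of ?A "uI z" "%a w. pt M yU (act M a m) (\<iota> (et w))"] by (simp add: eps_eps(6)[of \<one>])
  qed
  also have "... = act ?A \<one> (pt M yU m z)"
   by (subst YT.TT_act_pt) (simp_all add: yU_sel)
  finally show "pt M yU (rY M (pt M yU m z)) (\<iota> \<one>) = pt M yU m z" by simp
 qed simp_all
 show "bij_betw (rY M) (carrier ?A) (carrier M)"
  by (rule bij_betw_byWitness[where f' = "%m. pt M yU m (\<iota> \<one>)"]) (auto simp: i e1)
 show "z :. yU ==> m :. M ==> ?pt z m" by (rule ptl)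
qed

lemma pt_unit:
 assumes [simp]: "M : Y" "N : Y" "m :. M" "n :. N" and z: "z : Ht"
 shows "pt M N m (act N z n) = pt M N (act M (esb z) m) n"
proof -
 note [simp] = HtD(1)[OF z]
 let ?A = "yT M N"
 have p: "pt M N m n = sw ?A \<one> (%a b. pt M N (act M a m) (act N b n))" if [simp]: "m :. M" "n :. N" for m n
  using YT.TT_act_pt[of M N \<one> m n] by simp
 have "pt M N m (act N z n) = sw ?A \<one> (%a b. pt M N (act M a m) (act N (b \<otimes> z) n))" by (subst p) simp_all
 also have "... = pt M N (act M (esb z) m) n"
  by (rule HOL.trans, (rule sw_one_esb[OF _ z]; simp), subst p[of "act M (esb z) m"]) simp_all
 finally show ?thesis .
qed

end

text \<open>Morphisms are entered as D(H)-linear maps between the images under \<open>F_ob\<close>,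
  the same maps by \<open>F_linear_iff\<close>; closure under composition and inverses then comes
  from \<open>left_linear\<close>, with no separate argument for colinearity.\<close>

sublocale double_univ \<subseteq> YC: concrete_monoidal R "yd_category R H S \<iota>" "%M N. left_linear R D (F_ob R H S M) (F_ob R H S N)"
 pt "%M z m. act M (uI z) m" "%M z m. act M (esb (uI z)) m"
proof (intro concrete_monoidal.intro concrete_category.intro concrete_category_axioms.intro concrete_monoidal_axioms.intro base_axioms)
 let ?C = "yd_category R H S \<iota>"
 have o: "Ob ?C = Y" "TensOb ?C = yT" "Unit ?C = yU" by (simp_all add: yd_category_def)
 show "Ar ?C = {(M, f, N). M : Ob ?C \<and> N : Ob ?C \<and> hY M N f \<and> f : extensional (carrier M)}"
  unfolding o by (auto simp: yd_category_def F_linear_iff)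
 show "Dom ?C = (%(M, f, N). M)" "Cod ?C = (%(M, f, N). N)" "category.Id ?C = id_arrow" "Cmp ?C = comp_arrow"
  by (simp_all add: yd_category_def)
 show "Unit ?C : Ob ?C" by (simp add: o)
 fix M N P M' N' f g x m n z
 assume "M : Ob ?C"
 then have M [simp]: "M : Y" by (simp add: o)
 show "module R M" by simp
 show "hY M M (%x. x)" by (rule ll_id)
 show "\<exists>l. Lunit ?C M = (TensOb ?C (Unit ?C) M, restrict l (carrier (TensOb ?C (Unit ?C) M)), M) \<and> hY (TensOb ?C (Unit ?C) M) M l \<and>
   bij_betw l (carrier (TensOb ?C (Unit ?C) M)) (carrier M) \<and> (\<forall>z\<in>carrier (Unit ?C). \<forall>m\<in>carrier M. l (pt (Unit ?C) M z m) = act M (uI z) m)"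
 proof (intro exI[of _ "lY M"] conjI ballI)
  have "lsum M (map (%(z, m). act M (uI z) m) (unproject R H yU M x)) = lY M x" if "x :. (yT yU M)" for x
   by (rule YT.unproject_linear)
    (use that hY_linear[OF lY(2)[OF M]] in \<open>simp_all add: lY yU_bilin yT_sel same_module_linear[OF yT_sel(1) same_module_refl]\<close>)
  then show "Lunit ?C M = (TensOb ?C (Unit ?C) M, restrict (lY M) (carrier (TensOb ?C (Unit ?C) M)), M)"
   unfolding o by (simp add: yd_category_def lunit_arrow_def cong: restrict_cong)
 qed (simp_all add: o lY)
 show "\<exists>r. Runit ?C M = (TensOb ?C M (Unit ?C), restrict r (carrier (TensOb ?C M (Unit ?C))), M) \<and> hY (TensOb ?C M (Unit ?C)) M r \<and>
   bij_betw r (carrier (TensOb ?C M (Unit ?C))) (carrier M) \<and> (\<forall>m\<in>carrier M. \<forall>z\<in>carrier (Unit ?C). r (pt M (Unit ?C) m z) = act M (esb (uI z)) m)"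
 proof (intro exI[of _ "rY M"] conjI ballI)
  have "lsum M (map (%(m, z). act M (esb (uI z)) m) (unproject R H M yU x)) = rY M x" if "x :. (yT M yU)" for x
   by (rule YT.unproject_linear)
    (use that hY_linear[OF rY(2)[OF M]] in \<open>simp_all add: rY yU_bilin yT_sel same_module_linear[OF yT_sel(1) same_module_refl]\<close>)
  then show "Runit ?C M = (TensOb ?C M (Unit ?C), restrict (rY M) (carrier (TensOb ?C M (Unit ?C))), M)"
   unfolding o by (simp add: yd_category_def runit_arrow_def cong: restrict_cong)
 qed (simp_all add: o rY)
 assume "N : Ob ?C"
 then have N [simp]: "N : Y" by (simp add: o)
 show "TensOb ?C M N : Ob ?C" by (simp add: o)
 show "bilin R M N (TensOb ?C M N) (pt M N)" unfolding o by (rule YT.TT_pt_bilin) simp_all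
 { assume f: "hY M N f"
  then have L: "left_linear R H M N f" by (simp add: hY)
  show "linear_map R M N f" by (rule hY_linear[OF f])
  show "(!!x. x :. M ==> g x = f x) ==> hY M N g" by (rule ll_cong[OF F_left f]) (simp_all add: F_sel)
  show "bij_betw f (carrier M) (carrier N) ==> hY N M (inv_into (carrier M) f)"
   using ll_inv[OF F_left f] by (simp add: F_sel)
  assume "z :. (Unit ?C)" "m :. M"
  then show "f (act M (uI z) m) = act N (uI z) (f m)" "f (act M (esb (uI z)) m) = act N (esb (uI z)) (f m)"
   using ll_D(4)[OF L] by (simp_all add: o yU_sel) }
 { assume "m :. M" "z :. (Unit ?C)" "n :. N"
  then show "pt M N m (act N (uI z) n) = pt M N (act M (esb (uI z)) m) n"
   by (intro pt_unit) (simp_all add: o yU_sel) }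
 { assume "P : Ob ?C"
  then have P [simp]: "P : Y" by (simp add: o)
  show "hY M N f ==> hY N P g ==> hY M P (%x. g (f x))" by (rule ll_comp)
  show "linear_map R (TensOb ?C M N) P f ==> linear_map R (TensOb ?C M N) P g ==>
   (!!m n. m :. M ==> n :. N ==> f (pt M N m n) = g (pt M N m n)) ==> x :. (TensOb ?C M N) ==> f x = g x"
   unfolding o by (rule YT.TT_ext[of M N P f g x]) simp_all
  show "\<exists>a. Assoc ?C M N P = (TensOb ?C (TensOb ?C M N) P, restrict a (carrier (TensOb ?C (TensOb ?C M N) P)), TensOb ?C M (TensOb ?C N P)) \<and>
   hY (TensOb ?C (TensOb ?C M N) P) (TensOb ?C M (TensOb ?C N P)) a \<and>
   bij_betw a (carrier (TensOb ?C (TensOb ?C M N) P)) (carrier (TensOb ?C M (TensOb ?C N P))) \<and>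
   (\<forall>m\<in>carrier M. \<forall>n\<in>carrier N. \<forall>p\<in>carrier P. a (pt (TensOb ?C M N) P (pt M N m n) p) = pt M (TensOb ?C N P) m (pt N P n p))"
   unfolding o
   by (intro exI[of _ "YT.asm M N P"] conjI, simp add: yd_category_def assoc_arrow_def YT.asm_def[abs_def])
    (simp_all add: Y_assoc YT.asm_bij YT.asm_pt) }
 assume "M' : Ob ?C" "N' : Ob ?C" and f: "hY M M' f" and g: "hY N N' g"
 then have [simp]: "M' : Y" "N' : Y" by (simp_all add: o)
 have F: "left_linear R H M M' f" "left_linear R H N N' g" using f g by (simp_all add: hY)
 show "\<exists>t. TensAr ?C (M, f, M') (N, g, N') = (TensOb ?C M N, restrict t (carrier (TensOb ?C M N)), TensOb ?C M' N') \<and>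
   hY (TensOb ?C M N) (TensOb ?C M' N') t \<and> (\<forall>m\<in>carrier M. \<forall>n\<in>carrier N. t (pt M N m n) = pt M' N' (f m) (g n))"
  unfolding o
  by (intro exI[of _ "YT.tmap M' N' f g"] conjI, simp add: yd_category_def YT.tmap_def[abs_def])
   (simp_all add: Y_tens f g YT.tmap_pt[OF _ _ _ _ F])
qed

section \<open>The category of modules over \<open>D(H)\<close>\<close>

lemma (in diag_tensor) unproject_wf:
 assumes "obj M" "obj N" "x :. (TM M N)"
 shows "set (unproject R B M N x) \<subseteq> carrier M \<times> carrier N"
proof -
 have "\<exists>t. t :. (tensor R M N) \<and> x = Tens (dg M N \<one>\<^sub>B t)"
  using assms by (metis summands_TM summands_closed)
 then have "unproject R B M N x :. (tensor R M N)"
  unfolding unproject_def by (rule someI2_ex) simp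
 then show ?thesis using assms by (intro tensor_wf) auto
qed

context double_univ
begin

abbreviation "DO \<equiv> module_objects R D :: ('k, ('h \<times> ('h \<Rightarrow> 'k)) list set, 'x universe) bmodule set"
abbreviation "TD \<equiv> tens_mod R D"
abbreviation "dU \<equiv> unit_mod R D \<delta>"
abbreviation "uD \<equiv> inv_into (carrier (target D)) \<delta>"
abbreviation "FY A B \<equiv> F_ob R H S (yT (G_ob B) (G_ob A))"

lemma DO_left [simp]: "A : DO ==> left_module R D A"
 by (simp add: module_objects_def)

lemma DO_tens [simp]: "A : DO ==> B : DO ==> TD A B : DO"
 unfolding module_objects_def[of R D]
 by (intro CollectI conjI DT.TM_left DT.TM_normal) (simp_all add: DT.TM_sel cong: restrict_cong)

lemma DO_unit [simp]: "dU : DO"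
 unfolding module_objects_def[of R D]
 by (intro CollectI conjI UD.unit_left UD.unit_normal UD.unit_sel(4))

lemma DO_F [simp]: "M : Y ==> F_ob R H S M : DO" and Y_G [simp]: "A : DO ==> G_ob A : Y"
 by (rule F_obj, simp) (rule G_obj, simp)

text \<open>The flip \<open>M \<otimes>\<^sub>t N \<rightarrow> N \<otimes>\<^sub>t M\<close> relates the tensor product over \<open>D(H)\<close> to that of Yetter-Drinfeld modules.\<close>

definition fphi where
 "fphi A B x = Tens (flp A B (summands x))"

text \<open>By \<open>diag_D\<close> at 1 the flip exchanges the elements fixed by the two
  projections; its linearity over D(H) is \<open>diag_D\<close> for general X.\<close>

lemma fphi:
 fixes A B :: "('k, ('h \<times> ('h \<Rightarrow> 'k)) list set, 'x universe) bmodule"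
 assumes A [simp]: "left_module R D A" and B [simp]: "left_module R D B"
 shows "left_linear R D (TD A B) (FY A B) (fphi A B)" "bij_betw (fphi A B) (carrier (TD A B)) (carrier (FY A B))"
  "a :. A ==> b :. B ==> fphi A B (DT.pt A B a b) = pt (G_ob B) (G_ob A) b a"
proof -
 let ?M = "G_ob A" and ?N = "G_ob B"
 let ?T = "yT ?N ?M" and ?p = "%t. Tens (diag_act R H (G_ob B) (G_ob A) \<one> t)"
 note [simp] = left_moduleD(1)[OF A] left_moduleD(1)[OF B]
 have p: "linear_map R (tensor R B A) ?T ?p"
  using YT.TT_proj_linear[of ?N ?M] by (simp add: G_tens)
 have s: "linear_map R ?T (tensor R B A) summands"
  using YT.TT_summands_linear[of ?N ?M] by (simp add: G_tens)
 have sD: "linear_map R (TD A B) (tensor R A B) summands" by (rule DT.summands_linear0) simp_all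
 have Fc: "act (FY A B) X y :. ?T" if "X :. D" "y :. ?T" for X y
  using linear_mapD(1)[OF left_moduleD(2)[OF F_left that(1), of ?T]] that by (simp add: F_sel)
 have F1: "act (FY A B) \<one>\<^sub>D y = y" if "y :. ?T" for y
  using left_moduleD(5)[OF F_left, of ?T y] that by (simp add: F_sel)
 have d: "diag_act R D A B X t = flp B A (summands (act (FY A B) X (?p (flp A B t))))"
  if "X :. D" "t :. (tensor R A B)" for X t by (rule diag_D) (simp_all add: that)
 have Ts: "Tens (summands y) = y" if "y :. ?T" for y
  using YT.TT_summands(2)[of ?N ?M y] that by simp
 have w: "?p (flp A B (summands x)) = fphi A B x" "fphi A B x :. ?T" if x: "x :. (TD A B)" for x
 proof -
  have sx: "summands x :. (tensor R A B)" by (rule linear_mapD(1)[OF sD x])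
  have y: "?p (flp A B (summands x)) :. ?T" by (rule linear_mapD(1)[OF p]) (simp add: flp(3) sx)
  have "summands x = flp B A (summands (?p (flp A B (summands x))))"
   using d[OF _ sx, of "\<one>\<^sub>D"] F1[OF y] DT.summands_TM(1)[OF A B x] by simp
  then have "flp A B (summands x) = summands (?p (flp A B (summands x)))"
   using flp(4)[of B A, OF _ _ linear_mapD(1)[OF s y]] by simp
  then show e: "?p (flp A B (summands x)) = fphi A B x" unfolding fphi_def using Ts[OF y] by simp
  show "fphi A B x :. ?T" using y unfolding e .
 qed
 have l: "linear_map R (TD A B) ?T (fphi A B)"
  by (rule linear_map_cong[OF _ w(1)[symmetric] linear_comp[OF p flp(1)[OF _ _ sD]]]) simp_all
 have c: "fphi A B (act (TD A B) X x) = act (FY A B) X (fphi A B x)" if X: "X :. D" and x: "x :. (TD A B)" for X x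
 proof -
  have sx: "summands x :. (tensor R A B)" by (rule linear_mapD(1)[OF sD x])
  have y: "act (FY A B) X (fphi A B x) :. ?T" by (rule Fc[OF X w(2)[OF x]])
  have "flp A B (summands (act (TD A B) X x)) = summands (act (FY A B) X (fphi A B x))"
   using X x flp(4)[of B A, OF _ _ linear_mapD(1)[OF s y]] by (simp add: DT.act_TM d[OF X sx] w(1))
  then show ?thesis using Ts[OF y] unfolding fphi_def[of A B "act (TD A B) X x"] by simp
 qed
 show "left_linear R D (TD A B) (FY A B) (fphi A B)"
  using l c by (simp add: left_linear_def same_module_linear[OF same_module_refl same_F, symmetric])
 have inv: "Tens (flp B A (summands y)) :. (TD A B) \<and> fphi A B (Tens (flp B A (summands y))) = y" if y: "y :. ?T" for y
 proof -
  have sy: "summands y :. (tensor R B A)" by (rule linear_mapD(1)[OF s y])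
  have py: "?p (summands y) = y" using YT.TT_summands[of ?N ?M y] y by simp
  have "diag_act R D A B \<one>\<^sub>D (flp B A (summands y)) = flp B A (summands y)"
   by (subst d) (simp_all add: flp sy py F1 y)
  then have "Tens (flp B A (summands y)) :. (TD A B)" using sy by (simp add: DT.TM_carrier flp(3))
  then show ?thesis using sy Ts[OF y] by (simp add: fphi_def flp(4))
 qed
 have inv': "Tens (flp B A (summands (fphi A B x))) = x" if x: "x :. (TD A B)" for x
  using DT.summands_TM(2)[OF A B x] flp(4)[of A B, OF _ _ linear_mapD(1)[OF sD x]] by (simp add: fphi_def)
 show "bij_betw (fphi A B) (carrier (TD A B)) (carrier (FY A B))"
  unfolding F_sel by (rule bij_betw_byWitness[where f' = "%y. Tens (flp B A (summands y))"]) (use inv inv' w in auto)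
 assume ab: "a :. A" "b :. B"
 then have y: "pt ?N ?M b a :. ?T" by (simp add: G_sel)
 have "DT.pt A B a b = Tens (diag_act R D A B \<one>\<^sub>D (tn A B a b))" using ab by (simp add: DT.pt_proj)
 also have "... = Tens (flp B A (summands (?p (tn B A b a))))"
  using ab linear_mapD(1)[OF p] by (simp add: d flp F1)
 also have "?p (tn B A b a) = pt ?N ?M b a" using ab YT.pt_proj[of ?N ?M b a] by (simp add: G_sel G_tens)
 finally show "fphi A B (DT.pt A B a b) = pt (G_ob B) (G_ob A) b a" using inv[OF y] by simp
qed

text \<open>Linearity is imported from the Yetter-Drinfeld side. Flips, and for \<open>p\<close>
  also \<open>YT.asm\<close>, carry both bracketings to the same Yetter-Drinfeld module by
  D(H)-linear maps \<open>p\<close> and \<open>q\<close>; on generators \<open>p\<close> after the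
  associativity is \<open>q\<close>, and \<open>p\<close> is injective.\<close>

lemma D_asm:
 assumes [simp]: "A : DO" "B : DO" "C : DO"
 shows "left_linear R D (TD (TD A B) C) (TD A (TD B C)) (DT.asm A B C)"
proof -
 let ?a = "G_ob A" and ?b = "G_ob B" and ?c = "G_ob C"
 let ?L = "TD (TD A B) C" and ?Q = "TD A (TD B C)" and ?Z = "F_ob R H S (yT ?c (yT ?b ?a))"
 have GF: "G_ob (FY A B) = yT ?b ?a" "G_ob (FY B C) = yT ?c ?b" by (simp_all add: G_F)
 define p where "p x = YT.asm ?c ?b ?a (fphi A (FY B C) (DT.tmap A (FY B C) (%x. x) (fphi B C) x))" for x
 define q where "q x = fphi (FY A B) C (DT.tmap (FY A B) C (fphi A B) (%x. x) x)" for x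
 note f1 = fphi(1,2)[of B C, simplified] and f2 = fphi(1,2)[of A "FY B C", simplified, unfolded GF]
  and g1 = fphi(1,2)[of A B, simplified] and g2 = fphi(1)[of "FY A B" C, simplified, unfolded GF]
 note t1 = DT.tmap_linear[OF _ _ _ _ ll_id f1(1)] and t2 = DT.tmap_linear[OF _ _ _ _ g1(1) ll_id]
 have pl: "left_linear R D ?Q ?Z p"
  unfolding p_def by (rule ll_comp[OF ll_comp[OF t1 f2(1)] Y_assoc]) simp_all
 have ql: "left_linear R D ?L ?Z q"
  unfolding q_def by (rule ll_comp[OF t2 g2]) simp_all
 have "inj_on p (carrier ?Q)"
 proof -
  have b: "bij_betw (DT.tmap A (FY B C) (%x. x) (fphi B C)) (carrier ?Q) (carrier (TD A (FY B C)))"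
   by (rule DT.tmap_bij[OF _ _ _ _ ll_id _ f1]) (simp_all add: bij_betw_def inj_on_def)
  have a: "bij_betw (YT.asm ?c ?b ?a) (carrier (yT (yT ?c ?b) ?a)) (carrier ?Z)"
   unfolding F_sel by (rule YT.asm_bij) simp_all
  have "p = YT.asm ?c ?b ?a \<circ> (fphi A (FY B C) \<circ> DT.tmap A (FY B C) (%x. x) (fphi B C))" by (simp add: p_def fun_eq_iff)
  then have "bij_betw p (carrier ?Q) (carrier ?Z)"
   using bij_betw_trans[OF bij_betw_trans[OF b f2(2)], unfolded F_sel, OF a[unfolded F_sel]] by (simp add: F_sel)
  then show ?thesis by (simp add: bij_betw_def)
 qed
 note al = DT.asm_linear[of A B C, simplified]
 have pq: "p (DT.asm A B C x) = q x" if x: "x :. ?L" for x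
 proof (rule DT.TT_ext2[OF _ _ _ _ _ _ _ x, where Q = ?Z and f = "%x. p (DT.asm A B C x)"])
  show "linear_map R ?L ?Z (%x. p (DT.asm A B C x))" by (rule ll_D(2)[OF pl al])
  show "linear_map R ?L ?Z q" by (rule ll_D(1)[OF ql])
  fix a b c assume [simp]: "a :. A" "b :. B" "c :. C"
  have [simp]: "a :. ?a" "b :. ?b" "c :. ?c" by (simp_all add: G_sel)
  have [simp]: "pt ?c ?b c b :. (FY B C)" "pt ?b ?a b a :. (FY A B)" by (simp_all add: F_sel)
  show "p (DT.asm A B C (DT.pt (TD A B) C (DT.pt A B a b) c)) = q (DT.pt (TD A B) C (DT.pt A B a b) c)"
   using DT.tmap_pt[OF _ _ _ _ ll_id f1(1), of A a "DT.pt B C b c"] DT.tmap_pt[OF _ _ _ _ g1(1) ll_id, of C "DT.pt A B a b" c]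
   by (simp add: p_def q_def DT.asm_pt fphi(3) GF YT.asm_pt)
 qed simp_all
 have "DT.asm A B C (act ?L X x) = act ?Q X (DT.asm A B C x)" if X: "X :. D" and x: "x :. ?L" for X x
 proof -
  have Lc: "act ?L X x :. ?L" "y :. ?Q ==> act ?Q X y :. ?Q" for y
   using X x linear_mapD(1)[OF left_moduleD(2)[OF DO_left X]] by auto
  note ax = linear_mapD(1)[OF al]
  have "p (DT.asm A B C (act ?L X x)) = p (act ?Q X (DT.asm A B C x))"
   using X x Lc ax by (simp add: pq ll_D(4)[OF pl] ll_D(4)[OF ql])
  then show ?thesis using \<open>inj_on p (carrier ?Q)\<close> X x Lc ax by (auto dest: inj_onD)
 qed
 then show ?thesis using al by (simp add: left_linear_def)
qed

text \<open>Up to the embeddings this is \<open>chi\<close> restricted to D(H)_t, an isomorphism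
  onto H_t whose inverse sends h to \<open>iE (esb h)\<close>.\<close>

definition phi0 where "phi0 z = \<iota> (chi (uD z))"

lemma phi0: "left_linear R D dU FU phi0" "bij_betw phi0 (carrier dU) (carrier FU)"
 "z :. dU ==> uI (phi0 z) = chi (uD z)" "z :. dU ==> phi0 z :. mU"
proof -
 have e: "\<iota> c = \<iota> (et c)" if "c : Ht" for c using that by simp
 have zc: "uD z :. D" "iE (esb (chi (uD z))) = uD z" if "z :. dU" for z
  using UD.unit_elem(3,4)[OF that] by (simp_all add: eps_D)
 show m: "phi0 z :. mU" and u: "uI (phi0 z) = chi (uD z)" if "z :. dU" for z
  unfolding phi0_def using e[OF chi_Ht[OF zc(1)[OF that]]] uI_iet[of "chi (uD z)"] zc(1)[OF that]
   iet_closed[of "chi (uD z)"] by simp_all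
 have "linear_map R dU mU (%z. \<iota> (et (chi (uD z))))"
  by (rule iet_linear, rule chi_linear, rule UD.unit_linear(2))
 then have l: "linear_map R dU mU phi0"
  by (rule linear_map_cong[OF UD.unit_module, rotated]) (use zc in \<open>simp add: phi0_def\<close>)
 have "phi0 (act dU X z) = act FU X (phi0 z)" if X [simp]: "X :. D" and z: "z :. dU" for X z
 proof -
  note [simp] = zc[OF z]
  have "phi0 (act dU X z) = \<iota> (chi (iE (esb (chi (X \<otimes>\<^sub>D uD z)))))"
   unfolding phi0_def using z by (simp add: UD.unI_act eps_D)
  also have "... = \<iota> (chi (X \<otimes>\<^sub>D uD z))" by (simp add: chi_iE eps_eps(7)[of \<one>])
  also have "... = act FU X (phi0 z)"
   unfolding phi0_def by (simp add: chi_mult UN.unit_elem(2) iota_chi)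
  finally show ?thesis .
 qed
 then show "left_linear R D dU FU phi0"
  using l by (simp add: left_linear_def same_module_linear[OF same_module_refl same_FU, symmetric])
 let ?g = "%x. \<delta> (iE (esb (uI x)))"
 have t: "iE (esb (uI x)) :. (target D)" if "x :. mU" for x
  using that by (simp add: UD.target_carrier eps_D chi_iE eps_eps(7,9)[of \<one>])
 have ut: "uD (?g x) = iE (esb (uI x))" if "x :. mU" for x
  by (rule inv_into_f_f[OF UD.inj_target t[OF that]])
 show "bij_betw phi0 (carrier dU) (carrier FU)"
  unfolding FU_carrier
 proof (rule bij_betw_byWitness[where f' = ?g], safe)
  show "?g (phi0 z) = z" if "z :. dU" for z using that by (simp add: u zc UD.unit_elem)
  show "phi0 (?g x) = x" if "x :. mU" for x
   unfolding phi0_def ut[OF that] using that by (simp add: chi_iE eps_eps(7)[of \<one>] UN.unit_elem)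
  show "?g x :. dU" if "x :. mU" for x
   using t[OF that] by (simp add: UD.unit_sel(1))
 qed (use m in simp)
qed

text \<open>The unit constraints of Yetter-Drinfeld modules transported along the flip, which
  exchanges left and right. Linearity and bijectivity are thus inherited, and only the values on
  generators have to be compared with the prescribed ones.\<close>

definition lD where "lD A x = rY (G_ob A) (fphi FU A (DT.tmap FU A phi0 (%x. x) x))"
definition rD where "rD A x = lY (G_ob A) (fphi A FU (DT.tmap A FU (%x. x) phi0 x))"

lemma lD:
 assumes A [simp]: "A : DO"
 shows "left_linear R D (TD dU A) A (lD A)" "bij_betw (lD A) (carrier (TD dU A)) (carrier A)"
  "z :. dU ==> a :. A ==> lD A (DT.pt dU A z a) = act A (uD z) a"
  "left_linear R D (TD A dU) A (rD A)" "bij_betw (rD A) (carrier (TD A dU)) (carrier A)"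
  "z :. dU ==> a :. A ==> rD A (DT.pt A dU a z) = act A (iE (chi (uD z))) a"
proof -
 have GF: "G_ob FU = yU" by (rule G_F) simp
 have FG: "F_ob R H S (G_ob A) = A" by (rule F_G) simp
 have b: "bij_betw (%x. x) (carrier A) (carrier A)" by (simp add: bij_betw_def inj_on_def)
 note i = DO_left[OF DO_unit] DO_left[OF A] FU_left
 note f = fphi(1,2)[OF FU_left i(2), unfolded GF] fphi(1,2)[OF i(2) FU_left, unfolded GF]
  and t = DT.tmap_linear[OF i(1,2,3,2) phi0(1) ll_id] DT.tmap_linear[OF i(2,1,2,3) ll_id phi0(1)]
  and tb = DT.tmap_bij[OF i(1,2,3,2) phi0(1,2) ll_id b] DT.tmap_bij[OF i(2,1,2,3) ll_id b phi0(1,2)]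
  and r = rY[OF Y_G[OF A], unfolded FG] and l = lY[OF Y_G[OF A], unfolded FG]
 show "left_linear R D (TD dU A) A (lD A)"
  unfolding lD_def by (rule ll_comp[OF ll_comp[OF t(1) f(1)] r(2)])
 show "left_linear R D (TD A dU) A (rD A)"
  unfolding rD_def by (rule ll_comp[OF ll_comp[OF t(2) f(3)] l(2)])
 have "lD A = rY (G_ob A) \<circ> (fphi FU A \<circ> DT.tmap FU A phi0 (%x. x))" "rD A = lY (G_ob A) \<circ> (fphi A FU \<circ> DT.tmap A FU (%x. x) phi0)"
  by (simp_all add: lD_def rD_def fun_eq_iff)
 then show "bij_betw (lD A) (carrier (TD dU A)) (carrier A)" "bij_betw (rD A) (carrier (TD A dU)) (carrier A)"
  using bij_betw_trans[OF bij_betw_trans[OF tb(1) f(2), unfolded F_sel] r(3)]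
   bij_betw_trans[OF bij_betw_trans[OF tb(2) f(4), unfolded F_sel] l(3)] by (simp_all add: G_sel)
 assume z: "z :. dU" and a: "a :. A"
 have [simp]: "phi0 z :. FU" "phi0 z :. yU" "a :. (G_ob A)"
  using phi0(4)[OF z] a by (simp_all add: FU_carrier yU_sel G_sel)
 have zc: "uD z :. D" "iE (esb (chi (uD z))) = uD z"
  using UD.unit_elem(3,4)[OF z] by (simp_all add: eps_D)
 show "lD A (DT.pt dU A z a) = act A (uD z) a" "rD A (DT.pt A dU a z) = act A (iE (chi (uD z))) a"
  unfolding lD_def rD_def DT.tmap_pt[OF i(1,2,3,2) phi0(1) ll_id z a] DT.tmap_pt[OF i(2,1,2,3) ll_id phi0(1) a z]
  using a z zc by (simp_all add: fphi(3) GF r l phi0 G_act)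
qed

end

sublocale double_univ \<subseteq> DC: concrete_category R "module_category R D \<delta>" "left_linear R D"
proof (intro concrete_category.intro concrete_category_axioms.intro base_axioms)
 let ?C = "module_category R D \<delta>"
 have o: "Ob ?C = DO" by (simp add: module_category_def)
 show "Ar ?C = {(M, f, N). M : Ob ?C \<and> N : Ob ?C \<and> left_linear R D M N f \<and> f : extensional (carrier M)}"
  "Dom ?C = (%(M, f, N). M)" "Cod ?C = (%(M, f, N). N)" "category.Id ?C = id_arrow" "Cmp ?C = comp_arrow"
  by (simp_all add: module_category_def)
 fix M N P :: "('k, ('h \<times> ('h \<Rightarrow> 'k)) list set, 'x universe) bmodule" and f g :: "'x universe \<Rightarrow> 'x universe"
 assume "M : Ob ?C"
 then have M: "left_module R D M" by (simp add: o)
 show "module R M" by (rule left_moduleD(1)[OF M])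
 show "left_linear R D M M (%x. x)" by (rule ll_id)
 { assume f: "left_linear R D M N f"
  show "linear_map R M N f" by (rule ll_D(1)[OF f])
  show "(!!x. x :. M ==> g x = f x) ==> left_linear R D M N g" by (rule ll_cong[OF M f])
  show "bij_betw f (carrier M) (carrier N) ==> left_linear R D N M (inv_into (carrier M) f)" by (rule ll_inv[OF M f])
  show "left_linear R D N P g ==> left_linear R D M P (%x. g (f x))" by (rule ll_comp[OF f]) }
qed

text \<open>Reversal exchanges the unit constraints: the left one now acts by
  \<open>eps_s_bar\<close> of z, which is \<open>iE (chi z)\<close> on D(H)_t, and the right one by
  z itself.\<close>

sublocale double_univ \<subseteq> RC: concrete_monoidal R "reversed (module_category R D \<delta>)" "left_linear R D"
 "%A B a b. DT.pt B A b a" "%A z a. act A (iE (chi (uD z))) a" "%A z a. act A (uD z) a"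
proof (intro concrete_monoidal.intro concrete_monoidal_axioms.intro)
 let ?B = "module_category R D \<delta>"
 let ?C = "reversed ?B"
 have c: "Ob ?C = Ob ?B" "Ar ?C = Ar ?B" "Dom ?C = Dom ?B" "Cod ?C = Cod ?B" "category.Id ?C = category.Id ?B" "Cmp ?C = Cmp ?B"
  by (simp_all add: reversed_def)
 show "concrete_category R ?C (left_linear R D)"
  using DC.concrete_category_axioms unfolding concrete_category_def concrete_category_axioms_def c .
 have o: "Ob ?C = DO" "TensOb ?C = (%A B. TD B A)" "Unit ?C = dU" by (simp_all add: module_category_def reversed_def)
 have sD: "zc :. D \<and> iE (esb (chi zc)) = zc \<and> chi zc : Ht" if "z :. dU" "zc = uD z" for z zc
  using UD.unit_elem(3,4)[OF that(1)] that(2) by (simp add: eps_D)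
 show "Unit ?C : Ob ?C" by (simp add: o)
 fix M N P M' N' f g x m n z
 assume "M : Ob ?C"
 then have M [simp]: "M : DO" by (simp add: o)
 show "\<exists>l. Lunit ?C M = (TensOb ?C (Unit ?C) M, restrict l (carrier (TensOb ?C (Unit ?C) M)), M) \<and> left_linear R D (TensOb ?C (Unit ?C) M) M l \<and>
   bij_betw l (carrier (TensOb ?C (Unit ?C) M)) (carrier M) \<and> (\<forall>z\<in>carrier (Unit ?C). \<forall>m\<in>carrier M. l (DT.pt M (Unit ?C) m z) = act M (iE (chi (uD z))) m)"
  unfolding o
 proof (intro exI[of _ "rD M"] conjI ballI)
  have bl: "bilin R M dU M (%m z. act M (iE (chi (uD z))) m)"
   using left_moduleD(1)[OF DO_left[OF M]] by (intro bilinI) (simp_all add: act_lin[OF DO_left[OF M]] UD.unit_elem UD.unit_linear(2))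
  have "lsum M (map (%(m, z). act M (eps_s_bar D (uD z)) m) (unproject R D M dU x)) = rD M x" if "x :. (TD M dU)" for x
  proof -
   have 1: "lsum M (map (%(m, z). act M (iE (chi (uD z))) m) (unproject R D M dU x)) = rD M x"
    by (rule DT.unproject_linear[OF _ _ _ bl ll_D(1)[OF lD(4)[OF M]] that]) (simp_all add: lD left_moduleD(1)[OF DO_left[OF M]])
   have "set (unproject R D M dU x) \<subseteq> carrier M \<times> carrier dU"
    by (rule DT.unproject_wf) (simp_all add: that)
   then have 2: "map (%(m, z). act M (eps_s_bar D (uD z)) m) (unproject R D M dU x) = map (%(m, z). act M (iE (chi (uD z))) m) (unproject R D M dU x)"
    by (intro map_cong HOL.refl) (auto simp: eps_D UD.unit_elem)
   show ?thesis unfolding 2 by (rule 1)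
  qed
  then show "Lunit ?C M = (TD M dU, restrict (rD M) (carrier (TD M dU)), M)"
   by (simp add: module_category_def reversed_def runit_arrow_def cong: restrict_cong)
 qed (simp_all add: lD)
 show "\<exists>r. Runit ?C M = (TensOb ?C M (Unit ?C), restrict r (carrier (TensOb ?C M (Unit ?C))), M) \<and> left_linear R D (TensOb ?C M (Unit ?C)) M r \<and>
   bij_betw r (carrier (TensOb ?C M (Unit ?C))) (carrier M) \<and> (\<forall>m\<in>carrier M. \<forall>z\<in>carrier (Unit ?C). r (DT.pt (Unit ?C) M z m) = act M (uD z) m)"
  unfolding o
 proof (intro exI[of _ "lD M"] conjI ballI)
  have bl: "bilin R dU M M (%z m. act M (uD z) m)"
   using left_moduleD(1)[OF DO_left[OF M]] by (intro bilinI) (simp_all add: act_lin[OF DO_left[OF M]] UD.unit_elem UD.unit_linear(2))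
  have "lsum M (map (%(z, m). act M (uD z) m) (unproject R D dU M x)) = lD M x" if "x :. (TD dU M)" for x
   by (rule DT.unproject_linear[OF _ _ _ bl ll_D(1)[OF lD(1)[OF M]] that]) (simp_all add: lD left_moduleD(1)[OF DO_left[OF M]])
  then show "Runit ?C M = (TD dU M, restrict (lD M) (carrier (TD dU M)), M)"
   by (simp add: module_category_def reversed_def lunit_arrow_def cong: restrict_cong)
 qed (simp_all add: lD)
 assume "N : Ob ?C"
 then have N [simp]: "N : DO" by (simp add: o)
 show "TensOb ?C M N : Ob ?C" by (simp add: o)
 show "bilin R M N (TensOb ?C M N) (%a b. DT.pt N M b a)"
  using DT.TT_pt_bilin[of N M] unfolding o by (simp add: bilin_def)
 { assume f: "left_linear R D M N f" and z: "z :. (Unit ?C)" and m: "m :. M"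
  show "f (act M (iE (chi (uD z))) m) = act N (iE (chi (uD z))) (f m)" "f (act M (uD z) m) = act N (uD z) (f m)"
   using z m sD[of z "uD z"] by (simp_all add: o ll_D(4)[OF f]) }
 { assume z: "z :. (Unit ?C)" and mn [simp]: "m :. M" "n :. N"
  have z' [simp]: "uD z :. D" "chi (uD z) : Ht" and e: "iE (esb (chi (uD z))) = uD z"
   using z sD[of z "uD z"] by (simp_all add: o)
  have [simp]: "act N (iE (chi (uD z))) n :. N" "act M (uD z) m :. M"
   using linear_mapD(1)[OF left_moduleD(2)[OF DO_left[OF N]]] linear_mapD(1)[OF left_moduleD(2)[OF DO_left[OF M]]] by simp_all
  \<comment> \<open>The identity is pulled back along the injective flip from \<open>pt_unit\<close>
    for Yetter-Drinfeld modules.\<close>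
  have "fphi N M (DT.pt N M (act N (iE (chi (uD z))) n) m) = pt (G_ob M) (G_ob N) m (act (G_ob N) (chi (uD z)) n)"
   by (simp add: fphi(3) G_act)
  also have "... = fphi N M (DT.pt N M n (act M (uD z) m))"
   by (rule HOL.trans, (rule pt_unit; simp add: G_sel)) (simp add: fphi(3) G_act e)
  finally show "DT.pt N M (act N (iE (chi (uD z))) n) m = DT.pt N M n (act M (uD z) m)"
   using fphi(2)[of N M] by (auto simp: bij_betw_def dest: inj_onD) }
 { assume "P : Ob ?C"
  then have P [simp]: "P : DO" by (simp add: o)
  show "linear_map R (TensOb ?C M N) P f ==> linear_map R (TensOb ?C M N) P g ==>
   (!!m n. m :. M ==> n :. N ==> f (DT.pt N M n m) = g (DT.pt N M n m)) ==> x :. (TensOb ?C M N) ==> f x = g x"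
   unfolding o by (rule DT.TT_ext[of N M P f g x]) (simp_all add: left_moduleD(1)[OF DO_left[OF P]])
  let ?A = "TD (TD P N) M" and ?Z = "TD P (TD N M)"
  let ?as = "(?A, restrict (DT.asm P N M) (carrier ?A), ?Z)"
  have as: "Assoc ?B P N M = ?as"
   by (simp add: module_category_def assoc_arrow_def DT.asm_def[abs_def])
  have ar: "?as : Ar ?B" by (rule DC.arr_hom) (simp_all add: D_asm module_category_def)
  have bij: "bij_betw (restrict (DT.asm P N M) (carrier ?A)) (carrier ?A) (carrier ?Z)"
   using DC.bij_restrict[OF DT.asm_bij[of P N M]] by simp
  \<comment> \<open>The associativity of the reversed category is the inverse of that for P, N, M;
    its values on generators are those of \<open>DT.asm\<close> read backwards.\<close>
  let ?a = "inv_into (carrier ?A) (restrict (DT.asm P N M) (carrier ?A))"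
  have 1: "Assoc ?C M N P = (?Z, restrict ?a (carrier ?Z), ?A)"
   using DC.inv_arrow_eq[OF DC.iso_hom[OF ar]] bij by (simp add: reversed_def as)
  have 2: "left_linear R D ?Z ?A ?a"
   by (rule ll_inv[OF _ _ bij]) (use DC.Ar_D(3)[OF ar] in simp_all)
  have 3: "?a (DT.pt P (TD N M) p (DT.pt N M n m)) = DT.pt (TD P N) M (DT.pt P N p n) m"
   if "p :. P" "n :. N" "m :. M" for p n m
  proof -
   have x: "DT.pt (TD P N) M (DT.pt P N p n) m :. ?A" using that by simp
   then have e: "restrict (DT.asm P N M) (carrier ?A) (DT.pt (TD P N) M (DT.pt P N p n) m) = DT.pt P (TD N M) p (DT.pt N M n m)"
    using that by (simp add: DT.asm_pt)
   from inv_into_f_f[OF bij_betw_imp_inj_on[OF bij] x] show ?thesis unfolding e .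
  qed
  show "\<exists>a. Assoc ?C M N P = (TensOb ?C (TensOb ?C M N) P, restrict a (carrier (TensOb ?C (TensOb ?C M N) P)), TensOb ?C M (TensOb ?C N P)) \<and>
   left_linear R D (TensOb ?C (TensOb ?C M N) P) (TensOb ?C M (TensOb ?C N P)) a \<and>
   bij_betw a (carrier (TensOb ?C (TensOb ?C M N) P)) (carrier (TensOb ?C M (TensOb ?C N P))) \<and>
   (\<forall>m\<in>carrier M. \<forall>n\<in>carrier N. \<forall>p\<in>carrier P. a (DT.pt P (TensOb ?C M N) p (DT.pt N M n m)) = DT.pt (TensOb ?C N P) M (DT.pt P N p n) m)"
   unfolding o by (intro exI[of _ ?a] conjI ballI 1 2 3 bij_betw_inv_into[OF bij]) }
 assume "M' : Ob ?C" "N' : Ob ?C" and f: "left_linear R D M M' f" and g: "left_linear R D N N' g"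
 then have [simp]: "M' : DO" "N' : DO" by (simp_all add: o)
 show "\<exists>t. TensAr ?C (M, f, M') (N, g, N') = (TensOb ?C M N, restrict t (carrier (TensOb ?C M N)), TensOb ?C M' N') \<and>
   left_linear R D (TensOb ?C M N) (TensOb ?C M' N') t \<and> (\<forall>m\<in>carrier M. \<forall>n\<in>carrier N. t (DT.pt N M n m) = DT.pt N' M' (g n) (f m))"
  unfolding o
  by (intro exI[of _ "DT.tmap N' M' g f"] conjI, simp add: module_category_def reversed_def DT.tmap_def[abs_def])
   (simp_all add: DT.tmap_linear[OF _ _ _ _ g f] DT.tmap_pt[OF _ _ _ _ g f])
qed

section \<open>The functor\<close>

context double_univ
begin

abbreviation "YDc \<equiv> yd_category R H S \<iota>"
abbreviation "RDc \<equiv> reversed (module_category R D \<delta>)"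
abbreviation "FO \<equiv> F_ob R H S :: ('k, 'h, 'x universe) ydmodule \<Rightarrow> _"
abbreviation "FA \<equiv> F_ar R H S :: (('k, 'h, 'x universe) ydmodule, 'x universe) arrow \<Rightarrow> _"

text \<open>The arguments of \<open>fphi\<close> are in the order N, M because the product of
  \<open>FO M\<close> and \<open>FO N\<close> in the reversed category is the tensor product of
  \<open>FO N\<close> and \<open>FO M\<close> over D(H).\<close>

definition PH where
 "PH M N = (TensOb RDc (FO M) (FO N), restrict (fphi (FO N) (FO M)) (carrier (TensOb RDc (FO M) (FO N))), FO (TensOb YDc M N))"

definition PH0 where
 "PH0 = (Unit RDc, restrict phi0 (carrier (Unit RDc)), FO (Unit YDc))"

lemma YDc_sel: "Ob YDc = Y" "TensOb YDc = yT" "Unit YDc = yU"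
 by (simp_all add: yd_category_def)

lemma RDc_sel: "Ob RDc = DO" "TensOb RDc = (%A B. TD B A)" "Unit RDc = dU"
 by (simp_all add: module_category_def reversed_def)

lemma FO_Ob [simp]: "M : Ob YDc ==> FO M : Ob RDc"
 by (simp add: YDc_sel RDc_sel)

lemma FO_carrier [simp]: "carrier (FO M) = carrier M"
 by (rule F_sel)

lemma FA_ar [simp]: "fst (FA f) = FO (fst f)" "fst (snd (FA f)) = fst (snd f)" "snd (snd (FA f)) = FO (snd (snd f))"
 by (cases f, simp)+

lemma FA_Ar [simp]: "f : Ar YDc ==> FA f : Ar RDc"
 unfolding RC.Ar_iff YC.Ar_iff FA_ar FO_carrier by simp

lemma PH [simp]:
 assumes "M : Ob YDc" "N : Ob YDc"
 shows "PH M N : Ar RDc" "fst (PH M N) = TensOb RDc (FO M) (FO N)" "snd (snd (PH M N)) = FO (TensOb YDc M N)"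
  "m :. M ==> n :. N ==> fst (snd (PH M N)) (DT.pt (FO N) (FO M) n m) = pt M N m n"
  "bij_betw (fst (snd (PH M N))) (carrier (TensOb RDc (FO M) (FO N))) (carrier (TensOb YDc M N))"
proof -
 have [simp]: "M : Y" "N : Y" using assms by (simp_all add: YDc_sel)
 note f = fphi[of "FO N" "FO M", simplified, unfolded G_F[OF \<open>M : Y\<close>] G_F[OF \<open>N : Y\<close>]]
 show "PH M N : Ar RDc"
  unfolding PH_def by (rule RC.arr_hom) (use f(1) in \<open>simp_all add: RDc_sel YDc_sel\<close>)
 show "fst (PH M N) = TensOb RDc (FO M) (FO N)" "snd (snd (PH M N)) = FO (TensOb YDc M N)" by (simp_all add: PH_def)
 show "m :. M ==> n :. N ==> fst (snd (PH M N)) (DT.pt (FO N) (FO M) n m) = pt M N m n"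
  unfolding PH_def using f(3)[of n m] by (simp add: RDc_sel)
 show "bij_betw (fst (snd (PH M N))) (carrier (TensOb RDc (FO M) (FO N))) (carrier (TensOb YDc M N))"
  unfolding PH_def using RC.bij_restrict f(2) by (simp add: RDc_sel YDc_sel F_sel)
qed

lemma PH0 [simp]: "PH0 : Ar RDc" "fst PH0 = Unit RDc" "snd (snd PH0) = FO (Unit YDc)"
 "z :. (Unit RDc) ==> uI (fst (snd PH0) z) = chi (uD z)"
 "bij_betw (fst (snd PH0)) (carrier (Unit RDc)) (carrier (Unit YDc))"
 "z :. (Unit RDc) ==> fst (snd PH0) z :. (Unit YDc)"
proof -
 show "PH0 : Ar RDc"
  unfolding PH0_def by (rule RC.arr_hom) (use phi0(1) in \<open>simp_all add: RDc_sel YDc_sel\<close>)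
 show "fst PH0 = Unit RDc" "snd (snd PH0) = FO (Unit YDc)" by (simp_all add: PH0_def)
 show "z :. (Unit RDc) ==> uI (fst (snd PH0) z) = chi (uD z)"
  by (simp add: PH0_def phi0(3) RDc_sel)
 show "bij_betw (fst (snd PH0)) (carrier (Unit RDc)) (carrier (Unit YDc))"
  unfolding PH0_def using RC.bij_restrict phi0(2) by (simp add: RDc_sel YDc_sel F_sel)
 then show "z :. (Unit RDc) ==> fst (snd PH0) z :. (Unit YDc)" by (auto simp: bij_betw_def)
qed

lemma FO_act [simp]:
 assumes "M : Ob YDc" "m :. M" "z :. (Unit RDc)"
 shows "act (FO M) (iE (chi (uD z))) m = act M (chi (uD z)) m" "act (FO M) (uD z) m = act M (esb (chi (uD z))) m"
proof -
 have "M : Y" "z :. dU" using assms by (simp_all add: YDc_sel RDc_sel)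
 then have [simp]: "yd_module R H M" "uD z :. D" and e: "iE (esb (chi (uD z))) = uD z"
  using UD.unit_elem(3,4)[of z] by (simp_all add: eps_D)
 show "act (FO M) (iE (chi (uD z))) m = act M (chi (uD z)) m" using assms by (simp add: F_iE)
 show "act (FO M) (uD z) m = act M (esb (chi (uD z))) m" by (subst e[symmetric]) (simp add: F_iE assms)
qed

lemma FA_functor: "category_functor YDc RDc FO FA"
proof (intro category_functor.intro category_functor_axioms.intro)
 show "category YDc" "category RDc"
  using YC.monoidal RC.monoidal by (simp_all add: monoidal_category_def)
 fix A B E f g
 show "A : Ob YDc ==> FO A : Ob RDc" by simp
 show "A : Ob YDc ==> FA (category.Id YDc A) = category.Id RDc (FO A)"
  by (simp add: RC.sel YC.sel id_arrow_def)
 assume f: "f : Hom YDc A B"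
 then show "FA f : Hom RDc (FO A) (FO B)" by (simp add: YC.Hom_iff RC.Hom_iff)
 assume "g : Hom YDc B E"
 with f show "FA (Cmp YDc g f) = Cmp RDc (FA g) (FA f)"
  by (cases f, cases g) (simp add: RC.sel YC.sel)
qed

text \<open>All equations of arrows are compared on generators, where \<open>PH\<close> merely
  exchanges the two arguments of \<open>pt\<close> and \<open>PH0\<close> replaces z by chi(z); the
  actions of the unit objects match by \<open>FO_act\<close>.\<close>

lemma strong: "strong_monoidal_functor YDc RDc FO FA PH PH0"
proof (intro strong_monoidal_functor.intro strong_monoidal_functor_axioms.intro FA_functor YC.monoidal RC.monoidal)
 fix A B E A' B' f g
 show "PH0 : Hom RDc (Unit RDc) (FO (Unit YDc)) \<and> iso_arrow RDc PH0"
  using RC.iso_arrowI[of PH0] by (simp add: RC.Hom_iff)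
 { assume f: "f : Hom YDc A A'" and g: "g : Hom YDc B B'"
  show "Cmp RDc (PH A' B') (TensAr RDc (FA f) (FA g)) = Cmp RDc (FA (TensAr YDc f g)) (PH A B)"
   by (rule RC.eq2[of _ _ "FO A" "FO B"]) (use f g YC.Ar_D[of f] YC.Ar_D[of g] in \<open>simp_all add: YC.Hom_iff\<close>) }
 assume [simp]: "A : Ob YDc"
 show "Cmp RDc (FA (Lunit YDc A)) (Cmp RDc (PH (Unit YDc) A) (TensAr RDc PH0 (category.Id RDc (FO A)))) = Lunit RDc (FO A)"
  by (rule RC.eq2[of _ _ "Unit RDc" "FO A"]) simp_all
 show "Cmp RDc (FA (Runit YDc A)) (Cmp RDc (PH A (Unit YDc)) (TensAr RDc (category.Id RDc (FO A)) PH0)) = Runit RDc (FO A)"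
  by (rule RC.eq2[of _ _ "FO A" "Unit RDc"]) simp_all
 assume [simp]: "B : Ob YDc"
 show "PH A B : Hom RDc (TensOb RDc (FO A) (FO B)) (FO (TensOb YDc A B)) \<and> iso_arrow RDc (PH A B)"
  using RC.iso_arrowI[of "PH A B"] by (simp add: RC.Hom_iff)
 assume [simp]: "E : Ob YDc"
 show "Cmp RDc (FA (Assoc YDc A B E)) (Cmp RDc (PH (TensOb YDc A B) E) (TensAr RDc (PH A B) (category.Id RDc (FO E)))) =
   Cmp RDc (PH A (TensOb YDc B E)) (Cmp RDc (TensAr RDc (category.Id RDc (FO A)) (PH B E)) (Assoc RDc (FO A) (FO B) (FO E)))"
  by (rule RC.eq3[of _ _ "FO A" "FO B" "FO E"]) simp_all
qed

lemma iso_categories: "isomorphism_of_categories YDc RDc FO FA"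
 unfolding isomorphism_of_categories_def
proof (intro conjI FA_functor)
 show b: "bij_betw FO (Ob YDc) (Ob RDc)"
  unfolding YDc_sel RDc_sel by (rule bij_betw_byWitness[where f' = G_ob]) (auto simp: F_G G_F)
 show "bij_betw FA (Ar YDc) (Ar RDc)"
 proof (rule bij_betw_byWitness[where f' = "%(M, f, N). (G_ob M, f, G_ob N)"])
  show "\<forall>f\<in>Ar YDc. (case FA f of (M, f, N) \<Rightarrow> (G_ob M, f, G_ob N)) = f"
   by (auto simp: YC.sel YDc_sel G_F)
  show "\<forall>f\<in>Ar RDc. FA (case f of (M, f, N) \<Rightarrow> (G_ob M, f, G_ob N)) = f"
   by (auto simp: RC.sel RDc_sel F_G)
  show "(%(M, f, N). (G_ob M, f, G_ob N)) ` Ar RDc \<subseteq> Ar YDc"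
   by (auto simp: YC.sel RC.sel YDc_sel RDc_sel F_G G_sel)
  show "FA ` Ar YDc \<subseteq> Ar RDc" by (rule image_subsetI) (rule FA_Ar)
 qed
qed

end

theorem proposition4p6:
  fixes R :: "('k, 'r) ring_scheme" and H :: "('k, 'h, 'e) bialg_scheme" and S :: "'h \<Rightarrow> 'h"
  assumes "weak_hopf_algebra R H S"
    and "bij_betw S (carrier H) (carrier H)"
    and "finitely_generated_module R H"
    and "projective_module R H"
  defines "YD \<equiv> yd_category R H S (H_atom :: 'h \<Rightarrow> ('k, 'h, 'x) yd_universe)"
    and "DM \<equiv> module_category R (double R H S)
                (double_atom :: _ \<Rightarrow> ('k, 'h, 'x) yd_universe)"
  shows "(\<forall>M\<in>Ob YD. \<forall>h\<in>carrier H. \<forall>f\<in>carrier (dual R H). \<forall>m\<in>carrier M.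
            act (F_ob R H S M) (double_class R H S h f) m =
              lsum M [f m1 \<odot>\<^bsub>M\<^esub> act M h m0. (m0, m1) \<leftarrow> coact M m])
       \<and> isomorphism_of_monoidal_categories YD (reversed DM) (F_ob R H S) (F_ar R H S)"
proof -
 interpret weak_hopf_algebra R H S by fact
 interpret double_univ R H S "H_atom :: 'h \<Rightarrow> ('k, 'h, 'x) yd_universe" "double_atom :: _ \<Rightarrow> ('k, 'h, 'x) yd_universe"
  by unfold_locales (use assms in \<open>auto simp: inj_on_def H_atom_def double_atom_def\<close>)
 show ?thesis
  unfolding YD_def DM_def isomorphism_of_monoidal_categories_def
  by (intro conjI ballI F_double_class iso_categories exI, simp_all add: YDc_sel) (rule strong)
qed

end
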